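(* Let $\Gamma$ be a finite simplicial graph, let $A_\Gamma$ be the right-angled Artin group on $\Gamma$, let $p$ be a prime, and let $\mathbf{A}_\Gamma$ be the pro-$p$ completion of $A_\Gamma$. Let $\mathbb{Z}_p\langle\langle\Gamma\rangle\rangle$ be the Magnus ring of $\Gamma$ over $\mathbb{Z}_p$ and let $\omega\subseteq\mathbb{Z}_p\langle\langle\Gamma\rangle\rangle$ be the two-sided ideal generated by $V(\Gamma)$. (1) There is a continuous homomorphism $$\mu_p\colon\mathbf{A}_\Gamma\to 1+\omega$$ determined by $\mu_p(s_v)=1+v$ for $v\in V(\Gamma)$. (2) The map $\mu_p$ is injective. (3) For all integers $n\geqslant 1$, we have $\mu_p^{-1}(1+\omega^n)=\gamma_n(\mathbf{A}_\Gamma)$.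
   Context: $A_\Gamma$ has generators $s_v$ ($v\in V(\Gamma)$) and relations $[s_u,s_v]=1$ exactly for the edges $\{u,v\}$ of $\Gamma$; $s_v$ also denotes its image in $\mathbf{A}_\Gamma$. For a ring $R$, $R\langle\Gamma\rangle$ is the free associative unital $R$-algebra on $V(\Gamma)$ modulo the two-sided ideal generated by $uv-vu$ for all edges $\{u,v\}$ of $\Gamma$ (polynomials in partially commuting variables). With $\omega_{R\langle\Gamma\rangle}$ the two-sided ideal of $R\langle\Gamma\rangle$ generated by $V(\Gamma)$, the Magnus ring is $R\langle\langle\Gamma\rangle\rangle=\varprojlim_{n}R\langle\Gamma\rangle/\omega_{R\langle\Gamma\rangle}^n$, the ring of formal power series in the partially commuting variables $V(\Gamma)$. The ring $\mathbb{Z}_p\langle\langle\Gamma\rangle\rangle$ is topologised as the profinite ring $\varprojlim_{n,k}(\mathbb{Z}/p^k)\langle\Gamma\rangle/\omega^n_{(\mathbb{Z}/p^k)\langle\Gamma\rangle}$ (an inverse limit of finite discrete rings). The set $1+\omega$ is a subgroup of its unit group and carries the subspace topology. The lower central series is $\gamma_1(G)=G$, $\gamma_n(G)=[G,\gamma_{n-1}(G)]$. *)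

theory Defs
  imports
    "HOL-Analysis.Analysis"
    "HOL-Algebra.Algebra"
    "HOL-Number_Theory.Residues"
begin

section \<open>Finite simplicial graphs\<close>

definition finite_simplicial_graph :: "'a set \<Rightarrow> 'a set set \<Rightarrow> bool" where
  "finite_simplicial_graph V E \<longleftrightarrow>
     finite V \<and> (\<forall>e\<in>E. \<exists>u\<in>V. \<exists>v\<in>V. u \<noteq> v \<and> e = {u, v})"


section \<open>Inverse limits\<close>

text \<open>An inverse system indexed by the set \<open>I\<close>: whenever \<open>below i j\<close>, there is a transition map
  \<open>f i j\<close> from the \<open>j\<close>-th object to the \<open>i\<close>-th one.\<close>

definition inv_lim ::
  "'i set \<Rightarrow> ('i \<Rightarrow> 'i \<Rightarrow> bool) \<Rightarrow> ('i \<Rightarrow> 'x set) \<Rightarrow> ('i \<Rightarrow> 'i \<Rightarrow> 'x \<Rightarrow> 'x) \<Rightarrow> ('i \<Rightarrow> 'x) set" where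
  "inv_lim I below A f =
     {x \<in> PiE I A. \<forall>i\<in>I. \<forall>j\<in>I. below i j \<longrightarrow> f i j (x j) = x i}"

definition inv_lim_monoid ::
  "'i set \<Rightarrow> ('i \<Rightarrow> 'i \<Rightarrow> bool) \<Rightarrow> ('i \<Rightarrow> 'x monoid) \<Rightarrow> ('i \<Rightarrow> 'i \<Rightarrow> 'x \<Rightarrow> 'x) \<Rightarrow> ('i \<Rightarrow> 'x) monoid" where
  "inv_lim_monoid I below G f =
     \<lparr>carrier = inv_lim I below (\<lambda>i. carrier (G i)) f,
      monoid.mult = (\<lambda>x y. \<lambda>i\<in>I. x i \<otimes>\<^bsub>G i\<^esub> y i),
      monoid.one = (\<lambda>i\<in>I. \<one>\<^bsub>G i\<^esub>)\<rparr>"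

definition inv_lim_ring ::
  "'i set \<Rightarrow> ('i \<Rightarrow> 'i \<Rightarrow> bool) \<Rightarrow> ('i \<Rightarrow> 'x ring) \<Rightarrow> ('i \<Rightarrow> 'i \<Rightarrow> 'x \<Rightarrow> 'x) \<Rightarrow> ('i \<Rightarrow> 'x) ring" where
  "inv_lim_ring I below R f =
     \<lparr>carrier = inv_lim I below (\<lambda>i. carrier (R i)) f,
      monoid.mult = (\<lambda>x y. \<lambda>i\<in>I. x i \<otimes>\<^bsub>R i\<^esub> y i),
      monoid.one = (\<lambda>i\<in>I. \<one>\<^bsub>R i\<^esub>),
      ring.zero = (\<lambda>i\<in>I. \<zero>\<^bsub>R i\<^esub>),
      ring.add = (\<lambda>x y. \<lambda>i\<in>I. x i \<oplus>\<^bsub>R i\<^esub> y i)\<rparr>"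

definition inv_lim_topology ::
  "'i set \<Rightarrow> ('i \<Rightarrow> 'i \<Rightarrow> bool) \<Rightarrow> ('i \<Rightarrow> 'x set) \<Rightarrow> ('i \<Rightarrow> 'i \<Rightarrow> 'x \<Rightarrow> 'x) \<Rightarrow> ('i \<Rightarrow> 'x) topology" where
  "inv_lim_topology I below A f =
     subtopology (product_topology (\<lambda>i. discrete_topology (A i)) I) (inv_lim I below A f)"


section \<open>Right-angled Artin groups\<close>

text \<open>In a word over \<open>S \<times> UNIV\<close>, the letter \<open>(x, True)\<close> stands for the generator \<open>x\<close> and
  \<open>(x, False)\<close> for its inverse.\<close>

inductive pres_eq :: "'a set \<Rightarrow> ('a \<times> bool) list set \<Rightarrow> ('a \<times> bool) list \<Rightarrow> ('a \<times> bool) list \<Rightarrow> bool"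
  for S Rel where
  refl: "w \<in> lists (S \<times> UNIV) \<Longrightarrow> pres_eq S Rel w w"
| sym: "pres_eq S Rel u w \<Longrightarrow> pres_eq S Rel w u"
| trans: "pres_eq S Rel u v \<Longrightarrow> pres_eq S Rel v w \<Longrightarrow> pres_eq S Rel u w"
| cancel: "u \<in> lists (S \<times> UNIV) \<Longrightarrow> w \<in> lists (S \<times> UNIV) \<Longrightarrow> x \<in> S
    \<Longrightarrow> pres_eq S Rel (u @ [(x, b), (x, \<not> b)] @ w) (u @ w)"
| relator: "u \<in> lists (S \<times> UNIV) \<Longrightarrow> w \<in> lists (S \<times> UNIV) \<Longrightarrow> r \<in> Rel \<inter> lists (S \<times> UNIV)
    \<Longrightarrow> pres_eq S Rel (u @ r @ w) (u @ w)"

definition pres_class :: "'a set \<Rightarrow> ('a \<times> bool) list set \<Rightarrow> ('a \<times> bool) list \<Rightarrow> ('a \<times> bool) list set" where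
  "pres_class S Rel w = {w'. pres_eq S Rel w w'}"

definition presented_group :: "'a set \<Rightarrow> ('a \<times> bool) list set \<Rightarrow> ('a \<times> bool) list set monoid" where
  "presented_group S Rel =
     \<lparr>carrier = pres_class S Rel ` lists (S \<times> UNIV),
      monoid.mult = (\<lambda>A B. \<Union>a\<in>A. \<Union>b\<in>B. pres_class S Rel (a @ b)),
      monoid.one = pres_class S Rel []\<rparr>"

definition raag_relators :: "'a set set \<Rightarrow> ('a \<times> bool) list set" where
  "raag_relators E = {[(u, True), (v, True), (u, False), (v, False)] | u v. {u, v} \<in> E}"

definition raag :: "'a set \<Rightarrow> 'a set set \<Rightarrow> ('a \<times> bool) list set monoid" where
  "raag V E = presented_group V (raag_relators E)"

definition raag_gen :: "'a set \<Rightarrow> 'a set set \<Rightarrow> 'a \<Rightarrow> ('a \<times> bool) list set" where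
  "raag_gen V E v = pres_class V (raag_relators E) [(v, True)]"


section \<open>Pro-\<open>p\<close> completions\<close>

definition p_power_index_normal :: "nat \<Rightarrow> ('g, 'm) monoid_scheme \<Rightarrow> 'g set set" where
  "p_power_index_normal p G = {N. N \<lhd> G \<and> (\<exists>k. order (G Mod N) = p ^ k)}"

text \<open>For normal subgroups \<open>M \<subseteq> N\<close>, the natural map from \<open>G Mod M\<close> to \<open>G Mod N\<close> sends a coset \<open>A\<close>
  to \<open>N <#>\<^bsub>G\<^esub> A\<close>.\<close>

definition pro_p_completion :: "nat \<Rightarrow> ('g, 'm) monoid_scheme \<Rightarrow> ('g set \<Rightarrow> 'g set) monoid" where
  "pro_p_completion p G =
     inv_lim_monoid (p_power_index_normal p G) (\<lambda>N M. M \<subseteq> N) (\<lambda>N. G Mod N) (\<lambda>N M A. N <#>\<^bsub>G\<^esub> A)"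

definition pro_p_topology :: "nat \<Rightarrow> ('g, 'm) monoid_scheme \<Rightarrow> ('g set \<Rightarrow> 'g set) topology" where
  "pro_p_topology p G =
     inv_lim_topology (p_power_index_normal p G) (\<lambda>N M. M \<subseteq> N) (\<lambda>N. carrier (G Mod N))
       (\<lambda>N M A. N <#>\<^bsub>G\<^esub> A)"

definition pro_p_embed :: "nat \<Rightarrow> ('g, 'm) monoid_scheme \<Rightarrow> 'g \<Rightarrow> 'g set \<Rightarrow> 'g set" where
  "pro_p_embed p G g = (\<lambda>N \<in> p_power_index_normal p G. N #>\<^bsub>G\<^esub> g)"


section \<open>Lower central series\<close>

definition commutator_subgroup :: "('g, 'm) monoid_scheme \<Rightarrow> 'g set \<Rightarrow> 'g set \<Rightarrow> 'g set" where
  "commutator_subgroup G H K =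
     generate G (\<Union>h\<in>H. \<Union>k\<in>K. {h \<otimes>\<^bsub>G\<^esub> k \<otimes>\<^bsub>G\<^esub> inv\<^bsub>G\<^esub> h \<otimes>\<^bsub>G\<^esub> inv\<^bsub>G\<^esub> k})"

text \<open>No closure is taken: these are abstract subgroups, also when \<open>G\<close> is profinite. The series is
  indexed from 1; the value at 0 is a dummy.\<close>

fun lower_central :: "('g, 'm) monoid_scheme \<Rightarrow> nat \<Rightarrow> 'g set" where
  "lower_central G 0 = carrier G"
| "lower_central G (Suc 0) = carrier G"
| "lower_central G (Suc (Suc n)) = commutator_subgroup G (carrier G) (lower_central G (Suc n))"


section \<open>Polynomials in partially commuting variables\<close>

text \<open>The free associative unital algebra: a polynomial is given by its coefficient function on
  words in \<open>V\<close> (extended by zero to all words), and the product is convolution.\<close>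

definition free_alg :: "('r, 'm) ring_scheme \<Rightarrow> 'a set \<Rightarrow> ('a list \<Rightarrow> 'r) ring" where
  "free_alg R V =
     \<lparr>carrier = {f. (\<forall>w. f w \<in> carrier R) \<and> finite {w. f w \<noteq> \<zero>\<^bsub>R\<^esub>} \<and> {w. f w \<noteq> \<zero>\<^bsub>R\<^esub>} \<subseteq> lists V},
      monoid.mult = (\<lambda>f g w. \<Oplus>\<^bsub>R\<^esub>i\<in>{..length w}. f (take i w) \<otimes>\<^bsub>R\<^esub> g (drop i w)),
      monoid.one = (\<lambda>w. if w = [] then \<one>\<^bsub>R\<^esub> else \<zero>\<^bsub>R\<^esub>),
      ring.zero = (\<lambda>w. \<zero>\<^bsub>R\<^esub>),
      ring.add = (\<lambda>f g w. f w \<oplus>\<^bsub>R\<^esub> g w)\<rparr>"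

definition free_alg_var :: "('r, 'm) ring_scheme \<Rightarrow> 'a \<Rightarrow> 'a list \<Rightarrow> 'r" where
  "free_alg_var R v = (\<lambda>w. if w = [v] then \<one>\<^bsub>R\<^esub> else \<zero>\<^bsub>R\<^esub>)"

definition pc_ideal :: "('r, 'm) ring_scheme \<Rightarrow> 'a set \<Rightarrow> 'a set set \<Rightarrow> ('a list \<Rightarrow> 'r) set" where
  "pc_ideal R V E = Idl\<^bsub>free_alg R V\<^esub>
     {(free_alg_var R u \<otimes>\<^bsub>free_alg R V\<^esub> free_alg_var R v)
        \<ominus>\<^bsub>free_alg R V\<^esub> (free_alg_var R v \<otimes>\<^bsub>free_alg R V\<^esub> free_alg_var R u) | u v. {u, v} \<in> E}"

definition pc_poly :: "('r, 'm) ring_scheme \<Rightarrow> 'a set \<Rightarrow> 'a set set \<Rightarrow> ('a list \<Rightarrow> 'r) set ring" where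
  "pc_poly R V E = free_alg R V Quot pc_ideal R V E"

definition pc_var :: "('r, 'm) ring_scheme \<Rightarrow> 'a set \<Rightarrow> 'a set set \<Rightarrow> 'a \<Rightarrow> ('a list \<Rightarrow> 'r) set" where
  "pc_var R V E v = pc_ideal R V E +>\<^bsub>free_alg R V\<^esub> free_alg_var R v"

definition pc_omega :: "('r, 'm) ring_scheme \<Rightarrow> 'a set \<Rightarrow> 'a set set \<Rightarrow> ('a list \<Rightarrow> 'r) set set" where
  "pc_omega R V E = Idl\<^bsub>pc_poly R V E\<^esub> (pc_var R V E ` V)"

primrec ideal_power :: "('r, 'm) ring_scheme \<Rightarrow> 'r set \<Rightarrow> nat \<Rightarrow> 'r set" where
  "ideal_power R J 0 = carrier R"
| "ideal_power R J (Suc n) = ideal_prod R J (ideal_power R J n)"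

abbreviation pc_omega_pow ::
  "('r, 'm) ring_scheme \<Rightarrow> 'a set \<Rightarrow> 'a set set \<Rightarrow> nat \<Rightarrow> ('a list \<Rightarrow> 'r) set set" where
  "pc_omega_pow R V E n \<equiv> ideal_power (pc_poly R V E) (pc_omega R V E) n"

definition pc_trunc ::
  "('r, 'm) ring_scheme \<Rightarrow> 'a set \<Rightarrow> 'a set set \<Rightarrow> nat \<Rightarrow> ('a list \<Rightarrow> 'r) set set ring" where
  "pc_trunc R V E n = pc_poly R V E Quot pc_omega_pow R V E n"


section \<open>The Magnus ring\<close>

text \<open>The map induced on quotients by \<open>h : A \<rightarrow> B\<close> with \<open>h ` I \<subseteq> J\<close>, where \<open>J\<close> is an ideal of \<open>B\<close>,
  takes a coset \<open>C\<close> of \<open>I\<close> to \<open>J + h ` C\<close>.\<close>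

definition quot_map :: "('s, 'm) ring_scheme \<Rightarrow> 's set \<Rightarrow> ('r \<Rightarrow> 's) \<Rightarrow> 'r set \<Rightarrow> 's set" where
  "quot_map B J h C = J <+>\<^bsub>B\<^esub> (h ` C)"

definition magnus_ring ::
  "('r, 'm) ring_scheme \<Rightarrow> 'a set \<Rightarrow> 'a set set \<Rightarrow> (nat \<Rightarrow> ('a list \<Rightarrow> 'r) set set) ring" where
  "magnus_ring R V E =
     inv_lim_ring {1..} (\<le>) (pc_trunc R V E)
       (\<lambda>m n. quot_map (pc_poly R V E) (pc_omega_pow R V E m) id)"

definition magnus_var ::
  "('r, 'm) ring_scheme \<Rightarrow> 'a set \<Rightarrow> 'a set set \<Rightarrow> 'a \<Rightarrow> nat \<Rightarrow> ('a list \<Rightarrow> 'r) set set" where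
  "magnus_var R V E v = (\<lambda>n\<in>{1..}. pc_omega_pow R V E n +>\<^bsub>pc_poly R V E\<^esub> pc_var R V E v)"

definition magnus_omega ::
  "('r, 'm) ring_scheme \<Rightarrow> 'a set \<Rightarrow> 'a set set \<Rightarrow> (nat \<Rightarrow> ('a list \<Rightarrow> 'r) set set) set" where
  "magnus_omega R V E = Idl\<^bsub>magnus_ring R V E\<^esub> (magnus_var R V E ` V)"

definition one_plus :: "('r, 'm) ring_scheme \<Rightarrow> 'r set \<Rightarrow> 'r set" where
  "one_plus R J = {\<one>\<^bsub>R\<^esub> \<oplus>\<^bsub>R\<^esub> x | x. x \<in> J}"

text \<open>The map \<open>R\<langle>\<Gamma>\<rangle>/\<omega>\<^sup>m \<rightarrow> S\<langle>\<Gamma>\<rangle>/\<omega>\<^sup>n\<close> (\<open>n \<le> m\<close>) induced by a ring homomorphism \<open>h : R \<rightarrow> S\<close>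
  applied to coefficients; the argument \<open>S\<close> is the target ring.\<close>

definition pc_trunc_map ::
  "('s, 'm) ring_scheme \<Rightarrow> 'a set \<Rightarrow> 'a set set \<Rightarrow> nat \<Rightarrow> ('r \<Rightarrow> 's)
     \<Rightarrow> ('a list \<Rightarrow> 'r) set set \<Rightarrow> ('a list \<Rightarrow> 's) set set" where
  "pc_trunc_map S V E n h =
     quot_map (pc_poly S V E) (pc_omega_pow S V E n)
       (quot_map (free_alg S V) (pc_ideal S V E) (\<lambda>f. h \<circ> f))"


section \<open>The Magnus ring over the \<open>p\<close>-adic integers\<close>

text \<open>The indices \<open>k\<close> and \<open>n\<close> start at 1 (\<open>residue_ring\<close> is only meant for moduli greater than 1);
  this does not affect the limits.\<close>

definition Zp :: "nat \<Rightarrow> (nat \<Rightarrow> int) ring" where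
  "Zp p = inv_lim_ring {1..} (\<le>) (\<lambda>k. residue_ring (int p ^ k)) (\<lambda>l k a. a mod int p ^ l)"

abbreviation magnus_Zp :: "nat \<Rightarrow> 'a set \<Rightarrow> 'a set set \<Rightarrow> (nat \<Rightarrow> ('a list \<Rightarrow> nat \<Rightarrow> int) set set) ring" where
  "magnus_Zp p V E \<equiv> magnus_ring (Zp p) V E"

text \<open>The profinite topology of the inverse limit of the finite discrete rings
  \<open>(\<int>/p\<^sup>k)\<langle>\<Gamma>\<rangle>/\<omega>\<^sup>n\<close>, indexed by the pairs \<open>(n, k)\<close>.\<close>

definition magnus_profinite_topology ::
  "nat \<Rightarrow> 'a set \<Rightarrow> 'a set set \<Rightarrow> (nat \<times> nat \<Rightarrow> ('a list \<Rightarrow> int) set set) topology" where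
  "magnus_profinite_topology p V E =
     inv_lim_topology ({1..} \<times> {1..})
       (\<lambda>(m, l) (n, k). m \<le> n \<and> l \<le> k)
       (\<lambda>(n, k). carrier (pc_trunc (residue_ring (int p ^ k)) V E n))
       (\<lambda>(m, l) (n, k). pc_trunc_map (residue_ring (int p ^ l)) V E m (\<lambda>a. a mod int p ^ l))"

definition magnus_to_profinite ::
  "nat \<Rightarrow> 'a set \<Rightarrow> 'a set set \<Rightarrow> (nat \<Rightarrow> ('a list \<Rightarrow> nat \<Rightarrow> int) set set)
     \<Rightarrow> (nat \<times> nat \<Rightarrow> ('a list \<Rightarrow> int) set set)" where
  "magnus_to_profinite p V E x =
     (\<lambda>(n, k) \<in> {1..} \<times> {1..}. pc_trunc_map (residue_ring (int p ^ k)) V E n (\<lambda>a. a k) (x n))"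

text \<open>For finite \<open>V\<close> the canonical map \<open>magnus_to_profinite\<close> is bijective onto the inverse limit;
  the Magnus ring carries the topology transported along it.\<close>

definition magnus_topology ::
  "nat \<Rightarrow> 'a set \<Rightarrow> 'a set set \<Rightarrow> (nat \<Rightarrow> ('a list \<Rightarrow> nat \<Rightarrow> int) set set) topology" where
  "magnus_topology p V E =
     pullback_topology (carrier (magnus_Zp p V E)) (magnus_to_profinite p V E)
       (magnus_profinite_topology p V E)"

definition one_plus_omega_group ::
  "nat \<Rightarrow> 'a set \<Rightarrow> 'a set set \<Rightarrow> (nat \<Rightarrow> ('a list \<Rightarrow> nat \<Rightarrow> int) set set) monoid" where
  "one_plus_omega_group p V E =
     (units_of (magnus_Zp p V E))
       \<lparr>carrier := one_plus (magnus_Zp p V E) (magnus_omega (Zp p) V E)\<rparr>"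

definition one_plus_omega_topology ::
  "nat \<Rightarrow> 'a set \<Rightarrow> 'a set set \<Rightarrow> (nat \<Rightarrow> ('a list \<Rightarrow> nat \<Rightarrow> int) set set) topology" where
  "one_plus_omega_topology p V E =
     subtopology (magnus_topology p V E) (one_plus (magnus_Zp p V E) (magnus_omega (Zp p) V E))"


section \<open>The Magnus map\<close>

abbreviation raag_pro_p :: "nat \<Rightarrow> 'a set \<Rightarrow> 'a set set
    \<Rightarrow> (('a \<times> bool) list set set \<Rightarrow> ('a \<times> bool) list set set) monoid" where
  "raag_pro_p p V E \<equiv> pro_p_completion p (raag V E)"

text \<open>Maps out of the completion are taken \<open>extensional\<close> (arbitrary but fixed outside the carrier),
  so that uniqueness of such a map can be stated as equality of HOL functions.\<close>

definition is_magnus_map :: "nat \<Rightarrow> 'a set \<Rightarrow> 'a set set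
    \<Rightarrow> ((('a \<times> bool) list set set \<Rightarrow> ('a \<times> bool) list set set)
          \<Rightarrow> nat \<Rightarrow> ('a list \<Rightarrow> nat \<Rightarrow> int) set set) \<Rightarrow> bool" where
  "is_magnus_map p V E \<mu> \<longleftrightarrow>
     \<mu> \<in> extensional (carrier (raag_pro_p p V E)) \<and>
     \<mu> \<in> hom (raag_pro_p p V E) (one_plus_omega_group p V E) \<and>
     continuous_map (pro_p_topology p (raag V E)) (one_plus_omega_topology p V E) \<mu> \<and>
     (\<forall>v\<in>V. \<mu> (pro_p_embed p (raag V E) (raag_gen V E v)) =
        \<one>\<^bsub>magnus_Zp p V E\<^esub> \<oplus>\<^bsub>magnus_Zp p V E\<^esub> magnus_var (Zp p) V E v)"

end

theory Submission
  imports Defs "HOL-Library.List_Lexorder"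
begin

text \<open>Sending \<open>s\<^sub>v\<close> to \<open>1 + v\<close> and its inverse to the geometric series turns every word in the letters
  \<open>s\<^sub>v\<^sup>\<plusminus>\<^sup>1\<close> into a power series with integer coefficients in noncommuting variables (\<open>magnus\<close>). After
  imposing the commutation relations, a series is determined by its class sums: the sums of its
  coefficients over the traces, that is, over the classes of words modulo exchanging neighbouring
  letters that are joined by an edge (\<open>csum\<close>). So the whole argument can be run on words and integers:
  the elements of \<open>A\<^sub>\<Gamma>\<close> whose series is \<open>1\<close> below degree \<open>n\<close> modulo \<open>q\<close> form a congruence subgroup
  \<open>KA n q\<close>, and the cosets of \<open>KA n q\<close> correspond to the class sums below degree \<open>n\<close> modulo \<open>q\<close>.

  The groups \<open>KA n (p\<^sup>k)\<close> are normal of \<open>p\<close>-power index (\<open>KA_index\<close>), and every normal subgroup of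
  \<open>p\<close>-power index contains one of them (\<open>KA_cofinal\<close>): the augmentation ideal of a finite \<open>p\<close>-group
  over \<open>\<int>/p\<close> is nilpotent, so a truncated Magnus expansion modulo \<open>p\<close> determines the image of a word in
  the quotient. Hence an element of the pro-\<open>p\<close> completion is a coherent family of class sums modulo all
  \<open>p\<^sup>k\<close>, which amounts to one \<open>p\<close>-adic integer per trace, and these are the coefficients of an element
  of the Magnus ring. This yields the map \<open>\<mu>\<^sub>p\<close>, its continuity and its injectivity; it is the only map
  with these properties because \<open>A\<^sub>\<Gamma>\<close> is dense.

  The preimage of \<open>1 + \<omega>\<^sup>n\<close> is the set \<open>PD n\<close> of those elements that are trivial modulo \<open>KA n (p\<^sup>k)\<close> for
  all \<open>k\<close>. It remains to show that \<open>PD (n + 1)\<close> is the subgroup generated by the commutators of arbitrary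
  elements with elements of \<open>PD n\<close>. These commutators lie in \<open>PD (n + 1)\<close> for degree reasons. The converse
  has three ingredients.

  \<^item> The leading term of a group element is a Lie polynomial (\<open>leading_term_lie\<close>), and every Lie polynomial
    is the leading term of a group element (\<open>lie_realised\<close>). The first statement rests on the fact that
    Magnus expansions are group-like: the smallest word of the leading term is then a Lyndon word
    (\<open>leading_word_lyndon\<close>), every Lyndon word is the smallest word of a Lie polynomial (\<open>lyndon_lie\<close>), and
    subtracting a multiple of the latter makes progress. This holds over the integers and also
    modulo divisibility: if the leading coefficients are divisible by \<open>q\<close>, the term is \<open>q\<close> times a
    Lie polynomial.

  \<^item> An element of the completion that lies in \<open>PD (n + 1)\<close> is only approximated by words of low degree
    whose coefficients are divisible by high powers of \<open>p\<close>. Dividing by high powers of group elements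
    pushes such a word to degree \<open>n + 1\<close> without changing it much (\<open>approximate_in_filtration\<close>).

  \<^item> A Lie polynomial of degree \<open>m > 1\<close> is a sum of brackets \<open>[v, Q\<^sub>v]\<close>, one for each vertex. So a word of
    degree \<open>n + 1\<close> agrees up to any given degree with a product of commutators \<open>[s\<^sub>v, y\<^sub>v]\<close>, one for each
    vertex, with \<open>y\<^sub>v\<close> of degree \<open>n\<close> (\<open>product_of_commutators\<close>). The number of factors does not depend on
    the precision, so by compactness the \<open>y\<^sub>v\<close> can be chosen to converge, and every element of
    \<open>PD (n + 1)\<close> is a product of one commutator for each vertex. This is why the abstract lower central
    series needs no closure.\<close>

section \<open>Traces\<close>

text \<open>Two words are related when they represent the same element of the trace monoid, in which the
  two ends of every edge commute.\<close>


inductive tr :: "'a set set \<Rightarrow> 'a list \<Rightarrow> 'a list \<Rightarrow> bool" for E where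
  tr_refl: "tr E w w"
| tr_swap: "tr E u (x @ a # b # y) \<Longrightarrow> {a, b} \<in> E \<Longrightarrow> tr E u (x @ b # a # y)"

lemma tr_trans: "tr E v w \<Longrightarrow> tr E u v \<Longrightarrow> tr E u w"
  by (induction rule: tr.induct) (auto intro: tr.intros)

lemma tr_step: "{a, b} \<in> E \<Longrightarrow> tr E (x @ a # b # y) (x @ b # a # y)"
  by (rule tr_swap[OF tr_refl])

lemma tr_sym: "tr E u w \<Longrightarrow> tr E w u"
proof (induction rule: tr.induct)
  case (tr_swap u x a b y)
  have "tr E (x @ b # a # y) (x @ a # b # y)" by (rule tr_step) (use tr_swap in \<open>simp add: insert_commute\<close>)
  then show ?case using tr_swap tr_trans by metis
qed (rule tr_refl)

lemma tr_mset: "tr E u w \<Longrightarrow> mset w = mset u"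
proof (induction rule: tr.induct)
  case (tr_swap u x a b y)
  have "mset (x @ b # a # y) = mset (x @ a # b # y)" by simp
  then show ?case using tr_swap.IH by metis
qed simp

lemma tr_length: "tr E u w \<Longrightarrow> length w = length u"
  by (metis tr_mset size_mset)

lemma tr_set: "tr E u w \<Longrightarrow> set w = set u"
  by (metis tr_mset set_mset_mset)

lemma tr_lists: "tr E u w \<Longrightarrow> u \<in> lists V \<Longrightarrow> w \<in> lists V"
  by (metis tr_set in_lists_conv_set)

lemma tr_append_left: "tr E u w \<Longrightarrow> tr E (x @ u) (x @ w)"
proof (induction rule: tr.induct)
  case (tr_swap u y a b z)
  then show ?case using tr.tr_swap[of E "x @ u" "x @ y" a b z] by simp
qed (rule tr_refl)

lemma tr_append_right: "tr E u w \<Longrightarrow> tr E (u @ x) (w @ x)"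
proof (induction rule: tr.induct)
  case (tr_swap u y a b z)
  then show ?case using tr.tr_swap[of E "u @ x" "y" a b "z @ x"] by simp
qed (rule tr_refl)

lemma tr_append: "tr E u u' \<Longrightarrow> tr E w w' \<Longrightarrow> tr E (u @ w) (u' @ w')"
  by (meson tr_trans tr_append_left tr_append_right)

definition cl :: "'a set set \<Rightarrow> 'a list \<Rightarrow> 'a list set" where
  "cl E w = {w'. tr E w w'}"

lemma cl_self[simp]: "w \<in> cl E w"
  by (simp add: cl_def tr_refl)

lemma cl_eqI: "tr E u w \<Longrightarrow> cl E w = cl E u"
proof -
  assume uw: "tr E u w"
  have "tr E w x \<longleftrightarrow> tr E u x" for x
    using tr_trans[of E w x u] tr_trans[of E u x w] tr_sym[OF uw] uw by blast
  then show ?thesis by (simp add: cl_def)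
qed

lemma finite_mset_eq: "finite {w'. mset w' = M}"
proof -
  obtain w where w: "M = mset w" by (metis ex_mset)
  have "{w'. mset w' = mset w} \<subseteq> {w'. set w' \<subseteq> set w \<and> length w' = length w}"
    by (auto dest: mset_eq_length mset_eq_setD)
  then show ?thesis unfolding w by (rule finite_subset) (simp add: finite_lists_length_eq)
qed

lemma finite_cl[simp]: "finite (cl E w)"
  by (rule finite_subset[OF _ finite_mset_eq[of "mset w"]]) (auto simp: cl_def tr_mset)

lemma cl_nil[simp]: "cl E [] = {[]}"
  unfolding cl_def using tr_length[of E "[]"] by (auto intro: tr_refl)

text \<open>Sums over a set that is closed under \<open>tr\<close> split into class sums; the induction principle peels off
  one trace at a time.\<close>

definition tr_closed :: "'a set set \<Rightarrow> 'a list set \<Rightarrow> bool" where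
  "tr_closed E A \<longleftrightarrow> (\<forall>u w. u \<in> A \<longrightarrow> tr E u w \<longrightarrow> w \<in> A)"

lemma tr_closed_induct [consumes 2, case_names empty union]:
  assumes "finite A" "tr_closed E A"
    and "P {}"
    and "\<And>w B. finite B \<Longrightarrow> tr_closed E B \<Longrightarrow> w \<in> A \<Longrightarrow> B \<subseteq> A \<Longrightarrow> P B \<Longrightarrow> cl E w \<inter> B = {} \<Longrightarrow> P (cl E w \<union> B)"
  shows "P A"
proof -
  have "B \<subseteq> A \<Longrightarrow> tr_closed E B \<Longrightarrow> P B" for B
  proof (induction "card B" arbitrary: B rule: less_induct)
    case less
    have fB: "finite B" using less.prems assms(1) finite_subset by blast
    show ?case
    proof (cases "B = {}")
      case False
      then obtain w where w: "w \<in> B" by blast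
      define C where "C = B - cl E w"
      have sub: "cl E w \<subseteq> B" using less.prems(2) w by (auto simp: tr_closed_def cl_def)
      have C: "tr_closed E C" unfolding tr_closed_def
      proof (intro allI impI)
        fix u v assume u: "u \<in> C" and uv: "tr E u v"
        have "v \<in> B" using u uv less.prems(2) by (auto simp: C_def tr_closed_def)
        moreover have "v \<notin> cl E w"
        proof
          assume "v \<in> cl E w"
          then have "tr E w u" using uv tr_sym tr_trans unfolding cl_def by (metis mem_Collect_eq)
          then show False using u by (auto simp: C_def cl_def)
        qed
        ultimately show "v \<in> C" by (simp add: C_def)
      qed
      have "card C < card B" unfolding C_def
        by (rule psubset_card_mono[OF fB]) (use w in \<open>auto intro: cl_self\<close>)
      then have "P C" using less.hyps C less.prems C_def by blast
      then have "P (cl E w \<union> C)"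
        using assms(4)[of C w] C fB w less.prems unfolding C_def by auto
      moreover have "cl E w \<union> C = B" using sub by (auto simp: C_def)
      ultimately show ?thesis by simp
    qed (simp add: assms(3))
  qed
  then show ?thesis using assms(2) by blast
qed

text \<open>The factorisations of a trace. They depend on \<open>w\<close> only up to \<open>tr\<close>, which is what makes class sums
  compatible with products.\<close>

definition splits :: "'a set set \<Rightarrow> 'a list \<Rightarrow> ('a list \<times> 'a list) set" where
  "splits E w = {(u, v). tr E w (u @ v)}"

lemma splits_bij:
  "bij_betw (\<lambda>(w', i). (take i w', drop i w')) (Sigma (cl E w) (\<lambda>w'. {..length w'})) (splits E w)"
  by (rule bij_betwI[where g = "\<lambda>(u, v). (u @ v, length u)"])
     (auto simp: splits_def cl_def)

lemma finite_splits[simp]: "finite (splits E w)"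
  using bij_betw_finite[OF splits_bij, of E w] by (auto intro!: finite_SigmaI)

lemma finite_splits_sections[simp]:
  "finite {u. (u, v) \<in> splits E w \<and> P u}" "finite {v. (u, v) \<in> splits E w \<and> Q v}"
  by (rule finite_subset[of _ "fst ` splits E w"], force, simp)
     (rule finite_subset[of _ "snd ` splits E w"], force, simp)

lemma splits_tr: "(u, v) \<in> splits E w \<Longrightarrow> tr E u u' \<Longrightarrow> tr E v v' \<Longrightarrow> (u', v') \<in> splits E w"
  unfolding splits_def using tr_append tr_trans by fast

lemma splits_length: "(u, v) \<in> splits E w \<Longrightarrow> length u + length v = length w"
  unfolding splits_def using tr_length by fastforce

lemma splits_closed:
  "tr_closed E {u. (u, v) \<in> splits E w \<and> P (length u)}"
  "tr_closed E {v. (u, v) \<in> splits E w \<and> Q (length v)}"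
  unfolding tr_closed_def by (auto intro: splits_tr tr_refl simp: tr_length)

section \<open>Noncommutative power series over the integers\<close>

typedef 'a ps = "UNIV :: ('a list \<Rightarrow> int) set" morphisms coef Ps by simp

setup_lifting type_definition_ps

lemma ps_eqI: "(\<And>w. coef f w = coef g w) \<Longrightarrow> f = g"
  by transfer auto

definition conv :: "('a list \<Rightarrow> int) \<Rightarrow> ('a list \<Rightarrow> int) \<Rightarrow> 'a list \<Rightarrow> int" where
  "conv f g w = (\<Sum>i\<le>length w. f (take i w) * g (drop i w))"

lemma conv_Nil: "conv f g [] = f [] * g []"
  by (simp add: conv_def)

lemma conv_Cons: "conv f g (a # w) = f [] * g (a # w) + conv (\<lambda>u. f (a # u)) g w"
  by (simp add: conv_def sum.atMost_Suc_shift del: sum.atMost_Suc)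

lemma conv_add_left: "conv (\<lambda>u. f u + g u) h w = conv f h w + conv g h w"
  by (simp add: conv_def sum.distrib distrib_right)

lemma conv_add_right: "conv f (\<lambda>u. g u + h u) w = conv f g w + conv f h w"
  by (simp add: conv_def sum.distrib distrib_left)

lemma conv_scale_left: "conv (\<lambda>u. c * f u) g w = c * conv f g w"
  by (simp add: conv_def sum_distrib_left mult.assoc)

lemma conv_assoc: "conv (conv f g) h w = conv f (conv g h) w"
proof (induction w arbitrary: f)
  case Nil
  then show ?case by (simp add: conv_Nil)
next
  case (Cons a w)
  have "(\<lambda>u. conv f g (a # u)) = (\<lambda>u. f [] * g (a # u) + conv (\<lambda>u. f (a # u)) g u)"
    by (simp add: conv_Cons)
  then show ?case
    by (simp add: conv_Cons conv_Nil conv_add_left conv_scale_left Cons.IH algebra_simps)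
qed

instantiation ps :: (type) ring_1
begin
lift_definition zero_ps :: "'a ps" is "\<lambda>w. 0" .
lift_definition one_ps :: "'a ps" is "\<lambda>w. if w = [] then 1 else 0" .
lift_definition plus_ps :: "'a ps \<Rightarrow> 'a ps \<Rightarrow> 'a ps" is "\<lambda>f g w. f w + g w" .
lift_definition minus_ps :: "'a ps \<Rightarrow> 'a ps \<Rightarrow> 'a ps" is "\<lambda>f g w. f w - g w" .
lift_definition uminus_ps :: "'a ps \<Rightarrow> 'a ps" is "\<lambda>f w. - f w" .
lift_definition times_ps :: "'a ps \<Rightarrow> 'a ps \<Rightarrow> 'a ps" is conv .
instance
proof
  fix f g h :: "'a ps"
  show "f * g * h = f * (g * h)" by transfer (simp add: conv_assoc fun_eq_iff)
  show "(f + g) * h = f * h + g * h" by transfer (simp add: conv_add_left fun_eq_iff)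
  show "f * (g + h) = f * g + f * h" by transfer (simp add: conv_add_right fun_eq_iff)
  show "1 * f = f"
  proof (transfer, rule ext)
    fix f :: "'a list \<Rightarrow> int" and w
    have z: "conv (\<lambda>u. 0) f w = 0" for w by (simp add: conv_def)
    show "conv (\<lambda>w. if w = [] then 1 else 0) f w = f w"
      by (cases w) (simp_all add: conv_Nil conv_Cons z)
  qed
  show "f * 1 = f"
  proof (transfer, rule ext)
    fix f :: "'a list \<Rightarrow> int" and w
    show "conv f (\<lambda>w. if w = [] then 1 else 0) w = f w"
      by (induction w arbitrary: f) (simp_all add: conv_Nil conv_Cons)
  qed
  show "(0 :: 'a ps) \<noteq> 1" by transfer (auto simp: fun_eq_iff)
  show "f + g + h = f + (g + h)" by transfer (simp add: fun_eq_iff)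
  show "f + g = g + f" by transfer (simp add: fun_eq_iff)
  show "0 + f = f" by transfer simp
  show "- f + f = 0" by transfer simp
  show "f - g = f + - g" by transfer simp
qed
end

lemma coef_simps[simp]:
  "coef 0 w = 0" "coef 1 w = (if w = [] then 1 else 0)" "coef (f + g) w = coef f w + coef g w"
  "coef (f - g) w = coef f w - coef g w" "coef (- f) w = - coef f w"
  by (transfer, simp)+

lemma coef_mult: "coef (f * g) w = (\<Sum>i\<le>length w. coef f (take i w) * coef g (drop i w))"
  by transfer (simp add: conv_def)

lemma coef_mult_Cons: "coef (f * g) (a # w) = coef f [] * coef g (a # w) + coef (Ps (\<lambda>u. coef f (a # u)) * g) w"
  by (transfer, simp add: conv_Cons)

lemma coef_sum[simp]: "coef (sum f A) w = (\<Sum>x\<in>A. coef (f x) w)"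
  by (induction A rule: infinite_finite_induct) auto

lemma coef_of_int: "coef (of_int c * f) w = c * coef f w"
proof -
  have "coef (of_nat n * f) w = int n * coef f w" for n
    by (induction n) (auto simp: algebra_simps)
  then show ?thesis
    by (cases c rule: int_cases2) simp_all
qed

lift_definition var :: "'a \<Rightarrow> 'a ps" is "\<lambda>v w. if w = [v] then 1 else 0" .

lemma coef_var: "coef (var v) w = (if w = [v] then 1 else 0)"
  by transfer simp

lemma coef_var_mult_Nil[simp]: "coef (var v * f) [] = 0"
  by (simp add: coef_mult coef_var)

lemma coef_var_mult_Cons[simp]: "coef (var v * f) (a # w) = (if a = v then coef f w else 0)"
proof -
  have "Ps (\<lambda>u. coef (var v) (a # u)) = (if a = v then 1 else 0)"
    by (rule ps_eqI) (simp add: Ps_inverse coef_var)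
  from arg_cong[OF this, of "\<lambda>g. coef (g * f) w"] show ?thesis
    unfolding coef_mult_Cons by (auto simp: coef_var)
qed

section \<open>Class sums\<close>

text \<open>The coefficient of the trace of \<open>w\<close> in the image of a series in the partially commuting variables.\<close>

definition csum :: "'a set set \<Rightarrow> 'a ps \<Rightarrow> 'a list \<Rightarrow> int" where
  "csum E f w = (\<Sum>w'\<in>cl E w. coef f w')"

lemma csum_simps[simp]:
  "csum E 0 w = 0" "csum E (f + g) w = csum E f w + csum E g w"
  "csum E (f - g) w = csum E f w - csum E g w" "csum E (- f) w = - csum E f w"
  by (simp_all add: csum_def sum.distrib sum_subtractf sum_negf)

lemma csum_of_int[simp]: "csum E (of_int c * f) w = c * csum E f w"
  by (simp add: csum_def coef_of_int sum_distrib_left)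

lemma csum_sum[simp]: "csum E (sum f A) w = (\<Sum>x\<in>A. csum E (f x) w)"
  by (induction A rule: infinite_finite_induct) auto

lemma csum_tr: "tr E u w \<Longrightarrow> csum E f w = csum E f u"
  using cl_eqI[of E u w] by (simp add: csum_def)

lemma csum_Nil[simp]: "csum E f [] = coef f []"
  by (simp add: csum_def)

lemma csum_1: "csum E 1 w = (if w = [] then 1 else 0)"
proof (cases "w = []")
  case False
  then have "coef 1 w' = 0" if "w' \<in> cl E w" for w'
    using that tr_length[of E w w'] by (auto simp: cl_def)
  then show ?thesis using False by (simp add: csum_def)
qed simp

lemma csum_mult: "csum E (f * g) w = (\<Sum>(u, v)\<in>splits E w. coef f u * coef g v)"
proof -
  have "csum E (f * g) w = (\<Sum>(w', i)\<in>Sigma (cl E w) (\<lambda>w'. {..length w'}). coef f (take i w') * coef g (drop i w'))"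
    by (simp add: csum_def coef_mult sum.Sigma)
  also have "\<dots> = (\<Sum>x\<in>Sigma (cl E w) (\<lambda>w'. {..length w'}).
      (\<lambda>p. coef f (fst p) * coef g (snd p)) ((\<lambda>(w', i). (take i w', drop i w')) x))"
    by (simp add: case_prod_beta)
  also have "\<dots> = (\<Sum>p\<in>splits E w. coef f (fst p) * coef g (snd p))"
    by (rule sum.reindex_bij_betw[OF splits_bij])
  finally show ?thesis by (simp add: case_prod_beta)
qed

lemma dvd_sum_tr_closed:
  assumes "finite A" "tr_closed E A" "\<And>w. w \<in> A \<Longrightarrow> q dvd csum E f w"
  shows "q dvd (\<Sum>w\<in>A. coef f w)"
  using assms(1,2)
proof (induction rule: tr_closed_induct)
  case (union w B)
  have "(\<Sum>w\<in>cl E w \<union> B. coef f w) = csum E f w + (\<Sum>w\<in>B. coef f w)"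
    unfolding csum_def by (rule sum.union_disjoint) (use union in auto)
  then show ?case using union assms(3) by simp
qed simp

text \<open>The ideal of series that vanish below degree \<open>n\<close>, modulo \<open>q\<close>, in the partially commuting
  variables; the modulus \<open>q = 0\<close> means honest vanishing.\<close>

definition Idn :: "'a set set \<Rightarrow> nat \<Rightarrow> int \<Rightarrow> 'a ps set" where
  "Idn E n q = {f. \<forall>w. length w < n \<longrightarrow> q dvd csum E f w}"

lemma Idn_I: "(\<And>w. length w < n \<Longrightarrow> q dvd csum E f w) \<Longrightarrow> f \<in> Idn E n q"
  by (simp add: Idn_def)

lemma Idn_D: "f \<in> Idn E n q \<Longrightarrow> length w < n \<Longrightarrow> q dvd csum E f w"
  by (simp add: Idn_def)

lemma Idn_zero[simp]: "0 \<in> Idn E n q"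
  and Idn_add: "f \<in> Idn E n q \<Longrightarrow> g \<in> Idn E n q \<Longrightarrow> f + g \<in> Idn E n q"
  and Idn_diff: "f \<in> Idn E n q \<Longrightarrow> g \<in> Idn E n q \<Longrightarrow> f - g \<in> Idn E n q"
  and Idn_neg: "f \<in> Idn E n q \<Longrightarrow> - f \<in> Idn E n q"
  and Idn_of_int: "f \<in> Idn E n q \<Longrightarrow> of_int c * f \<in> Idn E n q"
  by (simp_all add: Idn_def)

lemma Idn_sum: "(\<And>x. x \<in> A \<Longrightarrow> f x \<in> Idn E n q) \<Longrightarrow> sum f A \<in> Idn E n q"
  by (induction A rule: infinite_finite_induct) (auto intro: Idn_add)

lemma Idn_mono: "f \<in> Idn E n q \<Longrightarrow> m \<le> n \<Longrightarrow> r dvd q \<Longrightarrow> f \<in> Idn E m r"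
  by (auto simp: Idn_def intro: dvd_trans)

lemma Idn_0[simp]: "f \<in> Idn E 0 q"
  by (simp add: Idn_def)

text \<open>In \<open>csum_mult\<close> the pairs \<open>(u, v)\<close> with \<open>u\<close> short are summed over \<open>u\<close> first, the others over \<open>v\<close> first. Either
  inner sum runs over a set closed under \<open>tr\<close>, hence is a sum of class sums in a low degree.\<close>

lemma Idn_mult:
  assumes "f \<in> Idn E n q" "g \<in> Idn E m q"
  shows "f * g \<in> Idn E (n + m) q"
proof (rule Idn_I)
  fix w :: "'a list" assume len: "length w < n + m"
  let ?P = "{p \<in> splits E w. length (fst p) < n}" and ?Q = "{p \<in> splits E w. \<not> length (fst p) < n}"
  have 1: "q dvd (\<Sum>(u, v)\<in>?P. coef f u * coef g v)"
  proof -
    have "?P = prod.swap ` (Sigma (snd ` splits E w) (\<lambda>v. {u. (u, v) \<in> splits E w \<and> length u < n}))"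
      by force
    then have "(\<Sum>(u, v)\<in>?P. coef f u * coef g v) =
        (\<Sum>(v, u)\<in>Sigma (snd ` splits E w) (\<lambda>v. {u. (u, v) \<in> splits E w \<and> length u < n}). coef f u * coef g v)"
      by (simp add: sum.reindex case_prod_beta)
    also have "\<dots> = (\<Sum>v\<in>snd ` splits E w. (\<Sum>u | (u, v) \<in> splits E w \<and> length u < n. coef f u) * coef g v)"
      by (subst sum.Sigma[symmetric])
        (simp_all add: sum_distrib_right)
    also have "q dvd \<dots>"
      by (intro dvd_sum dvd_mult2 dvd_sum_tr_closed[where E = E] splits_closed)
        (auto intro: Idn_D[OF assms(1)])
    finally show ?thesis .
  qed
  have 2: "q dvd (\<Sum>(u, v)\<in>?Q. coef f u * coef g v)"
  proof -
    have "?Q = (Sigma (fst ` splits E w) (\<lambda>u. {v. (u, v) \<in> splits E w \<and> \<not> length u < n}))"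
      by force
    then have "(\<Sum>(u, v)\<in>?Q. coef f u * coef g v) =
        (\<Sum>(u, v)\<in>Sigma (fst ` splits E w) (\<lambda>u. {v. (u, v) \<in> splits E w \<and> \<not> length u < n}). coef f u * coef g v)"
      by simp
    also have "\<dots> = (\<Sum>u\<in>fst ` splits E w. coef f u * (\<Sum>v | (u, v) \<in> splits E w \<and> \<not> length u < n. coef g v))"
      by (subst sum.Sigma[symmetric])
        (simp_all add: sum_distrib_left)
    also have "q dvd \<dots>"
      by (intro dvd_sum dvd_mult dvd_sum_tr_closed[where E = E] splits_closed)
        (use len in \<open>auto intro!: Idn_D[OF assms(2)] dest: splits_length\<close>)
    finally show ?thesis .
  qed
  have "csum E (f * g) w = (\<Sum>(u, v)\<in>?P. coef f u * coef g v) + (\<Sum>(u, v)\<in>?Q. coef f u * coef g v)"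
  proof -
    have "splits E w = ?P \<union> ?Q" by blast
    then have "csum E (f * g) w = (\<Sum>(u, v)\<in>?P \<union> ?Q. coef f u * coef g v)"
      unfolding csum_mult by simp
    also have "\<dots> = (\<Sum>(u, v)\<in>?P. coef f u * coef g v) + (\<Sum>(u, v)\<in>?Q. coef f u * coef g v)"
      by (rule sum.union_disjoint) auto
    finally show ?thesis .
  qed
  then show "q dvd csum E (f * g) w" using 1 2 by simp
qed

lemma Idn_mult_left: "f \<in> Idn E n q \<Longrightarrow> g * f \<in> Idn E n q"
  using Idn_mult[of g E 0 q f n] by simp

lemma Idn_mult_right: "f \<in> Idn E n q \<Longrightarrow> f * g \<in> Idn E n q"
  using Idn_mult[of f E n q g 0] by simp

section \<open>Shuffles and lexicographically minimal suffixes\<close>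

lemma lex_append_mono: "u \<le> u' \<Longrightarrow> length u = length u' \<Longrightarrow> v \<le> v' \<Longrightarrow> u @ v \<le> u' @ (v' :: 'a::linorder list)"
proof (induction u arbitrary: u')
  case (Cons a u)
  then show ?case by (cases u') auto
qed auto

lemma lex_append_less: "u < u' \<Longrightarrow> length u = length u' \<Longrightarrow> u @ v < u' @ (v' :: 'a::linorder list)"
proof (induction u arbitrary: u')
  case (Cons a u)
  then show ?case by (cases u') auto
qed auto

lemma lex_append_same[simp]: "u @ v \<le> u @ w \<longleftrightarrow> v \<le> (w :: 'a::linorder list)" "u @ v < u @ w \<longleftrightarrow> v < w"
  by (induction u) auto

lemma lex_le_append: "u \<le> u @ (v :: 'a::linorder list)"
  by (induction u) auto

lemma lex_less_cases: "u < (v :: 'a::linorder list) \<Longrightarrow> (\<exists>x. x \<noteq> [] \<and> v = u @ x) \<or> (\<forall>x y. u @ x < v @ y)"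
proof (induction u arbitrary: v)
  case Nil
  then show ?case by (cases v) auto
next
  case (Cons a u)
  then obtain b v' where v: "v = b # v'" by (cases v) auto
  show ?case
  proof (cases "a < b")
    case False
    then have "a = b" "u < v'" using Cons.prems v by auto
    then show ?thesis using Cons.IH[of v'] v by auto
  qed (use v in auto)
qed

lemma append_shuffle: "u @ v \<in> shuffles u v"
proof (induction u)
  case (Cons a u)
  then show ?case by (cases v) auto
qed auto

text \<open>A shuffle of \<open>qy\<close> and \<open>y'\<close> does not get smaller when the common prefix \<open>q\<close> is attached to the smaller
  of the two words instead, since the larger word \<open>y\<close> is then available earlier.\<close>

lemma shuffles_exchange:
  fixes y y' :: "'a::linorder list"
  assumes "y' \<le> y" "z \<in> shuffles (q @ y) y'"
  shows "\<exists>z'\<in>shuffles y (q @ y'). z \<le> z'"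
  using assms
proof (induction z arbitrary: q y y')
  case Nil
  then show ?case by auto
next
  case (Cons c z)
  show ?case
  proof (cases q)
    case Nil
    then show ?thesis using Cons.prems by auto
  next
    case q: (Cons a q')
    from Cons.prems(2) q consider "c = a" "z \<in> shuffles (q' @ y) y'"
      | y'' where "y' = c # y''" "z \<in> shuffles (q @ y) y''"
      by (cases y') auto
    then show ?thesis
    proof cases
      case 1
      then obtain z' where "z' \<in> shuffles y (q' @ y')" "z \<le> z'" using Cons.IH Cons.prems(1) by blast
      then show ?thesis using 1 q by (intro bexI[of _ "c # z'"]) (auto intro: Cons_in_shuffles_rightI)
    next
      case 2
      then obtain d y3 where y: "y = d # y3" "c \<le> d" using Cons.prems(1) by (cases y) auto
      show ?thesis
      proof (cases "c = d")
        case True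
        then have "y'' \<le> y3" "z \<in> shuffles ((q @ [c]) @ y3) y''" using 2 y Cons.prems(1) by auto
        then obtain z' where "z' \<in> shuffles y3 ((q @ [c]) @ y'')" "z \<le> z'" using Cons.IH by blast
        then show ?thesis using 2 y True by (intro bexI[of _ "c # z'"]) (auto intro: Cons_in_shuffles_leftI)
      next
        case False
        have "d # (y3 @ q @ y') \<in> shuffles y (q @ y')"
          unfolding y by (intro Cons_in_shuffles_leftI append_shuffle) 
        then show ?thesis using False y by (intro bexI[of _ "d # (y3 @ q @ y')"]) auto
      qed
    qed
  qed
qed

text \<open>If no suffix of \<open>u\<close> is smaller than \<open>v\<close>, then it never pays to use a letter of \<open>v\<close> before \<open>u\<close> is
  exhausted.\<close>

lemma shuffles_le_append:
  fixes u v :: "'a::linorder list"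
  assumes "\<And>x y. u = x @ y \<Longrightarrow> y \<noteq> [] \<Longrightarrow> v \<le> y" "z \<in> shuffles u v"
  shows "z \<le> u @ v"
  using assms
proof (induction u arbitrary: z)
  case (Cons a u)
  have IH: "z \<le> u @ v" if "z \<in> shuffles u v" for z
    using Cons.IH[OF _ that] Cons.prems(1)[of "a # _"] by auto
  have "v \<le> a # u" using Cons.prems(1)[of "[]"] by simp
  have "\<exists>z'. z' \<in> shuffles u v \<and> z \<le> a # z'"
  proof (cases v)
    case Nil
    then show ?thesis using Cons.prems(2) by auto
  next
    case v: (Cons c v')
    from Cons.prems(2) v consider z1 where "z = a # z1" "z1 \<in> shuffles u v"
      | z1 where "z = c # z1" "z1 \<in> shuffles (a # u) v'" by auto
    then show ?thesis
    proof cases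
      case 2
      show ?thesis
      proof (cases "c = a")
        case True
        then have "v' \<le> u" using \<open>v \<le> a # u\<close> v by simp
        then obtain z' where "z' \<in> shuffles u ([a] @ v')" "z1 \<le> z'"
          using shuffles_exchange[of v' u z1 "[a]"] 2 by auto
        then show ?thesis using True v 2 by auto
      next
        case False
        then have "c < a" using \<open>v \<le> a # u\<close> v by auto
        then show ?thesis using 2 append_shuffle[of u v] by auto
      qed
    qed auto
  qed
  then obtain z' where "z' \<in> shuffles u v" "z \<le> a # z'" by blast
  moreover from this have "a # z' \<le> (a # u) @ v" using IH by simp
  ultimately show ?case by (meson order_trans)
qed simp

lemma shuffles_mono:
  fixes u v :: "'a::linorder list"
  assumes "z \<in> shuffles u v" "u \<le> u'" "v \<le> v'" "length u = length u'" "length v = length v'"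
  shows "\<exists>z'\<in>shuffles u' v'. z \<le> z'"
  using assms
proof (induction u v arbitrary: u' v' z rule: shuffles.induct)
  case (3 a u b v)
  obtain a' u'' where u': "u' = a' # u''" using 3 by (cases u') auto
  obtain b' v'' where v': "v' = b' # v''" using 3 by (cases v') auto
  from "3.prems"(1) consider z1 where "z = a # z1" "z1 \<in> shuffles u (b # v)"
      | z1 where "z = b # z1" "z1 \<in> shuffles (a # u) v" by auto
  then show ?case
  proof cases
    case 1
    show ?thesis
    proof (cases "a = a'")
      case True
      then obtain z' where "z' \<in> shuffles u'' v'" "z1 \<le> z'"
        using "3.IH"(1)[OF 1(2), of u'' v'] True u' "3.prems" by auto
      then show ?thesis using 1 True u' by (intro bexI[of _ "a # z'"]) (auto intro: Cons_in_shuffles_leftI)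
    next
      case False
      then have "z \<le> a' # (u'' @ v')" using 1 3 u' by auto
      then show ?thesis unfolding u' by (blast intro: Cons_in_shuffles_leftI append_shuffle)
    qed
  next
    case 2
    show ?thesis
    proof (cases "b = b'")
      case True
      then obtain z' where "z' \<in> shuffles u' v''" "z1 \<le> z'"
        using "3.IH"(2)[OF 2(2), of u' v''] True v' "3.prems" by auto
      then show ?thesis using 2 True v' by (intro bexI[of _ "b # z'"]) (auto intro: Cons_in_shuffles_rightI)
    next
      case False
      then have "z \<le> b' # (u' @ v'')" using 2 3 v' by auto
      then show ?thesis unfolding v' by (blast intro: Cons_in_shuffles_rightI append_shuffle)
    qed
  qed
qed (auto)

section \<open>Lyndon words\<close>

definition lyndon :: "'a::linorder list \<Rightarrow> bool" where
  "lyndon w \<longleftrightarrow> w \<noteq> [] \<and> (\<forall>x y. w = x @ y \<longrightarrow> x \<noteq> [] \<longrightarrow> y \<noteq> [] \<longrightarrow> w < y)"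

lemma min_suffix:
  fixes w :: "'a::linorder list"
  assumes "w \<noteq> []"
  obtains u v where "w = u @ v" "v \<noteq> []" "\<And>x y. w = x @ y \<Longrightarrow> y \<noteq> [] \<Longrightarrow> v \<le> y"
proof -
  let ?S = "(\<lambda>i. drop i w) ` {..<length w}"
  have S: "finite ?S" "?S \<noteq> {}" using assms by auto
  obtain i where i: "Min ?S = drop i w" "i < length w" using Min_in[OF S] by auto
  have "drop i w \<le> y" if "w = x @ y" "y \<noteq> []" for x y
  proof -
    have "y = drop (length x) w" "length x < length w" using that by auto
    then have "y \<in> ?S" by blast
    then show ?thesis using Min_le[OF S(1)] i by metis
  qed
  then show ?thesis using that[of "take i w" "drop i w"] i by auto
qed

text \<open>Cut off the smallest suffix \<open>v\<close>. The shuffles of the two parts are then no larger than \<open>w\<close> itself,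
  which makes \<open>w\<close> the largest word in the product of \<open>u\<close> and \<open>v\<close>.\<close>

lemma nonlyndon_split:
  fixes w :: "'a::linorder list"
  assumes "w \<noteq> []" "\<not> lyndon w"
  obtains u v where "w = u @ v" "u \<noteq> []" "v \<noteq> []" "\<And>z. z \<in> shuffles u v \<Longrightarrow> z \<le> w"
proof -
  obtain u v where uv: "w = u @ v" "v \<noteq> []" "\<And>x y. w = x @ y \<Longrightarrow> y \<noteq> [] \<Longrightarrow> v \<le> y"
    using min_suffix[OF assms(1)] by metis
  have "u \<noteq> []"
  proof
    assume "u = []"
    then have "lyndon w" unfolding lyndon_def using uv assms(1)
      by (metis append_Nil append_self_conv2 order_le_imp_less_or_eq self_append_conv2)
    then show False using assms by simp
  qed
  moreover have "z \<le> w" if "z \<in> shuffles u v" for z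
    unfolding uv(1)
  proof (rule shuffles_le_append[OF _ that])
    fix x y assume y: "u = x @ y" "y \<noteq> []"
    have le: "v \<le> y @ v" using uv(3)[of x "y @ v"] uv(1) y by simp
    show "v \<le> y"
    proof (rule ccontr)
      assume "\<not> v \<le> y"
      then have "y < v" by simp
      then consider s where "s \<noteq> []" "v = y @ s" | "y @ v < v @ []" using lex_less_cases by blast
      then show False
      proof cases
        case 1
        have "v \<le> s" using uv(3)[of "u @ y" s] uv(1) 1 by simp
        then show False using le 1 y(2) by (metis append_self_conv2 lex_append_same(1) lex_le_append nle_le order_antisym_conv)
      qed (use le in simp)
    qed
  qed
  ultimately show ?thesis using that uv by blast
qed

text \<open>The standard factorisation, with \<open>v\<close> the smallest proper suffix. The last property says that in the
  bracket \<open>[P, Q]\<close> of Lie polynomials with smallest words \<open>u\<close> and \<open>v\<close> the product \<open>QP\<close> cannot reach down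
  to \<open>w = uv\<close>.\<close>

lemma lyndon_factor:
  fixes w :: "'a::linorder list"
  assumes "lyndon w" "length w > 1"
  obtains u v where "w = u @ v" "u \<noteq> []" "v \<noteq> []" "lyndon u" "lyndon v"
    "\<And>u' v'. length u' = length u \<Longrightarrow> length v' = length v \<Longrightarrow> u \<le> u' \<Longrightarrow> v \<le> v' \<Longrightarrow> w < v' @ u'"
proof -
  obtain a t where w: "w = a # t" "t \<noteq> []" using assms by (cases w) auto
  obtain s v where sv: "t = s @ v" "v \<noteq> []" "\<And>x y. t = x @ y \<Longrightarrow> y \<noteq> [] \<Longrightarrow> v \<le> y"
    using min_suffix[OF w(2)] by metis
  define u where "u = a # s"
  have min: "v \<le> y" if "w = x @ y" "x \<noteq> []" "y \<noteq> []" for x y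
    using that sv(3)[of "tl x" y] w by (cases x) auto
  have wuv: "w = u @ v" using w sv u_def by simp
  have "lyndon v" unfolding lyndon_def
  proof (intro conjI allI impI)
    fix x y assume xy: "v = x @ y" "x \<noteq> []" "y \<noteq> []"
    have "v \<le> y" using min[of "u @ x" y] wuv xy by simp
    moreover have "length y < length v" using xy by simp
    ultimately show "v < y" by (metis order_le_imp_less_or_eq order_less_irrefl)
  qed (rule sv(2))
  moreover have "lyndon u" unfolding lyndon_def
  proof (intro conjI allI impI)
    fix x y assume xy: "u = x @ y" "x \<noteq> []" "y \<noteq> []"
    show "u < y"
    proof (rule ccontr)
      assume "\<not> u < y"
      moreover have "length y < length u" using xy by simp
      ultimately have "y < u" by (metis linorder_neqE order_less_irrefl)
      have w1: "w < y @ v" using assms(1) wuv xy unfolding lyndon_def by simp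
      from lex_less_cases[OF \<open>y < u\<close>] consider s where "s \<noteq> []" "u = y @ s" | "y @ v < u @ v" by blast
      then show False
      proof cases
        case 1
        then have "s @ v < v" using w1 wuv by simp
        moreover have "v \<le> s @ v" using min[of y "s @ v"] wuv 1 xy by simp
        ultimately show False by simp
      qed (use w1 wuv in simp)
    qed
  qed (simp add: u_def)
  moreover have "w < v' @ u'" if "length u' = length u" "length v' = length v" "u \<le> u'" "v \<le> v'" for u' v'
  proof -
    have "u \<noteq> []" by (simp add: u_def)
    then have "w < v" using assms(1) wuv sv(2) unfolding lyndon_def by blast
    then have "w < v @ u" using lex_le_append[of v u] by simp
    also have "\<dots> \<le> v' @ u'" using lex_append_mono that by metis
    finally show ?thesis .
  qed
  ultimately show ?thesis using that[of u v] wuv sv(2) u_def by blast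
qed

section \<open>The Magnus expansion of a word\<close>

lemma coef_mult_var: "coef (f * var v) w = (if w \<noteq> [] \<and> last w = v then coef f (butlast w) else 0)"
proof (induction w arbitrary: f)
  case (Cons a w)
  have "coef (f * var v) (a # w) = coef f [] * coef (var v) (a # w) + coef (Ps (\<lambda>u. coef f (a # u)) * var v) w"
    by (rule coef_mult_Cons)
  then show ?case using Cons.IH[of "Ps (\<lambda>u. coef f (a # u))"] by (auto simp: coef_var Ps_inverse)
qed (simp add: coef_mult coef_var)

text \<open>The inverse of \<open>1 + v\<close>.\<close>

definition geom :: "'a \<Rightarrow> 'a ps" where
  "geom v = Ps (\<lambda>w. if set w \<subseteq> {v} then (- 1) ^ length w else 0)"

lemma coef_geom: "coef (geom v) w = (if set w \<subseteq> {v} then (- 1) ^ length w else 0)"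
  by (simp add: geom_def Ps_inverse)

lemma geom_inverse: "(1 + var v) * geom v = 1" "geom v * (1 + var v) = 1"
proof -
  show "(1 + var v) * geom v = 1"
  proof (rule ps_eqI)
    fix w show "coef ((1 + var v) * geom v) w = coef 1 w"
      by (cases w) (auto simp: distrib_right coef_geom)
  qed
  show "geom v * (1 + var v) = 1"
  proof (rule ps_eqI)
    fix w show "coef (geom v * (1 + var v)) w = coef 1 w"
      by (cases w rule: rev_cases) (auto simp: distrib_left coef_geom coef_mult_var)
  qed
qed

fun mletter :: "'a \<times> bool \<Rightarrow> 'a ps" where
  "mletter (v, True) = 1 + var v"
| "mletter (v, False) = geom v"

definition magnus :: "('a \<times> bool) list \<Rightarrow> 'a ps" where
  "magnus w = prod_list (map mletter w)"

lemma magnus_simps[simp]: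
  "magnus [] = 1" "magnus (x # w) = mletter x * magnus w" "magnus (u @ w) = magnus u * magnus w"
  by (simp_all add: magnus_def)

definition word_inv :: "('a \<times> bool) list \<Rightarrow> ('a \<times> bool) list" where
  "word_inv w = rev (map (\<lambda>(v, b). (v, \<not> b)) w)"

lemma word_inv_simps[simp]:
  "word_inv [] = []" "word_inv ((v, b) # w) = word_inv w @ [(v, \<not> b)]"
  by (simp_all add: word_inv_def)

lemma word_inv_lists[simp]: "w \<in> lists (V \<times> UNIV) \<Longrightarrow> word_inv w \<in> lists (V \<times> UNIV)"
  by (auto simp: word_inv_def in_lists_conv_set)

lemma mletter_inverse: "mletter (v, b) * mletter (v, \<not> b) = 1"
  by (cases b) (simp_all add: geom_inverse)

lemma magnus_inv[simp]: "magnus w * magnus (word_inv w) = 1" "magnus (word_inv w) * magnus w = 1"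
proof (induction w)
  case (Cons x w)
  obtain v b where x: "x = (v, b)" by force
  {
    case 1
    have "magnus (x # w) * magnus (word_inv (x # w)) = mletter (v, b) * (magnus w * magnus (word_inv w)) * mletter (v, \<not> b)"
      by (simp add: x mult.assoc)
    then show ?case using Cons mletter_inverse by simp
  next
    case 2
    have "magnus (word_inv (x # w)) * magnus (x # w) = magnus (word_inv w) * (mletter (v, \<not> b) * mletter (v, \<not> \<not> b)) * magnus w"
      by (simp add: x mult.assoc)
    then show ?case unfolding mletter_inverse using Cons by simp
  }
qed auto

lemma magnus_const[simp]: "coef (magnus w) [] = 1"
proof (induction w)
  case (Cons x w)
  obtain v b where "x = (v, b)" by force
  with Cons show ?case by (cases b) (simp_all add: coef_mult coef_geom coef_var)
qed simp

lemma coef_mult_supp: 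
  assumes "\<And>w. coef f w \<noteq> 0 \<Longrightarrow> w \<in> lists V" "\<And>w. coef g w \<noteq> 0 \<Longrightarrow> w \<in> lists V" "coef (f * g) w \<noteq> 0"
  shows "w \<in> lists V"
proof -
  obtain i where "coef f (take i w) * coef g (drop i w) \<noteq> 0"
    using assms(3) unfolding coef_mult by (meson sum.neutral)
  then have "take i w \<in> lists V" "drop i w \<in> lists V" using assms(1,2) by auto
  then show ?thesis by (metis append_take_drop_id append_in_lists_conv)
qed

lemma magnus_supp: "a \<in> lists (V \<times> UNIV) \<Longrightarrow> coef (magnus a) w \<noteq> 0 \<Longrightarrow> w \<in> lists V"
proof (induction a arbitrary: w)
  case Nil
  then show ?case by (auto split: if_splits)
next
  case (Cons x a)
  obtain v b where x: "x = (v, b)" "v \<in> V" using Cons.prems by auto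
  have "coef (mletter x) w \<noteq> 0 \<Longrightarrow> w \<in> lists V" for w
    using x by (cases b) (auto simp: coef_var coef_geom in_lists_conv_set split: if_splits)
  with Cons show ?case using coef_mult_supp[of "mletter x" V "magnus a" w] by auto
qed

text \<open>Words whose Magnus expansion is \<open>1\<close> below degree \<open>n\<close> modulo \<open>q\<close>, in the partially commuting
  variables. For \<open>q = 0\<close> this is the dimension filtration of the discrete group.\<close>

definition Kw :: "'a set set \<Rightarrow> nat \<Rightarrow> int \<Rightarrow> ('a \<times> bool) list set" where
  "Kw E n q = {w. magnus w - 1 \<in> Idn E n q}"

lemma magnus_minus_1: "magnus w - 1 \<in> Idn E 1 q"
  by (rule Idn_I) simp

lemma Idn_free: 
  fixes f :: "'a ps"
  shows "f \<in> Idn {} n q \<Longrightarrow> f \<in> Idn E n q"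
proof (rule Idn_I)
  fix w :: "'a list" assume f: "f \<in> Idn {} n q" and w: "length w < n"
  have "tr {} u v \<Longrightarrow> u = v" for u v :: "'a list" by (induction rule: tr.induct) auto
  then have *: "cl {} u = {u}" for u :: "'a list" by (auto simp: cl_def tr_refl)
  have "q dvd coef f w'" if "w' \<in> cl E w" for w'
    using Idn_D[OF f, of w'] that w unfolding csum_def * by (simp add: cl_def tr_length)
  then show "q dvd csum E f w" unfolding csum_def by (rule dvd_sum)
qed

section \<open>Group-like series and the infiltration product\<close>

text \<open>The infiltrations of two words: the words covered by a subsequence equal to \<open>u\<close> and one equal to \<open>v\<close>,
  with multiplicities. Those of maximal length are the shuffles.\<close>

fun infil :: "'a list \<Rightarrow> 'a list \<Rightarrow> 'a list list" where
  "infil [] v = [v]"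
| "infil (a # u) [] = [a # u]"
| "infil (a # u) (b # v) = map ((#) a) (infil u (b # v)) @ map ((#) b) (infil (a # u) v)
     @ (if a = b then map ((#) a) (infil u v) else [])"

definition pair :: "'a ps \<Rightarrow> 'a list list \<Rightarrow> int" where
  "pair g ws = sum_list (map (coef g) ws)"

lemma pair_simps[simp]:
  "pair g [] = 0" "pair g (w # ws) = coef g w + pair g ws" "pair g (ws @ ws') = pair g ws + pair g ws'"
  by (simp_all add: pair_def)

text \<open>Group-like elements for the coproduct \<open>v \<mapsto> v \<otimes> 1 + 1 \<otimes> v + v \<otimes> v\<close>, for which \<open>1 + v\<close> is group-like,
  expressed dually through coefficients.\<close>

definition grouplike :: "'a ps \<Rightarrow> bool" where
  "grouplike g \<longleftrightarrow> coef g [] = 1 \<and> (\<forall>u v. coef g u * coef g v = pair g (infil u v))"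

lemma infil_Nil_right[simp]: "infil u [] = [u]"
  by (cases u) auto

lemma pair_Cons_map: "pair (var x * g) (map ((#) a) ws) = (if a = x then pair g ws else 0)"
  by (induction ws) auto

lemma pair_add: "pair (f + g) ws = pair f ws + pair g ws"
  by (induction ws) auto

lemma pair_var_infil:
  "pair (var x * g) (infil (a # u) (b # v)) =
     (if a = x then pair g (infil u (b # v)) else 0) + (if b = x then pair g (infil (a # u) v) else 0)
     + (if a = x \<and> b = x then pair g (infil u v) else 0)"
  by (auto simp: pair_Cons_map)

lemma grouplike_mult_var:
  assumes "grouplike g"
  shows "grouplike ((1 + var x) * g)"
proof -
  let ?h = "(1 + var x) * g"
  have h: "coef ?h w = coef g w + coef (var x * g) w" for w by (simp add: distrib_right)
  have g: "coef g u * coef g v = pair g (infil u v)" "coef g [] = 1" for u v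
    using assms by (auto simp: grouplike_def)
  have "coef ?h u * coef ?h v = pair ?h (infil u v)" for u v
  proof (cases u)
    case Nil
    then show ?thesis using g(2) by (simp add: h)
  next
    case u: (Cons a u')
    show ?thesis
    proof (cases v)
      case Nil
      then show ?thesis using g(2) by (simp add: h)
    next
      case v: (Cons b v')
      have "pair ?h (infil u v) = pair g (infil u v) + pair (var x * g) (infil u v)"
        by (simp only: distrib_right pair_add mult_1_left)
      also have "\<dots> = coef ?h u * coef ?h v"
        unfolding u v pair_var_infil by (simp add: h g(1)[symmetric] distrib_left distrib_right del: infil.simps)
      finally show ?thesis by simp
    qed
  qed
  then show ?thesis using g(2) unfolding grouplike_def by (simp add: h)
qed

lemma grouplike_cancel_var:
  assumes "grouplike ((1 + var x) * g)"
  shows "grouplike g"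
proof -
  let ?h = "(1 + var x) * g"
  have h: "coef ?h w = coef g w + coef (var x * g) w" for w by (simp add: distrib_right)
  have hh: "coef ?h u * coef ?h v = pair ?h (infil u v)" for u v
    using assms by (auto simp: grouplike_def)
  have one: "coef g [] = 1" using assms by (simp add: grouplike_def h)
  have "coef g u * coef g v = pair g (infil u v)" for u v
  proof (induction "length u + length v" arbitrary: u v rule: less_induct)
    case less
    show ?case
    proof (cases u)
      case Nil
      then show ?thesis using one by simp
    next
      case u: (Cons a u')
      show ?thesis
      proof (cases v)
        case Nil
        then show ?thesis using one by simp
      next
        case v: (Cons b v')
        have IH: "pair g (infil u' v) = coef g u' * coef g v" "pair g (infil u v') = coef g u * coef g v'"
          "pair g (infil u' v') = coef g u' * coef g v'"
          using less[of u' v] less[of u v'] less[of u' v'] by (simp_all add: u v)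
        have "pair ?h (infil u v) = pair g (infil u v) + pair (var x * g) (infil u v)"
          by (simp only: distrib_right pair_add mult_1_left)
        also have "pair (var x * g) (infil u v) = coef ?h u * coef ?h v - coef g u * coef g v"
          unfolding u v pair_var_infil IH[unfolded u v] by (simp add: h distrib_left distrib_right)
        finally show ?thesis using hh[of u v] by simp
      qed
    qed
  qed
  then show ?thesis using one unfolding grouplike_def by simp
qed

lemma grouplike_magnus: "grouplike (magnus w)"
proof (induction w)
  case Nil
  have "coef 1 u * coef 1 v = pair 1 (infil u v)" for u v :: "'a list"
  proof (induction u v rule: infil.induct)
    case (3 a u b v)
    have "pair 1 (map ((#) c) ws) = 0" for c and ws :: "'a list list" by (induction ws) auto
    then show ?case by simp
  qed auto
  then show ?case by (simp add: grouplike_def)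
next
  case (Cons y w)
  obtain v b where y: "y = (v, b)" by force
  show ?case
  proof (cases b)
    case True
    then show ?thesis using grouplike_mult_var[OF Cons] y by simp
  next
    case False
    have "(1 + var v) * (geom v * magnus w) = magnus w"
      by (simp add: mult.assoc[symmetric] geom_inverse)
    then show ?thesis using grouplike_cancel_var[of v "geom v * magnus w"] Cons y False by simp
  qed
qed

text \<open>The transpose of the infiltration product: sum over the ways to cover the positions of a word
  by two subsequences.\<close>

fun cover_sum :: "('a list \<Rightarrow> 'a list \<Rightarrow> int) \<Rightarrow> 'a list \<Rightarrow> int" where
  "cover_sum \<phi> [] = \<phi> [] []"
| "cover_sum \<phi> (a # w) = cover_sum (\<lambda>i j. \<phi> (a # i) j) w + cover_sum (\<lambda>i j. \<phi> i (a # j)) w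
     + cover_sum (\<lambda>i j. \<phi> (a # i) (a # j)) w"

lemma cover_sum_zero[simp]: "cover_sum (\<lambda>i j. 0) w = 0"
  by (induction w) auto

lemma cover_sum_sum: "cover_sum (\<lambda>i j. \<Sum>x\<in>S. \<phi> x i j) w = (\<Sum>x\<in>S. cover_sum (\<phi> x) w)"
  by (induction w arbitrary: \<phi>) (auto simp: sum.distrib)

lemma count_list_map_Cons: "count_list (map ((#) a) ws) (b # w) = (if a = b then count_list ws w else 0)"
  "count_list (map ((#) a) ws) [] = 0"
  by (induction ws) auto

lemma count_infil_Cons:
  "int (count_list (infil u v) (a # w)) =
     (case u of [] \<Rightarrow> 0 | b # u' \<Rightarrow> if a = b then int (count_list (infil u' v) w) else 0)
   + (case v of [] \<Rightarrow> 0 | b # v' \<Rightarrow> if a = b then int (count_list (infil u v') w) else 0)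
   + (case u of [] \<Rightarrow> 0 | b # u' \<Rightarrow> case v of [] \<Rightarrow> 0 | c # v' \<Rightarrow>
        if a = b \<and> a = c then int (count_list (infil u' v') w) else 0)"
  by (cases u; cases v) (auto simp: count_list_map_Cons)

lemma count_infil: "int (count_list (infil u v) w) = cover_sum (\<lambda>i j. if i = u \<and> j = v then 1 else 0) w"
proof (induction w arbitrary: u v)
  case Nil
  then show ?case by (cases u; cases v) (auto simp: count_list_map_Cons)
next
  case (Cons a w)
  have *: "(\<lambda>i j. if a # i = u \<and> j = v then 1 else 0) =
      (case u of [] \<Rightarrow> (\<lambda>i j. 0) | b # u' \<Rightarrow> if a = b then (\<lambda>i j. if i = u' \<and> j = v then 1 else (0::int)) else (\<lambda>i j. 0))"
     "(\<lambda>i j. if i = u \<and> a # j = v then 1 else 0) =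
      (case v of [] \<Rightarrow> (\<lambda>i j. 0) | b # v' \<Rightarrow> if a = b then (\<lambda>i j. if i = u \<and> j = v' then 1 else (0::int)) else (\<lambda>i j. 0))"
     "(\<lambda>i j. if a # i = u \<and> a # j = v then 1 else 0) =
      (case u of [] \<Rightarrow> (\<lambda>i j. 0) | b # u' \<Rightarrow> case v of [] \<Rightarrow> (\<lambda>i j. 0) | c # v' \<Rightarrow>
        if a = b \<and> a = c then (\<lambda>i j. if i = u' \<and> j = v' then 1 else (0::int)) else (\<lambda>i j. 0))"
    by (auto simp: fun_eq_iff split: list.splits)
  show ?case unfolding count_infil_Cons cover_sum.simps * 
    by (auto simp: Cons.IH[symmetric] split: list.splits)
qed

lemma cover_sum_tr:
  assumes "\<And>i i' j j'. tr E i i' \<Longrightarrow> tr E j j' \<Longrightarrow> \<phi> i j = \<phi> i' j'" "tr E w w'"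
  shows "cover_sum \<phi> w' = cover_sum \<phi> w"
  using assms(2)
proof (induction rule: tr.induct)
  case (tr_swap u x a b y)
  have "cover_sum \<phi> (x @ a # b # y) = cover_sum \<phi> (x @ b # a # y)"
    using assms(1)
  proof (induction x arbitrary: \<phi>)
    case Nil
    have c: "tr E (a # b # i) (b # a # i)" for i using tr_step[OF tr_swap(2), of "[]" i] by simp
    have *: "\<phi> (b # a # i) = \<phi> (a # b # i)" "\<phi> i (b # a # j) = \<phi> i (a # b # j)" for i j
      using Nil[OF c tr_refl] Nil[OF tr_refl c] by (auto simp: fun_eq_iff)
    show ?case by (cases "a = b") (simp_all add: *)
  next
    case (Cons c x)
    have t: "tr E i i' \<Longrightarrow> tr E (c # i) (c # i')" for i i' using tr_append_left[of E i i' "[c]"] by simp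
    show ?case by (auto simp: Cons.IH[of "\<lambda>i j. \<phi> (c # i) j"] Cons.IH[of "\<lambda>i j. \<phi> i (c # j)"]
        Cons.IH[of "\<lambda>i j. \<phi> (c # i) (c # j)"] t intro!: arg_cong2[where f = "(+)"] Cons.IH Cons.prems)
  qed
  then show ?case using tr_swap by simp
qed simp

definition cover_count :: "'a set set \<Rightarrow> 'a list \<Rightarrow> 'a list \<Rightarrow> 'a list \<Rightarrow> int" where
  "cover_count E u v w = cover_sum (\<lambda>i j. if tr E u i \<and> tr E v j then 1 else 0) w"

lemma cover_count_tr: "tr E w w' \<Longrightarrow> cover_count E u v w' = cover_count E u v w"
  unfolding cover_count_def
  by (rule cover_sum_tr) (auto intro: tr_trans tr_sym)

lemma cover_count_eq:
  "cover_count E u v w = (\<Sum>u'\<in>cl E u. \<Sum>v'\<in>cl E v. int (count_list (infil u' v') w))"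
proof -
  have "(\<Sum>u'\<in>cl E u. \<Sum>v'\<in>cl E v. int (count_list (infil u' v') w)) =
    cover_sum (\<lambda>i j. \<Sum>u'\<in>cl E u. \<Sum>v'\<in>cl E v. if i = u' \<and> j = v' then 1 else 0) w"
    by (simp add: count_infil cover_sum_sum)
  also have "(\<lambda>i j. \<Sum>u'\<in>cl E u. \<Sum>v'\<in>cl E v. if i = u' \<and> j = v' then 1 else 0) =
      (\<lambda>i j. if tr E u i \<and> tr E v j then 1 else (0::int))"
  proof (intro ext)
    fix i j :: "'a list"
    have "(\<Sum>v'\<in>cl E v. if i = u' \<and> j = v' then 1 else 0) = (if i = u' then if tr E v j then 1 else 0 else (0::int))" for u'
      by (auto simp: cl_def[of E v, symmetric] sum.delta) (auto simp: cl_def)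
    then show "(\<Sum>u'\<in>cl E u. \<Sum>v'\<in>cl E v. if i = u' \<and> j = v' then 1 else 0) = (if tr E u i \<and> tr E v j then 1 else (0::int))"
      by (auto simp: sum.delta) (auto simp: cl_def)
  qed
  finally show ?thesis by (simp add: cover_count_def)
qed

lemma pair_eq_count: "set ws \<subseteq> W \<Longrightarrow> finite W \<Longrightarrow> pair g ws = (\<Sum>w\<in>W. int (count_list ws w) * coef g w)"
proof (induction ws)
  case (Cons a ws)
  have "(\<Sum>w\<in>W. int (count_list (a # ws) w) * coef g w) =
      (\<Sum>w\<in>W. int (count_list ws w) * coef g w + (if a = w then coef g w else 0))"
    by (intro sum.cong) (auto simp: algebra_simps)
  also have "\<dots> = pair g ws + coef g a"
    using Cons by (simp add: sum.distrib sum.delta')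
  finally show ?case by simp
qed simp

text \<open>Group-likeness survives the passage to partially commuting variables: the infiltration product of two
  trace classes is constant on trace classes, because its transpose \<open>cover_sum\<close> is.\<close>

lemma csum_mult_csum:
  assumes "grouplike g"
  shows "finite {w. cover_count E u v w \<noteq> 0}"
    and "csum E g u * csum E g v = (\<Sum>w | cover_count E u v w \<noteq> 0. cover_count E u v w * coef g w)"
proof -
  define W where "W = (\<Union>u'\<in>cl E u. \<Union>v'\<in>cl E v. set (infil u' v'))"
  have W: "finite W" by (auto simp: W_def)
  have W0: "cover_count E u v w = 0" if "w \<notin> W" for w
    using that unfolding cover_count_eq W_def by (intro sum.neutral ballI) (auto simp: count_notin)
  show fin: "finite {w. cover_count E u v w \<noteq> 0}" by (rule finite_subset[OF _ W]) (use W0 in blast)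
  have "csum E g u * csum E g v = (\<Sum>u'\<in>cl E u. \<Sum>v'\<in>cl E v. pair g (infil u' v'))"
    using assms by (simp add: csum_def sum_product grouplike_def)
  also have "\<dots> = (\<Sum>u'\<in>cl E u. \<Sum>v'\<in>cl E v. \<Sum>w\<in>W. int (count_list (infil u' v') w) * coef g w)"
    by (intro sum.cong HOL.refl pair_eq_count W) (auto simp: W_def)
  also have "\<dots> = (\<Sum>u'\<in>cl E u. \<Sum>w\<in>W. \<Sum>v'\<in>cl E v. int (count_list (infil u' v') w) * coef g w)"
    by (rule sum.cong[OF HOL.refl]) (rule sum.swap)
  also have "\<dots> = (\<Sum>w\<in>W. cover_count E u v w * coef g w)"
    by (subst sum.swap) (simp add: cover_count_eq sum_distrib_right)
  also have "\<dots> = (\<Sum>w | cover_count E u v w \<noteq> 0. cover_count E u v w * coef g w)"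
    by (rule sum.mono_neutral_right[OF W]) (use W0 in auto)
  finally show "csum E g u * csum E g v = \<dots>" .
qed

lemma infil_length: "w \<in> set (infil u v) \<Longrightarrow> length w \<le> length u + length v"
  by (induction u v arbitrary: w rule: infil.induct) (fastforce split: if_splits)+

lemma infil_shuffle: "w \<in> set (infil u v) \<Longrightarrow> length w = length u + length v \<Longrightarrow> w \<in> shuffles u v"
proof (induction u v arbitrary: w rule: infil.induct)
  case (3 a u b v)
  have "False" if "w = a # w'" "w' \<in> set (infil u v)" for w'
    using infil_length[OF that(2)] 3 that by simp
  then show ?case using 3 by (auto split: if_splits)
qed auto

lemma append_in_infil: "u @ v \<in> set (infil u v)"
proof (induction u)
  case (Cons a u)
  then show ?case by (cases v) auto
qed auto

lemma cover_count_pos_iff: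
  "cover_count E u v w \<noteq> 0 \<longleftrightarrow> (\<exists>u' v'. tr E u u' \<and> tr E v v' \<and> w \<in> set (infil u' v'))"
proof
  assume "cover_count E u v w \<noteq> 0"
  then have "\<exists>u'\<in>cl E u. \<exists>v'\<in>cl E v. int (count_list (infil u' v') w) \<noteq> 0"
    unfolding cover_count_eq by (metis (no_types, lifting) sum.neutral)
  then show "\<exists>u' v'. tr E u u' \<and> tr E v v' \<and> w \<in> set (infil u' v')"
    by (auto simp: cl_def count_list_0_iff)
next
  assume "\<exists>u' v'. tr E u u' \<and> tr E v v' \<and> w \<in> set (infil u' v')"
  then obtain u' v' where *: "u' \<in> cl E u" "v' \<in> cl E v" "w \<in> set (infil u' v')" by (auto simp: cl_def)
  have c: "0 < int (count_list (infil u' v') w)" using *(3) count_list_0_iff[of "infil u' v'" w] by simp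
  have "0 < (\<Sum>v'\<in>cl E v. int (count_list (infil u' v') w))"
    using c by - (rule sum_pos2[OF finite_cl *(2)], simp_all)
  then have "0 < cover_count E u v w" unfolding cover_count_eq
    using *(1) by - (rule sum_pos2[where i = u'], simp_all add: sum_nonneg)
  then show "cover_count E u v w \<noteq> 0" by simp
qed

section \<open>Lie polynomials\<close>

abbreviation brk :: "'a ps \<Rightarrow> 'a ps \<Rightarrow> 'a ps" where
  "brk f g \<equiv> f * g - g * f"

text \<open>Left-normed brackets suffice to span the Lie polynomials of degree \<open>n\<close>; closure under general brackets
  is a consequence of the Jacobi identity (\<open>lie_bracket\<close>).\<close>

inductive lie :: "'a set \<Rightarrow> nat \<Rightarrow> 'a ps \<Rightarrow> bool" for V where
  lie_var: "v \<in> V \<Longrightarrow> lie V 1 (var v)"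
| lie_brk: "v \<in> V \<Longrightarrow> lie V n P \<Longrightarrow> lie V (Suc n) (brk (var v) P)"
| lie_add: "lie V n P \<Longrightarrow> lie V n Q \<Longrightarrow> lie V n (P + Q)"
| lie_neg: "lie V n P \<Longrightarrow> lie V n (- P)"
| lie_zero: "0 < n \<Longrightarrow> lie V n 0"

lemma lie_pos: "lie V n P \<Longrightarrow> 0 < n"
  by (induction rule: lie.induct) auto

lemma lie_diff: "lie V n P \<Longrightarrow> lie V n Q \<Longrightarrow> lie V n (P - Q)"
  using lie_add[of V n P "- Q"] lie_neg by auto

lemma lie_of_int: "lie V n P \<Longrightarrow> lie V n (of_int c * P)"
proof -
  assume P: "lie V n P"
  have "lie V n (of_nat k * P)" for k
    by (induction k) (auto simp: distrib_right intro: lie_add P lie_zero[OF lie_pos[OF P]])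
  then show ?thesis by (cases c rule: int_cases2) (auto intro: lie_neg)
qed

lemma lie_bracket: "lie V m P \<Longrightarrow> lie V n Q \<Longrightarrow> lie V (m + n) (brk P Q)"
proof (induction arbitrary: n Q rule: lie.induct)
  case (lie_var v)
  then show ?case using lie_brk by fastforce
next
  case (lie_brk v m P)
  have eq: "brk (brk (var v) P) Q = brk (var v) (brk P Q) - brk P (brk (var v) Q)"
    by (simp add: algebra_simps)
  have "lie V (m + Suc n) (brk P (brk (var v) Q))"
    using lie_brk.IH[OF lie.lie_brk[OF lie_brk(1) lie_brk.prems]] .
  moreover have "lie V (Suc (m + n)) (brk (var v) (brk P Q))"
    using lie.lie_brk[OF lie_brk(1) lie_brk.IH[OF lie_brk.prems]] .
  ultimately show ?case unfolding eq by (simp add: lie_diff)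
next
  case (lie_add m P P')
  have "brk (P + P') Q = brk P Q + brk P' Q" by (simp add: algebra_simps)
  then show ?case using lie_add.IH lie_add.prems lie.lie_add by metis
next
  case (lie_neg m P)
  have "brk (- P) Q = - brk P Q" by (simp add: algebra_simps)
  then show ?case using lie_neg.IH lie_neg.prems lie.lie_neg by metis
next
  case (lie_zero m)
  then show ?case using lie.lie_zero[of "m + n" V] by simp
qed

lemma lie_left_normed:
  assumes "lie V n P" "1 < n" "finite V"
  shows "\<exists>Q. (\<forall>v\<in>V. lie V (n - 1) (Q v)) \<and> P = (\<Sum>v\<in>V. brk (var v) (Q v))"
  using assms
proof (induction rule: lie.induct)
  case (lie_brk v n P)
  then have n: "0 < n" by simp
  let ?Q = "\<lambda>u. if u = v then P else 0"
  have "(\<Sum>u\<in>V. brk (var u) (?Q u)) = (\<Sum>u\<in>V. if u = v then brk (var v) P else 0)"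
    by (intro sum.cong) auto
  then have "brk (var v) P = (\<Sum>u\<in>V. brk (var u) (?Q u))"
    using lie_brk by (simp add: sum.delta')
  then show ?case using lie_brk n by (intro exI[of _ ?Q]) (auto intro: lie_zero)
next
  case (lie_add n P P')
  then obtain Q Q' where "\<forall>v\<in>V. lie V (n - 1) (Q v)" "P = (\<Sum>v\<in>V. brk (var v) (Q v))"
    "\<forall>v\<in>V. lie V (n - 1) (Q' v)" "P' = (\<Sum>v\<in>V. brk (var v) (Q' v))" by auto
  then show ?case
    by (intro exI[of _ "\<lambda>v. Q v + Q' v"])
       (auto simp: sum.distrib[symmetric] algebra_simps intro!: lie.lie_add sum.cong)
next
  case (lie_neg n P)
  then obtain Q where "\<forall>v\<in>V. lie V (n - 1) (Q v)" "P = (\<Sum>v\<in>V. brk (var v) (Q v))" by auto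
  then show ?case
    by (intro exI[of _ "\<lambda>v. - Q v"]) (auto simp: sum_negf[symmetric] algebra_simps intro!: lie.lie_neg sum.cong)
next
  case (lie_zero n)
  then show ?case by (intro exI[of _ "\<lambda>v. 0"]) (auto intro: lie.lie_zero)
qed auto

lemma lie_supp: "lie V n P \<Longrightarrow> coef P w \<noteq> 0 \<Longrightarrow> w \<in> lists V \<and> length w = n"
proof (induction arbitrary: w rule: lie.induct)
  case (lie_brk v n P)
  have "coef (var v * P) w = 0 \<or> (w \<in> lists V \<and> length w = Suc n)"
    using lie_brk.IH[of "tl w"] lie_brk(1) by (cases w) auto
  moreover have "coef (P * var v) w = 0 \<or> (w \<in> lists V \<and> length w = Suc n)"
    using lie_brk.IH[of "butlast w"] lie_brk(1) by (cases w rule: rev_cases) (auto simp: coef_mult_var)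
  ultimately show ?case using lie_brk.prems by auto
next
  case (lie_add n P Q)
  then show ?case by (cases "coef P w = 0") auto
qed (auto simp: coef_var split: if_splits)

lemma lie_Idn: "lie V n P \<Longrightarrow> P \<in> Idn {} n 0"
proof (rule Idn_I)
  fix w :: "'a list" assume P: "lie V n P" and w: "length w < n"
  have "coef P w' = 0" if "tr {} w w'" for w'
    using lie_supp[OF P, of w'] tr_length[OF that] w by auto
  then show "0 dvd csum {} P w" by (simp add: csum_def cl_def)
qed

section \<open>Every Lie polynomial is the leading term of a group element\<close>

definition wcomm :: "('a \<times> bool) list \<Rightarrow> ('a \<times> bool) list \<Rightarrow> ('a \<times> bool) list" where
  "wcomm a b = a @ b @ word_inv a @ word_inv b"

lemma magnus_inv_cancel[simp]:
  "magnus a * (magnus (word_inv a) * f) = f" "magnus (word_inv a) * (magnus a * f) = f"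
  by (simp_all add: mult.assoc[symmetric])

lemma magnus_wcomm: "magnus (wcomm a b) - 1 =
    brk (magnus a - 1) (magnus b - 1) * (magnus (word_inv a) * magnus (word_inv b))"
proof -
  have "brk (magnus a - 1) (magnus b - 1) = magnus a * magnus b - magnus b * magnus a"
    by (simp add: algebra_simps)
  then have "brk (magnus a - 1) (magnus b - 1) * (magnus (word_inv a) * magnus (word_inv b)) =
     magnus a * magnus b * (magnus (word_inv a) * magnus (word_inv b))
     - magnus b * (magnus a * magnus (word_inv a)) * magnus (word_inv b)"
    by (simp add: left_diff_distrib mult.assoc)
  then show ?thesis by (simp add: wcomm_def mult.assoc)
qed

lemma brk_Idn: "f \<in> Idn E n q \<Longrightarrow> g \<in> Idn E m q \<Longrightarrow> brk f g \<in> Idn E (n + m) q"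
  using Idn_mult[of f E n q g m] Idn_mult[of g E m q f n] by (simp add: Idn_diff add.commute)

lemma one_plus_mult_Idn: "f \<in> Idn E n q \<Longrightarrow> f * magnus w - f \<in> Idn E (Suc n) q"
  using Idn_mult[of f E n q "magnus w - 1" 1] magnus_minus_1[of w E q] by (simp add: algebra_simps)

lemma one_plus_mult_Idn': "f \<in> Idn E n q \<Longrightarrow> magnus w * f - f \<in> Idn E (Suc n) q"
  using Idn_mult[of "magnus w - 1" E 1 q f n] magnus_minus_1[of w E q] by (simp add: algebra_simps)

lemma Idn_cong: "f - g \<in> Idn E n q \<Longrightarrow> g \<in> Idn E n q \<Longrightarrow> f \<in> Idn E n q"
  using Idn_add[of "f - g" E n q g] by simp

lemma Idn_trans: "f - g \<in> Idn E n q \<Longrightarrow> g - h \<in> Idn E n q \<Longrightarrow> f - h \<in> Idn E n q"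
  using Idn_add[of "f - g" E n q "g - h"] by simp

lemma lead_wcomm:
  assumes "magnus a - 1 - P \<in> Idn E (Suc n) q" "P \<in> Idn E n q" 
    "magnus b - 1 - Q \<in> Idn E (Suc m) q" "Q \<in> Idn E m q"
  shows "magnus (wcomm a b) - 1 - brk P Q \<in> Idn E (Suc (n + m)) q"
proof -
  let ?B = "brk (magnus a - 1) (magnus b - 1)" and ?c = "word_inv a @ word_inv b"
  have a: "magnus a - 1 \<in> Idn E n q" and b: "magnus b - 1 \<in> Idn E m q"
    using Idn_cong Idn_mono assms dvd_refl le_SucI order_refl by metis+
  have "?B * magnus ?c - ?B \<in> Idn E (Suc (n + m)) q"
    by (rule one_plus_mult_Idn[OF brk_Idn[OF a b]])
  moreover have "?B - brk P Q = brk (magnus a - 1 - P) (magnus b - 1) + brk P (magnus b - 1 - Q)"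
    by (simp add: algebra_simps)
  moreover have "brk (magnus a - 1 - P) (magnus b - 1) + brk P (magnus b - 1 - Q) \<in> Idn E (Suc (n + m)) q"
    using brk_Idn[OF assms(1) b] brk_Idn[OF assms(2,3)] by (simp add: Idn_add)
  ultimately show ?thesis unfolding magnus_wcomm using Idn_trans by (metis magnus_simps(3))
qed

lemma lead_append:
  assumes "magnus a - 1 - P \<in> Idn E (Suc n) q" "P \<in> Idn E n q" 
    "magnus b - 1 - Q \<in> Idn E (Suc n) q" "Q \<in> Idn E n q" "0 < n"
  shows "magnus (a @ b) - 1 - (P + Q) \<in> Idn E (Suc n) q"
proof -
  have b: "magnus b - 1 \<in> Idn E n q"
    using Idn_cong Idn_mono assms dvd_refl le_SucI order_refl by metis
  have eq: "magnus (a @ b) - 1 - (P + Q) = (magnus a - 1 - P) + (magnus b - 1 - Q) + (magnus a * (magnus b - 1) - (magnus b - 1))"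
    by (simp add: algebra_simps)
  show ?thesis unfolding eq by (intro Idn_add assms one_plus_mult_Idn'[OF b])
qed

lemma lead_inv:
  assumes "magnus a - 1 - P \<in> Idn E (Suc n) q" "P \<in> Idn E n q"
  shows "magnus (word_inv a) - 1 - (- P) \<in> Idn E (Suc n) q"
proof -
  have a: "magnus a - 1 \<in> Idn E n q"
    using Idn_cong Idn_mono assms dvd_refl le_SucI order_refl by metis
  have "magnus (word_inv a) - 1 = - ((magnus a - 1) * magnus (word_inv a))"
    by (simp add: left_diff_distrib)
  then have "magnus (word_inv a) - 1 - (- P) = - ((magnus a - 1) * magnus (word_inv a) - (magnus a - 1)) - (magnus a - 1 - P)"
    by simp
  then show ?thesis using Idn_diff[OF Idn_neg[OF one_plus_mult_Idn[OF a]] assms(1)] by metis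
qed

text \<open>Brackets are leading terms of commutators, sums of products, negatives of inverses. No commutation
  relation enters, so the congruence holds for the empty edge set.\<close>

theorem lie_realised:
  assumes "lie V n P"
  shows "\<exists>y\<in>lists (V \<times> UNIV). magnus y - 1 - P \<in> Idn {} (Suc n) 0"
  using assms
proof (induction rule: lie.induct)
  case (lie_var v)
  then show ?case by (intro bexI[of _ "[(v, True)]"]) auto
next
  case (lie_brk v n P)
  then obtain y where y: "y \<in> lists (V \<times> UNIV)" "magnus y - 1 - P \<in> Idn {} (Suc n) 0" by auto
  have "magnus [(v, True)] - 1 - var v \<in> Idn {} (Suc 1) 0" by simp
  from lead_wcomm[OF this _ y(2)] lie_Idn[OF lie.lie_var, OF lie_brk(1)] lie_Idn[OF lie_brk(2)]
  have "magnus (wcomm [(v, True)] y) - 1 - brk (var v) P \<in> Idn {} (Suc (Suc n)) 0" by simp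
  moreover have "wcomm [(v, True)] y \<in> lists (V \<times> UNIV)" using y lie_brk(1) by (simp add: wcomm_def)
  ultimately show ?case by blast
next
  case (lie_add n P Q)
  then obtain y z where y: "y \<in> lists (V \<times> UNIV)" "magnus y - 1 - P \<in> Idn {} (Suc n) 0" 
    and z: "z \<in> lists (V \<times> UNIV)" "magnus z - 1 - Q \<in> Idn {} (Suc n) 0" by auto
  have "magnus (y @ z) - 1 - (P + Q) \<in> Idn {} (Suc n) 0"
    by (rule lead_append) (use lie_add lie_Idn lie_pos y z in auto)
  then show ?case using y z by (intro bexI[of _ "y @ z"]) auto
next
  case (lie_neg n P)
  then obtain y where y: "y \<in> lists (V \<times> UNIV)" "magnus y - 1 - P \<in> Idn {} (Suc n) 0" by auto
  from lead_inv[OF y(2) lie_Idn[OF lie_neg(1)]] show ?case using y by (intro bexI[of _ "word_inv y"]) auto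
next
  case (lie_zero n)
  then show ?case by (intro bexI[of _ "[]"]) auto
qed

section \<open>Normal words\<close>

locale ranked_graph =
  fixes V :: "'a set" and E :: "'a set set" and r :: "'a \<Rightarrow> nat"
  assumes inj_r: "inj_on r V" and fin_V: "finite V"
begin

text \<open>The lexicographically largest word of each trace. Its factors are again of this kind, so that
  normal words can be split like ordinary words.\<close>

definition nrm :: "'a list \<Rightarrow> bool" where
  "nrm w \<longleftrightarrow> w \<in> lists V \<and> (\<forall>w'. tr E w w' \<longrightarrow> map r w' \<le> map r w)"

lemma map_r_inj: "u \<in> lists V \<Longrightarrow> w \<in> lists V \<Longrightarrow> map r u = map r w \<Longrightarrow> u = w"
  using inj_on_mapI[of r "{u, w}"] inj_r inj_on_subset by (metis inj_on_map_lists in_lists_conv_set inj_onD lists_eq_set mem_Collect_eq)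

lemma nrm_ex: "w \<in> lists V \<Longrightarrow> \<exists>w'. tr E w w' \<and> nrm w'"
proof -
  assume w: "w \<in> lists V"
  let ?S = "map r ` cl E w"
  have S: "finite ?S" "?S \<noteq> {}" using cl_self[of w E] by (simp, blast)
  obtain w' where w': "w' \<in> cl E w" "Max ?S = map r w'" using Max_in[OF S] by auto
  have "map r x \<le> map r w'" if "tr E w' x" for x
  proof -
    have "x \<in> cl E w" using w' that tr_trans by (auto simp: cl_def)
    then show ?thesis using Max_ge[OF S(1)] w'(2) by (metis imageI)
  qed
  moreover have "tr E w w'" using w' by (simp add: cl_def)
  ultimately show ?thesis using tr_lists[OF _ w] unfolding nrm_def by blast
qed

lemma nrm_unique: "nrm u \<Longrightarrow> nrm w \<Longrightarrow> tr E u w \<Longrightarrow> u = w"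
  using tr_sym[of E u w] map_r_inj[of u w] unfolding nrm_def by (meson order_antisym)

lemma nrm_lists: "nrm w \<Longrightarrow> w \<in> lists V"
  by (simp add: nrm_def)

lemma nrm_append: "nrm (u @ v) \<Longrightarrow> nrm u \<and> nrm v"
proof -
  assume uv: "nrm (u @ v)"
  have "map r u' \<le> map r u" if "tr E u u'" for u'
  proof (rule ccontr)
    assume "\<not> map r u' \<le> map r u"
    then have "map r u @ map r v < map r u' @ map r v"
      using tr_length[OF that] by (intro lex_append_less) auto
    moreover have "map r (u' @ v) \<le> map r (u @ v)" using uv tr_append_right[OF that] unfolding nrm_def by blast
    ultimately show False by simp
  qed
  moreover have "map r v' \<le> map r v" if "tr E v v'" for v'
  proof -
    have "map r (u @ v') \<le> map r (u @ v)" using uv tr_append_left[OF that] unfolding nrm_def by blast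
    then show ?thesis by simp
  qed
  ultimately show ?thesis using uv by (auto simp: nrm_def)
qed

lemma finite_nrm: "finite {w. nrm w \<and> length w = n}"
  by (rule finite_subset[OF _ finite_lists_length_eq[OF fin_V, of n]]) (auto simp: nrm_def)

text \<open>Each trace coefficient is placed on the normal word of the trace, so that a series is replaced by one
  with the same class sums and no cancellation within classes.\<close>

definition coll :: "'a ps \<Rightarrow> 'a ps" where
  "coll f = Ps (\<lambda>w. if nrm w then csum E f w else 0)"

lemma coef_coll: "coef (coll f) w = (if nrm w then csum E f w else 0)"
  by (simp add: coll_def Ps_inverse)

lemma csum_supp: "(\<And>w. coef f w \<noteq> 0 \<Longrightarrow> w \<in> lists V) \<Longrightarrow> t \<notin> lists V \<Longrightarrow> csum E f t = 0"
  unfolding csum_def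
proof (rule sum.neutral, rule ballI, rule ccontr)
  assume supp: "\<And>w. coef f w \<noteq> 0 \<Longrightarrow> w \<in> lists V" and t: "t \<notin> lists V"
  fix w assume "w \<in> cl E t" "coef f w \<noteq> 0"
  then show False using supp t tr_lists[of E w t V] tr_sym[of E t w] by (simp add: cl_def)
qed

lemma csum_coll:
  assumes "\<And>w. coef f w \<noteq> 0 \<Longrightarrow> w \<in> lists V"
  shows "csum E (coll f) t = csum E f t"
proof (cases "t \<in> lists V")
  case True
  obtain t' where t': "tr E t t'" "nrm t'" using nrm_ex[OF True] by blast
  have "csum E (coll f) t = (\<Sum>w\<in>cl E t. if w = t' then csum E f t' else 0)"
    unfolding csum_def[of E "coll f"]
  proof (rule sum.cong)
    fix w assume "w \<in> cl E t"
    then have "tr E w t'" using t' tr_sym tr_trans unfolding cl_def by fast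
    then show "coef (coll f) w = (if w = t' then csum E f t' else 0)"
    proof (cases "nrm w")
      case True
      then have "w = t'" using nrm_unique t'(2) \<open>tr E w t'\<close> by blast
      then show ?thesis using True by (simp add: coef_coll)
    next
      case False
      then have "w \<noteq> t'" using t'(2) by blast
      then show ?thesis using False by (simp add: coef_coll)
    qed
  qed simp
  also have "\<dots> = csum E f t" using t' csum_tr[OF t'(1)] by (simp add: sum.delta' cl_def[symmetric]) (simp add: cl_def)
  finally show ?thesis .
next
  case False
  have "csum E (coll f) t = 0" by (rule csum_supp[OF _ False]) (auto simp: coef_coll nrm_lists split: if_splits)
  then show ?thesis using csum_supp[OF assms False] by simp
qed

lemma coll_Idn: "(\<And>w. coef f w \<noteq> 0 \<Longrightarrow> w \<in> lists V) \<Longrightarrow> f - coll f \<in> Idn E n 0"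
  by (rule Idn_I) (simp add: csum_coll)

lemma csum_coll_mult:
  assumes "\<And>w. coef f w \<noteq> 0 \<Longrightarrow> w \<in> lists V" "\<And>w. coef g w \<noteq> 0 \<Longrightarrow> w \<in> lists V"
  shows "csum E (f * g) t = (\<Sum>(x, y)\<in>splits E t. coef (coll f) x * coef (coll g) y)"
proof -
  have "f * g - coll f * coll g = (f - coll f) * g + coll f * (g - coll g)"
    by (simp add: algebra_simps)
  also have "\<dots> \<in> Idn E (Suc (length t)) 0"
    by (intro Idn_add Idn_mult_left Idn_mult_right coll_Idn assms)
  finally have "csum E (f * g) t = csum E (coll f * coll g) t"
    using Idn_D[of _ E "Suc (length t)" 0 t] by fastforce
  then show ?thesis by (simp add: csum_mult)
qed

section \<open>Lyndon Lie polynomials\<close>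

text \<open>The smallest normal word of \<open>P\<close> in degree \<open>n\<close> is \<open>w\<close>, with coefficient 1.\<close>

definition leads :: "'a ps \<Rightarrow> 'a list \<Rightarrow> bool" where
  "leads P w \<longleftrightarrow> csum E P w = 1 \<and> (\<forall>w'. nrm w' \<and> csum E P w' \<noteq> 0 \<longrightarrow> length w' = length w \<and> map r w \<le> map r w')"

lemma lie_csum_length: "lie V n P \<Longrightarrow> csum E P w \<noteq> 0 \<Longrightarrow> length w = n"
  unfolding csum_def using lie_supp by (metis (no_types, lifting) cl_def mem_Collect_eq sum.neutral tr_length)

text \<open>Along the standard factorisation \<open>w = uv\<close> take the bracket of the polynomials for \<open>u\<close> and \<open>v\<close>. The
  smallest normal word of the first product is \<open>w\<close>, while all normal words in the second are larger
  (\<open>lyndon_factor\<close>). Normal words being maximal in their class is what lets the comparison of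
  representatives go in the required direction.\<close>

theorem lyndon_lie:
  assumes "nrm w" "lyndon (map r w)"
  shows "\<exists>P. lie V (length w) P \<and> leads P w"
  using assms
proof (induction "length w" arbitrary: w rule: less_induct)
  case less
  have "w \<noteq> []" using less.prems(2) by (auto simp: lyndon_def)
  show ?case
  proof (cases "length w > 1")
    case False
    then obtain v where w: "w = [v]" using \<open>w \<noteq> []\<close> by (cases w) auto
    have c: "csum E (var v) w' = (if w' = [v] then 1 else 0)" for w'
    proof (cases "w' = [v]")
      case True
      have "u = [v]" if "tr E [v] u" for u using tr_mset[OF that] by simp
      then have "cl E [v] = {[v]}" by (auto simp: cl_def intro: tr_refl)
      then show ?thesis using True by (simp add: csum_def coef_var)
    next
      case False
      have "u \<noteq> [v]" if "tr E w' u" for u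
      proof
        assume "u = [v]"
        then show False using tr_mset[OF that] False by simp
      qed
      then show ?thesis using False by (auto simp: csum_def coef_var cl_def intro!: sum.neutral)
    qed
    have "v \<in> V" using less.prems(1) w by (auto simp: nrm_def)
    then show ?thesis unfolding w leads_def using lie_var[of v V]
      by (intro exI[of _ "var v"]) (auto simp: c split: if_splits)
  next
    case True
    then obtain mu mv where m: "map r w = mu @ mv" "mu \<noteq> []" "mv \<noteq> []" "lyndon mu" "lyndon mv"
      "\<And>u' v'. length u' = length mu \<Longrightarrow> length v' = length mv \<Longrightarrow> mu \<le> u' \<Longrightarrow> mv \<le> v' \<Longrightarrow> map r w < v' @ u'"
      using lyndon_factor[OF less.prems(2)] by (metis length_map)
    obtain u v where w: "w = u @ v" "mu = map r u" "mv = map r v"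
      using m(1) unfolding map_eq_append_conv by blast
    have nuv: "nrm u" "nrm v" using nrm_append less.prems(1) unfolding w(1) by blast+
    have ne: "u \<noteq> []" "v \<noteq> []" using m(2,3) w by auto
    have len: "length u < length w" "length v < length w" using ne unfolding w(1) by simp_all
    obtain P where P: "lie V (length u) P" "leads P u"
      using less.hyps[OF len(1) nuv(1)] m(4) unfolding w(2) by blast
    obtain Q where Q: "lie V (length v) Q" "leads Q v"
      using less.hyps[OF len(2) nuv(2)] m(5) unfolding w(3) by blast
    have sP: "\<And>w. coef P w \<noteq> 0 \<Longrightarrow> w \<in> lists V" and sQ: "\<And>w. coef Q w \<noteq> 0 \<Longrightarrow> w \<in> lists V"
      using lie_supp P Q by blast+
    have big: "map r u \<le> map r x \<and> length x = length u" if "coef (coll P) x \<noteq> 0" for x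
      using that P(2) by (auto simp: coef_coll leads_def split: if_splits)
    have big': "map r v \<le> map r y \<and> length y = length v" if "coef (coll Q) y \<noteq> 0" for y
      using that Q(2) by (auto simp: coef_coll leads_def split: if_splits)
    have PQ0: "map r w \<le> map r t" if nt: "nrm t" and nz: "csum E (P * Q) t \<noteq> 0" for t
    proof -
      obtain x y where xy: "(x, y) \<in> splits E t" "coef (coll P) x \<noteq> 0" "coef (coll Q) y \<noteq> 0"
      proof -
        have "(\<Sum>(x, y)\<in>splits E t. coef (coll P) x * coef (coll Q) y) \<noteq> 0"
          using nz csum_coll_mult[OF sP sQ] by simp
        then obtain p where "p \<in> splits E t" "(case p of (x, y) \<Rightarrow> coef (coll P) x * coef (coll Q) y) \<noteq> 0"
          by (rule sum.not_neutral_contains_not_neutral)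
        then show ?thesis using that by (cases p) auto
      qed
      have "map r w \<le> map r (x @ y)"
        unfolding w map_append using big[OF xy(2)] big'[OF xy(3)] by (intro lex_append_mono) auto
      also have "\<dots> \<le> map r t" using xy(1) nt unfolding nrm_def splits_def by blast
      finally show ?thesis .
    qed
    have QP0: "map r w < map r t" if nt: "nrm t" and nz: "csum E (Q * P) t \<noteq> 0" for t
    proof -
      obtain x y where xy: "(y, x) \<in> splits E t" "coef (coll P) x \<noteq> 0" "coef (coll Q) y \<noteq> 0"
      proof -
        have "(\<Sum>(x, y)\<in>splits E t. coef (coll Q) x * coef (coll P) y) \<noteq> 0"
          using nz csum_coll_mult[OF sQ sP] by simp
        then obtain p where "p \<in> splits E t" "(case p of (x, y) \<Rightarrow> coef (coll Q) x * coef (coll P) y) \<noteq> 0"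
          by (rule sum.not_neutral_contains_not_neutral)
        then show ?thesis using that by (cases p) auto
      qed
      have "map r w < map r (y @ x)"
        using m(6)[of "map r x" "map r y"] big[OF xy(2)] big'[OF xy(3)] w by simp
      also have "\<dots> \<le> map r t" using xy(1) nt unfolding nrm_def splits_def by blast
      finally show ?thesis .
    qed
    have "csum E (P * Q) w = (\<Sum>(x, y)\<in>splits E w. coef (coll P) x * coef (coll Q) y)"
      by (rule csum_coll_mult) (use sP sQ in auto)
    also have "\<dots> = (\<Sum>p\<in>splits E w. if p = (u, v) then 1 else 0)"
    proof (intro sum.cong HOL.refl)
      fix p assume p: "p \<in> splits E w"
      obtain x y where xy: "p = (x, y)" by force
      show "(case p of (x, y) \<Rightarrow> coef (coll P) x * coef (coll Q) y) = (if p = (u, v) then 1 else 0)"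
      proof (cases "coef (coll P) x \<noteq> 0 \<and> coef (coll Q) y \<noteq> 0")
        case True
        have le: "map r (x @ y) \<le> map r (u @ v)" using p xy less.prems(1) unfolding nrm_def splits_def w by blast
        have bx: "map r u \<le> map r x" "length x = length u" and yv: "map r v \<le> map r y" "length y = length v"
          using True big big' by auto
        have "map r x = map r u"
        proof (rule ccontr)
          assume "map r x \<noteq> map r u"
          then have "map r u < map r x" using bx by simp
          then have "map r u @ map r v < map r x @ map r y" using bx by (intro lex_append_less) auto
          then show False using le by simp
        qed
        moreover from this have "map r y = map r v" using le yv by simp
        moreover have "x \<in> lists V" "y \<in> lists V" using True by (auto simp: coef_coll nrm_lists split: if_splits)
        ultimately have "x = u" "y = v" using map_r_inj nuv nrm_lists by blast+
        then show ?thesis using xy P(2) Q(2) nuv by (simp add: coef_coll leads_def)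
      next
        case False
        then have "p \<noteq> (u, v)" using xy P(2) Q(2) nuv by (auto simp: coef_coll leads_def)
        then show ?thesis using False xy by auto
      qed
    qed
    also have "\<dots> = 1" using w by (simp add: sum.delta') (simp add: splits_def tr_refl)
    finally have one: "csum E (P * Q) w = 1" .
    have "lie V (length w) (brk P Q)" using lie_bracket[OF P(1) Q(1)] w by simp
    moreover have "leads (brk P Q) w" unfolding leads_def
    proof (intro conjI allI impI)
      have "csum E (Q * P) w = 0" using QP0[OF less.prems(1)] by auto
      then show "csum E (brk P Q) w = 1" using one by simp
      fix t assume t: "nrm t \<and> csum E (brk P Q) t \<noteq> 0"
      then show "length t = length w" using lie_csum_length calculation by blast
      from t have "csum E (P * Q) t \<noteq> 0 \<or> csum E (Q * P) t \<noteq> 0" by auto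
      then show "map r w \<le> map r t" using PQ0 QP0 t by (meson less_imp_le)
    qed
    ultimately show ?thesis by blast
  qed
qed

lemma shuffles_map: "z \<in> shuffles u v \<Longrightarrow> map f z \<in> shuffles (map f u) (map f v)"
  by (induction u v arbitrary: z rule: shuffles.induct) auto

section \<open>Leading terms of group elements are Lie polynomials\<close>

lemma sum_tr_closed_zero:
  assumes "finite A" "tr_closed E A" "\<And>w w'. tr E w w' \<Longrightarrow> F w' = F w" "\<And>w. w \<in> A \<Longrightarrow> csum E f w = 0"
  shows "(\<Sum>w\<in>A. F w * coef f w) = 0"
  using assms(1,2)
proof (induction rule: tr_closed_induct)
  case (union w B)
  have "(\<Sum>x\<in>cl E w. F x * coef f x) = F w * csum E f w"
    unfolding csum_def sum_distrib_left using assms(3) by (intro sum.cong) (auto simp: cl_def)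
  then show ?case using union assms(4) by (subst sum.union_disjoint) auto
qed simp

text \<open>If \<open>w\<close> were not Lyndon, split it as \<open>uv\<close> by \<open>nonlyndon_split\<close>. The product of the coefficients of \<open>u\<close> and
  \<open>v\<close> vanishes, as both degrees are below that of \<open>w\<close>. By group-likeness it is a sum over infiltrations;
  the ones shorter than \<open>w\<close> vanish for the same reason, those of full length are shuffles and hence at
  most \<open>w\<close>, so all but those in the class of \<open>w\<close> vanish by minimality. What remains is a positive multiple of the
  coefficient of \<open>w\<close>.\<close>

lemma leading_word_lyndon:
  assumes g: "grouplike g" and low: "\<And>t. 0 < length t \<Longrightarrow> length t < length w \<Longrightarrow> csum E g t = 0"
    and w: "nrm w" "csum E g w \<noteq> 0"
    and min: "\<And>t. nrm t \<Longrightarrow> length t = length w \<Longrightarrow> map r t < map r w \<Longrightarrow> csum E g t = 0"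
    and "w \<noteq> []"
  shows "lyndon (map r w)"
proof (rule ccontr)
  assume "\<not> lyndon (map r w)"
  then obtain mu mv where m: "map r w = mu @ mv" "mu \<noteq> []" "mv \<noteq> []" "\<And>z. z \<in> shuffles mu mv \<Longrightarrow> z \<le> map r w"
    using nonlyndon_split[of "map r w"] \<open>w \<noteq> []\<close> by (metis map_is_Nil_conv)
  obtain u v where uv: "w = u @ v" "mu = map r u" "mv = map r v"
    using m(1) unfolding map_eq_append_conv by blast
  have ne: "u \<noteq> []" "v \<noteq> []" using m(2,3) uv by auto
  have nuv: "nrm u" "nrm v" using nrm_append w(1) unfolding uv(1) by blast+
  let ?F = "cover_count E u v" and ?W = "{t. cover_count E u v t \<noteq> 0}"
  have fin: "finite ?W" and eq: "csum E g u * csum E g v = (\<Sum>t\<in>?W. ?F t * coef g t)"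
    using csum_mult_csum[OF g] by blast+
  have "csum E g u = 0" using low[of u] ne uv by simp
  then have sum0: "(\<Sum>t\<in>?W. ?F t * coef g t) = 0" using eq by simp
  have wW: "w \<in> ?W" unfolding cover_count_pos_iff mem_Collect_eq uv(1)
    using append_in_infil tr_refl by blast
  have clW: "cl E w \<subseteq> ?W"
  proof
    fix x assume "x \<in> cl E w"
    then show "x \<in> ?W" using wW cover_count_tr[of E w x u v] by (simp add: cl_def)
  qed
  have "(\<Sum>t\<in>?W - cl E w. ?F t * coef g t) = 0"
  proof (rule sum_tr_closed_zero)
    show "finite (?W - cl E w)" using fin by simp
    show "tr_closed E (?W - cl E w)" unfolding tr_closed_def
    proof (intro allI impI)
      fix t t' assume t: "t \<in> ?W - cl E w" and tt: "tr E t t'"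
      have "\<not> tr E w t'" using t tr_trans[OF tr_sym[OF tt]] by (auto simp: cl_def)
      then show "t' \<in> ?W - cl E w" using t cover_count_tr[OF tt] by (simp add: cl_def)
    qed
    show "tr E t t' \<Longrightarrow> ?F t' = ?F t" for t t' by (rule cover_count_tr)
    fix t assume t: "t \<in> ?W - cl E w"
    have len: "length t \<le> length w" if tW: "t \<in> ?W" for t
    proof -
      obtain u' v' where *: "tr E u u'" "tr E v v'" "t \<in> set (infil u' v')"
        using tW unfolding mem_Collect_eq cover_count_pos_iff by blast
      then show ?thesis using infil_length[OF *(3)] tr_length[OF *(1)] tr_length[OF *(2)] uv(1) by simp
    qed
    show "csum E g t = 0"
    proof (cases "t \<in> lists V")
      case False
      obtain u' v' where "tr E u u'" "tr E v v'" "t \<in> set (infil u' v')"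
        using t unfolding Diff_iff mem_Collect_eq cover_count_pos_iff by blast
      moreover have "set t \<subseteq> set u' \<union> set v'" if "t \<in> set (infil u' v')" for t u' v' :: "'a list"
        using that by (induction u' v' arbitrary: t rule: infil.induct) (fastforce split: if_splits)+
      ultimately have "set t \<subseteq> set u \<union> set v" using tr_set by blast
      then show ?thesis using False nuv unfolding nrm_def by (auto simp: in_lists_conv_set)
    next
      case True
      then obtain t' where t': "tr E t t'" "nrm t'" using nrm_ex by blast
      have t'W: "t' \<in> ?W" using t cover_count_tr[OF t'(1), of u v] by simp
      have "t \<noteq> []"
      proof
        assume "t = []"
        then obtain u' v' where *: "tr E u u'" "tr E v v'" "[] \<in> set (infil u' v')"
          using t unfolding Diff_iff mem_Collect_eq cover_count_pos_iff by blast
        have "u' \<noteq> []" "v' \<noteq> []" using ne tr_length[OF *(1)] tr_length[OF *(2)] by auto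
        then show False using *(3) by (cases u'; cases v') (auto split: if_splits)
      qed
      show ?thesis
      proof (cases "length t < length w")
        case True
        then show ?thesis using low \<open>t \<noteq> []\<close> by simp
      next
        case False
        then have len_eq: "length t' = length w" using len[of t] t tr_length[OF t'(1)] by simp
        obtain u' v' where *: "tr E u u'" "tr E v v'" "t' \<in> set (infil u' v')"
          using t'W unfolding mem_Collect_eq cover_count_pos_iff by blast
        have "length t' = length u' + length v'" using len_eq uv(1) tr_length[OF *(1)] tr_length[OF *(2)] by simp
        then have "t' \<in> shuffles u' v'" using infil_shuffle *(3) by blast
        then have "map r t' \<in> shuffles (map r u') (map r v')" by (rule shuffles_map)
        moreover have "map r u' \<le> map r u" "map r v' \<le> map r v" using * nuv unfolding nrm_def by blast+
        ultimately obtain z where "z \<in> shuffles (map r u) (map r v)" "map r t' \<le> z"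
          using shuffles_mono[of "map r t'" "map r u'" "map r v'" "map r u" "map r v"]
            tr_length[OF *(1)] tr_length[OF *(2)] by auto
        then have "map r t' \<le> map r w" using m(4) uv(2,3) order_trans by blast
        moreover have "t' \<noteq> w" using t tr_sym[OF t'(1)] by (auto simp: cl_def)
        ultimately have "map r t' < map r w" using map_r_inj t'(2) w(1) nrm_lists by (metis order_le_imp_less_or_eq)
        then have "csum E g t' = 0" using min t'(2) len_eq by blast
        then show ?thesis using csum_tr[OF t'(1)] by simp
      qed
    qed
  qed
  then have "(\<Sum>t\<in>cl E w. ?F t * coef g t) = 0"
    using sum0 sum.subset_diff[OF clW fin, of "\<lambda>t. ?F t * coef g t"] by simp
  moreover have "(\<Sum>t\<in>cl E w. ?F t * coef g t) = ?F w * csum E g w"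
    unfolding csum_def sum_distrib_left by (intro sum.cong) (auto simp: cl_def cover_count_tr)
  ultimately show False using wW w(2) by simp
qed

text \<open>The smallest word of the leading term is Lyndon, so it is also the smallest word of a Lie polynomial
  with coefficient \<open>1\<close>. Multiplying the group element by a word with the opposite multiple of that
  polynomial as leading term removes the smallest word, and there are only finitely many normal words of
  degree \<open>n\<close>. The multiples that occur are divisible by \<open>q\<close>.\<close>

theorem leading_term_lie:
  assumes "a \<in> lists (V \<times> UNIV)" "a \<in> Kw E n 0" "0 < n"
    and "\<And>t. length t = n \<Longrightarrow> q dvd csum E (magnus a) t"
  shows "\<exists>P. lie V n P \<and> (\<forall>t. length t = n \<longrightarrow> csum E (magnus a) t = q * csum E P t)"
proof -
  define N where "N = {w. nrm w \<and> length w = n}"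
  define S where "S a = {w \<in> N. csum E (magnus a) w \<noteq> 0}" for a
  define U where "U a = {w \<in> N. \<exists>w'\<in>S a. map r w' \<le> map r w}" for a
  have finN: "finite N" unfolding N_def by (rule finite_nrm)
  show ?thesis using assms(1,2,4)
  proof (induction "card (U a)" arbitrary: a rule: less_induct)
    case less
    show ?case
    proof (cases "S a = {}")
      case True
      have "csum E (magnus a) t = 0" if t: "length t = n" for t
      proof (cases "t \<in> lists V")
        case True
        then obtain t' where t': "tr E t t'" "nrm t'" using nrm_ex by blast
        then have "t' \<in> N" using t tr_length by (auto simp: N_def)
        then show ?thesis using \<open>S a = {}\<close> csum_tr[OF t'(1)] by (auto simp: S_def)
      qed (use csum_supp magnus_supp less.prems(1) in blast)
      then show ?thesis using lie_zero[OF assms(3)] by (intro exI[of _ 0]) auto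
    next
      case False
      have finS: "finite (S a)" using finN by (simp add: S_def)
      obtain w where w: "w \<in> S a" "map r w = Min (map r ` S a)"
      proof -
        have "Min (map r ` S a) \<in> map r ` S a" by (rule Min_in) (use finS False in auto)
        then show ?thesis using that by (metis imageE)
      qed
      have wmin: "map r w \<le> map r t" if "t \<in> S a" for t using w(2) finS that by simp
      have wN: "nrm w" "length w = n" "csum E (magnus a) w \<noteq> 0" using w(1) by (auto simp: S_def N_def)
      have low: "csum E (magnus a) t = 0" if "0 < length t" "length t < n" for t
        using less.prems(2) that Idn_D[of "magnus a - 1" E n 0 t] by (simp add: Kw_def csum_1)
      have "lyndon (map r w)"
      proof (rule leading_word_lyndon[OF grouplike_magnus[of a]])
        show "w \<noteq> []" using wN assms(3) by auto
        fix t assume t: "nrm t" "length t = length w" "map r t < map r w"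
        then have "t \<notin> S a" using wmin by (auto simp: not_le[symmetric])
        then show "csum E (magnus a) t = 0" using t wN by (auto simp: S_def N_def)
      qed (use wN low in auto)
      then obtain B where B: "lie V n B" "leads B w" using lyndon_lie wN by blast
      obtain c where c: "csum E (magnus a) w = q * c" using less.prems(3)[OF wN(2)] by (auto elim: dvdE)
      let ?P = "of_int (q * c) * B"
      have P: "lie V n ?P" by (rule lie_of_int[OF B(1)])
      obtain y where y: "y \<in> lists (V \<times> UNIV)" "magnus y - 1 - ?P \<in> Idn {} (Suc n) 0"
        using lie_realised[OF P] by blast
      define a' where "a' = a @ word_inv y"
      have PI: "?P \<in> Idn E n 0" using Idn_free[OF lie_Idn[OF P]] .
      have iy: "magnus (word_inv y) - 1 - (- ?P) \<in> Idn E (Suc n) 0"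
        by (rule lead_inv[OF Idn_free[OF y(2)] PI])
      have iyn: "magnus (word_inv y) - 1 \<in> Idn E n 0"
        using Idn_cong[OF Idn_mono[OF iy] Idn_neg[OF PI]] by simp
      have eq: "magnus a' - magnus a - (- ?P) = (magnus (word_inv y) - 1 - (- ?P)) + (magnus a * (magnus (word_inv y) - 1) - (magnus (word_inv y) - 1))"
        by (simp add: a'_def algebra_simps)
      have a'I: "magnus a' - magnus a - (- ?P) \<in> Idn E (Suc n) 0"
        unfolding eq by (rule Idn_add[OF iy one_plus_mult_Idn'[OF iyn, of a]])
      have deg: "csum E (magnus a') t = csum E (magnus a) t - q * (c * csum E B t)" if "length t = n" for t
      proof -
        have "csum E (magnus a' - magnus a - (- ?P)) t = 0"
          using Idn_D[OF a'I, of t] that by (simp del: csum_simps)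
        then show ?thesis unfolding csum_simps csum_of_int by (simp add: mult.assoc)
      qed
      have a'V: "a' \<in> lists (V \<times> UNIV)" using less.prems(1) y(1) by (simp add: a'_def)
      have a'K: "a' \<in> Kw E n 0"
      proof -
        have "magnus a' - 1 = (magnus a - 1) * magnus (word_inv y) + (magnus (word_inv y) - 1)"
          by (simp add: a'_def algebra_simps)
        then show ?thesis using less.prems(2) iyn Idn_mult_right Idn_add unfolding Kw_def by (metis mem_Collect_eq)
      qed
      have sub: "U a' \<subset> U a"
      proof -
        have S': "t \<in> N \<and> map r w < map r t" if "t \<in> S a'" for t
        proof -
          have t: "t \<in> N" "length t = n" "nrm t" "csum E (magnus a') t \<noteq> 0" using that by (auto simp: S_def N_def)
          have "t \<noteq> w"
          proof
            assume "t = w"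
            then have "csum E (magnus a') t = 0" using deg[OF wN(2)] c B(2) by (simp add: leads_def)
            then show False using t by simp
          qed
          moreover have "map r w \<le> map r t"
          proof (cases "csum E B t = 0")
            case True
            then have "t \<in> S a" using t deg[of t] by (auto simp: S_def)
            then show ?thesis using wmin by simp
          qed (use B(2) t in \<open>auto simp: leads_def\<close>)
          ultimately show ?thesis using t wN map_r_inj nrm_lists by (metis order_le_imp_less_or_eq)
        qed
        have "U a' \<subseteq> U a"
        proof
          fix x assume "x \<in> U a'"
          then obtain t where "x \<in> N" "t \<in> S a'" "map r t \<le> map r x" by (auto simp: U_def)
          then have "map r w \<le> map r x" using S' by fastforce
          then show "x \<in> U a" using \<open>x \<in> N\<close> w(1) by (auto simp: U_def)
        qed
        moreover have "w \<in> U a" using w(1) by (auto simp: U_def S_def)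
        moreover have "w \<notin> U a'" using S' by (fastforce simp: U_def)
        ultimately show ?thesis by blast
      qed
      have "card (U a') < card (U a)" by (rule psubset_card_mono[OF _ sub]) (use finN in \<open>auto simp: U_def\<close>)
      moreover have "q dvd csum E (magnus a') t" if "length t = n" for t
        using less.prems(3)[OF that] deg[OF that] by simp
      ultimately obtain P' where P': "lie V n P'" "\<forall>t. length t = n \<longrightarrow> csum E (magnus a') t = q * csum E P' t"
        using less.hyps[OF _ a'V a'K] by blast
      have "lie V n (of_int c * B + P')" using lie_add[OF lie_of_int[OF B(1)] P'(1)] .
      moreover have "csum E (magnus a) t = q * csum E (of_int c * B + P') t" if "length t = n" for t
        using P'(2) deg[OF that] that by (simp add: algebra_simps)
      ultimately show ?thesis by blast
    qed
  qed
qed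

end

section \<open>The congruence filtration of words\<close>

lemma Kw_append: "a \<in> Kw E n q \<Longrightarrow> b \<in> Kw E n q \<Longrightarrow> a @ b \<in> Kw E n q"
proof -
  assume "a \<in> Kw E n q" "b \<in> Kw E n q"
  moreover have "magnus (a @ b) - 1 = (magnus a - 1) * magnus b + (magnus b - 1)" by (simp add: algebra_simps)
  ultimately show ?thesis using Idn_add Idn_mult_right unfolding Kw_def by (metis mem_Collect_eq)
qed

lemma Kw_inv: "a \<in> Kw E n q \<Longrightarrow> word_inv a \<in> Kw E n q"
proof -
  assume "a \<in> Kw E n q"
  moreover have "magnus (word_inv a) - 1 = - ((magnus a - 1) * magnus (word_inv a))" by (simp add: algebra_simps)
  ultimately show ?thesis using Idn_neg Idn_mult_right unfolding Kw_def by (metis mem_Collect_eq)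
qed

lemma Kw_Nil[simp]: "[] \<in> Kw E n q"
  by (simp add: Kw_def)

lemma Kw_conj: "a \<in> Kw E n q \<Longrightarrow> b @ a @ word_inv b \<in> Kw E n q"
proof -
  assume "a \<in> Kw E n q"
  moreover have "magnus (b @ a @ word_inv b) - 1 = magnus b * (magnus a - 1) * magnus (word_inv b)" by (simp add: algebra_simps)
  ultimately show ?thesis using Idn_mult_left Idn_mult_right unfolding Kw_def by (metis mem_Collect_eq)
qed

lemma Kw_mono: "a \<in> Kw E n q \<Longrightarrow> m \<le> n \<Longrightarrow> r dvd q \<Longrightarrow> a \<in> Kw E m r"
  unfolding Kw_def using Idn_mono by blast

lemma Kw_1[simp]: "a \<in> Kw E (Suc 0) q"
  using magnus_minus_1[of a E q] by (simp add: Kw_def)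

lemma Kw_comm: "b \<in> Kw E n q \<Longrightarrow> wcomm a b \<in> Kw E (Suc n) q"
  unfolding Kw_def mem_Collect_eq magnus_wcomm
  using brk_Idn[OF magnus_minus_1[of a E q], of "magnus b - 1" n] Idn_mult_right by simp

text \<open>Two words are close when their quotient lies in the filtration.\<close>

lemma Kw_div_iff: "a @ word_inv b \<in> Kw E n q \<longleftrightarrow> magnus a - magnus b \<in> Idn E n q"
proof
  have eq: "magnus a - magnus b = (magnus (a @ word_inv b) - 1) * magnus b"
    by (simp add: algebra_simps)
  show "magnus a - magnus b \<in> Idn E n q" if "a @ word_inv b \<in> Kw E n q"
    unfolding eq using that Idn_mult_right by (simp add: Kw_def)
  have eq: "magnus (a @ word_inv b) - 1 = (magnus a - magnus b) * magnus (word_inv b)"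
    by (simp add: algebra_simps)
  show "a @ word_inv b \<in> Kw E n q" if "magnus a - magnus b \<in> Idn E n q"
    unfolding Kw_def mem_Collect_eq eq using that Idn_mult_right by blast
qed

definition wpow :: "('a \<times> bool) list \<Rightarrow> nat \<Rightarrow> ('a \<times> bool) list" where
  "wpow a N = concat (replicate N a)"

lemma wpow_simps[simp]: "wpow a 0 = []" "wpow a (Suc N) = a @ wpow a N"
  by (simp_all add: wpow_def)

lemma wpow_lists[simp]: "a \<in> lists S \<Longrightarrow> wpow a N \<in> lists S"
  by (induction N) auto

lemma wpow_add: "wpow a (M + N) = wpow a M @ wpow a N"
  by (induction M) auto

lemma wpow_mult: "wpow a (M * N) = wpow (wpow a M) N"
  by (induction N) (simp_all add: wpow_add)

lemma lead_wpow:
  assumes "magnus a - 1 - P \<in> Idn E (Suc n) q" "P \<in> Idn E n q" "0 < n"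
  shows "magnus (wpow a N) - 1 - of_int (int N) * P \<in> Idn E (Suc n) q"
proof (induction N)
  case (Suc N)
  have "of_int (int (Suc N)) * P = P + of_int (int N) * P" by (simp add: algebra_simps)
  then show ?case using lead_append[OF assms(1,2) Suc _ assms(3)] Idn_of_int[OF assms(2), of "int N"] by simp
qed simp

text \<open>The leading term of the \<open>q\<close>-th power is multiplied by \<open>q\<close>, so powers move down the filtration. This
  accounts for the quotients being \<open>p\<close>-groups, and makes high powers negligible.\<close>

lemma Kw_wpow_modulus:
  assumes "a \<in> Kw E n (int q)" "0 < n"
  shows "wpow a q \<in> Kw E (Suc n) (int q)"
proof -
  have a: "magnus a - 1 \<in> Idn E n (int q)" using assms by (simp add: Kw_def)
  have "magnus (wpow a q) - 1 - of_int (int q) * (magnus a - 1) \<in> Idn E (Suc n) (int q)"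
    by (rule lead_wpow[OF _ a assms(2)]) simp
  moreover have "of_int (int q) * (magnus a - 1) \<in> Idn E (Suc n) (int q)"
    by (rule Idn_I) (simp only: csum_of_int dvd_triv_left)
  ultimately show ?thesis unfolding Kw_def by (auto intro: Idn_cong)
qed

lemma Kw_wpow_pow: "wpow a (q ^ n) \<in> Kw E (Suc n) (int q)"
proof (induction n)
  case (Suc n)
  have "wpow a (q ^ Suc n) = wpow (wpow a (q ^ n)) q" by (simp add: wpow_mult[symmetric] mult.commute)
  then show ?case using Kw_wpow_modulus[OF Suc] by simp
qed simp

context ranked_graph
begin

text \<open>\<open>leading_term_lie\<close> as a congruence of series in the next degree.\<close>

lemma leading_lie_congruence:
  assumes a: "a \<in> lists (V \<times> UNIV)" "a \<in> Kw E n 0" and n: "0 < n"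
    and q: "\<And>t. length t = n \<Longrightarrow> q dvd csum E (magnus a) t"
  obtains P where "lie V n P" "magnus a - 1 - of_int q * P \<in> Idn E (Suc n) 0"
proof -
  obtain P where P: "lie V n P" "\<And>t. length t = n \<Longrightarrow> csum E (magnus a) t = q * csum E P t"
    using leading_term_lie[OF a n q] by blast
  have "magnus a - 1 - of_int q * P \<in> Idn E (Suc n) 0"
  proof (rule Idn_I)
    fix w :: "'a list" assume w: "length w < Suc n"
    show "0 dvd csum E (magnus a - 1 - of_int q * P) w"
    proof (cases "length w = n")
      case True
      then show ?thesis using P(2)[OF True] n by (auto simp: csum_1)
    next
      case False
      then have "csum E (magnus a - 1) w = 0" using a(2) w Idn_D[of "magnus a - 1" E n 0 w] by (simp add: Kw_def del: csum_simps)
      moreover have "csum E P w = 0" using lie_csum_length[OF P(1), of w] False by auto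
      ultimately show ?thesis by (simp only: csum_simps(3)[of E "magnus a - 1"] csum_of_int) simp
    qed
  qed
  then show ?thesis using that P(1) by blast
qed

text \<open>An element of degree \<open>j\<close> that is close to degree \<open>n\<close> modulo a high power of \<open>p\<close> can be
  corrected, by factors that are high powers themselves, to an element of degree \<open>n\<close>.\<close>

lemma approximate_in_filtration:
  assumes "0 < j" "j \<le> n"
  shows "\<exists>k'\<ge>k. \<forall>a\<in>lists (V \<times> UNIV). a \<in> Kw E j 0 \<longrightarrow> a \<in> Kw E n (int p ^ k') \<longrightarrow>
    (\<exists>b\<in>lists (V \<times> UNIV). b \<in> Kw E n 0 \<and> magnus a - magnus b \<in> Idn E m (int p ^ k))"
  using assms(2,1)
proof (induction j rule: inc_induct)
  case base
  show ?case by (intro exI[of _ k]) (auto intro!: exI bexI)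
next
  case (step j)
  then obtain k' where k': "k' \<ge> k" "\<And>a. a \<in> lists (V \<times> UNIV) \<Longrightarrow> a \<in> Kw E (Suc j) 0 \<Longrightarrow> a \<in> Kw E n (int p ^ k') \<Longrightarrow>
    (\<exists>b\<in>lists (V \<times> UNIV). b \<in> Kw E n 0 \<and> magnus a - magnus b \<in> Idn E m (int p ^ k))" by auto
  define M where "M = max m n"
  \<comment> \<open>By \<open>Kw_wpow_pow\<close> a power with this exponent lies in degree \<open>M\<close> modulo \<open>p\<close> to the power \<open>k'\<close>.\<close>
  define k2 where "k2 = k' * Suc M"
  have k2: "k' \<le> k2" "k \<le> k2" using k'(1) by (auto simp: k2_def)
  show ?case
  proof (intro exI[of _ k2] conjI ballI impI k2)
    fix a :: "('a \<times> bool) list"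
    assume a: "a \<in> lists (V \<times> UNIV)" "a \<in> Kw E j 0" "a \<in> Kw E n (int p ^ k2)"
    have "int p ^ k2 dvd csum E (magnus a) t" if "length t = j" for t
      using a(3) Idn_D[of "magnus a - 1" E n "int p ^ k2" t] step that by (auto simp: Kw_def csum_1)
    then obtain P where P: "lie V j P" "magnus a - 1 - of_int (int p ^ k2) * P \<in> Idn E (Suc j) 0"
      using leading_lie_congruence[OF a(1,2) step.prems, of "int p ^ k2"] by metis
    obtain y where y: "y \<in> lists (V \<times> UNIV)" "magnus y - 1 - P \<in> Idn {} (Suc j) 0"
      using lie_realised[OF P(1)] by blast
    define h where "h = wpow y (p ^ k2)"
    have PI: "P \<in> Idn E j 0" using Idn_free lie_Idn P(1) by blast
    have h: "magnus h - 1 - of_int (int p ^ k2) * P \<in> Idn E (Suc j) 0"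
      using lead_wpow[OF Idn_free[OF y(2)] PI step.prems, of "p ^ k2"] by (simp add: h_def)
    have hK: "h \<in> Kw E M (int p ^ k')"
    proof -
      have "p ^ k2 = (p ^ k') ^ Suc M" by (simp only: k2_def power_mult)
      then have "h \<in> Kw E (Suc (Suc M)) (int (p ^ k'))" unfolding h_def using Kw_wpow_pow by metis
      then show ?thesis using Kw_mono[of h E "Suc (Suc M)" "int p ^ k'" M] by simp
    qed
    define a' where "a' = a @ word_inv h"
    have a'V: "a' \<in> lists (V \<times> UNIV)" using a y by (simp add: a'_def h_def)
    have "magnus a - magnus h = (magnus a - 1 - of_int (int p ^ k2) * P) - (magnus h - 1 - of_int (int p ^ k2) * P)"
      by simp
    then have "a' \<in> Kw E (Suc j) 0" unfolding a'_def Kw_div_iff using Idn_diff[OF P(2) h] by simp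
    moreover have "a' \<in> Kw E n (int p ^ k')" unfolding a'_def
      by (intro Kw_append Kw_inv)
         (use Kw_mono[OF a(3)] Kw_mono[OF hK] k2 in \<open>auto simp: M_def le_imp_power_dvd\<close>)
    ultimately obtain b where b: "b \<in> lists (V \<times> UNIV)" "b \<in> Kw E n 0" "magnus a' - magnus b \<in> Idn E m (int p ^ k)"
      using k'(2)[OF a'V] by blast
    have "magnus a - magnus a' \<in> Idn E m (int p ^ k)"
    proof -
      have eq: "magnus a - magnus a' = magnus a' * (magnus h - 1)" by (simp add: a'_def algebra_simps mult.assoc)
      have "h \<in> Kw E m (int p ^ k)" using Kw_mono[OF hK, of m] k'(1) by (auto simp: M_def le_imp_power_dvd)
      then show ?thesis unfolding eq using Idn_mult_left by (auto simp: Kw_def)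
    qed
    then have "magnus a - magnus b \<in> Idn E m (int p ^ k)" using b(3) Idn_trans by blast
    then show "\<exists>b\<in>lists (V \<times> UNIV). b \<in> Kw E n 0 \<and> magnus a - magnus b \<in> Idn E m (int p ^ k)"
      using b by blast
  qed
qed

text \<open>Products of commutators \<open>[s\<^sub>v, y\<^sub>v]\<close> over a fixed enumeration of the vertices.\<close>

definition comm_prod :: "'a list \<Rightarrow> ('a \<Rightarrow> ('a \<times> bool) list) \<Rightarrow> ('a \<times> bool) list" where
  "comm_prod vs y = concat (map (\<lambda>v. wcomm [(v, True)] (y v)) vs)"

lemma comm_prod_Cons[simp]: "comm_prod (v # vs) y = wcomm [(v, True)] (y v) @ comm_prod vs y"
  and comm_prod_Nil[simp]: "comm_prod [] y = []"
  by (simp_all add: comm_prod_def)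

lemma comm_prod_lists: "set vs \<subseteq> V \<Longrightarrow> (\<And>v. v \<in> V \<Longrightarrow> y v \<in> lists (V \<times> UNIV)) \<Longrightarrow> comm_prod vs y \<in> lists (V \<times> UNIV)"
  by (induction vs) (auto simp: wcomm_def)

lemma wcomm_append_right:
  assumes "z \<in> Kw E n 0" "0 < n"
  shows "magnus (wcomm a (y @ z)) - magnus (wcomm a y) - (magnus (wcomm a z) - 1) \<in> Idn E (Suc (Suc n)) 0"
proof -
  have "magnus (wcomm a (y @ z)) = magnus (wcomm a y) * (magnus y * magnus (wcomm a z) * magnus (word_inv y))"
    by (simp add: wcomm_def word_inv_def mult.assoc)
       (simp add: word_inv_def[symmetric] mult.assoc)
  then have eq: "magnus (wcomm a (y @ z)) - magnus (wcomm a y) - (magnus (wcomm a z) - 1) =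
      (magnus (wcomm a y @ y) * (magnus (wcomm a z) - 1) * magnus (word_inv y) - magnus (wcomm a y @ y) * (magnus (wcomm a z) - 1))
      + (magnus (wcomm a y @ y) * (magnus (wcomm a z) - 1) - (magnus (wcomm a z) - 1))"
    by (simp add: algebra_simps)
  have z: "magnus (wcomm a z) - 1 \<in> Idn E (Suc n) 0" using Kw_comm[OF assms(1)] by (simp add: Kw_def)
  show ?thesis unfolding eq
    by (intro Idn_add one_plus_mult_Idn one_plus_mult_Idn' Idn_mult_left z)
qed

lemma comm_prod_append:
  assumes "\<And>v. z v \<in> Kw E n 0" "0 < n"
  shows "magnus (comm_prod vs (\<lambda>v. y v @ z v)) - magnus (comm_prod vs y)
    - (\<Sum>v\<leftarrow>vs. magnus (wcomm [(v, True)] (z v)) - 1) \<in> Idn E (Suc (Suc n)) 0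
   \<and> (\<Sum>v\<leftarrow>vs. magnus (wcomm [(v, True)] (z v)) - 1) \<in> Idn E (Suc n) 0"
proof (induction vs)
  case (Cons v vs)
  define A B e where "A = magnus (wcomm [(v, True)] (y v @ z v))" and "B = magnus (wcomm [(v, True)] (y v))"
    and "e = magnus (wcomm [(v, True)] (z v)) - 1"
  define F G f where "F = magnus (comm_prod vs (\<lambda>v. y v @ z v))" and "G = magnus (comm_prod vs y)"
    and "f = (\<Sum>v\<leftarrow>vs. magnus (wcomm [(v, True)] (z v)) - 1)"
  have 1: "A - B - e \<in> Idn E (Suc (Suc n)) 0"
    unfolding A_def B_def e_def by (rule wcomm_append_right[OF assms])
  have e: "e \<in> Idn E (Suc n) 0" using Kw_comm[OF assms(1)] by (simp add: Kw_def e_def)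
  have 2: "F - G - f \<in> Idn E (Suc (Suc n)) 0" and f: "f \<in> Idn E (Suc n) 0"
    using Cons by (auto simp: F_def G_def f_def)
  have "A * F - B * G - (e + f) = (A - B - e) * F + (e * F - e) + B * (F - G - f) + (B * f - f)"
    by (simp add: algebra_simps)
  also have "\<dots> \<in> Idn E (Suc (Suc n)) 0"
    unfolding F_def B_def
    by (intro Idn_add Idn_mult_left Idn_mult_right one_plus_mult_Idn one_plus_mult_Idn' 1[unfolded B_def] 2[unfolded F_def] e f)
  finally show ?case using Idn_add[OF e f] by (simp add: A_def B_def e_def F_def G_def f_def)
qed simp

text \<open>Improve the precision one degree at a time. The error in degree \<open>m\<close> is a Lie polynomial, hence a sum of
  brackets \<open>[v, Q\<^sub>v]\<close>; extending \<open>y\<^sub>v\<close> on the right by a word with leading term \<open>Q\<^sub>v\<close> removes it and creates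
  only errors of higher degree.\<close>

lemma product_of_commutators:
  assumes vs: "set vs = V" "distinct vs" and a: "a \<in> lists (V \<times> UNIV)" "a \<in> Kw E (Suc n) 0" and n: "0 < n"
  shows "\<exists>y. (\<forall>v. y v \<in> lists (V \<times> UNIV) \<and> y v \<in> Kw E n 0) \<and> magnus a - magnus (comm_prod vs y) \<in> Idn E m 0"
proof (induction m)
  case 0
  show ?case by (intro exI[of _ "\<lambda>v. []"]) auto
next
  case (Suc m)
  show ?case
  proof (cases "m \<le> n")
    case True
    have "magnus (comm_prod us (\<lambda>v. [])) = 1" for us
      by (induction us) (auto simp: wcomm_def geom_inverse)
    moreover have "magnus a - 1 \<in> Idn E (Suc m) 0" using a(2) True Idn_mono[of "magnus a - 1" E "Suc n" 0 "Suc m" 0] by (simp add: Kw_def)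
    ultimately show ?thesis by (intro exI[of _ "\<lambda>v. []"]) auto
  next
    case False
    obtain y where y: "\<And>v. y v \<in> lists (V \<times> UNIV)" "\<And>v. y v \<in> Kw E n 0"
      "magnus a - magnus (comm_prod vs y) \<in> Idn E m 0" using Suc by blast
    define C where "C = comm_prod vs y"
    define b where "b = word_inv C @ a"
    have C: "C \<in> lists (V \<times> UNIV)" unfolding C_def by (rule comm_prod_lists) (use vs y in auto)
    have b: "b \<in> lists (V \<times> UNIV)" using a C by (simp add: b_def)
    have "magnus b - 1 = magnus (word_inv C) * (magnus a - magnus C)" by (simp add: b_def algebra_simps)
    then have bK: "b \<in> Kw E m 0" using Idn_mult_left y(3) unfolding Kw_def C_def by (metis mem_Collect_eq)
    obtain P where P: "lie V m P" "magnus b - 1 - of_int 1 * P \<in> Idn E (Suc m) 0"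
      using leading_lie_congruence[OF b bK, of 1] False by (metis gr_zeroI le0 one_dvd)
    have m1: "1 < m" using False n by simp
    obtain Q where Q: "\<And>v. v \<in> V \<Longrightarrow> lie V (m - 1) (Q v)" "P = (\<Sum>v\<in>V. brk (var v) (Q v))"
      using lie_left_normed[OF P(1) m1 fin_V] by blast
    have "\<forall>v\<in>V. \<exists>z. z \<in> lists (V \<times> UNIV) \<and> magnus z - 1 - Q v \<in> Idn {} (Suc (m - 1)) 0"
      using lie_realised[OF Q(1)] by blast
    then obtain z0 where z0: "\<And>v. v \<in> V \<Longrightarrow> z0 v \<in> lists (V \<times> UNIV)" 
      "\<And>v. v \<in> V \<Longrightarrow> magnus (z0 v) - 1 - Q v \<in> Idn {} (Suc (m - 1)) 0" by metis
    define z where "z v = (if v \<in> V then z0 v else [])" for v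
    have QI: "Q v \<in> Idn E (m - 1) 0" if "v \<in> V" for v using Idn_free lie_Idn Q(1) that by blast
    have zI: "magnus (z v) - 1 - Q v \<in> Idn E (Suc (m - 1)) 0" if "v \<in> V" for v
      using Idn_free[OF z0(2)] that by (simp add: z_def)
    have zK: "z v \<in> Kw E (m - 1) 0" for v
    proof (cases "v \<in> V")
      case True
      have "magnus (z v) - 1 - Q v \<in> Idn E (m - 1) 0" by (rule Idn_mono[OF zI[OF True]]) auto
      then show ?thesis unfolding Kw_def using Idn_cong QI[OF True] by blast
    qed (simp add: z_def)
    have zn: "z v \<in> Kw E n 0" for v using Kw_mono[OF zK] False by simp
    have zl: "z v \<in> lists (V \<times> UNIV)" for v using z0 by (simp add: z_def)
    define y' where "y' v = y v @ z v" for v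
    have S: "(\<Sum>v\<leftarrow>vs. magnus (wcomm [(v, True)] (z v)) - 1) = (\<Sum>v\<in>V. magnus (wcomm [(v, True)] (z v)) - 1)"
      using vs by (simp add: sum_list_distinct_conv_sum_set)
    have "(\<Sum>v\<in>V. magnus (wcomm [(v, True)] (z v)) - 1) - P = (\<Sum>v\<in>V. magnus (wcomm [(v, True)] (z v)) - 1 - brk (var v) (Q v))"
      unfolding Q(2) by (simp add: sum_subtractf)
    also have "\<dots> \<in> Idn E (Suc m) 0"
    proof (rule Idn_sum)
      fix v assume v: "v \<in> V"
      have "magnus [(v, True)] - 1 - var v \<in> Idn E (Suc 1) 0" by simp
      from lead_wcomm[OF this _ zI[OF v] QI[OF v]] Idn_free[OF lie_Idn[OF lie_var[OF v]], of E]
      show "magnus (wcomm [(v, True)] (z v)) - 1 - brk (var v) (Q v) \<in> Idn E (Suc m) 0" using m1 by simp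
    qed
    finally have sP: "(\<Sum>v\<in>V. magnus (wcomm [(v, True)] (z v)) - 1) - P \<in> Idn E (Suc m) 0" .
    have "magnus (comm_prod vs y') - magnus C - (\<Sum>v\<in>V. magnus (wcomm [(v, True)] (z v)) - 1) \<in> Idn E (Suc (Suc (m - 1))) 0"
      using comm_prod_append[where z = z and n = "m - 1" and vs = vs and y = y, OF zK] m1 S
      unfolding C_def y'_def by auto
    then have c: "magnus (comm_prod vs y') - magnus C - (\<Sum>v\<in>V. magnus (wcomm [(v, True)] (z v)) - 1) \<in> Idn E (Suc m) 0"
      using m1 by simp
    have d: "magnus a - magnus C - P \<in> Idn E (Suc m) 0"
    proof -
      have b1: "magnus b - 1 \<in> Idn E m 0" using bK by (simp add: Kw_def)
      have eq: "magnus a - magnus C - P = (magnus C * (magnus b - 1) - (magnus b - 1)) + (magnus b - 1 - P)"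
        by (simp add: b_def algebra_simps)
      have P2: "magnus b - 1 - P \<in> Idn E (Suc m) 0" using P(2) by simp
      show ?thesis unfolding eq by (rule Idn_add[OF one_plus_mult_Idn'[OF b1] P2])
    qed
    have "magnus a - magnus (comm_prod vs y') = (magnus a - magnus C - P)
      - (magnus (comm_prod vs y') - magnus C - (\<Sum>v\<in>V. magnus (wcomm [(v, True)] (z v)) - 1))
      - ((\<Sum>v\<in>V. magnus (wcomm [(v, True)] (z v)) - 1) - P)" by simp
    then have "magnus a - magnus (comm_prod vs y') \<in> Idn E (Suc m) 0"
      using Idn_diff[OF Idn_diff[OF d c] sP] by simp
    moreover have "\<forall>v. y' v \<in> lists (V \<times> UNIV) \<and> y' v \<in> Kw E n 0"
      using y zl zn by (auto simp: y'_def intro: Kw_append)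
    ultimately show ?thesis by blast
  qed
qed

end

section \<open>Finite \<open>p\<close>-groups\<close>

text \<open>A prime divisor of the order gives an element of that prime order by Cauchy's theorem.\<close>

lemma prime_power_order:
  fixes G :: "('g, 'm) monoid_scheme" (structure)
  assumes G: "group G" "finite (carrier G)" and p: "Factorial_Ring.prime (p::nat)"
    and exponent: "\<And>x. x \<in> carrier G \<Longrightarrow> x [^]\<^bsub>G\<^esub> (p ^ e) = \<one>\<^bsub>G\<^esub>"
  shows "\<exists>k. order G = p ^ k"
proof -
  interpret group G by (rule G)
  have pos: "order G > 0" using G(2) order_gt_0_iff_finite by blast
  obtain m where m: "order G = p ^ multiplicity p (order G) * m" "\<not> p dvd m"
    using multiplicity_decompose'[of "order G" p] pos prime_gt_1_nat[OF p] by auto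
  have "m = 1"
  proof (rule ccontr)
    assume "m \<noteq> 1"
    then obtain q where q: "Factorial_Ring.prime q" "q dvd m" using prime_factor_nat by blast
    have "q \<noteq> p" using q m by blast
    obtain m' where "m = q * m'" using q(2) by (auto elim: dvdE)
    then have "order G = q ^ 1 * (p ^ multiplicity p (order G) * m')" using m(1) by (metis mult.left_commute power_one_right)
    then obtain H where H: "subgroup H G" "card H = q"
      using sylow_thm[of q G 1 "p ^ multiplicity p (order G) * m'"] q(1) G by auto
    have "card H > 1" using H(2) q(1) prime_gt_1_nat by simp
    then obtain x where x: "x \<in> H" "x \<noteq> \<one>"
    proof -
      have "\<not> H \<subseteq> {\<one>}" using card_mono[of "{\<one>}" H] \<open>card H > 1\<close> by auto
      then show ?thesis using that by blast
    qed
    have xG: "x \<in> carrier G" using x H subgroup.mem_carrier by fast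
    interpret H: group "G\<lparr>carrier := H\<rparr>" using subgroup.subgroup_is_group[OF H(1) G(1)] .
    have "x [^]\<^bsub>G\<lparr>carrier := H\<rparr>\<^esub> order (G\<lparr>carrier := H\<rparr>) = \<one>\<^bsub>G\<lparr>carrier := H\<rparr>\<^esub>"
      by (rule H.pow_order_eq_1) (use x in simp)
    then have "x [^] q = \<one>" using H(2) by (simp add: order_def nat_pow_consistent[symmetric])
    then have "ord x dvd q" using pow_eq_id xG by blast
    moreover have "ord x dvd p ^ e" using exponent pow_eq_id xG by blast
    moreover have "coprime q (p ^ e)" using \<open>q \<noteq> p\<close> q(1) p by (simp add: primes_coprime)
    ultimately have "ord x = 1" by (metis coprime_common_divisor_nat nat_dvd_1_iff_1)
    then show False using x(2) ord_eq_1 xG by simp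
  qed
  then show ?thesis using m(1) by auto
qed

lemma p_group_central:
  fixes G :: "('g, 'm) monoid_scheme" (structure)
  assumes G: "group G" and p: "Factorial_Ring.prime (p::nat)" and ord: "order G = p ^ Suc k"
  shows "\<exists>z\<in>carrier G. z \<noteq> \<one>\<^bsub>G\<^esub> \<and> (\<forall>x\<in>carrier G. x \<otimes>\<^bsub>G\<^esub> z = z \<otimes>\<^bsub>G\<^esub> x)"
proof (rule ccontr)
  assume contra: "\<not> ?thesis"
  interpret group G by (rule G)
  define \<phi> where "\<phi> = (\<lambda>g. \<lambda>h \<in> carrier G. g \<otimes> h \<otimes> inv g)"
  interpret A: group_action G "carrier G" \<phi> unfolding \<phi>_def by (rule action_by_conjugation)
  have p0: "p > 0" using p prime_gt_0_nat by blast
  have fin: "finite (carrier G)" using ord p0 order_gt_0_iff_finite by simp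
  have one: "orbit G \<phi> \<one> = {\<one>}" unfolding orbit_def \<phi>_def by (auto intro!: exI[of _ \<one>])
  have dvd: "p dvd card (orbit G \<phi> x)" if x: "x \<in> carrier G" "x \<noteq> \<one>" for x
  proof (rule ccontr)
    assume nd: "\<not> p dvd card (orbit G \<phi> x)"
    have "card (orbit G \<phi> x) dvd p ^ Suc k"
      using A.orbit_stabilizer_theorem[OF x(1)] ord by (metis dvd_triv_left)
    then obtain i where "card (orbit G \<phi> x) = p ^ i" using divides_primepow_nat[OF p] by blast
    then have c1: "card (orbit G \<phi> x) = 1" using nd by (cases i) auto
    have xo: "x \<in> orbit G \<phi> x" using A.orbit_refl x(1) by blast
    have "g \<otimes> x = x \<otimes> g" if g: "g \<in> carrier G" for g
    proof -
      have "\<phi> g x \<in> orbit G \<phi> x" using g by (auto simp: orbit_def)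
      then have "\<phi> g x = x" using c1 xo by (metis card_1_singletonE singletonD)
      then have "g \<otimes> x \<otimes> inv g = x" using x by (simp add: \<phi>_def)
      then show ?thesis using g x(1) by (metis inv_solve_right' m_closed)
    qed
    then show False using contra x by blast
  qed
  have "(\<Sum>orb\<in>orbits G (carrier G) \<phi>. \<Sum>x\<in>orb. 1::nat) = (\<Sum>x\<in>carrier G. 1)"
    by (rule A.disjoint_sum[OF fin])
  then have s: "(\<Sum>orb\<in>orbits G (carrier G) \<phi>. card orb) = p ^ Suc k" using ord by (simp add: order_def)
  have fo: "finite (orbits G (carrier G) \<phi>)" using fin by (simp add: orbits_def)
  have o1: "{\<one>} \<in> orbits G (carrier G) \<phi>" using one by (auto simp: orbits_def)
  have "p dvd (\<Sum>orb\<in>orbits G (carrier G) \<phi> - {{\<one>}}. card orb)"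
  proof (rule dvd_sum)
    fix orb assume "orb \<in> orbits G (carrier G) \<phi> - {{\<one>}}"
    then obtain x where "x \<in> carrier G" "orb = orbit G \<phi> x" "orb \<noteq> {\<one>}" by (auto simp: orbits_def)
    then show "p dvd card orb" using dvd one by metis
  qed
  moreover have "p ^ Suc k = 1 + (\<Sum>orb\<in>orbits G (carrier G) \<phi> - {{\<one>}}. card orb)"
    unfolding s[symmetric] using sum.remove[OF fo o1, of card] by simp
  ultimately have "p dvd 1" by (metis dvd_add_left_iff dvd_triv_left power_Suc)
  then show False using p not_prime_unit by blast
qed

lemma p_group_central_order_p:
  fixes G :: "('g, 'm) monoid_scheme" (structure)
  assumes G: "group G" and p: "Factorial_Ring.prime (p::nat)" and ord: "order G = p ^ Suc k"
  shows "\<exists>z\<in>carrier G. z \<noteq> \<one>\<^bsub>G\<^esub> \<and> (\<forall>x\<in>carrier G. x \<otimes>\<^bsub>G\<^esub> z = z \<otimes>\<^bsub>G\<^esub> x) \<and> z [^]\<^bsub>G\<^esub> p = \<one>\<^bsub>G\<^esub>"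
proof -
  interpret group G by (rule G)
  obtain z where z: "z \<in> carrier G" "z \<noteq> \<one>" "\<And>x. x \<in> carrier G \<Longrightarrow> x \<otimes> z = z \<otimes> x"
    using p_group_central[OF assms] by blast
  have fin: "finite (carrier G)" using ord p prime_gt_0_nat order_gt_0_iff_finite by simp
  have ex: "\<exists>j. z [^] (p ^ j) = \<one>" using pow_order_eq_1[OF z(1)] ord by metis
  define j where "j = (LEAST j. z [^] (p ^ j) = \<one>)"
  have j: "z [^] (p ^ j) = \<one>" unfolding j_def using ex by (rule LeastI_ex)
  have "j \<noteq> 0" using j z(1,2) by (metis nat_pow_eone power_0)
  then obtain i where i: "j = Suc i" by (cases j) auto
  define y where "y = z [^] (p ^ i)"
  have "y \<noteq> \<one>" using not_less_Least[of i "\<lambda>j. z [^] (p ^ j) = \<one>"] i unfolding j_def y_def by auto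
  moreover have "y [^] p = \<one>" using j i z(1) by (simp add: y_def nat_pow_pow mult.commute)
  moreover have "x \<otimes> z [^] (n::nat) = z [^] n \<otimes> x" if "x \<in> carrier G" for x n
    using that z by (induction n) (simp_all add: m_assoc, metis m_assoc nat_pow_closed)
  ultimately show ?thesis using z(1) by (intro bexI[of _ y]) (auto simp: y_def)
qed

text \<open>The action of the product of the elements \<open>s - 1\<close> of the group ring on functions, so nilpotency of the
  augmentation ideal says that long iterated differences vanish.\<close>

fun shift_diff :: "('g, 'm) monoid_scheme \<Rightarrow> 'g list \<Rightarrow> ('g \<Rightarrow> int) \<Rightarrow> 'g \<Rightarrow> int" where
  "shift_diff G [] h = h"
| "shift_diff G (s # ss) h = (\<lambda>x. shift_diff G ss h (x \<otimes>\<^bsub>G\<^esub> s) - shift_diff G ss h x)"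

lemma shift_diff_append: "shift_diff G (ss @ ts) h = shift_diff G ss (shift_diff G ts h)"
  by (induction ss) auto

definition periodic_mod :: "nat \<Rightarrow> ('g, 'm) monoid_scheme \<Rightarrow> 'g set \<Rightarrow> ('g \<Rightarrow> int) \<Rightarrow> bool" where
  "periodic_mod p G N h \<longleftrightarrow> (\<forall>x\<in>carrier G. \<forall>y\<in>N. int p dvd h (x \<otimes>\<^bsub>G\<^esub> y) - h x)"

lemma periodic_shift_diff:
  fixes G :: "('g, 'm) monoid_scheme" (structure)
  assumes "N \<lhd> G" "periodic_mod p G N h" "set ss \<subseteq> carrier G"
  shows "periodic_mod p G N (shift_diff G ss h)"
  using assms(3)
proof (induction ss)
  case (Cons s ss)
  interpret normal N G by (rule assms(1))
  let ?f = "shift_diff G ss h"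
  have f: "periodic_mod p G N ?f" using Cons by simp
  show ?case unfolding periodic_mod_def
  proof (intro ballI)
    fix x y assume x: "x \<in> carrier G" and y: "y \<in> N"
    have s: "s \<in> carrier G" using Cons.prems by simp
    have yG: "y \<in> carrier G" using y by simp
    have y': "inv s \<otimes> y \<otimes> s \<in> N" using inv_op_closed1[OF s y] .
    have "x \<otimes> y \<otimes> s = x \<otimes> s \<otimes> (inv s \<otimes> y \<otimes> s)"
      using x yG s by (simp add: m_assoc[symmetric]) (simp add: m_assoc)
    then have "int p dvd ?f (x \<otimes> y \<otimes> s) - ?f (x \<otimes> s)"
      using f y' x s unfolding periodic_mod_def by simp
    moreover have "int p dvd ?f (x \<otimes> y) - ?f x" using f x y unfolding periodic_mod_def by simp
    ultimately have "int p dvd (?f (x \<otimes> y \<otimes> s) - ?f (x \<otimes> s)) - (?f (x \<otimes> y) - ?f x)" by (rule dvd_diff)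
    then show "int p dvd shift_diff G (s # ss) h (x \<otimes> y) - shift_diff G (s # ss) h x"
      by (simp add: algebra_simps)
  qed
qed (use assms in simp)

lemma shift_diff_replicate:
  fixes G :: "('g, 'm) monoid_scheme" (structure)
  assumes "group G" "z \<in> carrier G" "x \<in> carrier G"
  shows "shift_diff G (replicate i z) h x = (\<Sum>j\<le>i. (- 1) ^ (i - j) * int (i choose j) * h (x \<otimes>\<^bsub>G\<^esub> z [^]\<^bsub>G\<^esub> j))"
  using assms(3)
proof (induction i arbitrary: x)
  case 0
  interpret group G by (rule assms)
  show ?case using 0 by simp
next
  case (Suc i)
  interpret group G by (rule assms)
  let ?c = "\<lambda>i j. (- 1) ^ (i - j) * int (i choose j)"
  have eq: "x \<otimes> z \<otimes> z [^] j = x \<otimes> z [^] Suc j" for j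
    using Suc.prems assms(2) by (simp add: m_assoc nat_pow_Suc2[symmetric] del: nat_pow_Suc)
  have "shift_diff G (replicate (Suc i) z) h x =
     (\<Sum>j\<le>i. ?c i j * h (x \<otimes> z [^] Suc j)) - (\<Sum>j\<le>i. ?c i j * h (x \<otimes> z [^] j))"
    using Suc assms(2) by (simp add: eq del: nat_pow_Suc)
  also have "(\<Sum>j\<le>i. ?c i j * h (x \<otimes> z [^] j)) = (\<Sum>j\<le>Suc i. ?c i j * h (x \<otimes> z [^] j))"
    by simp
  also have "\<dots> = (- 1) ^ i * h (x \<otimes> z [^] (0::nat)) + (\<Sum>j\<le>i. ?c i (Suc j) * h (x \<otimes> z [^] Suc j))"
    by (subst sum.atMost_Suc_shift) simp
  also have "(\<Sum>j\<le>i. ?c i j * h (x \<otimes> z [^] Suc j)) - \<dots> =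
     (\<Sum>j\<le>i. ?c (Suc i) (Suc j) * h (x \<otimes> z [^] Suc j)) + (- 1) ^ Suc i * h (x \<otimes> z [^] (0::nat))"
  proof -
    have "?c i j - ?c i (Suc j) = ?c (Suc i) (Suc j)" if "j \<le> i" for j
    proof (cases "j = i")
      case False
      then have "i - j = Suc (i - Suc j)" using that by simp
      then show ?thesis by (simp add: algebra_simps)
    qed simp
    then have "(\<Sum>j\<le>i. ?c i j * h (x \<otimes> z [^] Suc j)) - (\<Sum>j\<le>i. ?c i (Suc j) * h (x \<otimes> z [^] Suc j))
        = (\<Sum>j\<le>i. ?c (Suc i) (Suc j) * h (x \<otimes> z [^] Suc j))"
      unfolding sum_subtractf[symmetric] left_diff_distrib[symmetric] by (intro sum.cong) auto
    then show ?thesis by simp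
  qed
  also have "\<dots> = (\<Sum>j\<le>Suc i. ?c (Suc i) j * h (x \<otimes> z [^] j))"
    by (subst sum.atMost_Suc_shift) simp
  finally show ?case .
qed

text \<open>\<open>(z - 1)\<^sup>p = z\<^sup>p - 1\<close> modulo \<open>p\<close>.\<close>

lemma shift_diff_p:
  fixes G :: "('g, 'm) monoid_scheme" (structure)
  assumes G: "group G" and p: "Factorial_Ring.prime p" and N: "periodic_mod p G N h"
    and z: "z \<in> carrier G" "z [^]\<^bsub>G\<^esub> p \<in> N" and x: "x \<in> carrier G"
  shows "int p dvd shift_diff G (replicate p z) h x"
proof -
  interpret group G by (rule G)
  have p1: "p > 1" using p prime_gt_1_nat by blast
  let ?t = "\<lambda>j. (- 1) ^ (p - j) * int (p choose j) * h (x \<otimes> z [^] j)"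
  have mid: "int p dvd (\<Sum>j\<in>{0<..<p}. ?t j)"
  proof (rule dvd_sum)
    fix j assume "j \<in> {0<..<p}"
    then have "p dvd p choose j" using dvd_choose_prime[of j p] p by auto
    then have "int p dvd int (p choose j)" by simp
    then show "int p dvd ?t j" by simp
  qed
  have "{..p} = insert 0 (insert p {0<..<p})" using p1 by auto
  then have "shift_diff G (replicate p z) h x = ?t 0 + (?t p + (\<Sum>j\<in>{0<..<p}. ?t j))"
    unfolding shift_diff_replicate[OF G z(1) x] using p1 by simp
  also have "\<dots> = ((h (x \<otimes> z [^] p) - h x) + (1 + (- 1) ^ p) * h x) + (\<Sum>j\<in>{0<..<p}. ?t j)"
    using x by (simp add: algebra_simps)
  finally have eq: "shift_diff G (replicate p z) h x = \<dots>" .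
  have "int p dvd h (x \<otimes> z [^] p) - h x" using N z(2) x unfolding periodic_mod_def by blast
  moreover have "int p dvd (1 + (- 1) ^ p) * h x"
  proof (cases "p = 2")
    case False
    then have "odd p" using p primes_dvd_imp_eq two_is_prime_nat by blast
    then show ?thesis by simp
  qed simp
  ultimately show ?thesis unfolding eq using mid by (intro dvd_add)
qed

text \<open>Upward induction on \<open>N\<close>. Let \<open>z\<close> be central modulo \<open>N\<close> with \<open>z\<^sup>p \<in> N\<close>, so that \<open>(z - 1)\<^sup>p\<close> annihilates
  functions with period \<open>N\<close> (\<open>shift_diff_p\<close>). If \<open>(z - 1)\<^sup>i\<^sup>+\<^sup>1\<close> annihilates such a function, then \<open>(z - 1)\<^sup>i\<close> turns it
  into a function whose periods also include \<open>z\<close>, to which the induction hypothesis applies. After \<open>p\<close> batches of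
  differences nothing is left.\<close>

theorem augmentation_nilpotent:
  fixes G :: "('g, 'm) monoid_scheme" (structure)
  assumes G: "group G" and p: "Factorial_Ring.prime p" and ord: "order G = p ^ m" and "N \<lhd> G"
  shows "\<exists>n. \<forall>h. periodic_mod p G N h \<longrightarrow> (\<forall>ss x. set ss \<subseteq> carrier G \<longrightarrow> n \<le> length ss \<longrightarrow>
    x \<in> carrier G \<longrightarrow> int p dvd shift_diff G ss h x)"
  using assms(4)
proof (induction "order G - card N" arbitrary: N rule: less_induct)
  case less
  interpret group G by (rule G)
  interpret N: normal N G by (rule less.prems)
  have p0: "p > 0" using p prime_gt_0_nat by blast
  have fin: "finite (carrier G)" using ord p0 order_gt_0_iff_finite by simp
  have finN: "finite N" using fin N.subset finite_subset by blast
  show ?case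
  proof (cases "N = carrier G")
    case True
    show ?thesis
    proof (intro exI[of _ 1] allI impI)
      fix h ss x assume h: "periodic_mod p G N h" and ss: "set ss \<subseteq> carrier G" "1 \<le> length ss" and x: "x \<in> carrier G"
      obtain s ts where "ss = s # ts" using ss(2) by (cases ss) auto
      then show "int p dvd shift_diff G ss h x"
        using periodic_shift_diff[OF less.prems h, of ts] ss(1) x True unfolding periodic_mod_def by auto
    qed
  next
    case False
    interpret Q: group "G Mod N" by (rule N.factorgroup_is_group)
    note [simp del] = mult_FactGroup one_FactGroup
    have lag: "order (G Mod N) * card N = p ^ m"
      using lagrange[OF N.subgroup_axioms] ord by (simp add: order_def FactGroup_def)
    then obtain k where k: "order (G Mod N) = p ^ k" using divides_primepow_nat[OF p] by (metis dvd_triv_left)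
    have "k \<noteq> 0"
    proof
      assume "k = 0"
      then have "card N = card (carrier G)" using lag k ord by (simp add: order_def)
      then show False using False card_subset_eq[OF fin N.subset] by simp
    qed
    then obtain k' where "k = Suc k'" by (cases k) auto
    then obtain Z where Z: "Z \<in> carrier (G Mod N)" "Z \<noteq> \<one>\<^bsub>G Mod N\<^esub>"
      "\<And>Y. Y \<in> carrier (G Mod N) \<Longrightarrow> Y \<otimes>\<^bsub>G Mod N\<^esub> Z = Z \<otimes>\<^bsub>G Mod N\<^esub> Y" "Z [^]\<^bsub>G Mod N\<^esub> p = \<one>\<^bsub>G Mod N\<^esub>"
      using p_group_central_order_p[OF Q.group_axioms p] k by metis
    obtain z where z: "z \<in> carrier G" "Z = N #> z" using Z(1) by (auto simp: FactGroup_def RCOSETS_def)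
    have coset: "N #> x \<in> carrier (G Mod N)" if "x \<in> carrier G" for x
      using that by (auto simp: FactGroup_def RCOSETS_def)
    have eqN: "x \<otimes> inv y \<in> N" if "N #> x = N #> y" "x \<in> carrier G" "y \<in> carrier G" for x y
    proof -
      have "x \<in> N #> y" using rcos_self[OF that(2) N.subgroup_axioms] that(1) by simp
      then obtain n where "n \<in> N" "x = n \<otimes> y" by (auto simp: r_coset_def)
      then show ?thesis using that(3) N.subset by (auto simp: m_assoc)
    qed
    have pi: "(N #> x) \<otimes>\<^bsub>G Mod N\<^esub> (N #> y) = N #> (x \<otimes> y)" if "x \<in> carrier G" "y \<in> carrier G" for x y
      using that by (simp add: FactGroup_def N.rcos_sum)
    have Zc: "Y \<otimes>\<^bsub>G Mod N\<^esub> Z [^]\<^bsub>G Mod N\<^esub> i = Z [^]\<^bsub>G Mod N\<^esub> i \<otimes>\<^bsub>G Mod N\<^esub> Y" if "Y \<in> carrier (G Mod N)" for Y and i :: nat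
    proof (induction i)
      case (Suc i)
      have "Y \<otimes>\<^bsub>G Mod N\<^esub> Z [^]\<^bsub>G Mod N\<^esub> Suc i = (Z [^]\<^bsub>G Mod N\<^esub> i \<otimes>\<^bsub>G Mod N\<^esub> Y) \<otimes>\<^bsub>G Mod N\<^esub> Z"
        using Suc that Z(1) by (simp add: Q.m_assoc[symmetric])
      also have "\<dots> = Z [^]\<^bsub>G Mod N\<^esub> Suc i \<otimes>\<^bsub>G Mod N\<^esub> Y"
        using that Z(1) by (simp add: Q.m_assoc Z(3))
      finally show ?case .
    qed (use that in simp)
    define N' where "N' = {x \<in> carrier G. \<exists>i::nat. N #> x = Z [^]\<^bsub>G Mod N\<^esub> i}"
    have one: "N #> \<one> = \<one>\<^bsub>G Mod N\<^esub>" using N.subset by (simp add: FactGroup_def)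
    have "subgroup N' G"
    proof (rule subgroupI)
      have "N #> \<one> = Z [^]\<^bsub>G Mod N\<^esub> (0::nat)" using one by simp
      then have "\<one> \<in> N'" unfolding N'_def by blast
      then show "N' \<noteq> {}" by blast
      fix x assume x: "x \<in> N'"
      then obtain i where i: "x \<in> carrier G" "N #> x = Z [^]\<^bsub>G Mod N\<^esub> (i::nat)" unfolding N'_def by blast
      obtain p' where p': "p = Suc p'" using p0 by (cases p) auto
      have "(N #> x) \<otimes>\<^bsub>G Mod N\<^esub> Z [^]\<^bsub>G Mod N\<^esub> (p' * i) = (Z [^]\<^bsub>G Mod N\<^esub> p) [^]\<^bsub>G Mod N\<^esub> i"
      proof -
        have "i + p' * i = p * i" using p' by simp
        then show ?thesis unfolding i(2) Q.nat_pow_mult[OF Z(1)] Q.nat_pow_pow[OF Z(1)] by simp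
      qed
      then have "(N #> x) \<otimes>\<^bsub>G Mod N\<^esub> Z [^]\<^bsub>G Mod N\<^esub> (p' * i) = \<one>\<^bsub>G Mod N\<^esub>" by (simp add: Z(4))
      moreover have "(N #> x) \<otimes>\<^bsub>G Mod N\<^esub> (N #> inv x) = \<one>\<^bsub>G Mod N\<^esub>" using pi[of x "inv x"] i(1) one by simp
      ultimately have "N #> inv x = Z [^]\<^bsub>G Mod N\<^esub> (p' * i)"
        using coset i(1) Z(1) Q.l_cancel[of "N #> x" "N #> inv x" "Z [^]\<^bsub>G Mod N\<^esub> (p' * i)"] by simp
      then show "inv x \<in> N'" using i(1) unfolding N'_def by blast
      fix y assume y: "y \<in> N'"
      then obtain j where j: "y \<in> carrier G" "N #> y = Z [^]\<^bsub>G Mod N\<^esub> (j::nat)" unfolding N'_def by blast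
      have "N #> (x \<otimes> y) = Z [^]\<^bsub>G Mod N\<^esub> (i + j)" using pi[OF i(1) j(1)] i j Z(1) by (simp add: Q.nat_pow_mult)
      then show "x \<otimes> y \<in> N'" using i(1) j(1) unfolding N'_def by blast
    qed (auto simp: N'_def)
    moreover have "x \<otimes> y \<otimes> inv x \<in> N'" if x: "x \<in> carrier G" and y: "y \<in> N'" for x y
    proof -
      obtain j where j: "y \<in> carrier G" "N #> y = Z [^]\<^bsub>G Mod N\<^esub> (j::nat)" using y unfolding N'_def by blast
      have "N #> (x \<otimes> y \<otimes> inv x) = (N #> x) \<otimes>\<^bsub>G Mod N\<^esub> Z [^]\<^bsub>G Mod N\<^esub> j \<otimes>\<^bsub>G Mod N\<^esub> (N #> inv x)"
        unfolding j(2)[symmetric] using pi[OF x j(1)] pi[of "x \<otimes> y" "inv x"] x j(1) by simp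
      also have "\<dots> = Z [^]\<^bsub>G Mod N\<^esub> j \<otimes>\<^bsub>G Mod N\<^esub> ((N #> x) \<otimes>\<^bsub>G Mod N\<^esub> (N #> inv x))"
        using coset x Z(1) by (simp add: Zc Q.m_assoc)
      also have "\<dots> = Z [^]\<^bsub>G Mod N\<^esub> j" using pi[of x "inv x"] x one Z(1) by simp
      finally show ?thesis using x j(1) unfolding N'_def by blast
    qed
    ultimately have N': "N' \<lhd> G" using normal_inv_iff by blast
    have N'sub: "N' \<subseteq> carrier G" by (auto simp: N'_def)
    have NN': "N \<subseteq> N'"
    proof
      fix y assume y: "y \<in> N"
      then have "N #> y = \<one>\<^bsub>G Mod N\<^esub>" using coset_join2[of y N] N.subgroup_axioms N.subset by (auto simp: FactGroup_def)
      then have "N #> y = Z [^]\<^bsub>G Mod N\<^esub> (0::nat)" by simp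
      then show "y \<in> N'" using y N.subset unfolding N'_def by blast
    qed
    have "N #> z = Z [^]\<^bsub>G Mod N\<^esub> (1::nat)" using z(2) Z(1) by simp
    then have zN': "z \<in> N'" using z(1) unfolding N'_def by blast
    have zpow: "N #> (z [^] n) = Z [^]\<^bsub>G Mod N\<^esub> n" for n :: nat
    proof (induction n)
      case (Suc n)
      then show ?case using pi[of "z [^] n" z] z by simp
    qed (use one in simp)
    have zp: "z [^] p \<in> N"
      using zpow[of p] Z(4) eqN[of "z [^] p" \<one>] z(1) one by simp
    have zN: "z \<notin> N"
    proof
      assume "z \<in> N"
      then have "N #> z = N" using coset_join2[of z N] N.subgroup_axioms z(1) by simp
      then show False using Z(2) z(2) by (simp add: FactGroup_def)
    qed
    have "card N < card N'" by (rule psubset_card_mono) (use NN' zN' zN N'sub fin finite_subset in auto)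
    moreover have "card N' \<le> order G" using N'sub fin card_mono by (auto simp: order_def)
    ultimately have "order G - card N' < order G - card N" by simp
    from less.hyps[OF this N'] obtain n where n: "\<And>h ss x. periodic_mod p G N' h \<Longrightarrow> set ss \<subseteq> carrier G \<Longrightarrow> n \<le> length ss \<Longrightarrow>
      x \<in> carrier G \<Longrightarrow> int p dvd shift_diff G ss h x" by blast
    have step: "periodic_mod p G N' g" if g: "periodic_mod p G N g" "\<And>x. x \<in> carrier G \<Longrightarrow> int p dvd shift_diff G [z] g x" for g
      unfolding periodic_mod_def
    proof (intro ballI)
      fix x y assume x: "x \<in> carrier G" and y: "y \<in> N'"
      then obtain i where i: "y \<in> carrier G" "N #> y = N #> (z [^] (i::nat))" by (auto simp: N'_def zpow)
      define c where "c = y \<otimes> inv (z [^] i)"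
      have c: "c \<in> N" unfolding c_def by (rule eqN[OF i(2) i(1)]) (use z in simp)
      have cG: "c \<in> carrier G" using c by simp
      have yc: "y = c \<otimes> z [^] i" using i(1) z(1) by (simp add: c_def m_assoc)
      have "int p dvd g (w \<otimes> z [^] j) - g w" if w: "w \<in> carrier G" for w and j :: nat
      proof (induction j)
        case (Suc j)
        have "int p dvd g (w \<otimes> z [^] j \<otimes> z) - g (w \<otimes> z [^] j)" using g(2)[of "w \<otimes> z [^] j"] w z(1) by simp
        from dvd_add[OF this Suc] show ?case using w z(1) by (simp add: m_assoc)
      qed (use w in simp)
      from this[of "x \<otimes> c" i] have "int p dvd g (x \<otimes> y) - g (x \<otimes> c)" using x cG z(1) by (simp add: yc m_assoc)
      moreover have "int p dvd g (x \<otimes> c) - g x" using g(1) x c by (auto simp: periodic_mod_def)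
      ultimately have "int p dvd (g (x \<otimes> y) - g (x \<otimes> c)) + (g (x \<otimes> c) - g x)" by (rule dvd_add)
      then show "int p dvd g (x \<otimes> y) - g x" by simp
    qed
    have sdc: "\<forall>x\<in>carrier G. int p dvd shift_diff G ss f x - shift_diff G ss g x"
      if fg: "\<And>x. x \<in> carrier G \<Longrightarrow> int p dvd f x - g x" and ss: "set ss \<subseteq> carrier G" for f g ss
      using ss
    proof (induction ss)
      case (Cons s ss)
      show ?case
      proof
        fix x assume x: "x \<in> carrier G"
        have "int p dvd (shift_diff G ss f (x \<otimes> s) - shift_diff G ss g (x \<otimes> s)) - (shift_diff G ss f x - shift_diff G ss g x)"
          using Cons x by - (rule dvd_diff, auto)
        then show "int p dvd shift_diff G (s # ss) f x - shift_diff G (s # ss) g x" by (simp add: algebra_simps)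
      qed
    qed (use fg in simp)
    have comm: "int p dvd shift_diff G (ss @ [z]) f x - shift_diff G (z # ss) f x"
      if f: "periodic_mod p G N f" and ss: "set ss \<subseteq> carrier G" and x: "x \<in> carrier G" for f ss x
      using ss x
    proof (induction ss arbitrary: x)
      case (Cons s ss)
      let ?f = "shift_diff G ss f"
      have s: "s \<in> carrier G" and ss: "set ss \<subseteq> carrier G" using Cons.prems by auto
      note x = Cons.prems(2)
      have pf: "periodic_mod p G N ?f" by (rule periodic_shift_diff[OF less.prems f ss])
      have "N #> (z \<otimes> s) = N #> (s \<otimes> z)" using Z(3)[OF coset[OF s]] pi[OF s z(1)] pi[OF z(1) s] unfolding z(2) by simp
      then have "z \<otimes> s \<otimes> inv (s \<otimes> z) \<in> N" by (rule eqN) (use s z in auto)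
      define u w where "u = s \<otimes> z" and "w = z \<otimes> s"
      have uw: "u \<in> carrier G" "w \<in> carrier G" using s z(1) by (auto simp: u_def w_def)
      have "inv u \<otimes> (w \<otimes> inv u) \<otimes> u \<in> N"
        using N.inv_op_closed1[OF uw(1)] \<open>z \<otimes> s \<otimes> inv (s \<otimes> z) \<in> N\<close> by (simp add: u_def w_def)
      moreover have "inv u \<otimes> (w \<otimes> inv u) \<otimes> u = inv u \<otimes> w" using uw by (simp add: m_assoc)
      ultimately have c: "inv u \<otimes> w \<in> N" by simp
      have "x \<otimes> u \<otimes> (inv u \<otimes> w) = x \<otimes> (u \<otimes> inv u) \<otimes> w" using x uw by (simp only: m_assoc m_closed inv_closed)
      then have "x \<otimes> s \<otimes> z \<otimes> (inv u \<otimes> w) = x \<otimes> z \<otimes> s"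
        using x uw s z(1) by (simp add: u_def w_def m_assoc)
      then have e: "int p dvd ?f (x \<otimes> z \<otimes> s) - ?f (x \<otimes> s \<otimes> z)"
        using pf c x s z(1) unfolding periodic_mod_def by (metis m_closed)
      have i1: "int p dvd shift_diff G (ss @ [z]) f (x \<otimes> s) - shift_diff G (z # ss) f (x \<otimes> s)"
        and i2: "int p dvd shift_diff G (ss @ [z]) f x - shift_diff G (z # ss) f x"
        using Cons.IH[OF ss] x s by auto
      have "shift_diff G ((s # ss) @ [z]) f x - shift_diff G (z # s # ss) f x =
         (shift_diff G (ss @ [z]) f (x \<otimes> s) - shift_diff G (z # ss) f (x \<otimes> s))
         - (shift_diff G (ss @ [z]) f x - shift_diff G (z # ss) f x)
         - (?f (x \<otimes> z \<otimes> s) - ?f (x \<otimes> s \<otimes> z))" by simp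
      also have "int p dvd \<dots>" by (rule dvd_diff[OF dvd_diff[OF i1 i2] e])
      finally show ?case .
    qed simp
    have comms: "int p dvd shift_diff G (ss @ replicate i z) f x - shift_diff G (replicate i z @ ss) f x"
      if f: "periodic_mod p G N f" and ss: "set ss \<subseteq> carrier G" and x: "x \<in> carrier G" for f ss x i
      using x
    proof (induction i arbitrary: x)
      case (Suc i)
      have zi: "set (replicate i z) \<subseteq> carrier G" using z(1) by auto
      have "int p dvd shift_diff G (ss @ [z]) (shift_diff G (replicate i z) f) x - shift_diff G (z # ss) (shift_diff G (replicate i z) f) x"
        by (rule comm[OF periodic_shift_diff[OF less.prems f zi] ss Suc.prems])
      moreover have "int p dvd (shift_diff G (ss @ replicate i z) f (x \<otimes> z) - shift_diff G (replicate i z @ ss) f (x \<otimes> z))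
        - (shift_diff G (ss @ replicate i z) f x - shift_diff G (replicate i z @ ss) f x)"
        using Suc z(1) by - (rule dvd_diff, auto)
      ultimately have "int p dvd (shift_diff G (ss @ [z]) (shift_diff G (replicate i z) f) x - shift_diff G (z # ss) (shift_diff G (replicate i z) f) x)
        + ((shift_diff G (ss @ replicate i z) f (x \<otimes> z) - shift_diff G (replicate i z @ ss) f (x \<otimes> z))
        - (shift_diff G (ss @ replicate i z) f x - shift_diff G (replicate i z @ ss) f x))" by (rule dvd_add)
      then show ?case by (simp add: shift_diff_append algebra_simps)
    qed simp
    have main: "\<forall>x\<in>carrier G. int p dvd shift_diff G ss h x"
      if "periodic_mod p G N h" "\<forall>x\<in>carrier G. int p dvd shift_diff G (replicate i z) h x" "set ss \<subseteq> carrier G" "i * n \<le> length ss" for h i ss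
      using that
    proof (induction i arbitrary: h ss)
      case 0
      then show ?case using sdc[of h "\<lambda>x. 0" ss] 
      proof -
        have "shift_diff G ss (\<lambda>x. 0) x = 0" for x by (induction ss arbitrary: x) auto
        then show ?thesis using sdc[of h "\<lambda>x. 0" ss] 0 by simp
      qed
    next
      case (Suc i)
      define s1 s2 where "s1 = take (i * n) ss" and "s2 = drop (i * n) ss"
      have ss: "ss = s1 @ s2" "set s1 \<subseteq> carrier G" "set s2 \<subseteq> carrier G" "i * n \<le> length s1" "n \<le> length s2"
        using Suc.prems(3,4) set_take_subset[of "i * n" ss] set_drop_subset[of "i * n" ss] by (auto simp: s1_def s2_def)
      have zi: "set (replicate i z) \<subseteq> carrier G" using z(1) by auto
      let ?g = "shift_diff G (replicate i z) h"
      have pg: "periodic_mod p G N' ?g"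
        by (rule step[OF periodic_shift_diff[OF less.prems Suc.prems(1) zi]]) (use Suc.prems(2) in auto)
      have "int p dvd shift_diff G (replicate i z) (shift_diff G s2 h) x" if x: "x \<in> carrier G" for x
      proof -
        have a: "int p dvd shift_diff G (s2 @ replicate i z) h x" unfolding shift_diff_append using n[OF pg ss(3,5) x] .
        have b: "int p dvd shift_diff G (s2 @ replicate i z) h x - shift_diff G (replicate i z @ s2) h x"
          by (rule comms[OF Suc.prems(1) ss(3) x])
        from dvd_diff[OF a b] show ?thesis by (simp add: shift_diff_append)
      qed
      then have "\<forall>x\<in>carrier G. int p dvd shift_diff G s1 (shift_diff G s2 h) x"
        using Suc.IH[OF periodic_shift_diff[OF less.prems Suc.prems(1) ss(3)]] ss by blast
      then show ?case by (simp add: ss(1) shift_diff_append)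
    qed
    show ?thesis
    proof (intro exI[of _ "p * n"] allI impI)
      fix h ss x assume h: "periodic_mod p G N h" and ss: "set ss \<subseteq> carrier G" "p * n \<le> length ss" and x: "x \<in> carrier G"
      then show "int p dvd shift_diff G ss h x"
        using main[OF h _ ss] shift_diff_p[OF G p h z(1) zp] by blast
    qed
  qed
qed

section \<open>Presented groups\<close>

lemma pres_eq_lists: "pres_eq S Rel u w \<Longrightarrow> u \<in> lists (S \<times> UNIV) \<and> w \<in> lists (S \<times> UNIV)"
  by (induction rule: pres_eq.induct) auto

lemma pres_eq_context:
  "pres_eq S Rel u w \<Longrightarrow> x \<in> lists (S \<times> UNIV) \<Longrightarrow> y \<in> lists (S \<times> UNIV) \<Longrightarrow> pres_eq S Rel (x @ u @ y) (x @ w @ y)"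
proof (induction rule: pres_eq.induct)
  case (refl w)
  then show ?case using pres_eq.refl[of "x @ w @ y" S Rel] by simp
next
  case (trans u v w)
  then show ?case using pres_eq.trans by blast
next
  case (cancel u w z b)
  then show ?case using pres_eq.cancel[of "x @ u" S "w @ y" z Rel b] by simp
next
  case (relator u w r)
  then show ?case using pres_eq.relator[of "x @ u" S "w @ y" r Rel] by simp
qed (auto intro: pres_eq.sym)

lemma pres_eq_append:
  assumes "pres_eq S Rel u u'" "pres_eq S Rel w w'"
  shows "pres_eq S Rel (u @ w) (u' @ w')"
proof (rule pres_eq.trans)
  show "pres_eq S Rel (u @ w) (u' @ w)"
    using pres_eq_context[OF assms(1), of "[]" w] pres_eq_lists[OF assms(2)] by simp
  show "pres_eq S Rel (u' @ w) (u' @ w')"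
    using pres_eq_context[OF assms(2), of u' "[]"] pres_eq_lists[OF assms(1)] by simp
qed

lemma pres_class_eq_iff: "w \<in> lists (S \<times> UNIV) \<Longrightarrow> pres_class S Rel w = pres_class S Rel w' \<longleftrightarrow> pres_eq S Rel w w'"
proof
  assume w: "w \<in> lists (S \<times> UNIV)"
  show "pres_eq S Rel w w'" if "pres_class S Rel w = pres_class S Rel w'"
  proof -
    have "w \<in> pres_class S Rel w'" using pres_eq.refl[OF w, of Rel] that unfolding pres_class_def by blast
    then show ?thesis unfolding pres_class_def using pres_eq.sym by blast
  qed
  show "pres_class S Rel w = pres_class S Rel w'" if "pres_eq S Rel w w'"
    unfolding pres_class_def using that pres_eq.sym pres_eq.trans by blast
qed

lemma pres_class_mult:
  assumes "u \<in> lists (S \<times> UNIV)" "w \<in> lists (S \<times> UNIV)"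
  shows "(\<Union>a\<in>pres_class S Rel u. \<Union>b\<in>pres_class S Rel w. pres_class S Rel (a @ b)) = pres_class S Rel (u @ w)"
proof -
  have "pres_class S Rel (a @ b) = pres_class S Rel (u @ w)"
    if "a \<in> pres_class S Rel u" "b \<in> pres_class S Rel w" for a b
  proof -
    have "pres_eq S Rel (u @ w) (a @ b)" using that pres_eq_append unfolding pres_class_def by blast
    then show ?thesis using pres_class_eq_iff[of "u @ w"] assms by fastforce
  qed
  moreover have "u \<in> pres_class S Rel u" "w \<in> pres_class S Rel w"
    using assms pres_eq.refl unfolding pres_class_def by auto
  ultimately show ?thesis by blast
qed

lemma pres_eq_inv: "w \<in> lists (S \<times> UNIV) \<Longrightarrow> pres_eq S Rel (word_inv w @ w) []"
proof (induction w rule: list.induct)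
  case Nil
  then show ?case by (simp add: pres_eq.refl)
next
  case (Cons y w)
  obtain x b where y: "y = (x, b)" "x \<in> S" using Cons.prems by auto
  have w: "w \<in> lists (S \<times> UNIV)" using Cons.prems by auto
  have "pres_eq S Rel (word_inv w @ [(x, \<not> b), (x, \<not> \<not> b)] @ w) (word_inv w @ w)"
    by (rule pres_eq.cancel) (use w y in auto)
  then show ?case using Cons.IH[OF w] y pres_eq.trans by fastforce
qed

lemma presented_group_simps:
  "carrier (presented_group S Rel) = pres_class S Rel ` lists (S \<times> UNIV)"
  "\<one>\<^bsub>presented_group S Rel\<^esub> = pres_class S Rel []"
  "u \<in> lists (S \<times> UNIV) \<Longrightarrow> w \<in> lists (S \<times> UNIV) \<Longrightarrow>
    pres_class S Rel u \<otimes>\<^bsub>presented_group S Rel\<^esub> pres_class S Rel w = pres_class S Rel (u @ w)"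
  by (simp_all add: presented_group_def pres_class_mult)

lemma group_presented_group: "group (presented_group S Rel)"
proof (rule groupI)
  let ?c = "pres_class S Rel" and ?L = "lists (S \<times> (UNIV :: bool set))"
  have app: "u @ w \<in> ?L" if "u \<in> ?L" "w \<in> ?L" for u w using that by simp
  have nil: "[] \<in> ?L" by simp
  note m = presented_group_simps(3) and one = presented_group_simps(2)
  fix x assume "x \<in> carrier (presented_group S Rel)"
  then obtain u where u: "u \<in> ?L" "x = ?c u" unfolding presented_group_simps by blast
  show "\<one>\<^bsub>presented_group S Rel\<^esub> \<otimes>\<^bsub>presented_group S Rel\<^esub> x = x"
    unfolding u(2) one m[OF nil u(1)] by simp
  have "?c (word_inv u @ u) = ?c []"
    using pres_class_eq_iff[OF app[OF word_inv_lists[OF u(1)] u(1)]] pres_eq_inv[OF u(1)] by blast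
  then have "?c (word_inv u) \<otimes>\<^bsub>presented_group S Rel\<^esub> x = \<one>\<^bsub>presented_group S Rel\<^esub>"
    unfolding u(2) one m[OF word_inv_lists[OF u(1)] u(1)] .
  then show "\<exists>y\<in>carrier (presented_group S Rel). y \<otimes>\<^bsub>presented_group S Rel\<^esub> x = \<one>\<^bsub>presented_group S Rel\<^esub>"
    using word_inv_lists[OF u(1)] unfolding presented_group_simps(1) by blast
  fix y assume "y \<in> carrier (presented_group S Rel)"
  then obtain w where w: "w \<in> ?L" "y = ?c w" unfolding presented_group_simps by blast
  show "x \<otimes>\<^bsub>presented_group S Rel\<^esub> y \<in> carrier (presented_group S Rel)"
    unfolding u(2) w(2) m[OF u(1) w(1)] presented_group_simps(1) using app[OF u(1) w(1)] by blast
  fix z assume "z \<in> carrier (presented_group S Rel)"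
  then obtain v where v: "v \<in> ?L" "z = ?c v" unfolding presented_group_simps by blast
  show "x \<otimes>\<^bsub>presented_group S Rel\<^esub> y \<otimes>\<^bsub>presented_group S Rel\<^esub> z = x \<otimes>\<^bsub>presented_group S Rel\<^esub> (y \<otimes>\<^bsub>presented_group S Rel\<^esub> z)"
    unfolding u(2) w(2) v(2) m[OF u(1) w(1)] m[OF w(1) v(1)] m[OF app[OF u(1) w(1)] v(1)] m[OF u(1) app[OF w(1) v(1)]] by simp
qed (simp add: presented_group_simps)

lemma presented_group_inv:
  assumes "w \<in> lists (S \<times> UNIV)"
  shows "inv\<^bsub>presented_group S Rel\<^esub> pres_class S Rel w = pres_class S Rel (word_inv w)"
proof -
  interpret group "presented_group S Rel" by (rule group_presented_group)
  have "word_inv w @ w \<in> lists (S \<times> UNIV)" using assms by simp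
  then have "pres_class S Rel (word_inv w @ w) = pres_class S Rel []"
    using pres_class_eq_iff pres_eq_inv[OF assms] by blast
  then have "pres_class S Rel (word_inv w) \<otimes>\<^bsub>presented_group S Rel\<^esub> pres_class S Rel w = \<one>\<^bsub>presented_group S Rel\<^esub>"
    unfolding presented_group_simps(2) presented_group_simps(3)[OF word_inv_lists[OF assms] assms] .
  then show ?thesis
    by (rule inv_equality) (use assms word_inv_lists[OF assms] in \<open>auto simp only: presented_group_simps(1)\<close>)
qed

lemma (in group) rcos_eq_iff:
  assumes "subgroup N G" "x \<in> carrier G" "y \<in> carrier G"
  shows "N #> x = N #> y \<longleftrightarrow> x \<otimes> inv y \<in> N"
proof
  interpret N: subgroup N G by (rule assms)
  show "x \<otimes> inv y \<in> N" if "N #> x = N #> y"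
  proof -
    have "x \<in> N #> y" using rcos_self[OF assms(2,1)] that by simp
    then obtain n where "n \<in> N" "x = n \<otimes> y" by (auto simp: r_coset_def)
    then show ?thesis using assms(3) by (auto simp: m_assoc)
  qed
  show "N #> x = N #> y" if n: "x \<otimes> inv y \<in> N"
  proof -
    have "x = (x \<otimes> inv y) \<otimes> y" using assms by (simp add: m_assoc)
    then have "N #> x = (N #> (x \<otimes> inv y)) #> y" using assms N.subset by (simp add: coset_mult_assoc)
    then show ?thesis using coset_join2[OF _ assms(1) n] assms by simp
  qed
qed

section \<open>The congruence subgroups of a right-angled Artin group\<close>

locale raag_prime = ranked_graph +
  fixes p :: nat
  assumes simplicial: "finite_simplicial_graph V E" and p: "Factorial_Ring.prime p"
begin

abbreviation "A \<equiv> raag V E"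
abbreviation "L \<equiv> lists (V \<times> (UNIV :: bool set))"
abbreviation "cls \<equiv> pres_class V (raag_relators E)"

lemma group_A: "group A"
  unfolding raag_def by (rule group_presented_group)

sublocale A: group A by (rule group_A)

lemma carrier_A: "carrier A = cls ` L"
  and one_A: "\<one>\<^bsub>A\<^esub> = cls []"
  and mult_A: "u \<in> L \<Longrightarrow> w \<in> L \<Longrightarrow> cls u \<otimes>\<^bsub>A\<^esub> cls w = cls (u @ w)"
  and inv_A: "w \<in> L \<Longrightarrow> inv\<^bsub>A\<^esub> cls w = cls (word_inv w)"
  by (simp_all add: raag_def presented_group_simps presented_group_inv)

lemma cls_carrier[simp]: "w \<in> L \<Longrightarrow> cls w \<in> carrier A"
  by (simp add: carrier_A)

lemma pow_A: "w \<in> L \<Longrightarrow> cls w [^]\<^bsub>A\<^esub> (n::nat) = cls (wpow w n)"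
proof (induction n)
  case (Suc n)
  have "wpow w (Suc n) = wpow w n @ w" using wpow_add[of w n 1] by simp
  then show ?case using Suc by (simp add: mult_A)
qed (simp add: one_A)

lemma edge_vertices: "{u, v} \<in> E \<Longrightarrow> u \<in> V \<and> v \<in> V \<and> u \<noteq> v"
  using simplicial unfolding finite_simplicial_graph_def by (metis doubleton_eq_iff)

lemma brk_var_Idn: 
  assumes "{u, v} \<in> E"
  shows "brk (var u) (var v) \<in> Idn E n q"
proof (rule Idn_I)
  fix t :: "'a list"
  have c: "coef (var a * var b) w = (if w = [a, b] then 1 else 0)" for a b :: 'a and w
    by (cases w) (auto simp: coef_var)
  have t: "tr E [u, v] [v, u]" "tr E [v, u] [u, v]" using tr_step[OF assms, of "[]" "[]"] tr_sym by fastforce+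
  have "[u, v] \<in> cl E t \<longleftrightarrow> [v, u] \<in> cl E t" unfolding cl_def using t tr_trans by blast
  then have "csum E (brk (var u) (var v)) t = 0"
    unfolding csum_def by (auto simp: c sum_subtractf sum.delta')
  then show "q dvd csum E (brk (var u) (var v)) t" by simp
qed

lemma magnus_pres_eq: "pres_eq V (raag_relators E) u w \<Longrightarrow> magnus u - magnus w \<in> Idn E n q"
proof (induction rule: pres_eq.induct)
  case (sym u w)
  then show ?case using Idn_neg[OF sym.IH] by simp
next
  case (trans u v w)
  then show ?case using Idn_trans by blast
next
  case (cancel u w x b)
  have "magnus (u @ [(x, b), (x, \<not> b)] @ w) = magnus u * (mletter (x, b) * mletter (x, \<not> b)) * magnus w"
    by (simp add: mult.assoc)
  then show ?case by (simp add: mletter_inverse)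
next
  case (relator u w r)
  then obtain a b where r: "r = wcomm [(a, True)] [(b, True)]" "{a, b} \<in> E"
    by (auto simp: raag_relators_def wcomm_def)
  have m: "magnus r - 1 = brk (var a) (var b) * (magnus (word_inv [(a, True)]) * magnus (word_inv [(b, True)]))"
    unfolding r(1) magnus_wcomm by simp
  have "magnus r - 1 \<in> Idn E n q" unfolding m using brk_var_Idn[OF r(2)] Idn_mult_right by blast
  moreover have "magnus (u @ r @ w) - magnus (u @ w) = magnus u * (magnus r - 1) * magnus w"
    by (simp add: algebra_simps)
  ultimately show ?case using Idn_mult_left Idn_mult_right by metis
qed auto

lemma magnus_cls_eq: "u \<in> L \<Longrightarrow> cls u = cls w \<Longrightarrow> magnus u - magnus w \<in> Idn E n q"
  using magnus_pres_eq pres_class_eq_iff by blast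

definition KA :: "nat \<Rightarrow> int \<Rightarrow> ('a \<times> bool) list set set" where
  "KA n q = cls ` (L \<inter> Kw E n q)"

lemma cls_in_KA: "w \<in> L \<Longrightarrow> cls w \<in> KA n q \<longleftrightarrow> w \<in> Kw E n q"
proof
  assume w: "w \<in> L" and "cls w \<in> KA n q"
  then obtain u where u: "u \<in> L" "u \<in> Kw E n q" "cls w = cls u" by (auto simp: KA_def)
  have "magnus w - 1 = (magnus w - magnus u) + (magnus u - 1)" by simp
  then show "w \<in> Kw E n q" using Idn_add[OF magnus_cls_eq[OF w u(3)]] u(2) unfolding Kw_def by (metis mem_Collect_eq)
qed (auto simp: KA_def)

lemma KA_sub: "KA n q \<subseteq> carrier A"
  by (auto simp: KA_def carrier_A)

lemma subgroup_KA: "subgroup (KA n q) A"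
proof (rule A.subgroupI)
  show "KA n q \<noteq> {}" using cls_in_KA[of "[]" n q] by auto
  fix x y assume "x \<in> KA n q"
  then obtain u where u: "u \<in> L" "u \<in> Kw E n q" "x = cls u" by (auto simp: KA_def)
  show "inv\<^bsub>A\<^esub> x \<in> KA n q" using u by (auto simp: inv_A cls_in_KA Kw_inv)
  assume "y \<in> KA n q"
  then obtain w where w: "w \<in> L" "w \<in> Kw E n q" "y = cls w" by (auto simp: KA_def)
  show "x \<otimes>\<^bsub>A\<^esub> y \<in> KA n q" using u w by (auto simp: mult_A cls_in_KA Kw_append)
qed (rule KA_sub)

lemma normal_KA: "KA n q \<lhd> A"
  unfolding A.normal_inv_iff
proof (intro conjI ballI subgroup_KA)
  fix x h assume "x \<in> carrier A" "h \<in> KA n q"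
  then obtain u w where "u \<in> L" "x = cls u" "w \<in> L" "w \<in> Kw E n q" "h = cls w" by (auto simp: KA_def carrier_A)
  then show "x \<otimes>\<^bsub>A\<^esub> h \<otimes>\<^bsub>A\<^esub> inv\<^bsub>A\<^esub> x \<in> KA n q"
    using Kw_conj[of w E n q u] by (simp add: inv_A mult_A cls_in_KA)
qed

lemma KA_mono: "m \<le> n \<Longrightarrow> q' dvd q \<Longrightarrow> KA n q \<subseteq> KA m q'"
  unfolding KA_def using Kw_mono by blast

lemma KA_coset_eq: "u \<in> L \<Longrightarrow> w \<in> L \<Longrightarrow> KA n q #>\<^bsub>A\<^esub> cls u = KA n q #>\<^bsub>A\<^esub> cls w \<longleftrightarrow> magnus u - magnus w \<in> Idn E n q"
  by (subst A.rcos_eq_iff[OF subgroup_KA]) (simp_all add: inv_A mult_A cls_in_KA Kw_div_iff)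

definition short :: "nat \<Rightarrow> 'a list set" where
  "short n = {u \<in> lists V. length u < n}"

lemma finite_short[simp]: "finite (short n)"
proof -
  have "short n \<subseteq> (\<Union>k<n. {xs. set xs \<subseteq> V \<and> length xs = k})" by (auto simp: short_def)
  then show ?thesis by (rule finite_subset) (auto intro!: finite_lists_length_eq fin_V)
qed

lemma short_closed: "tr_closed E (short n)"
  unfolding tr_closed_def short_def using tr_lists tr_length by fastforce

text \<open>Only the words of \<open>short n\<close> matter, so a coset of \<open>KA n q\<close> is a finite amount of data.\<close>

lemma magnus_Idn_iff:
  assumes "u \<in> L" "w \<in> L"
  shows "magnus u - magnus w \<in> Idn E n q \<longleftrightarrow> (\<forall>t\<in>short n. csum E (magnus u) t mod q = csum E (magnus w) t mod q)"
proof
  have z: "csum E (magnus a) t = 0" if "a \<in> L" "t \<notin> lists V" for a t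
    using csum_supp[OF magnus_supp[OF that(1)] that(2)] .
  show "\<forall>t\<in>short n. csum E (magnus u) t mod q = csum E (magnus w) t mod q" if "magnus u - magnus w \<in> Idn E n q"
  proof
    fix t assume "t \<in> short n"
    then have "q dvd csum E (magnus u - magnus w) t" using Idn_D[OF that] by (simp add: short_def)
    then show "csum E (magnus u) t mod q = csum E (magnus w) t mod q" by (simp add: mod_eq_dvd_iff)
  qed
  show "magnus u - magnus w \<in> Idn E n q" if h: "\<forall>t\<in>short n. csum E (magnus u) t mod q = csum E (magnus w) t mod q"
  proof (rule Idn_I)
    fix t :: "'a list" assume t: "length t < n"
    show "q dvd csum E (magnus u - magnus w) t"
    proof (cases "t \<in> lists V")
      case True
      then have "t \<in> short n" using t by (simp add: short_def)
      then show ?thesis using bspec[OF h] by (simp add: mod_eq_dvd_iff)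
    next
      case False
      then show ?thesis using z[OF assms(1) False] z[OF assms(2) False] by simp
    qed
  qed
qed

text \<open>The quotient embeds into a finite set of truncated class sums, and its exponent divides a power of \<open>p\<close>
  by \<open>Kw_wpow_pow\<close>.\<close>

lemma KA_index: "KA n (int p ^ k) \<in> p_power_index_normal p A"
proof -
  let ?q = "int p ^ k" and ?K = "KA n (int p ^ k)"
  interpret K: normal ?K A by (rule normal_KA)
  interpret Q: group "A Mod ?K" by (rule K.factorgroup_is_group)
  have q0: "?q > 0" using p prime_gt_0_nat by simp
  define g where "g w = restrict (\<lambda>t. csum E (magnus w) t mod ?q) (short n)" for w
  have gL: "g ` L \<subseteq> short n \<rightarrow>\<^sub>E {0..<?q}" using q0 by (auto simp: g_def)
  have fing: "finite (g ` L)" by (rule finite_subset[OF gL]) (rule finite_PiE, auto)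
  have geq: "?K #>\<^bsub>A\<^esub> cls u = ?K #>\<^bsub>A\<^esub> cls w" if "u \<in> L" "w \<in> L" "g u = g w" for u w
    unfolding KA_coset_eq[OF that(1,2)] magnus_Idn_iff[OF that(1,2)]
    using fun_cong[OF that(3)] by (metis g_def restrict_apply')
  have car: "carrier (A Mod ?K) = (\<lambda>w. ?K #>\<^bsub>A\<^esub> cls w) ` L"
    by (auto simp: carrier_FactGroup carrier_A)
  have "(\<lambda>w. ?K #>\<^bsub>A\<^esub> cls w) ` L \<subseteq> (\<lambda>f. ?K #>\<^bsub>A\<^esub> cls (SOME w. w \<in> L \<and> g w = f)) ` (g ` L)"
  proof
    fix C assume "C \<in> (\<lambda>w. ?K #>\<^bsub>A\<^esub> cls w) ` L"
    then obtain w where w: "w \<in> L" "C = ?K #>\<^bsub>A\<^esub> cls w" by blast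
    let ?w = "SOME w'. w' \<in> L \<and> g w' = g w"
    have "?w \<in> L \<and> g ?w = g w" by (rule someI[where P = "\<lambda>w'. w' \<in> L \<and> g w' = g w"]) (use w(1) in blast)
    then have "C = ?K #>\<^bsub>A\<^esub> cls ?w" unfolding w(2) using geq[OF w(1), of ?w] by simp
    then show "C \<in> (\<lambda>f. ?K #>\<^bsub>A\<^esub> cls (SOME w. w \<in> L \<and> g w = f)) ` (g ` L)" using w(1) by (intro image_eqI) auto
  qed
  then have fin: "finite (carrier (A Mod ?K))" unfolding car using fing finite_subset by blast
  have exponent: "x [^]\<^bsub>A Mod ?K\<^esub> (p ^ (k * n)) = \<one>\<^bsub>A Mod ?K\<^esub>" if xc: "x \<in> carrier (A Mod ?K)" for x
  proof -
    obtain w where w: "w \<in> L" "x = ?K #>\<^bsub>A\<^esub> cls w" using xc unfolding car by blast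
    have "wpow w (p ^ (k * n)) \<in> Kw E (Suc n) (int (p ^ k))"
      using Kw_wpow_pow[of w "p ^ k" n E] by (simp add: power_mult)
    then have "wpow w (p ^ (k * n)) \<in> Kw E n ?q" using Kw_mono[of _ E "Suc n" ?q n ?q] by simp
    then have "cls (wpow w (p ^ (k * n))) \<in> ?K" using w(1) by (simp add: cls_in_KA)
    then have "?K #>\<^bsub>A\<^esub> (cls w [^]\<^bsub>A\<^esub> (p ^ (k * n))) = ?K"
      using A.coset_join2[OF _ subgroup_KA] w(1) by (simp add: pow_A)
    then show ?thesis using K.FactGroup_pow[of "cls w" "p ^ (k * n)"] w by simp
  qed
  show ?thesis unfolding p_power_index_normal_def
    using prime_power_order[OF Q.group_axioms fin p exponent] normal_KA by blast
qed

lemma weighted_sum_dvd: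
  assumes "finite B" "tr_closed E B" "\<And>w w'. tr E w w' \<Longrightarrow> F w' = F w" "\<And>w. w \<in> B \<Longrightarrow> q dvd csum E f w"
  shows "q dvd (\<Sum>w\<in>B. coef f w * F w)"
  using assms(1,2)
proof (induction rule: tr_closed_induct)
  case (union w B)
  have "(\<Sum>x\<in>cl E w. coef f x * F x) = csum E f w * F w"
    unfolding csum_def sum_distrib_right using assms(3) by (intro sum.cong) (auto simp: cl_def)
  then show ?case using union assms(4) by (subst sum.union_disjoint) auto
qed simp

text \<open>The congruence subgroups modulo \<open>p\<close> are cofinal among the normal subgroups of \<open>p\<close>-power
  index: a word acts on functions on the finite quotient through its Magnus expansion.\<close>

theorem KA_cofinal:
  assumes "N \<in> p_power_index_normal p A"
  shows "\<exists>n. KA n (int p) \<subseteq> N"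
proof -
  obtain k where N: "N \<lhd> A" and k: "order (A Mod N) = p ^ k"
    using assms by (auto simp: p_power_index_normal_def)
  interpret N: normal N A by (rule N)
  interpret Q: group "A Mod N" by (rule N.factorgroup_is_group)
  note [simp del] = mult_FactGroup one_FactGroup
  define \<pi> where "\<pi> w = N #>\<^bsub>A\<^esub> cls w" for w
  have \<pi>: "\<pi> w \<in> carrier (A Mod N)" if "w \<in> L" for w
    using that by (auto simp: \<pi>_def carrier_FactGroup)
  have \<pi>m: "\<pi> u \<otimes>\<^bsub>A Mod N\<^esub> \<pi> w = \<pi> (u @ w)" if "u \<in> L" "w \<in> L" for u w
    using that by (simp add: \<pi>_def mult_FactGroup N.rcos_sum mult_A)
  have \<pi>1: "\<pi> [] = \<one>\<^bsub>A Mod N\<^esub>" using N.subset by (simp add: \<pi>_def one_A[symmetric] one_FactGroup)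
  define s where "s v = (if v \<in> V then \<pi> [(v, True)] else \<one>\<^bsub>A Mod N\<^esub>)" for v
  have s: "s v \<in> carrier (A Mod N)" for v using \<pi> by (simp add: s_def)
  have "{\<one>\<^bsub>A Mod N\<^esub>} \<lhd> A Mod N" using Q.normal_inv_iff Q.triv_subgroup by auto
  from augmentation_nilpotent[OF Q.group_axioms p k this]
  obtain n0 where n0: "\<And>h ss x. periodic_mod p (A Mod N) {\<one>\<^bsub>A Mod N\<^esub>} h \<Longrightarrow> set ss \<subseteq> carrier (A Mod N) \<Longrightarrow>
     n0 \<le> length ss \<Longrightarrow> x \<in> carrier (A Mod N) \<Longrightarrow> int p dvd shift_diff (A Mod N) ss h x" by blast
  define n where "n = Suc n0"
  \<comment> \<open>The indicator function of the trivial coset detects membership in \<open>N\<close>.\<close>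
  define h where "h C = (if C = \<one>\<^bsub>A Mod N\<^esub> then 1 else 0 :: int)" for C
  define F where "F u = shift_diff (A Mod N) (map s u) h" for u
  have F0: "F [] = h" by (simp add: F_def)
  have Fc: "F (v # u) x = F u (x \<otimes>\<^bsub>A Mod N\<^esub> s v) - F u x" for v u x by (simp add: F_def)
  have Fn: "int p dvd F u x" if "n0 \<le> length u" "x \<in> carrier (A Mod N)" for u x
    unfolding F_def by (rule n0) (use that s in \<open>auto simp: periodic_mod_def\<close>)
  \<comment> \<open>A series acts on \<open>h\<close> with the variable \<open>v\<close> acting as \<open>s\<^sub>v - 1\<close>; truncation is harmless modulo \<open>p\<close> as long differences vanish.\<close>
  define S where "S g x = (\<Sum>u\<in>short n. coef g u * F u x)" for g x
  have key: "int p dvd S g (x \<otimes>\<^bsub>A Mod N\<^esub> s v) - S ((1 + var v) * g) x" if x: "x \<in> carrier (A Mod N)" and v: "v \<in> V" for g x v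
  proof -
    have "S ((1 + var v) * g) x = S g x + (\<Sum>u\<in>short n. coef (var v * g) u * F u x)"
      by (simp add: S_def distrib_right sum.distrib)
    also have "(\<Sum>u\<in>short n. coef (var v * g) u * F u x) = (\<Sum>u\<in>(#) v ` short n0. coef (var v * g) u * F u x)"
    proof (rule sum.mono_neutral_right)
      show "(#) v ` short n0 \<subseteq> short n" using v by (auto simp: short_def n_def)
      show "\<forall>u\<in>short n - (#) v ` short n0. coef (var v * g) u * F u x = 0"
      proof
        fix u assume u: "u \<in> short n - (#) v ` short n0"
        show "coef (var v * g) u * F u x = 0"
          using u by (cases u) (auto simp: short_def n_def)
      qed
    qed simp
    also have "\<dots> = (\<Sum>u\<in>short n0. coef g u * F (v # u) x)"
      by (subst sum.reindex) auto
    finally have a: "S ((1 + var v) * g) x = S g x + (\<Sum>u\<in>short n0. coef g u * F (v # u) x)" .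
    have sub: "short n0 \<subseteq> short n" by (auto simp: short_def n_def)
    have "S g (x \<otimes>\<^bsub>A Mod N\<^esub> s v) - S g x = (\<Sum>u\<in>short n. coef g u * F (v # u) x)"
      unfolding S_def sum_subtractf[symmetric] Fc by (simp add: algebra_simps)
    also have "\<dots> = (\<Sum>u\<in>short n - short n0. coef g u * F (v # u) x) + (\<Sum>u\<in>short n0. coef g u * F (v # u) x)"
      by (rule sum.subset_diff[OF sub]) simp
    finally have b: "S g (x \<otimes>\<^bsub>A Mod N\<^esub> s v) - S ((1 + var v) * g) x = (\<Sum>u\<in>short n - short n0. coef g u * F (v # u) x)"
      using a by simp
    show ?thesis unfolding b
      by (intro dvd_sum dvd_mult Fn x) (auto simp: short_def)
  qed
  have act: "int p dvd h (x \<otimes>\<^bsub>A Mod N\<^esub> \<pi> w) - S (magnus w) x" if "w \<in> L" "x \<in> carrier (A Mod N)" for w x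
    using that
  proof (induction w arbitrary: x rule: list.induct)
    case Nil
    have "S 1 x = (\<Sum>u\<in>short n. if u = [] then h x else 0)"
      unfolding S_def by (intro sum.cong) (auto simp: F0)
    also have "\<dots> = h x" by (simp add: sum.delta') (simp add: short_def n_def)
    finally show ?case using Nil \<pi>1 by simp
  next
    case (Cons y w)
    obtain v b where y: "y = (v, b)" "v \<in> V" using Cons.prems by auto
    have w: "w \<in> L" using Cons.prems by auto
    have sv: "s v = \<pi> [(v, True)]" using y by (simp add: s_def)
    show ?case
    proof (cases b)
      case True
      have e: "x \<otimes>\<^bsub>A Mod N\<^esub> \<pi> (y # w) = (x \<otimes>\<^bsub>A Mod N\<^esub> s v) \<otimes>\<^bsub>A Mod N\<^esub> \<pi> w"
        using \<pi>m[of "[(v, True)]" w] w y True Cons.prems(2) \<pi> sv by (simp add: Q.m_assoc)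
      have "int p dvd (h ((x \<otimes>\<^bsub>A Mod N\<^esub> s v) \<otimes>\<^bsub>A Mod N\<^esub> \<pi> w) - S (magnus w) (x \<otimes>\<^bsub>A Mod N\<^esub> s v))
          + (S (magnus w) (x \<otimes>\<^bsub>A Mod N\<^esub> s v) - S ((1 + var v) * magnus w) x)"
        using Cons.IH[OF w, of "x \<otimes>\<^bsub>A Mod N\<^esub> s v"] key[OF Cons.prems(2) y(2)] s Cons.prems(2)
        by - (rule dvd_add, auto)
      then show ?thesis unfolding e using y True by simp
    next
      case False
      let ?g = "geom v * magnus w"
      let ?z = "x \<otimes>\<^bsub>A Mod N\<^esub> inv\<^bsub>A Mod N\<^esub> s v"
      have g: "(1 + var v) * ?g = magnus w" by (simp add: mult.assoc[symmetric] geom_inverse)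
      have z: "?z \<in> carrier (A Mod N)" using Cons.prems(2) s by simp
      have zs: "?z \<otimes>\<^bsub>A Mod N\<^esub> s v = x" using Cons.prems(2) s by (simp add: Q.m_assoc)
      have iv: "inv\<^bsub>A Mod N\<^esub> s v = \<pi> [(v, False)]"
      proof (rule Q.inv_equality)
        have "cls [(v, False), (v, True)] = cls []"
          by (subst pres_class_eq_iff) (use pres_eq.cancel[of "[]" V "[]" v "raag_relators E" False] y in auto)
        then have "\<pi> [(v, False), (v, True)] = \<one>\<^bsub>A Mod N\<^esub>" using \<pi>1 by (simp add: \<pi>_def)
        then show "\<pi> [(v, False)] \<otimes>\<^bsub>A Mod N\<^esub> s v = \<one>\<^bsub>A Mod N\<^esub>" using \<pi>m[of "[(v, False)]" "[(v, True)]"] y sv by simp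
      qed (use s \<pi> y in auto)
      have e: "x \<otimes>\<^bsub>A Mod N\<^esub> \<pi> (y # w) = ?z \<otimes>\<^bsub>A Mod N\<^esub> \<pi> w"
        using \<pi>m[of "[(v, False)]" w] w y False Cons.prems(2) \<pi> unfolding iv by (simp add: Q.m_assoc)
      have "int p dvd (h (?z \<otimes>\<^bsub>A Mod N\<^esub> \<pi> w) - S (magnus w) ?z) - (S ?g (?z \<otimes>\<^bsub>A Mod N\<^esub> s v) - S ((1 + var v) * ?g) ?z)"
        by (rule dvd_diff[OF Cons.IH[OF w z] key[OF z y(2)]])
      then show ?thesis unfolding e zs g using y False by simp
    qed
  qed
  \<comment> \<open>Generators joined by an edge commute in the quotient, so the action only sees class sums.\<close>
  have Finv: "F w' x = F w x" if "tr E w w'" "x \<in> carrier (A Mod N)" for w w' x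
    using that
  proof (induction rule: tr.induct)
    case (tr_swap w u a b y)
    have ab: "a \<in> V" "b \<in> V" using edge_vertices[OF tr_swap(2)] by auto
    have "pres_eq V (raag_relators E) ([] @ wcomm [(a, True)] [(b, True)] @ [(b, True), (a, True)]) ([] @ [(b, True), (a, True)])"
      by (rule pres_eq.relator) (use ab tr_swap(2) in \<open>auto simp: raag_relators_def wcomm_def\<close>)
    moreover have "pres_eq V (raag_relators E) ([(a, True), (b, True), (a, False)] @ [(b, False), (b, \<not> False)] @ [(a, True)]) ([(a, True), (b, True), (a, False)] @ [(a, True)])"
      by (rule pres_eq.cancel) (use ab in auto)
    moreover have "pres_eq V (raag_relators E) ([(a, True), (b, True)] @ [(a, False), (a, \<not> False)] @ []) ([(a, True), (b, True)] @ [])"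
      by (rule pres_eq.cancel) (use ab in auto)
    ultimately have "pres_eq V (raag_relators E) [(a, True), (b, True)] [(b, True), (a, True)]"
      by (simp add: wcomm_def) (meson pres_eq.sym pres_eq.trans)
    then have "cls [(a, True), (b, True)] = cls [(b, True), (a, True)]"
      by (subst pres_class_eq_iff) (use ab in auto)
    then have c: "s a \<otimes>\<^bsub>A Mod N\<^esub> s b = s b \<otimes>\<^bsub>A Mod N\<^esub> s a"
      using \<pi>m[of "[(a, True)]" "[(b, True)]"] \<pi>m[of "[(b, True)]" "[(a, True)]"] ab by (simp add: s_def \<pi>_def)
    have base: "F (a # b # y) x = F (b # a # y) x" if "x \<in> carrier (A Mod N)" for x
    proof -
      have e: "x \<otimes>\<^bsub>A Mod N\<^esub> s a \<otimes>\<^bsub>A Mod N\<^esub> s b = x \<otimes>\<^bsub>A Mod N\<^esub> s b \<otimes>\<^bsub>A Mod N\<^esub> s a"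
        unfolding Q.m_assoc[OF that s s] c by (rule HOL.refl)
      show ?thesis unfolding Fc e by simp
    qed
    have "F (u @ a # b # y) x = F (u @ b # a # y) x" if "x \<in> carrier (A Mod N)" for x
      using that
    proof (induction u arbitrary: x)
      case Nil
      then show ?case using base by simp
    next
      case (Cons c u)
      then show ?case by (simp add: Fc s)
    qed
    then show ?case using tr_swap by simp
  qed simp
  have "KA n (int p) \<subseteq> N"
  proof
    fix x assume "x \<in> KA n (int p)"
    then obtain w where w: "w \<in> L" "w \<in> Kw E n (int p)" "x = cls w" by (auto simp: KA_def)
    let ?o = "\<one>\<^bsub>A Mod N\<^esub>"
    have "int p dvd (\<Sum>u\<in>short n. coef (magnus w - 1) u * F u ?o)"
      by (rule weighted_sum_dvd[OF finite_short short_closed])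
         (use w Finv in \<open>auto simp: Kw_def short_def simp del: csum_simps intro: Idn_D\<close>)
    also have "(\<Sum>u\<in>short n. coef (magnus w - 1) u * F u ?o) = S (magnus w) ?o - S 1 ?o"
      by (simp add: S_def sum_subtractf[symmetric] algebra_simps)
    finally have 1: "int p dvd S (magnus w) ?o - S 1 ?o" .
    have 2: "int p dvd h (?o \<otimes>\<^bsub>A Mod N\<^esub> \<pi> w) - S (magnus w) ?o" using act[OF w(1), of ?o] by simp
    have 3: "int p dvd h (?o \<otimes>\<^bsub>A Mod N\<^esub> \<pi> []) - S (magnus []) ?o" by (rule act) auto
    have "int p dvd ((h (?o \<otimes>\<^bsub>A Mod N\<^esub> \<pi> w) - S (magnus w) ?o) + (S (magnus w) ?o - S 1 ?o)) - (h (?o \<otimes>\<^bsub>A Mod N\<^esub> \<pi> []) - S (magnus []) ?o)"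
      by (rule dvd_diff[OF dvd_add[OF 2 1] 3])
    then have "int p dvd h (\<pi> w) - 1" using \<pi>[OF w(1)] \<pi>1 by (simp add: h_def)
    then have "\<pi> w = ?o"
    proof (rule contrapos_pp)
      assume "\<pi> w \<noteq> ?o"
      moreover have "\<not> int p dvd - 1" using p prime_gt_1_nat[OF p] by simp
      ultimately show "\<not> int p dvd h (\<pi> w) - 1" by (simp add: h_def)
    qed
    then have "N #>\<^bsub>A\<^esub> cls w = N" by (simp add: \<pi>_def one_FactGroup)
    then show "x \<in> N" using w A.rcos_self[OF _ N.subgroup_axioms] by (metis cls_carrier)
  qed
  then show ?thesis by blast
qed

end

section \<open>The pro-\<open>p\<close> completion\<close>

text \<open>Koenig's lemma: the common values on longer and longer initial segments can be prescribed so that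
  infinitely many \<open>m\<close> remain.\<close>

lemma konig_subsequence:
  fixes f :: "nat \<Rightarrow> nat \<Rightarrow> 'b"
  assumes "\<And>i. finite (range (f i))"
  shows "\<exists>t. \<forall>i. infinite {m. \<forall>j\<le>i. f j m = t j}"
proof -
  have step: "\<exists>v. infinite {m \<in> S. f i m = v}" if "infinite S" for S i
  proof (rule ccontr)
    assume "\<nexists>v. infinite {m \<in> S. f i m = v}"
    then have "finite (\<Union>v\<in>range (f i). {m \<in> S. f i m = v})" using assms[of i] by blast
    moreover have "S = (\<Union>v\<in>range (f i). {m \<in> S. f i m = v})" by auto
    ultimately show False using that by simp
  qed
  define pick where "pick S i = (SOME v. infinite {m \<in> S. f i m = v})" for S i
  define S where "S = rec_nat UNIV (\<lambda>i B. {m \<in> B. f i m = pick B i})"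
  have S0: "S 0 = UNIV" and SS: "\<And>i. S (Suc i) = {m \<in> S i. f i m = pick (S i) i}" by (simp_all add: S_def)
  have inf: "infinite (S i)" for i
  proof (induction i)
    case (Suc i)
    show ?case unfolding SS pick_def by (rule someI_ex[OF step[OF Suc]])
  qed (simp add: S0)
  have mem: "m \<in> S (Suc i) \<longleftrightarrow> (\<forall>j\<le>i. f j m = pick (S j) j)" for m i
  proof (induction i)
    case (Suc i)
    have "m \<in> S (Suc (Suc i)) \<longleftrightarrow> m \<in> S (Suc i) \<and> f (Suc i) m = pick (S (Suc i)) (Suc i)"
      by (subst SS) simp
    then show ?case using Suc by (auto simp: le_Suc_eq)
  qed (auto simp: SS S0)
  then have eq: "S (Suc i) = {m. \<forall>j\<le>i. f j m = pick (S j) j}" for i by blast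
  show ?thesis
  proof (intro exI allI)
    fix i
    show "infinite {m. \<forall>j\<le>i. f j m = pick (S j) j}" using inf[of "Suc i"] unfolding eq .
  qed
qed

lemma (in group) set_mult_rcos:
  assumes "N \<lhd> G" "M \<lhd> G" "M \<subseteq> N" "a \<in> carrier G"
  shows "N <#> (M #> a) = N #> a"
proof -
  interpret N: normal N G by (rule assms)
  interpret M: normal M G by (rule assms)
  have "N <#> M = N"
  proof
    show "N <#> M \<subseteq> N" using assms(3) by (auto simp: set_mult_def)
    show "N \<subseteq> N <#> M"
    proof
      fix x assume "x \<in> N"
      then have "x = x \<otimes> \<one>" "\<one> \<in> M" by auto
      then show "x \<in> N <#> M" using \<open>x \<in> N\<close> unfolding set_mult_def by blast
    qed
  qed
  then show ?thesis using setmult_rcos_assoc[OF N.subset M.subset assms(4)] by simp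
qed

context raag_prime
begin

abbreviation "Ix \<equiv> p_power_index_normal p A"
abbreviation "PG \<equiv> raag_pro_p p V E"

lemma Ix_normal: "N \<in> Ix \<Longrightarrow> N \<lhd> A"
  by (simp add: p_power_index_normal_def)

lemma PG_carrier: "x \<in> carrier PG \<longleftrightarrow> x \<in> PiE Ix (\<lambda>N. carrier (A Mod N)) \<and>
   (\<forall>N\<in>Ix. \<forall>M\<in>Ix. M \<subseteq> N \<longrightarrow> N <#>\<^bsub>A\<^esub> x M = x N)"
  by (simp add: pro_p_completion_def inv_lim_monoid_def inv_lim_def)

lemma PG_mult: "x \<otimes>\<^bsub>PG\<^esub> y = (\<lambda>N\<in>Ix. x N \<otimes>\<^bsub>A Mod N\<^esub> y N)"
  and PG_one: "\<one>\<^bsub>PG\<^esub> = (\<lambda>N\<in>Ix. \<one>\<^bsub>A Mod N\<^esub>)"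
  by (simp_all add: pro_p_completion_def inv_lim_monoid_def)

lemma PG_rep: 
  assumes "x \<in> carrier PG" "N \<in> Ix"
  obtains w where "w \<in> L" "x N = N #>\<^bsub>A\<^esub> cls w"
proof -
  have "x N \<in> carrier (A Mod N)" using assms by (auto simp: PG_carrier)
  then show ?thesis using that by (auto simp: carrier_FactGroup carrier_A)
qed

lemma rcos_mono:
  assumes "N \<in> Ix" "M \<in> Ix" "M \<subseteq> N" "w \<in> L"
  shows "N <#>\<^bsub>A\<^esub> (M #>\<^bsub>A\<^esub> cls w) = N #>\<^bsub>A\<^esub> cls w"
  using A.set_mult_rcos[OF Ix_normal[OF assms(1)] Ix_normal[OF assms(2)] assms(3)] cls_carrier[OF assms(4)] by blast

lemma PG_rep_mono:
  assumes "x \<in> carrier PG" "N \<in> Ix" "M \<in> Ix" "M \<subseteq> N" "w \<in> L" "x M = M #>\<^bsub>A\<^esub> cls w"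
  shows "x N = N #>\<^bsub>A\<^esub> cls w"
proof -
  have "N <#>\<^bsub>A\<^esub> x M = x N" using assms(1-4) by (simp add: PG_carrier)
  then show ?thesis using rcos_mono[OF assms(2-5)] assms(6) by simp
qed

lemma Mod_mult:
  assumes "N \<in> Ix" "u \<in> L" "w \<in> L"
  shows "(N #>\<^bsub>A\<^esub> cls u) \<otimes>\<^bsub>A Mod N\<^esub> (N #>\<^bsub>A\<^esub> cls w) = N #>\<^bsub>A\<^esub> cls (u @ w)"
  using normal.rcos_sum[OF Ix_normal[OF assms(1)] cls_carrier[OF assms(2)] cls_carrier[OF assms(3)]] mult_A[OF assms(2,3)]
  by (simp add: mult_FactGroup)

lemma Mod_one: "N \<in> Ix \<Longrightarrow> \<one>\<^bsub>A Mod N\<^esub> = N #>\<^bsub>A\<^esub> cls []"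
  using A.coset_mult_one[of N] normal_imp_subgroup[OF Ix_normal] subgroup.subset unfolding one_A[symmetric] by (metis one_FactGroup)

lemma Mod_carrier: "w \<in> L \<Longrightarrow> N #>\<^bsub>A\<^esub> cls w \<in> carrier (A Mod N)"
  using cls_carrier by (auto simp: carrier_FactGroup)

lemma Mod_inv:
  assumes "N \<in> Ix" "w \<in> L"
  shows "inv\<^bsub>A Mod N\<^esub> (N #>\<^bsub>A\<^esub> cls w) = N #>\<^bsub>A\<^esub> cls (word_inv w)"
proof -
  interpret Q: group "A Mod N" using normal.factorgroup_is_group[OF Ix_normal[OF assms(1)]] .
  have i: "word_inv w \<in> L" using assms(2) by (rule word_inv_lists)
  have "cls (word_inv w @ w) = cls []"
    using mult_A[OF i assms(2)] inv_A[OF assms(2)] A.l_inv[OF cls_carrier[OF assms(2)]] one_A by simp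
  then have "(N #>\<^bsub>A\<^esub> cls (word_inv w)) \<otimes>\<^bsub>A Mod N\<^esub> (N #>\<^bsub>A\<^esub> cls w) = \<one>\<^bsub>A Mod N\<^esub>"
    using Mod_mult[OF assms(1) i assms(2)] Mod_one[OF assms(1)] by simp
  then show ?thesis by (rule Q.inv_equality[OF _ Mod_carrier[OF assms(2)] Mod_carrier[OF i]])
qed

text \<open>Membership in the completion can be checked on representing words.\<close>

lemma PG_I:
  assumes "x \<in> extensional Ix" "\<And>N M. N \<in> Ix \<Longrightarrow> M \<in> Ix \<Longrightarrow> M \<subseteq> N \<Longrightarrow> \<exists>w\<in>L. x M = M #>\<^bsub>A\<^esub> cls w \<and> x N = N #>\<^bsub>A\<^esub> cls w"
  shows "x \<in> carrier PG"
  unfolding PG_carrier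
proof (intro conjI ballI impI)
  show "x \<in> PiE Ix (\<lambda>N. carrier (A Mod N))"
  proof (rule PiE_I)
    fix N assume N: "N \<in> Ix"
    obtain w where "w \<in> L" "x N = N #>\<^bsub>A\<^esub> cls w" using assms(2)[OF N N] by auto
    then show "x N \<in> carrier (A Mod N)" using Mod_carrier by simp
  next
    fix N assume "N \<notin> Ix"
    then show "x N = undefined" using assms(1) by (simp add: extensional_def)
  qed
  fix N M assume *: "N \<in> Ix" "M \<in> Ix" "M \<subseteq> N"
  obtain w where "w \<in> L" "x M = M #>\<^bsub>A\<^esub> cls w" "x N = N #>\<^bsub>A\<^esub> cls w" using assms(2)[OF *] by blast
  then show "N <#>\<^bsub>A\<^esub> x M = x N" using rcos_mono[OF *] by simp
qed

lemma group_PG: "group PG"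
proof (rule groupI)
  have q: "group (A Mod N)" if "N \<in> Ix" for N
    using normal.factorgroup_is_group[OF Ix_normal[OF that]] .
  have car: "x N \<in> carrier (A Mod N)" if "x \<in> carrier PG" "N \<in> Ix" for x N
    using that by (auto simp: PG_carrier)
  show "\<one>\<^bsub>PG\<^esub> \<in> carrier PG"
  proof (rule PG_I)
    fix N M assume *: "N \<in> Ix" "M \<in> Ix" "M \<subseteq> N"
    have "[] \<in> L" by simp
    then show "\<exists>w\<in>L. \<one>\<^bsub>PG\<^esub> M = M #>\<^bsub>A\<^esub> cls w \<and> \<one>\<^bsub>PG\<^esub> N = N #>\<^bsub>A\<^esub> cls w"
      unfolding PG_one using *(1,2) Mod_one[OF *(1)] Mod_one[OF *(2)]
      by (intro bexI[of _ "[]"]) (simp_all del: one_FactGroup)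
  qed (simp add: PG_one)
  fix x assume x: "x \<in> carrier PG"
  have xout: "x N = undefined" if "N \<notin> Ix" for N using x that unfolding PG_carrier by blast
  show "\<one>\<^bsub>PG\<^esub> \<otimes>\<^bsub>PG\<^esub> x = x"
  proof
    fix N
    show "(\<one>\<^bsub>PG\<^esub> \<otimes>\<^bsub>PG\<^esub> x) N = x N"
    proof (cases "N \<in> Ix")
      case True
      have "\<one>\<^bsub>A Mod N\<^esub> \<otimes>\<^bsub>A Mod N\<^esub> x N = x N" by (rule monoid.l_one[OF group.is_monoid[OF q[OF True]] car[OF x True]])
      then show ?thesis unfolding PG_mult PG_one using True by (simp del: one_FactGroup mult_FactGroup)
    qed (simp add: PG_mult xout)
  qed
  show "\<exists>y\<in>carrier PG. y \<otimes>\<^bsub>PG\<^esub> x = \<one>\<^bsub>PG\<^esub>"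
  proof (rule bexI[of _ "\<lambda>N\<in>Ix. inv\<^bsub>A Mod N\<^esub> x N"])
    show "(\<lambda>N\<in>Ix. inv\<^bsub>A Mod N\<^esub> x N) \<otimes>\<^bsub>PG\<^esub> x = \<one>\<^bsub>PG\<^esub>"
      unfolding PG_mult PG_one
    proof (rule restrict_ext)
      fix N assume N: "N \<in> Ix"
      show "(\<lambda>N\<in>Ix. inv\<^bsub>A Mod N\<^esub> x N) N \<otimes>\<^bsub>A Mod N\<^esub> x N = \<one>\<^bsub>A Mod N\<^esub>"
        unfolding restrict_apply' [OF N] by (rule group.l_inv[OF q[OF N] car[OF x N]])
    qed
    show "(\<lambda>N\<in>Ix. inv\<^bsub>A Mod N\<^esub> x N) \<in> carrier PG"
    proof (rule PG_I)
      fix N M assume *: "N \<in> Ix" "M \<in> Ix" "M \<subseteq> N"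
      obtain w where w: "w \<in> L" "x M = M #>\<^bsub>A\<^esub> cls w" using PG_rep[OF x *(2)] by blast
      have "x N = N #>\<^bsub>A\<^esub> cls w" by (rule PG_rep_mono[OF x * w])
      then show "\<exists>w\<in>L. (\<lambda>N\<in>Ix. inv\<^bsub>A Mod N\<^esub> x N) M = M #>\<^bsub>A\<^esub> cls w \<and> (\<lambda>N\<in>Ix. inv\<^bsub>A Mod N\<^esub> x N) N = N #>\<^bsub>A\<^esub> cls w"
        using w * Mod_inv word_inv_lists[OF w(1)] by (intro bexI[of _ "word_inv w"]) simp_all
    qed simp
  qed
  fix y assume y: "y \<in> carrier PG"
  show "x \<otimes>\<^bsub>PG\<^esub> y \<in> carrier PG"
  proof (rule PG_I)
    fix N M assume *: "N \<in> Ix" "M \<in> Ix" "M \<subseteq> N"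
    obtain w where w: "w \<in> L" "x M = M #>\<^bsub>A\<^esub> cls w" using PG_rep[OF x *(2)] by blast
    obtain u where u: "u \<in> L" "y M = M #>\<^bsub>A\<^esub> cls u" using PG_rep[OF y *(2)] by blast
    have "x N = N #>\<^bsub>A\<^esub> cls w" "y N = N #>\<^bsub>A\<^esub> cls u" using PG_rep_mono[OF x * w] PG_rep_mono[OF y * u] .
    moreover have "w @ u \<in> L" using w u by simp
    ultimately show "\<exists>w\<in>L. (x \<otimes>\<^bsub>PG\<^esub> y) M = M #>\<^bsub>A\<^esub> cls w \<and> (x \<otimes>\<^bsub>PG\<^esub> y) N = N #>\<^bsub>A\<^esub> cls w"
      using w u * Mod_mult by (intro bexI[of _ "w @ u"]) (simp_all add: PG_mult del: mult_FactGroup)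
  qed (simp add: PG_mult)
  fix z assume z: "z \<in> carrier PG"
  show "x \<otimes>\<^bsub>PG\<^esub> y \<otimes>\<^bsub>PG\<^esub> z = x \<otimes>\<^bsub>PG\<^esub> (y \<otimes>\<^bsub>PG\<^esub> z)"
    unfolding PG_mult
  proof (rule restrict_ext)
    fix N assume N: "N \<in> Ix"
    show "(\<lambda>N\<in>Ix. x N \<otimes>\<^bsub>A Mod N\<^esub> y N) N \<otimes>\<^bsub>A Mod N\<^esub> z N = x N \<otimes>\<^bsub>A Mod N\<^esub> (\<lambda>N\<in>Ix. y N \<otimes>\<^bsub>A Mod N\<^esub> z N) N"
      unfolding restrict_apply'[OF N] by (rule monoid.m_assoc[OF group.is_monoid[OF q[OF N]] car[OF x N] car[OF y N] car[OF z N]])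
  qed
qed

sublocale PG: group PG by (rule group_PG)

lemma PG_inv:
  assumes x: "x \<in> carrier PG" "N \<in> Ix" "w \<in> L" "x N = N #>\<^bsub>A\<^esub> cls w"
  shows "(inv\<^bsub>PG\<^esub> x) N = N #>\<^bsub>A\<^esub> cls (word_inv w)"
proof -
  interpret Q: group "A Mod N" using normal.factorgroup_is_group[OF Ix_normal[OF x(2)]] .
  have "(inv\<^bsub>PG\<^esub> x \<otimes>\<^bsub>PG\<^esub> x) N = \<one>\<^bsub>PG\<^esub> N" using x(1) by simp
  then have e: "(inv\<^bsub>PG\<^esub> x) N \<otimes>\<^bsub>A Mod N\<^esub> x N = \<one>\<^bsub>A Mod N\<^esub>" using x(2) by (simp add: PG_mult PG_one)
  have "(inv\<^bsub>PG\<^esub> x) N \<in> carrier (A Mod N)" "x N \<in> carrier (A Mod N)"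
    using PG.inv_closed[OF x(1)] x(1,2) unfolding PG_carrier by auto
  from Q.inv_equality[OF e this(2,1)] show ?thesis using Mod_inv[OF x(2,3)] x(4) by simp
qed

lemma PG_mult_rep:
  assumes "N \<in> Ix" "u \<in> L" "w \<in> L" "x N = N #>\<^bsub>A\<^esub> cls u" "y N = N #>\<^bsub>A\<^esub> cls w"
  shows "(x \<otimes>\<^bsub>PG\<^esub> y) N = N #>\<^bsub>A\<^esub> cls (u @ w)"
  using assms Mod_mult[OF assms(1-3)] by (simp add: PG_mult)

lemma PG_comm_rep:
  assumes "x \<in> carrier PG" "y \<in> carrier PG" "N \<in> Ix" "u \<in> L" "w \<in> L" "x N = N #>\<^bsub>A\<^esub> cls u" "y N = N #>\<^bsub>A\<^esub> cls w"
  shows "(x \<otimes>\<^bsub>PG\<^esub> y \<otimes>\<^bsub>PG\<^esub> inv\<^bsub>PG\<^esub> x \<otimes>\<^bsub>PG\<^esub> inv\<^bsub>PG\<^esub> y) N = N #>\<^bsub>A\<^esub> cls (wcomm u w)"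
proof -
  have i: "word_inv u \<in> L" "word_inv w \<in> L" "u @ w \<in> L" "(u @ w) @ word_inv u \<in> L" using assms by simp_all
  have "(x \<otimes>\<^bsub>PG\<^esub> y) N = N #>\<^bsub>A\<^esub> cls (u @ w)" by (rule PG_mult_rep[where x = x and y = y, OF assms(3-7)])
  from PG_mult_rep[where x = "x \<otimes>\<^bsub>PG\<^esub> y" and y = "inv\<^bsub>PG\<^esub> x", OF assms(3) i(3,1) this PG_inv[OF assms(1,3,4,6)]]
  have "(x \<otimes>\<^bsub>PG\<^esub> y \<otimes>\<^bsub>PG\<^esub> inv\<^bsub>PG\<^esub> x) N = N #>\<^bsub>A\<^esub> cls ((u @ w) @ word_inv u)" .
  from PG_mult_rep[where x = "x \<otimes>\<^bsub>PG\<^esub> y \<otimes>\<^bsub>PG\<^esub> inv\<^bsub>PG\<^esub> x" and y = "inv\<^bsub>PG\<^esub> y", OF assms(3) i(4,2) this PG_inv[OF assms(2,3,5,7)]]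
  show ?thesis by (simp add: wcomm_def)
qed

text \<open>A countable cofinal chain of congruence subgroups.\<close>

definition Kc :: "nat \<Rightarrow> ('a \<times> bool) list set set" where
  "Kc j = KA j (int p ^ j)"

lemma Kc_Ix: "Kc j \<in> Ix"
  unfolding Kc_def by (rule KA_index)

lemma Kc_sub: "n \<le> j \<Longrightarrow> k \<le> j \<Longrightarrow> Kc j \<subseteq> KA n (int p ^ k)"
  unfolding Kc_def by (rule KA_mono) (auto intro: le_imp_power_dvd)

lemma Kc_mono: "i \<le> j \<Longrightarrow> Kc j \<subseteq> Kc i"
  unfolding Kc_def[of i] by (rule Kc_sub)

lemma Kc_cofinal: "N \<in> Ix \<Longrightarrow> \<exists>j. Kc j \<subseteq> N"
proof -
  assume "N \<in> Ix"
  then obtain n where n: "KA n (int p) \<subseteq> N" using KA_cofinal by blast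
  have "Kc (Suc n) \<subseteq> KA n (int p ^ 1)" by (rule Kc_sub) auto
  then show ?thesis using n by auto
qed

lemma Kc_coset: "u \<in> L \<Longrightarrow> w \<in> L \<Longrightarrow> Kc j #>\<^bsub>A\<^esub> cls u = Kc j #>\<^bsub>A\<^esub> cls w \<longleftrightarrow> magnus u - magnus w \<in> Idn E j (int p ^ j)"
  unfolding Kc_def by (rule KA_coset_eq)

lemma PG_eqI:
  assumes "x \<in> carrier PG" "y \<in> carrier PG" "\<And>j. x (Kc j) = y (Kc j)"
  shows "x = y"
proof (rule extensionalityI[of _ Ix])
  fix N assume N: "N \<in> Ix"
  obtain j where j: "Kc j \<subseteq> N" using Kc_cofinal[OF N] by blast
  obtain w where w: "w \<in> L" "x (Kc j) = Kc j #>\<^bsub>A\<^esub> cls w" using PG_rep[OF assms(1) Kc_Ix] by blast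
  have "y (Kc j) = Kc j #>\<^bsub>A\<^esub> cls w" using assms(3) w(2) by metis
  then show "x N = y N" using PG_rep_mono[OF assms(1) N Kc_Ix j w] PG_rep_mono[OF assms(2) N Kc_Ix j w(1)] by simp
qed (use assms in \<open>auto simp: PG_carrier PiE_def\<close>)

lemma rcos_sub:
  assumes "N \<in> Ix" "M \<in> Ix" "M \<subseteq> N" "u \<in> L" "w \<in> L" "M #>\<^bsub>A\<^esub> cls u = M #>\<^bsub>A\<^esub> cls w"
  shows "N #>\<^bsub>A\<^esub> cls u = N #>\<^bsub>A\<^esub> cls w"
  using rcos_mono[OF assms(1-4)] rcos_mono[OF assms(1-3,5)] assms(6) by simp

lemma PG_limit:
  assumes w: "\<And>j. w j \<in> L" "\<And>j. Kc j #>\<^bsub>A\<^esub> cls (w (Suc j)) = Kc j #>\<^bsub>A\<^esub> cls (w j)"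
  obtains x where "x \<in> carrier PG" "\<And>j. x (Kc j) = Kc j #>\<^bsub>A\<^esub> cls (w j)"
proof -
  have coh: "i \<le> j \<Longrightarrow> Kc i #>\<^bsub>A\<^esub> cls (w j) = Kc i #>\<^bsub>A\<^esub> cls (w i)" for i j
  proof (induction j rule: dec_induct)
    case (step j)
    have "Kc i #>\<^bsub>A\<^esub> cls (w (Suc j)) = Kc i #>\<^bsub>A\<^esub> cls (w j)"
      by (rule rcos_sub[OF Kc_Ix Kc_Ix Kc_mono w(1) w(1) w(2)]) (use step in simp)
    then show ?case using step by simp
  qed simp
  define J where "J N = (LEAST j. Kc j \<subseteq> N)" for N
  have J: "Kc (J N) \<subseteq> N" if "N \<in> Ix" for N
    unfolding J_def using Kc_cofinal[OF that] by (rule LeastI_ex)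
  have coh': "N #>\<^bsub>A\<^esub> cls (w j) = N #>\<^bsub>A\<^esub> cls (w i)" if "N \<in> Ix" "Kc i \<subseteq> N" "i \<le> j" for N i j
    by (rule rcos_sub[OF that(1) Kc_Ix that(2) w(1) w(1) coh[OF that(3)]])
  define x where "x = (\<lambda>N\<in>Ix. N #>\<^bsub>A\<^esub> cls (w (J N)))"
  have "x \<in> carrier PG"
  proof (rule PG_I)
    fix N M assume *: "N \<in> Ix" "M \<in> Ix" "M \<subseteq> N"
    have "Kc (J M) \<subseteq> N" using J[OF *(2)] *(3) by blast
    then have "J N \<le> J M" unfolding J_def[of N] by (rule Least_le)
    from coh'[OF *(1) J[OF *(1)] this] have "x N = N #>\<^bsub>A\<^esub> cls (w (J M))" using *(1) unfolding x_def by simp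
    then show "\<exists>u\<in>L. x M = M #>\<^bsub>A\<^esub> cls u \<and> x N = N #>\<^bsub>A\<^esub> cls u"
      using w(1)[of "J M"] *(2) by (intro bexI[of _ "w (J M)"]) (simp_all add: x_def)
  qed (simp add: x_def)
  moreover have "x (Kc j) = Kc j #>\<^bsub>A\<^esub> cls (w j)" for j
  proof -
    have "J (Kc j) \<le> j" unfolding J_def by (rule Least_le) simp
    from coh'[OF Kc_Ix J[OF Kc_Ix[of j]] this] show ?thesis using Kc_Ix[of j] unfolding x_def by simp
  qed
  ultimately show ?thesis using that by blast
qed

section \<open>The lower central series of the completion\<close>

text \<open>The elements that are trivial in every quotient by a congruence subgroup of degree \<open>n\<close>.\<close>

definition PD :: "nat \<Rightarrow> (('a \<times> bool) list set set \<Rightarrow> ('a \<times> bool) list set set) set" where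
  "PD n = {x \<in> carrier PG. \<forall>k. x (KA n (int p ^ k)) = KA n (int p ^ k)}"

lemma KA_rcos_self: "w \<in> L \<Longrightarrow> KA n q #>\<^bsub>A\<^esub> cls w = KA n q \<longleftrightarrow> w \<in> Kw E n q"
  using A.coset_join2[OF cls_carrier subgroup_KA, of w n q] A.rcos_self[OF cls_carrier subgroup_KA, of w n q] cls_in_KA[of w n q] by blast

lemma PD_D: "x \<in> PD n \<Longrightarrow> x (KA n (int p ^ k)) = KA n (int p ^ k)"
  by (simp add: PD_def)

lemma PD_c: "x \<in> PD n \<Longrightarrow> x \<in> carrier PG"
  by (simp add: PD_def)

lemma PD_rep:
  assumes "x \<in> PD n" "w \<in> L" "x (KA n (int p ^ k)) = KA n (int p ^ k) #>\<^bsub>A\<^esub> cls w"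
  shows "w \<in> Kw E n (int p ^ k)"
  using KA_rcos_self[OF assms(2)] PD_D[OF assms(1)] assms(3) by metis

lemma subgroup_PD: "subgroup (PD n) PG"
proof (rule PG.subgroupI)
  show "PD n \<subseteq> carrier PG" by (auto simp: PD_def)
  have "\<one>\<^bsub>PG\<^esub> \<in> PD n" unfolding PD_def using KA_index PG.one_closed by (simp add: PG_one)
  then show "PD n \<noteq> {}" by blast
  fix x assume x: "x \<in> PD n"
  have xr: "\<exists>u\<in>L. u \<in> Kw E n (int p ^ k) \<and> x (KA n (int p ^ k)) = KA n (int p ^ k) #>\<^bsub>A\<^esub> cls u" if that': "x \<in> PD n" for x k
  proof -
    obtain u where u: "u \<in> L" "x (KA n (int p ^ k)) = KA n (int p ^ k) #>\<^bsub>A\<^esub> cls u"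
      using PG_rep[OF PD_c[OF that'] KA_index] by blast
    then show ?thesis using PD_rep[OF that' u] by blast
  qed
  have xc: "x \<in> carrier PG" using x by (simp add: PD_def)
  show "inv\<^bsub>PG\<^esub> x \<in> PD n" unfolding PD_def
  proof (intro CollectI conjI allI PG.inv_closed xc)
    fix k
    obtain u where u: "u \<in> L" "u \<in> Kw E n (int p ^ k)" "x (KA n (int p ^ k)) = KA n (int p ^ k) #>\<^bsub>A\<^esub> cls u" using xr[OF x] by blast
    show "(inv\<^bsub>PG\<^esub> x) (KA n (int p ^ k)) = KA n (int p ^ k)"
      using PG_inv[OF xc KA_index u(1,3)] KA_rcos_self[OF word_inv_lists[OF u(1)]] Kw_inv[OF u(2)] by simp
  qed
  fix y assume y: "y \<in> PD n"
  have yc: "y \<in> carrier PG" using y by (simp add: PD_def)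
  show "x \<otimes>\<^bsub>PG\<^esub> y \<in> PD n" unfolding PD_def
  proof (intro CollectI conjI allI PG.m_closed xc yc)
    fix k
    obtain u where u: "u \<in> L" "u \<in> Kw E n (int p ^ k)" "x (KA n (int p ^ k)) = KA n (int p ^ k) #>\<^bsub>A\<^esub> cls u" using xr[OF x] by blast
    obtain w where w: "w \<in> L" "w \<in> Kw E n (int p ^ k)" "y (KA n (int p ^ k)) = KA n (int p ^ k) #>\<^bsub>A\<^esub> cls w" using xr[OF y] by blast
    have "u @ w \<in> L" using u w by simp
    then show "(x \<otimes>\<^bsub>PG\<^esub> y) (KA n (int p ^ k)) = KA n (int p ^ k)"
      using PG_mult_rep[where x = x and y = y, OF KA_index u(1) w(1) u(3) w(3)] KA_rcos_self[of "u @ w"] Kw_append[OF u(2) w(2)] by simp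
  qed
qed

lemma comm_PD:
  assumes x: "x \<in> carrier PG" and y: "y \<in> PD n"
  shows "x \<otimes>\<^bsub>PG\<^esub> y \<otimes>\<^bsub>PG\<^esub> inv\<^bsub>PG\<^esub> x \<otimes>\<^bsub>PG\<^esub> inv\<^bsub>PG\<^esub> y \<in> PD (Suc n)"
  unfolding PD_def
proof (intro CollectI conjI allI)
  have yc: "y \<in> carrier PG" using y by (simp add: PD_def)
  show "x \<otimes>\<^bsub>PG\<^esub> y \<otimes>\<^bsub>PG\<^esub> inv\<^bsub>PG\<^esub> x \<otimes>\<^bsub>PG\<^esub> inv\<^bsub>PG\<^esub> y \<in> carrier PG" using x yc by simp
  fix k
  let ?N = "KA (Suc n) (int p ^ k)"
  obtain u where u: "u \<in> L" "x ?N = ?N #>\<^bsub>A\<^esub> cls u" using PG_rep[OF x KA_index] by blast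
  obtain w where w: "w \<in> L" "y ?N = ?N #>\<^bsub>A\<^esub> cls w" using PG_rep[OF yc KA_index] by blast
  have sub: "?N \<subseteq> KA n (int p ^ k)" by (rule KA_mono) auto
  have "y (KA n (int p ^ k)) = KA n (int p ^ k) #>\<^bsub>A\<^esub> cls w" by (rule PG_rep_mono[OF yc KA_index KA_index sub w])
  then have "w \<in> Kw E n (int p ^ k)" by (rule PD_rep[OF y w(1)])
  then have "wcomm u w \<in> Kw E (Suc n) (int p ^ k)" by (rule Kw_comm)
  moreover have "wcomm u w \<in> L" using u w by (simp add: wcomm_def)
  ultimately show "(x \<otimes>\<^bsub>PG\<^esub> y \<otimes>\<^bsub>PG\<^esub> inv\<^bsub>PG\<^esub> x \<otimes>\<^bsub>PG\<^esub> inv\<^bsub>PG\<^esub> y) ?N = ?N"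
    using PG_comm_rep[OF x yc KA_index u(1) w(1) u(2) w(2)] KA_rcos_self by simp
qed

lemma PD_1: "PD (Suc 0) = carrier PG"
proof
  show "carrier PG \<subseteq> PD (Suc 0)"
  proof
    fix x assume x: "x \<in> carrier PG"
    have "x (KA (Suc 0) (int p ^ k)) = KA (Suc 0) (int p ^ k)" for k
    proof -
      obtain u where u: "u \<in> L" "x (KA (Suc 0) (int p ^ k)) = KA (Suc 0) (int p ^ k) #>\<^bsub>A\<^esub> cls u"
        using PG_rep[OF x KA_index] by blast
      then show ?thesis using KA_rcos_self[OF u(1)] by simp
    qed
    then show "x \<in> PD (Suc 0)" using x by (simp add: PD_def)
  qed
qed (auto simp: PD_def)

text \<open>Approximate \<open>x\<close> at every level \<open>j\<close> by a product of commutators \<open>[s\<^sub>v, y\<^sub>v]\<close> over the vertices, choose the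
  \<open>y\<^sub>v\<close> coherently by \<open>konig_subsequence\<close>, and pass to their limits in the completion.\<close>

lemma PD_comm_generated:
  assumes x: "x \<in> PD (Suc n)" and n: "0 < n"
  shows "x \<in> commutator_subgroup PG (carrier PG) (PD n)"
proof -
  obtain vs where vs: "set vs = V" "distinct vs" using finite_distinct_list[OF fin_V] by blast
  have xc: "x \<in> carrier PG" using x by (simp add: PD_def)
  have "\<exists>y. (\<forall>v. y v \<in> L \<and> y v \<in> Kw E n 0) \<and> x (Kc j) = Kc j #>\<^bsub>A\<^esub> cls (comm_prod vs y)" for j
  proof -
    obtain k' where k': "k' \<ge> j" "\<And>a. a \<in> L \<Longrightarrow> a \<in> Kw E 1 0 \<Longrightarrow> a \<in> Kw E (Suc n) (int p ^ k') \<Longrightarrow>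
       \<exists>b\<in>L. b \<in> Kw E (Suc n) 0 \<and> magnus a - magnus b \<in> Idn E j (int p ^ j)"
      using approximate_in_filtration[of 1 "Suc n" j p j] by auto
    let ?M = "Kc (max k' (Suc n))"
    obtain a where a: "a \<in> L" "x ?M = ?M #>\<^bsub>A\<^esub> cls a" using PG_rep[OF xc Kc_Ix] by blast
    have "x (KA (Suc n) (int p ^ k')) = KA (Suc n) (int p ^ k') #>\<^bsub>A\<^esub> cls a"
      by (rule PG_rep_mono[OF xc KA_index Kc_Ix Kc_sub a]) auto
    then have "a \<in> Kw E (Suc n) (int p ^ k')" by (rule PD_rep[OF x a(1)])
    then obtain b where b: "b \<in> L" "b \<in> Kw E (Suc n) 0" "magnus a - magnus b \<in> Idn E j (int p ^ j)"
      using k'(2)[OF a(1)] by auto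
    obtain y where y: "\<forall>v. y v \<in> L \<and> y v \<in> Kw E n 0" "magnus b - magnus (comm_prod vs y) \<in> Idn E j 0"
      using product_of_commutators[OF vs b(1,2) n] by blast
    have C: "comm_prod vs y \<in> L" by (rule comm_prod_lists) (use vs y in auto)
    have "magnus b - magnus (comm_prod vs y) \<in> Idn E j (int p ^ j)" using Idn_mono[OF y(2)] by simp
    from Idn_trans[OF b(3) this] have "Kc j #>\<^bsub>A\<^esub> cls a = Kc j #>\<^bsub>A\<^esub> cls (comm_prod vs y)"
      using Kc_coset[OF a(1) C] by blast
    moreover have "x (Kc j) = Kc j #>\<^bsub>A\<^esub> cls a"
      by (rule PG_rep_mono[OF xc Kc_Ix Kc_Ix Kc_mono a]) (use k' in auto)
    ultimately show ?thesis using y(1) by auto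
  qed
  then obtain y where y: "\<And>j v. y j v \<in> L" "\<And>j v. y j v \<in> Kw E n 0" "\<And>j. x (Kc j) = Kc j #>\<^bsub>A\<^esub> cls (comm_prod vs (y j))"
    by metis
  define f where "f i m = (\<lambda>v\<in>V. Kc i #>\<^bsub>A\<^esub> cls (y m v))" for i m
  have fin: "finite (carrier (A Mod Kc i))" for i
  proof -
    obtain k where "order (A Mod Kc i) = p ^ k" using Kc_Ix unfolding p_power_index_normal_def by blast
    then have "order (A Mod Kc i) > 0" using prime_gt_0_nat[OF p] by simp
    then show ?thesis by (simp add: order_def card_gt_0_iff)
  qed
  have "finite (range (f i))" for i
  proof (rule finite_subset)
    show "range (f i) \<subseteq> PiE V (\<lambda>_. carrier (A Mod Kc i))" using Mod_carrier[OF y(1)] by (auto simp: f_def)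
    show "finite (PiE V (\<lambda>_. carrier (A Mod Kc i)))" by (rule finite_PiE[OF fin_V fin])
  qed
  then obtain t where t: "\<And>i. infinite {m. \<forall>j\<le>i. f j m = t j}" using konig_subsequence[of f] by blast
  have "\<exists>m\<ge>i. \<forall>j\<le>i. f j m = t j" for i
    using t[of i] unfolding infinite_nat_iff_unbounded_le by blast
  then obtain J where J: "\<And>i. J i \<ge> i" "\<And>i j. j \<le> i \<Longrightarrow> f j (J i) = t j" by metis
  have ex: "\<exists>Y\<in>carrier PG. \<forall>j. Y (Kc j) = Kc j #>\<^bsub>A\<^esub> cls (y (J j) v)" if v: "v \<in> V" for v
  proof -
    have "Kc j #>\<^bsub>A\<^esub> cls (y (J (Suc j)) v) = Kc j #>\<^bsub>A\<^esub> cls (y (J j) v)" for j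
    proof -
      have "f j (J (Suc j)) v = f j (J j) v" using J(2)[of j "Suc j"] J(2)[of j j] by simp
      then show ?thesis using v by (simp add: f_def)
    qed
    from PG_limit[of "\<lambda>j. y (J j) v", OF y(1) this] show ?thesis by metis
  qed
  then obtain Y where Y: "\<And>v. v \<in> V \<Longrightarrow> Y v \<in> carrier PG" "\<And>v j. v \<in> V \<Longrightarrow> Y v (Kc j) = Kc j #>\<^bsub>A\<^esub> cls (y (J j) v)" by metis
  have YD: "Y v \<in> PD n" if v: "v \<in> V" for v
  proof -
    have "Y v (KA n (int p ^ k)) = KA n (int p ^ k)" for k
    proof -
      have "Y v (KA n (int p ^ k)) = KA n (int p ^ k) #>\<^bsub>A\<^esub> cls (y (J (max n k)) v)"
        by (rule PG_rep_mono[OF Y(1)[OF v] KA_index Kc_Ix Kc_sub y(1) Y(2)[OF v]]) auto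
      then show ?thesis using KA_rcos_self[OF y(1)] Kw_mono[OF y(2), of n "int p ^ k"] by simp
    qed
    then show ?thesis using Y(1)[OF v] by (simp add: PD_def)
  qed
  define s where "s v = pro_p_embed p A (cls [(v, True)])" for v
  have sl: "[(v, True)] \<in> L" if "v \<in> V" for v using that by simp
  have s: "s v \<in> carrier PG" if "v \<in> V" for v
    unfolding s_def pro_p_embed_def
  proof (rule PG_I)
    fix N M assume "N \<in> Ix" "M \<in> Ix"
    then show "\<exists>w\<in>L. (\<lambda>N\<in>Ix. N #>\<^bsub>A\<^esub> cls [(v, True)]) M = M #>\<^bsub>A\<^esub> cls w \<and> (\<lambda>N\<in>Ix. N #>\<^bsub>A\<^esub> cls [(v, True)]) N = N #>\<^bsub>A\<^esub> cls w"
      using sl[OF that] by (intro bexI[of _ "[(v, True)]"]) simp_all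
  qed simp
  have sK: "s v (Kc j) = Kc j #>\<^bsub>A\<^esub> cls [(v, True)]" for v j
    using Kc_Ix by (simp add: s_def pro_p_embed_def)
  define cm where "cm v = s v \<otimes>\<^bsub>PG\<^esub> Y v \<otimes>\<^bsub>PG\<^esub> inv\<^bsub>PG\<^esub> s v \<otimes>\<^bsub>PG\<^esub> inv\<^bsub>PG\<^esub> Y v" for v
  have cmc: "cm v \<in> carrier PG" if "v \<in> V" for v using that s Y(1) by (simp add: cm_def)
  have cmg: "cm v \<in> commutator_subgroup PG (carrier PG) (PD n)" if "v \<in> V" for v
    unfolding commutator_subgroup_def
    by (rule generate.incl) (use s[OF that] YD[OF that] in \<open>unfold cm_def, blast\<close>)
  have prod: "set us \<subseteq> V \<Longrightarrow> \<exists>z\<in>carrier PG. z \<in> commutator_subgroup PG (carrier PG) (PD n) \<and>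
      (\<forall>j. z (Kc j) = Kc j #>\<^bsub>A\<^esub> cls (comm_prod us (y (J j))))" for us
  proof (induction us)
    case Nil
    have "\<one>\<^bsub>PG\<^esub> (Kc j) = Kc j #>\<^bsub>A\<^esub> cls []" for j using Mod_one[OF Kc_Ix] Kc_Ix by (simp add: PG_one)
    moreover have "\<one>\<^bsub>PG\<^esub> \<in> commutator_subgroup PG (carrier PG) (PD n)"
      unfolding commutator_subgroup_def by (rule generate.one)
    ultimately show ?case using PG.one_closed by (intro bexI[of _ "\<one>\<^bsub>PG\<^esub>"]) simp_all
  next
    case (Cons v us)
    then obtain z where z: "z \<in> carrier PG" "z \<in> commutator_subgroup PG (carrier PG) (PD n)"
      "\<And>j. z (Kc j) = Kc j #>\<^bsub>A\<^esub> cls (comm_prod us (y (J j)))" by auto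
    have v: "v \<in> V" using Cons.prems by simp
    have "(cm v \<otimes>\<^bsub>PG\<^esub> z) (Kc j) = Kc j #>\<^bsub>A\<^esub> cls (comm_prod (v # us) (y (J j)))" for j
    proof -
      have 1: "cm v (Kc j) = Kc j #>\<^bsub>A\<^esub> cls (wcomm [(v, True)] (y (J j) v))"
        unfolding cm_def by (rule PG_comm_rep[OF s[OF v] Y(1)[OF v] Kc_Ix sl[OF v] y(1) sK Y(2)[OF v]])
      have 2: "wcomm [(v, True)] (y (J j) v) \<in> L" using sl[OF v] y(1) word_inv_lists[OF sl[OF v]] word_inv_lists[OF y(1)]
        unfolding wcomm_def by (simp only: append_in_lists_conv simp_thms)
      have 3: "comm_prod us (y (J j)) \<in> L" by (rule comm_prod_lists) (use Cons.prems y(1) in auto)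
      show ?thesis using PG_mult_rep[where x = "cm v" and y = z, OF Kc_Ix 2 3 1 z(3)] by simp
    qed
    moreover have "cm v \<otimes>\<^bsub>PG\<^esub> z \<in> commutator_subgroup PG (carrier PG) (PD n)"
      using cmg[OF v] z(2) unfolding commutator_subgroup_def by (rule generate.eng)
    ultimately show ?case using cmc[OF v] z(1) by (intro bexI[of _ "cm v \<otimes>\<^bsub>PG\<^esub> z"]) simp_all
  qed
  obtain z where z: "z \<in> carrier PG" "z \<in> commutator_subgroup PG (carrier PG) (PD n)"
      "\<And>j. z (Kc j) = Kc j #>\<^bsub>A\<^esub> cls (comm_prod vs (y (J j)))" using prod[of vs] vs by auto
  have "x (Kc j) = z (Kc j)" for j
  proof -
    have C: "comm_prod vs (y (J j)) \<in> L" by (rule comm_prod_lists) (use vs y(1) in auto)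
    show ?thesis unfolding z(3) by (rule PG_rep_mono[OF xc Kc_Ix Kc_Ix Kc_mono[OF J(1)] C y(3)])
  qed
  then have "x = z" by (rule PG_eqI[OF xc z(1)])
  then show ?thesis using z(2) by simp
qed

theorem lower_central_PG: "lower_central PG (Suc n) = PD (Suc n)"
proof (induction n)
  case 0
  show ?case by (simp add: PD_1)
next
  case (Suc n)
  have "commutator_subgroup PG (carrier PG) (PD (Suc n)) = PD (Suc (Suc n))"
  proof
    show "commutator_subgroup PG (carrier PG) (PD (Suc n)) \<subseteq> PD (Suc (Suc n))"
      unfolding commutator_subgroup_def
      by (rule PG.generate_subgroup_incl[OF _ subgroup_PD]) (use comm_PD in blast)
    show "PD (Suc (Suc n)) \<subseteq> commutator_subgroup PG (carrier PG) (PD (Suc n))"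
      using PD_comm_generated by blast
  qed
  then show ?case using Suc by simp
qed

end

section \<open>Free algebras over a commutative ring\<close>

text \<open>All coefficient functions supported on \<open>lists V\<close>, with convolution. The free algebra is a subring, and
  the elements of the Magnus ring are classes of such series.\<close>

definition series_ring :: "('r, 'm) ring_scheme \<Rightarrow> 'a set \<Rightarrow> ('a list \<Rightarrow> 'r) ring" where
  "series_ring R V = (free_alg R V)\<lparr>carrier := {f. \<forall>w. f w \<in> carrier R \<and> (f w \<noteq> \<zero>\<^bsub>R\<^esub> \<longrightarrow> w \<in> lists V)}\<rparr>"

locale trace_coeffs = cring R for R :: "('r, 'm) ring_scheme" (structure) +
  fixes V :: "'a set" and E :: "'a set set"
  assumes edges: "\<And>u v. {u, v} \<in> E \<Longrightarrow> u \<in> V \<and> v \<in> V"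
begin

abbreviation "FA \<equiv> free_alg R V"
abbreviation "SR \<equiv> series_ring R V"

definition rconv :: "('a list \<Rightarrow> 'r) \<Rightarrow> ('a list \<Rightarrow> 'r) \<Rightarrow> 'a list \<Rightarrow> 'r" where
  "rconv f g w = (\<Oplus>i\<in>{..length w}. f (take i w) \<otimes> g (drop i w))"

lemma FA_simps:
  "monoid.mult FA = rconv" "\<one>\<^bsub>FA\<^esub> = (\<lambda>w. if w = [] then \<one> else \<zero>)" "\<zero>\<^bsub>FA\<^esub> = (\<lambda>w. \<zero>)"
  "ring.add FA = (\<lambda>f g w. f w \<oplus> g w)"
  "monoid.mult SR = rconv" "\<one>\<^bsub>SR\<^esub> = (\<lambda>w. if w = [] then \<one> else \<zero>)" "\<zero>\<^bsub>SR\<^esub> = (\<lambda>w. \<zero>)"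
  "ring.add SR = (\<lambda>f g w. f w \<oplus> g w)"
  by (auto simp: free_alg_def series_ring_def rconv_def fun_eq_iff)

lemma SR_carrier: "f \<in> carrier SR \<longleftrightarrow> (\<forall>w. f w \<in> carrier R) \<and> (\<forall>w. f w \<noteq> \<zero> \<longrightarrow> w \<in> lists V)"
  by (auto simp: series_ring_def)

lemma FA_carrier: "f \<in> carrier FA \<longleftrightarrow> f \<in> carrier SR \<and> finite {w. f w \<noteq> \<zero>}"
  by (auto simp: free_alg_def SR_carrier)

lemma FA_SR: "f \<in> carrier FA \<Longrightarrow> f \<in> carrier SR"
  by (simp add: FA_carrier)

lemma rconv_closed: "(\<And>w. f w \<in> carrier R) \<Longrightarrow> (\<And>w. g w \<in> carrier R) \<Longrightarrow> rconv f g w \<in> carrier R"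
  unfolding rconv_def by (rule finsum_closed) auto

lemma rconv_Nil: "f [] \<in> carrier R \<Longrightarrow> g [] \<in> carrier R \<Longrightarrow> rconv f g [] = f [] \<otimes> g []"
  by (simp add: rconv_def)

lemma rconv_Cons:
  assumes "\<And>w. f w \<in> carrier R" "\<And>w. g w \<in> carrier R"
  shows "rconv f g (a # w) = rconv (\<lambda>u. f (a # u)) g w \<oplus> f [] \<otimes> g (a # w)"
  unfolding rconv_def list.size add_Suc_right add_0_right
  by (subst finsum_Suc2) (use assms in auto)

lemma rconv_add_left:
  assumes "\<And>w. f w \<in> carrier R" "\<And>w. g w \<in> carrier R" "\<And>w. h w \<in> carrier R"
  shows "rconv (\<lambda>u. f u \<oplus> g u) h w = rconv f h w \<oplus> rconv g h w"
  unfolding rconv_def using assms by (subst finsum_addf[symmetric]) (auto simp: l_distr)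

lemma rconv_add_right:
  assumes "\<And>w. f w \<in> carrier R" "\<And>w. g w \<in> carrier R" "\<And>w. h w \<in> carrier R"
  shows "rconv f (\<lambda>u. g u \<oplus> h u) w = rconv f g w \<oplus> rconv f h w"
  unfolding rconv_def using assms by (subst finsum_addf[symmetric]) (auto simp: r_distr)

lemma rconv_scale_left:
  assumes "c \<in> carrier R" "\<And>w. f w \<in> carrier R" "\<And>w. g w \<in> carrier R"
  shows "rconv (\<lambda>u. c \<otimes> f u) g w = c \<otimes> rconv f g w"
  unfolding rconv_def using assms by (subst finsum_rdistr) (auto simp: m_assoc intro!: finsum_cong')

lemma rconv_assoc:
  assumes "\<And>w. f w \<in> carrier R" "\<And>w. g w \<in> carrier R" "\<And>w. h w \<in> carrier R"
  shows "rconv (rconv f g) h w = rconv f (rconv g h) w"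
  using assms(1)
proof (induction w arbitrary: f)
  case Nil
  then show ?case using assms by (simp add: rconv_Nil rconv_closed m_assoc)
next
  case (Cons a w)
  note f = Cons.prems and g = assms(2) and h = assms(3)
  have c: "rconv (\<lambda>u. f (a # u)) g u \<in> carrier R" "rconv f g u \<in> carrier R" "rconv g h u \<in> carrier R"
    "rconv (\<lambda>u. g (a # u)) h u \<in> carrier R" "rconv (\<lambda>u. f (a # u)) (rconv g h) u \<in> carrier R" for u
    using f g h by (auto intro!: rconv_closed)
  have e: "(\<lambda>u. rconv f g (a # u)) = (\<lambda>u. rconv (\<lambda>u. f (a # u)) g u \<oplus> f [] \<otimes> g (a # u))"
    using f g by (simp add: rconv_Cons)
  have "rconv (rconv f g) h (a # w) = rconv (\<lambda>u. rconv f g (a # u)) h w \<oplus> rconv f g [] \<otimes> h (a # w)"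
    by (rule rconv_Cons) (use c h in auto)
  also have "\<dots> = (rconv (\<lambda>u. f (a # u)) (rconv g h) w \<oplus> f [] \<otimes> rconv (\<lambda>u. g (a # u)) h w) \<oplus> (f [] \<otimes> g []) \<otimes> h (a # w)"
    unfolding e using f g h c by (simp add: rconv_add_left rconv_scale_left Cons.IH rconv_Nil)
  also have "\<dots> = rconv (\<lambda>u. f (a # u)) (rconv g h) w \<oplus> f [] \<otimes> rconv g h (a # w)"
    using f g h c by (simp add: rconv_Cons r_distr m_assoc a_assoc)
  also have "\<dots> = rconv f (rconv g h) (a # w)"
    by (rule rconv_Cons[symmetric]) (use c f in auto)
  finally show ?case .
qed

lemma finsum_all_zero: "(\<And>x. x \<in> A \<Longrightarrow> f x = \<zero>) \<Longrightarrow> finsum R f A = \<zero>"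
  by (rule add.finprod_one_eqI) simp

lemma rconv_one: 
  assumes "\<And>w. f w \<in> carrier R"
  shows "rconv (\<lambda>w. if w = [] then \<one> else \<zero>) f w = f w" "rconv f (\<lambda>w. if w = [] then \<one> else \<zero>) w = f w"
proof -
  have z: "rconv (\<lambda>u. \<zero>) f w = \<zero>" for w
    unfolding rconv_def using assms by (intro finsum_all_zero) simp
  show "rconv (\<lambda>w. if w = [] then \<one> else \<zero>) f w = f w"
    by (cases w) (use assms in \<open>simp_all add: rconv_Nil rconv_Cons z\<close>)
  show "rconv f (\<lambda>w. if w = [] then \<one> else \<zero>) w = f w" using assms
    by (induction w arbitrary: f) (simp_all add: rconv_Nil rconv_Cons)
qed

lemma finsum_nonzero: "finsum R f A \<noteq> \<zero> \<Longrightarrow> \<exists>x\<in>A. f x \<noteq> \<zero>"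
proof (rule ccontr)
  assume "finsum R f A \<noteq> \<zero>" "\<not> (\<exists>x\<in>A. f x \<noteq> \<zero>)"
  then show False using finsum_all_zero[of A f] by blast
qed

lemma rconv_supp:
  assumes "\<And>w. f w \<in> carrier R" "\<And>w. g w \<in> carrier R" "rconv f g w \<noteq> \<zero>"
  shows "\<exists>u v. w = u @ v \<and> f u \<noteq> \<zero> \<and> g v \<noteq> \<zero>"
proof -
  obtain i where i: "f (take i w) \<otimes> g (drop i w) \<noteq> \<zero>"
    using finsum_nonzero[OF assms(3)[unfolded rconv_def]] by blast
  then have "f (take i w) \<noteq> \<zero>" "g (drop i w) \<noteq> \<zero>" using assms(1,2) l_null r_null by metis+
  then show ?thesis using append_take_drop_id[of i w] by (intro exI[of _ "take i w"] exI[of _ "drop i w"]) simp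
qed

lemma SR_closed: "f \<in> carrier SR \<Longrightarrow> f w \<in> carrier R"
  by (simp add: SR_carrier)

lemma SR_mult_closed:
  assumes f: "f \<in> carrier SR" and g: "g \<in> carrier SR"
  shows "rconv f g \<in> carrier SR"
  unfolding SR_carrier
proof (intro conjI allI impI)
  fix w show "rconv f g w \<in> carrier R" using f g by (intro rconv_closed SR_closed)
  assume "rconv f g w \<noteq> \<zero>"
  then obtain u v where "w = u @ v" "f u \<noteq> \<zero>" "g v \<noteq> \<zero>" using rconv_supp f g SR_closed by metis
  then show "w \<in> lists V" using f g unfolding SR_carrier by simp
qed

lemma SR_outside: "f \<in> carrier SR \<Longrightarrow> w \<notin> lists V \<Longrightarrow> f w = \<zero>"
  unfolding SR_carrier by blast

lemma SR_add_closed: "f \<in> carrier SR \<Longrightarrow> g \<in> carrier SR \<Longrightarrow> (\<lambda>w. f w \<oplus> g w) \<in> carrier SR"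
  using SR_closed[of f] SR_closed[of g] SR_outside[of f] SR_outside[of g] unfolding SR_carrier[of "\<lambda>w. f w \<oplus> g w"]
  by (metis a_closed r_zero zero_closed)

lemma SR_minus_closed: "f \<in> carrier SR \<Longrightarrow> (\<lambda>w. \<ominus> f w) \<in> carrier SR"
  using SR_closed[of f] SR_outside[of f] unfolding SR_carrier[of "\<lambda>w. \<ominus> f w"]
  by (metis a_inv_closed minus_zero)

lemma ring_SR: "ring SR"
proof (rule ringI)
  show "abelian_group SR"
  proof (rule abelian_groupI)
    fix f g h assume f: "f \<in> carrier SR" and g: "g \<in> carrier SR" and h: "h \<in> carrier SR"
    note c = SR_closed[OF f] SR_closed[OF g] SR_closed[OF h]
    show "f \<oplus>\<^bsub>SR\<^esub> g \<in> carrier SR"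
      unfolding FA_simps by (rule SR_add_closed[OF f g])
    show "f \<oplus>\<^bsub>SR\<^esub> g \<oplus>\<^bsub>SR\<^esub> h = f \<oplus>\<^bsub>SR\<^esub> (g \<oplus>\<^bsub>SR\<^esub> h)" unfolding FA_simps by (rule ext) (simp add: c a_assoc)
    show "f \<oplus>\<^bsub>SR\<^esub> g = g \<oplus>\<^bsub>SR\<^esub> f" unfolding FA_simps by (rule ext) (simp add: c a_comm)
  next
    fix f assume f: "f \<in> carrier SR"
    note c = SR_closed[OF f]
    show "\<zero>\<^bsub>SR\<^esub> \<oplus>\<^bsub>SR\<^esub> f = f" unfolding FA_simps by (rule ext) (simp add: c)
    have "(\<lambda>w. \<ominus> f w) \<in> carrier SR" by (rule SR_minus_closed[OF f])
    moreover have "(\<lambda>w. \<ominus> f w) \<oplus>\<^bsub>SR\<^esub> f = \<zero>\<^bsub>SR\<^esub>" unfolding FA_simps by (rule ext) (simp add: c l_neg)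
    ultimately show "\<exists>g\<in>carrier SR. g \<oplus>\<^bsub>SR\<^esub> f = \<zero>\<^bsub>SR\<^esub>" by blast
  qed (simp add: SR_carrier FA_simps)
  show "monoid SR"
  proof (rule monoidI)
    fix f g h assume f: "f \<in> carrier SR" and g: "g \<in> carrier SR" and h: "h \<in> carrier SR"
    note c = SR_closed[OF f] SR_closed[OF g] SR_closed[OF h]
    show "f \<otimes>\<^bsub>SR\<^esub> g \<in> carrier SR" unfolding FA_simps by (rule SR_mult_closed[OF f g])
    show "f \<otimes>\<^bsub>SR\<^esub> g \<otimes>\<^bsub>SR\<^esub> h = f \<otimes>\<^bsub>SR\<^esub> (g \<otimes>\<^bsub>SR\<^esub> h)" unfolding FA_simps by (rule ext) (rule rconv_assoc[OF c])
  next
    fix f assume f: "f \<in> carrier SR"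
    show "\<one>\<^bsub>SR\<^esub> \<otimes>\<^bsub>SR\<^esub> f = f" unfolding FA_simps by (rule ext) (rule rconv_one[OF SR_closed[OF f]])
    show "f \<otimes>\<^bsub>SR\<^esub> \<one>\<^bsub>SR\<^esub> = f" unfolding FA_simps by (rule ext) (rule rconv_one[OF SR_closed[OF f]])
  qed (simp add: SR_carrier FA_simps)
  fix f g h assume f: "f \<in> carrier SR" and g: "g \<in> carrier SR" and h: "h \<in> carrier SR"
  note c = SR_closed[OF f] SR_closed[OF g] SR_closed[OF h]
  show "(f \<oplus>\<^bsub>SR\<^esub> g) \<otimes>\<^bsub>SR\<^esub> h = f \<otimes>\<^bsub>SR\<^esub> h \<oplus>\<^bsub>SR\<^esub> g \<otimes>\<^bsub>SR\<^esub> h"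
    unfolding FA_simps by (rule ext) (rule rconv_add_left[OF c])
  show "h \<otimes>\<^bsub>SR\<^esub> (f \<oplus>\<^bsub>SR\<^esub> g) = h \<otimes>\<^bsub>SR\<^esub> f \<oplus>\<^bsub>SR\<^esub> h \<otimes>\<^bsub>SR\<^esub> g"
    unfolding FA_simps by (rule ext) (rule rconv_add_right[OF c(3,1,2)])
qed

sublocale SR: ring SR by (rule ring_SR)

lemma SR_minus: "f \<in> carrier SR \<Longrightarrow> \<ominus>\<^bsub>SR\<^esub> f = (\<lambda>w. \<ominus> f w)"
proof -
  assume f: "f \<in> carrier SR"
  have "(\<lambda>w. \<ominus> f w) \<in> carrier SR" by (rule SR_minus_closed[OF f])
  moreover have "(\<lambda>w. \<ominus> f w) \<oplus>\<^bsub>SR\<^esub> f = \<zero>\<^bsub>SR\<^esub>" unfolding FA_simps by (rule ext) (simp add: SR_closed[OF f] l_neg)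
  ultimately show ?thesis using SR.minus_equality f by blast
qed

lemma FA_eq: "FA = SR\<lparr>carrier := carrier FA\<rparr>"
  by (simp add: series_ring_def)

lemma FA_subring: "subring (carrier FA) SR"
proof (rule SR.subringI)
  show "carrier FA \<subseteq> carrier SR" using FA_SR by blast
  show "\<one>\<^bsub>SR\<^esub> \<in> carrier FA"
  proof -
    have "{w. \<one>\<^bsub>SR\<^esub> w \<noteq> \<zero>} \<subseteq> {[]}" by (auto simp: FA_simps)
    then show ?thesis unfolding FA_carrier using SR.one_closed finite_subset by blast
  qed
  fix f g assume f: "f \<in> carrier FA" and g: "g \<in> carrier FA"
  have fc: "\<And>w. f w \<in> carrier R" and gc: "\<And>w. g w \<in> carrier R" using f g by (auto simp: FA_carrier SR_carrier)
  have "{w. (\<ominus>\<^bsub>SR\<^esub> f) w \<noteq> \<zero>} \<subseteq> {w. f w \<noteq> \<zero>}" using FA_SR[OF f] by (auto simp: SR_minus)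
  then show "\<ominus>\<^bsub>SR\<^esub> f \<in> carrier FA" using f SR.a_inv_closed finite_subset unfolding FA_carrier by blast
  have "{w. (f \<oplus>\<^bsub>SR\<^esub> g) w \<noteq> \<zero>} \<subseteq> {w. f w \<noteq> \<zero>} \<union> {w. g w \<noteq> \<zero>}" by (auto simp: FA_simps)
  then show "f \<oplus>\<^bsub>SR\<^esub> g \<in> carrier FA" using f g SR.a_closed finite_subset unfolding FA_carrier by (metis finite_UnI)
  have "{w. (f \<otimes>\<^bsub>SR\<^esub> g) w \<noteq> \<zero>} \<subseteq> (\<lambda>(u, v). u @ v) ` ({w. f w \<noteq> \<zero>} \<times> {w. g w \<noteq> \<zero>})"
    unfolding FA_simps using rconv_supp[OF fc gc] by force
  then show "f \<otimes>\<^bsub>SR\<^esub> g \<in> carrier FA" using f g SR.m_closed finite_subset unfolding FA_carrier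
    by (metis (no_types, lifting) finite_SigmaI finite_imageI)
qed

lemma ring_FA: "ring FA"
  using SR.subring_is_ring[OF FA_subring] FA_eq by simp

sublocale FA: ring FA by (rule ring_FA)

lemma FA_minus: "f \<in> carrier FA \<Longrightarrow> \<ominus>\<^bsub>FA\<^esub> f = (\<lambda>w. \<ominus> f w)"
proof -
  assume f: "f \<in> carrier FA"
  have "(\<lambda>w. \<ominus> f w) \<in> carrier FA"
    using SR_minus[OF FA_SR[OF f]] subringE(5)[OF FA_subring f] by simp
  moreover have "(\<lambda>w. \<ominus> f w) \<oplus>\<^bsub>FA\<^esub> f = \<zero>\<^bsub>FA\<^esub>" unfolding FA_simps by (rule ext) (simp add: SR_closed[OF FA_SR[OF f]] l_neg)
  ultimately show ?thesis using FA.minus_equality f by blast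
qed

lemma FA_diff: "f \<in> carrier FA \<Longrightarrow> g \<in> carrier FA \<Longrightarrow> f \<ominus>\<^bsub>FA\<^esub> g = (\<lambda>w. f w \<ominus> g w)"
  by (simp add: a_minus_def FA_minus FA_simps)

definition mono :: "'r \<Rightarrow> 'a list \<Rightarrow> 'a list \<Rightarrow> 'r" where
  "mono r u = (\<lambda>w. if w = u then r else \<zero>)"

lemma mono_closed[simp]: "r \<in> carrier R \<Longrightarrow> u \<in> lists V \<Longrightarrow> mono r u \<in> carrier FA"
  by (auto simp: mono_def FA_carrier SR_carrier)

lemma rconv_mono_right:
  assumes "\<And>w. f w \<in> carrier R" "r \<in> carrier R"
  shows "rconv f (mono r u) (x @ u) = f x \<otimes> r"
    and "(\<And>x. w \<noteq> x @ u) \<Longrightarrow> rconv f (mono r u) w = \<zero>"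
proof -
  have "rconv f (mono r u) (x @ u) = (\<Oplus>i\<in>{..length (x @ u)}. if length x = i then f (take i (x @ u)) \<otimes> r else \<zero>)"
    unfolding rconv_def
  proof (rule finsum_cong')
    fix i assume i: "i \<in> {..length (x @ u)}"
    have "drop i (x @ u) = u \<longleftrightarrow> length x = i"
    proof
      assume "drop i (x @ u) = u"
      then have "length (drop i (x @ u)) = length u" by simp
      then show "length x = i" using i by simp
    qed auto
    then show "f (take i (x @ u)) \<otimes> mono r u (drop i (x @ u)) = (if length x = i then f (take i (x @ u)) \<otimes> r else \<zero>)"
      using assms by (simp add: mono_def)
  qed (use assms in auto)
  also have "\<dots> = f x \<otimes> r" by (subst finsum_singleton) (use assms in auto)
  finally show "rconv f (mono r u) (x @ u) = f x \<otimes> r" .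
  assume "\<And>x. w \<noteq> x @ u"
  then have "drop i w \<noteq> u" for i by (metis append_take_drop_id)
  then show "rconv f (mono r u) w = \<zero>" unfolding rconv_def
    by (intro finsum_all_zero) (use assms in \<open>simp add: mono_def\<close>)
qed

lemma rconv_mono_left:
  assumes "\<And>w. f w \<in> carrier R" "r \<in> carrier R"
  shows "rconv (mono r u) f (u @ x) = r \<otimes> f x"
    and "(\<And>x. w \<noteq> u @ x) \<Longrightarrow> rconv (mono r u) f w = \<zero>"
proof -
  have "rconv (mono r u) f (u @ x) = (\<Oplus>i\<in>{..length (u @ x)}. if length u = i then r \<otimes> f (drop i (u @ x)) else \<zero>)"
    unfolding rconv_def
  proof (rule finsum_cong')
    fix i assume i: "i \<in> {..length (u @ x)}"
    have "take i (u @ x) = u \<longleftrightarrow> length u = i"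
    proof
      assume "take i (u @ x) = u"
      then have "length (take i (u @ x)) = length u" by simp
      then show "length u = i" using i by simp
    qed auto
    then show "mono r u (take i (u @ x)) \<otimes> f (drop i (u @ x)) = (if length u = i then r \<otimes> f (drop i (u @ x)) else \<zero>)"
      using assms by (simp add: mono_def)
  qed (use assms in auto)
  also have "\<dots> = r \<otimes> f x" by (subst finsum_singleton) (use assms in auto)
  finally show "rconv (mono r u) f (u @ x) = r \<otimes> f x" .
  assume "\<And>x. w \<noteq> u @ x"
  then have "take i w \<noteq> u" for i by (metis append_take_drop_id)
  then show "rconv (mono r u) f w = \<zero>" unfolding rconv_def
    by (intro finsum_all_zero) (use assms in \<open>simp add: mono_def\<close>)
qed

lemma mono_mult: "r \<in> carrier R \<Longrightarrow> s \<in> carrier R \<Longrightarrow> mono r u \<otimes>\<^bsub>FA\<^esub> mono s v = mono (r \<otimes> s) (u @ v)"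
proof
  fix w assume rs: "r \<in> carrier R" "s \<in> carrier R"
  have c: "\<And>w. mono s v w \<in> carrier R" using rs by (simp add: mono_def)
  show "(mono r u \<otimes>\<^bsub>FA\<^esub> mono s v) w = mono (r \<otimes> s) (u @ v) w"
  proof (cases "\<exists>x. w = u @ x")
    case True
    then obtain x where x: "w = u @ x" by blast
    have "(mono r u \<otimes>\<^bsub>FA\<^esub> mono s v) w = r \<otimes> mono s v x"
      unfolding x FA_simps by (rule rconv_mono_left(1)[OF c rs(1)])
    then show ?thesis using rs unfolding x by (cases "x = v") (simp_all add: mono_def)
  next
    case False
    then have "(mono r u \<otimes>\<^bsub>FA\<^esub> mono s v) w = \<zero>"
      unfolding FA_simps using rconv_mono_left(2)[where f = "mono s v" and r = r and w = w and u = u] c rs(1) False by blast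
    then show ?thesis using False by (auto simp: mono_def)
  qed
qed

lemma FA_induct [consumes 2, case_names zero add mono]:
  assumes "f \<in> carrier FA" "{w. f w \<noteq> \<zero>} \<subseteq> S"
    and zero: "P (\<lambda>w. \<zero>)"
    and add: "\<And>f g. f \<in> carrier FA \<Longrightarrow> g \<in> carrier FA \<Longrightarrow> P f \<Longrightarrow> P g \<Longrightarrow> P (f \<oplus>\<^bsub>FA\<^esub> g)"
    and mono: "\<And>r u. r \<in> carrier R \<Longrightarrow> u \<in> lists V \<Longrightarrow> u \<in> S \<Longrightarrow> P (mono r u)"
  shows "P f"
  using assms(1,2)
proof (induction "card {w. f w \<noteq> \<zero>}" arbitrary: f rule: less_induct)
  case less
  have fin: "finite {w. f w \<noteq> \<zero>}" using less.prems(1) by (simp add: FA_carrier)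
  show ?case
  proof (cases "\<exists>u. f u \<noteq> \<zero>")
    case False
    then have "f = (\<lambda>w. \<zero>)" by auto
    then show ?thesis using zero by simp
  next
    case True
    then obtain u where u: "f u \<noteq> \<zero>" by blast
    let ?g = "f(u := \<zero>)"
    have "{w. ?g w \<noteq> \<zero>} \<subset> {w. f w \<noteq> \<zero>}" using u by auto
    moreover from this have g: "?g \<in> carrier FA"
      using less.prems(1) finite_subset[OF _ fin] unfolding FA_carrier SR_carrier by auto
    ultimately have "P ?g" using less.hyps[of ?g] less.prems(2) psubset_card_mono[OF fin] by blast
    moreover have fu: "f u \<in> carrier R" "u \<in> lists V" using less.prems(1) u by (auto simp: FA_carrier SR_carrier)
    moreover have "P (mono (f u) u)" by (rule mono[OF fu]) (use less.prems(2) u in auto)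
    moreover have "f = ?g \<oplus>\<^bsub>FA\<^esub> mono (f u) u"
      using less.prems(1) by (auto simp: FA_simps mono_def fun_eq_iff FA_carrier SR_carrier)
    ultimately show ?thesis using add[OF g, of "mono (f u) u"] mono_closed by metis
  qed
qed

section \<open>Class sums of polynomials\<close>

definition rcsum :: "('a list \<Rightarrow> 'r) \<Rightarrow> 'a list \<Rightarrow> 'r" where
  "rcsum f w = finsum R f (cl E w)"

lemma rcsum_closed[simp]: "f \<in> carrier SR \<Longrightarrow> rcsum f w \<in> carrier R"
  unfolding rcsum_def by (rule finsum_closed) (auto simp: SR_carrier)

lemma rcsum_add: "f \<in> carrier SR \<Longrightarrow> g \<in> carrier SR \<Longrightarrow> rcsum (\<lambda>w. f w \<oplus> g w) t = rcsum f t \<oplus> rcsum g t"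
  unfolding rcsum_def by (rule finsum_addf) (auto simp: SR_carrier)

lemma rcsum_zero[simp]: "rcsum (\<lambda>w. \<zero>) t = \<zero>"
  unfolding rcsum_def by (rule finsum_all_zero) simp

lemma rcsum_minus: "f \<in> carrier SR \<Longrightarrow> rcsum (\<lambda>w. \<ominus> f w) t = \<ominus> rcsum f t"
proof -
  assume f: "f \<in> carrier SR"
  have m: "(\<lambda>w. \<ominus> f w) \<in> carrier SR" by (rule SR_minus_closed[OF f])
  have "rcsum (\<lambda>w. \<ominus> f w) t \<oplus> rcsum f t = rcsum (\<lambda>w. \<zero>) t"
    unfolding rcsum_add[OF m f, symmetric] using f by (simp add: SR_carrier l_neg)
  then show ?thesis using minus_equality f m by simp
qed

lemma rcsum_diff: "f \<in> carrier SR \<Longrightarrow> g \<in> carrier SR \<Longrightarrow> rcsum (\<lambda>w. f w \<ominus> g w) t = rcsum f t \<ominus> rcsum g t"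
proof -
  assume f: "f \<in> carrier SR" and g: "g \<in> carrier SR"
  have m: "(\<lambda>w. \<ominus> g w) \<in> carrier SR" by (rule SR_minus_closed[OF g])
  show ?thesis using rcsum_add[OF f m] rcsum_minus[OF g] by (simp add: a_minus_def)
qed

lemma rcsum_tr: "tr E u w \<Longrightarrow> rcsum f w = rcsum f u"
  unfolding rcsum_def using cl_eqI[of E u w] by simp

lemma rcsum_notin: "f \<in> carrier SR \<Longrightarrow> t \<notin> lists V \<Longrightarrow> rcsum f t = \<zero>"
  unfolding rcsum_def
proof (rule finsum_all_zero, rule ccontr)
  fix w assume f: "f \<in> carrier SR" and t: "t \<notin> lists V" "w \<in> cl E t" "f w \<noteq> \<zero>"
  then have "w \<in> lists V" "tr E w t" by (auto simp: SR_carrier cl_def tr_sym)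
  then show False using tr_lists[of E w t V] t(1) by blast
qed

lemma finsum_tr_closed_zero:
  assumes "finite A" "tr_closed E A" "f \<in> carrier SR" "\<And>w. w \<in> A \<Longrightarrow> rcsum f w = \<zero>"
  shows "finsum R f A = \<zero>"
  using assms(1,2)
proof (induction rule: tr_closed_induct)
  case (union w B)
  have "finsum R f (cl E w \<union> B) = rcsum f w \<oplus> finsum R f B"
    unfolding rcsum_def by (rule finsum_Un_disjoint) (use union assms(3) in \<open>auto simp: SR_carrier\<close>)
  then show ?case using union assms(4) by simp
qed simp

lemma rcsum_low: "(\<And>w. length w < n \<Longrightarrow> f w = \<zero>) \<Longrightarrow> length t < n \<Longrightarrow> rcsum f t = \<zero>"
  unfolding rcsum_def by (rule finsum_all_zero) (auto simp: cl_def tr_length)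

text \<open>Series whose class sums vanish below degree \<open>n\<close>.\<close>

definition Wn :: "nat \<Rightarrow> ('a list \<Rightarrow> 'r) set" where
  "Wn n = {f \<in> carrier FA. \<forall>t. length t < n \<longrightarrow> rcsum f t = \<zero>}"

text \<open>This turns out to be the ideal generated by the commutators of adjacent variables (\<open>PI_eq\<close>).\<close>

definition ZI :: "('a list \<Rightarrow> 'r) set" where
  "ZI = {f \<in> carrier FA. \<forall>t. rcsum f t = \<zero>}"

lemma finsum_cl_scale:
  assumes f: "f \<in> carrier SR" "\<And>t. rcsum f t = \<zero>" and r: "r \<in> carrier R"
    and inj: "inj \<alpha>" and tr: "\<And>x y. tr E x y \<Longrightarrow> tr E (\<alpha> x) (\<alpha> y)"
    and g: "\<And>x. g (\<alpha> x) = r \<otimes> f x" "\<And>w. w \<notin> range \<alpha> \<Longrightarrow> g w = \<zero>"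
  shows "rcsum g w = \<zero>"
proof -
  have gc: "g u \<in> carrier R" for u using g f r by (cases "u \<in> range \<alpha>") (auto simp: SR_carrier)
  let ?A = "{x. \<alpha> x \<in> cl E w}"
  have finA: "finite ?A" using finite_vimageI[OF finite_cl inj, of E w] by (simp add: vimage_def)
  have clA: "tr_closed E ?A" unfolding tr_closed_def cl_def using tr tr_trans by blast
  have "rcsum g w = finsum R g (\<alpha> ` ?A)"
    unfolding rcsum_def
  proof (rule add.finprod_mono_neutral_cong_right)
    fix i assume "i \<in> cl E w - \<alpha> ` ?A"
    then have "i \<notin> range \<alpha>" by blast
    then show "g i = \<zero>\<^bsub>R\<^esub>" by (rule g(2))
  qed (use gc in auto)
  also have "\<dots> = finsum R (\<lambda>x. g (\<alpha> x)) ?A"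
    by (rule finsum_reindex) (use gc inj in \<open>auto intro: inj_on_subset\<close>)
  also have "\<dots> = r \<otimes> finsum R f ?A"
    unfolding g(1) by (rule finsum_rdistr[symmetric]) (use finA r f in \<open>auto simp: SR_carrier\<close>)
  also have "finsum R f ?A = \<zero>" by (rule finsum_tr_closed_zero[OF finA clA f(1)]) (rule f(2))
  finally show ?thesis using r by simp
qed

lemma ideal_ZI: "ideal ZI FA"
proof (rule idealI)
  show "ring FA" by (rule ring_FA)
  show "subgroup ZI (add_monoid FA)"
  proof (rule FA.add.subgroupI)
    show "ZI \<subseteq> carrier FA" by (auto simp: ZI_def)
    have "\<zero>\<^bsub>FA\<^esub> \<in> ZI" by (simp add: ZI_def) (simp add: FA_simps)
    then show "ZI \<noteq> {}" by blast
    fix f assume f: "f \<in> ZI"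
    then show "\<ominus>\<^bsub>FA\<^esub> f \<in> ZI" using FA.a_inv_closed unfolding ZI_def by (auto simp: FA_minus rcsum_minus FA_SR)
    fix g assume g: "g \<in> ZI"
    show "f \<oplus>\<^bsub>FA\<^esub> g \<in> ZI" using f g FA.a_closed unfolding ZI_def by (auto simp: FA_simps rcsum_add FA_SR)
  qed
  fix f g assume f: "f \<in> ZI" and g: "g \<in> carrier FA"
  have fF: "f \<in> carrier FA" and fz: "\<And>t. rcsum f t = \<zero>" using f by (auto simp: ZI_def)
  have fc: "\<And>w. f w \<in> carrier R" using fF by (auto simp: FA_carrier SR_carrier)
  show "g \<otimes>\<^bsub>FA\<^esub> f \<in> ZI" using g subset_UNIV
  proof (induction rule: FA_induct)
    case zero
    have "(\<lambda>w. \<zero>) \<otimes>\<^bsub>FA\<^esub> f = \<zero>\<^bsub>FA\<^esub>" using FA.l_null[OF fF] by (simp add: FA_simps)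
    then show ?case using FA.zero_closed by (simp add: ZI_def) (simp add: FA_simps)
  next
    case (add g h)
    then have "(g \<oplus>\<^bsub>FA\<^esub> h) \<otimes>\<^bsub>FA\<^esub> f = g \<otimes>\<^bsub>FA\<^esub> f \<oplus>\<^bsub>FA\<^esub> h \<otimes>\<^bsub>FA\<^esub> f" using FA.l_distr fF by blast
    then show ?case using add FA.a_closed unfolding ZI_def by (auto simp: FA_simps rcsum_add FA_SR)
  next
    case (mono r u)
    have out: "rconv (mono r u) f w = \<zero>" if "w \<notin> range (\<lambda>x. u @ x)" for w
      using rconv_mono_left(2)[where f = f and r = r and u = u and w = w] fc mono(1) that by blast
    have "rcsum (mono r u \<otimes>\<^bsub>FA\<^esub> f) w = \<zero>" for w
      unfolding FA_simps
      by (rule finsum_cl_scale[OF FA_SR[OF fF] fz mono(1), of "\<lambda>x. u @ x"])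
         (auto simp: inj_def rconv_mono_left(1)[OF fc mono(1)] out simp del: image_iff intro: tr_append_left)
    then show ?case using FA.m_closed mono_closed mono fF by (simp add: ZI_def)
  qed
  show "f \<otimes>\<^bsub>FA\<^esub> g \<in> ZI" using g subset_UNIV
  proof (induction rule: FA_induct)
    case zero
    have "f \<otimes>\<^bsub>FA\<^esub> (\<lambda>w. \<zero>) = \<zero>\<^bsub>FA\<^esub>" using FA.r_null[OF fF] by (simp add: FA_simps)
    then show ?case using FA.zero_closed by (simp add: ZI_def) (simp add: FA_simps)
  next
    case (add g h)
    then have "f \<otimes>\<^bsub>FA\<^esub> (g \<oplus>\<^bsub>FA\<^esub> h) = f \<otimes>\<^bsub>FA\<^esub> g \<oplus>\<^bsub>FA\<^esub> f \<otimes>\<^bsub>FA\<^esub> h" using FA.r_distr fF by blast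
    then show ?case using add FA.a_closed unfolding ZI_def by (auto simp: FA_simps rcsum_add FA_SR)
  next
    case (mono r u)
    have out: "rconv f (mono r u) w = \<zero>" if "w \<notin> range (\<lambda>x. x @ u)" for w
      using rconv_mono_right(2)[where f = f and r = r and u = u and w = w] fc mono(1) that by blast
    have "rcsum (f \<otimes>\<^bsub>FA\<^esub> mono r u) w = \<zero>" for w
      unfolding FA_simps
      by (rule finsum_cl_scale[OF FA_SR[OF fF] fz mono(1), of "\<lambda>x. x @ u"])
         (auto simp: inj_def rconv_mono_right(1)[OF fc mono(1)] m_comm[OF fc mono(1)] out simp del: image_iff intro: tr_append_right)
    then show ?case using FA.m_closed mono_closed mono fF by (simp add: ZI_def)
  qed
qed

definition rep :: "'a list \<Rightarrow> 'a list" where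
  "rep w = (SOME x. x \<in> cl E w)"

lemma rep: "tr E w (rep w)"
  unfolding rep_def using someI_ex[of "\<lambda>x. x \<in> cl E w"] cl_self[of w E] unfolding cl_def by blast

lemma rep_tr: "tr E u w \<Longrightarrow> rep w = rep u"
  unfolding rep_def using cl_eqI[of E u w] by simp

text \<open>The polynomial with prescribed class sums whose support meets every trace at most once. It transfers
  statements about class sums to statements about coefficients.\<close>

definition collapse :: "('a list \<Rightarrow> 'r) \<Rightarrow> 'a list \<Rightarrow> 'r" where
  "collapse c w = (if w = rep w then c w else \<zero>)"

lemma rcsum_collapse:
  assumes "\<And>u w. tr E u w \<Longrightarrow> c w = c u" "\<And>w. c w \<in> carrier R"
  shows "rcsum (collapse c) t = c t"
proof -
  have "rcsum (collapse c) t = (\<Oplus>w\<in>cl E t. if rep t = w then c t else \<zero>)"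
    unfolding rcsum_def
  proof (rule finsum_cong')
    fix w assume w: "w \<in> cl E t"
    then have "rep w = rep t" "c w = c t" using rep_tr assms(1) by (auto simp: cl_def)
    then show "collapse c w = (if rep t = w then c t else \<zero>)" by (auto simp: collapse_def)
  qed (use assms in auto)
  also have "\<dots> = c t"
  proof -
    have "rep t \<in> cl E t" using rep by (simp add: cl_def)
    then show ?thesis by (subst finsum_singleton) (use assms in auto)
  qed
  finally show ?thesis .
qed

lemma rcsum_rcsum_collapse[simp]: "f \<in> carrier SR \<Longrightarrow> rcsum (collapse (rcsum f)) t = rcsum f t"
  by (rule rcsum_collapse) (auto intro: rcsum_tr)

lemma collapse_FA: "f \<in> carrier FA \<Longrightarrow> collapse (rcsum f) \<in> carrier FA"
proof -
  assume f: "f \<in> carrier FA"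
  have sub: "{w. collapse (rcsum f) w \<noteq> \<zero>} \<subseteq> rep ` {w. f w \<noteq> \<zero>}"
  proof
    fix w assume "w \<in> {w. collapse (rcsum f) w \<noteq> \<zero>}"
    then have w: "w = rep w" "rcsum f w \<noteq> \<zero>" by (auto simp: collapse_def split: if_splits)
    then obtain x where "x \<in> cl E w" "f x \<noteq> \<zero>" using finsum_nonzero unfolding rcsum_def by blast
    then have "rep x = w" "x \<in> {w. f w \<noteq> \<zero>}" using w(1) rep_tr[of w x] by (auto simp: cl_def)
    then show "w \<in> rep ` {w. f w \<noteq> \<zero>}" by (metis imageI)
  qed
  show ?thesis unfolding FA_carrier SR_carrier
  proof (intro conjI allI impI)
    show "collapse (rcsum f) w \<in> carrier R" for w using FA_SR[OF f] by (simp add: collapse_def)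
    show "w \<in> lists V" if "collapse (rcsum f) w \<noteq> \<zero>" for w
      using that rcsum_notin[OF FA_SR[OF f], of w] by (auto simp: collapse_def split: if_splits)
    show "finite {w. collapse (rcsum f) w \<noteq> \<zero>}" by (rule finite_subset[OF sub]) (use f in \<open>simp add: FA_carrier\<close>)
  qed
qed

section \<open>Polynomials in partially commuting variables\<close>

lemma var_mono: "free_alg_var R v = mono \<one> [v]"
  by (simp add: free_alg_var_def mono_def fun_eq_iff)

abbreviation "PI \<equiv> pc_ideal R V E"

lemma pc_gens: "{(free_alg_var R u \<otimes>\<^bsub>FA\<^esub> free_alg_var R v) \<ominus>\<^bsub>FA\<^esub> (free_alg_var R v \<otimes>\<^bsub>FA\<^esub> free_alg_var R u) | u v. {u, v} \<in> E}
   = {mono \<one> [u, v] \<ominus>\<^bsub>FA\<^esub> mono \<one> [v, u] | u v. {u, v} \<in> E}"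
  by (simp add: var_mono mono_mult)

lemma pc_gens_FA: "{mono \<one> [u, v] \<ominus>\<^bsub>FA\<^esub> mono \<one> [v, u] | u v. {u, v} \<in> E} \<subseteq> carrier FA"
  using edges FA.minus_closed mono_closed by fastforce

lemma ideal_PI: "ideal PI FA"
  unfolding pc_ideal_def pc_gens by (rule FA.genideal_ideal[OF pc_gens_FA])

lemma rcsum_mono: "r \<in> carrier R \<Longrightarrow> rcsum (mono r u) t = (if tr E t u then r else \<zero>)"
proof (cases "tr E t u")
  case True
  assume r: "r \<in> carrier R"
  have "rcsum (mono r u) t = (\<Oplus>w\<in>cl E t. if u = w then r else \<zero>)"
    unfolding rcsum_def mono_def by (rule finsum_cong') (use r in auto)
  also have "\<dots> = r"
  proof -
    have "u \<in> cl E t" using True by (simp add: cl_def)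
    then show ?thesis by (subst finsum_singleton) (use r in auto)
  qed
  finally show ?thesis using True by simp
next
  case False
  then show ?thesis unfolding rcsum_def mono_def by (subst finsum_all_zero) (auto simp: cl_def)
qed

lemma PI_sub_ZI: "PI \<subseteq> ZI"
  unfolding pc_ideal_def pc_gens
proof (rule FA.genideal_minimal[OF ideal_ZI], rule subsetI)
  fix f assume "f \<in> {mono \<one> [u, v] \<ominus>\<^bsub>FA\<^esub> mono \<one> [v, u] |u v. {u, v} \<in> E}"
  then obtain u v where f: "f = mono \<one> [u, v] \<ominus>\<^bsub>FA\<^esub> mono \<one> [v, u]" "{u, v} \<in> E" by blast
  have uv: "u \<in> V" "v \<in> V" using edges f(2) by auto
  have m: "mono \<one> [u, v] \<in> carrier FA" "mono \<one> [v, u] \<in> carrier FA" using uv by auto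
  have "tr E [u, v] [v, u]" using tr_step[OF f(2), of "[]" "[]"] by simp
  then have "tr E t [u, v] \<longleftrightarrow> tr E t [v, u]" for t using tr_trans tr_sym by blast
  then have "rcsum f t = \<zero>" for t
    unfolding f(1) using m by (simp add: FA_diff rcsum_diff FA_SR rcsum_mono)
  then show "f \<in> ZI" unfolding ZI_def using f(1) m FA.minus_closed by simp
qed

lemma PI_rcos_eq: "f \<in> carrier FA \<Longrightarrow> g \<in> carrier FA \<Longrightarrow> PI +>\<^bsub>FA\<^esub> f = PI +>\<^bsub>FA\<^esub> g \<longleftrightarrow> f \<ominus>\<^bsub>FA\<^esub> g \<in> PI"
  using FA.quotient_eq_iff_same_a_r_cos[OF ideal_PI] by blast

lemma mono_tr_PI:
  assumes "tr E u w" "u \<in> lists V" "r \<in> carrier R"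
  shows "mono r u \<ominus>\<^bsub>FA\<^esub> mono r w \<in> PI"
  using assms
proof (induction rule: tr.induct)
  case (tr_refl w)
  then have "mono r w \<ominus>\<^bsub>FA\<^esub> mono r w = \<zero>\<^bsub>FA\<^esub>" by (simp add: FA.r_right_minus_eq)
  then show ?case using ideal_PI additive_subgroup.zero_closed ideal.axioms(1) by metis
next
  case (tr_swap u x a b y)
  interpret I: ideal PI FA by (rule ideal_PI)
  have l: "x @ a # b # y \<in> lists V" using tr_lists[OF tr_swap(1)] tr_swap.prems by simp
  then have x: "x \<in> lists V" "y \<in> lists V" "a \<in> V" "b \<in> V" by auto
  let ?g = "mono \<one> [a, b] \<ominus>\<^bsub>FA\<^esub> mono \<one> [b, a]"
  have "?g \<in> PI" unfolding pc_ideal_def pc_gens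
    using FA.genideal_self[OF pc_gens_FA] tr_swap(2) by blast
  then have "mono r x \<otimes>\<^bsub>FA\<^esub> ?g \<otimes>\<^bsub>FA\<^esub> mono \<one> y \<in> PI"
    using x tr_swap.prems by (intro I.I_r_closed I.I_l_closed) auto
  also have "mono r x \<otimes>\<^bsub>FA\<^esub> ?g \<otimes>\<^bsub>FA\<^esub> mono \<one> y = mono r (x @ a # b # y) \<ominus>\<^bsub>FA\<^esub> mono r (x @ b # a # y)"
  proof -
    have "mono r x \<otimes>\<^bsub>FA\<^esub> ?g = mono r x \<otimes>\<^bsub>FA\<^esub> mono \<one> [a, b] \<ominus>\<^bsub>FA\<^esub> mono r x \<otimes>\<^bsub>FA\<^esub> mono \<one> [b, a]"
      using x tr_swap.prems by (simp add: FA.minus_eq FA.r_distr FA.r_minus)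
    then show ?thesis using x tr_swap.prems
      by (simp add: FA.minus_eq FA.l_distr FA.l_minus mono_mult)
  qed
  finally have 1: "mono r (x @ a # b # y) \<ominus>\<^bsub>FA\<^esub> mono r (x @ b # a # y) \<in> PI" .
  have c: "mono r u \<in> carrier FA" "mono r (x @ a # b # y) \<in> carrier FA" "mono r (x @ b # a # y) \<in> carrier FA"
    using tr_swap.prems l by auto
  have "PI +>\<^bsub>FA\<^esub> mono r u = PI +>\<^bsub>FA\<^esub> mono r (x @ a # b # y)" "PI +>\<^bsub>FA\<^esub> mono r (x @ a # b # y) = PI +>\<^bsub>FA\<^esub> mono r (x @ b # a # y)"
    using PI_rcos_eq c 1 tr_swap by blast+
  then show ?case using PI_rcos_eq c by metis
qed

text \<open>Exchanging two adjacent letters that commute changes a monomial by an element of the ideal, so each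
  monomial may be moved to the representative of its trace.\<close>

lemma collapse_PI: "f \<in> carrier FA \<Longrightarrow> f \<ominus>\<^bsub>FA\<^esub> collapse (rcsum f) \<in> PI"
proof -
  interpret I: ideal PI FA by (rule ideal_PI)
  assume f: "f \<in> carrier FA"
  then show ?thesis using subset_UNIV
  proof (induction rule: FA_induct)
    case zero
    have "collapse (rcsum (\<lambda>w. \<zero>)) = (\<lambda>w. \<zero>)" by (simp add: collapse_def fun_eq_iff)
    then have "(\<lambda>w. \<zero>) \<ominus>\<^bsub>FA\<^esub> collapse (rcsum (\<lambda>w. \<zero>)) = \<zero>\<^bsub>FA\<^esub>"
      using FA.r_right_minus_eq[OF FA.zero_closed FA.zero_closed] unfolding FA_simps by simp
    with I.zero_closed show ?case by (simp only:)
  next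
    case (add f g)
    have c: "collapse (rcsum (f \<oplus>\<^bsub>FA\<^esub> g)) = collapse (rcsum f) \<oplus>\<^bsub>FA\<^esub> collapse (rcsum g)"
      using add(1,2) by (auto simp: collapse_def FA_simps rcsum_add FA_SR fun_eq_iff)
    have "(f \<oplus>\<^bsub>FA\<^esub> g) \<ominus>\<^bsub>FA\<^esub> (collapse (rcsum f) \<oplus>\<^bsub>FA\<^esub> collapse (rcsum g)) =
        (f \<ominus>\<^bsub>FA\<^esub> collapse (rcsum f)) \<oplus>\<^bsub>FA\<^esub> (g \<ominus>\<^bsub>FA\<^esub> collapse (rcsum g))"
      using add(1,2) collapse_FA by (simp add: FA.minus_eq FA.minus_add FA.a_ac)
    then show ?case unfolding c using add I.a_closed by simp
  next
    case (mono r u)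
    have e: "(tr E w u \<and> w = rep w) = (w = rep u)" for w
    proof
      show "w = rep u" if "tr E w u \<and> w = rep w" using that rep_tr[of w u] by simp
      show "tr E w u \<and> w = rep w" if w: "w = rep u" using rep[of u] rep_tr[OF rep[of u]] tr_sym[OF rep[of u]] unfolding w by simp
    qed
    have "collapse (rcsum (mono r u)) = mono r (rep u)"
    proof
      fix w
      have "collapse (rcsum (mono r u)) w = (if tr E w u \<and> w = rep w then r else \<zero>)"
        unfolding collapse_def rcsum_mono[OF mono(1)] by simp
      then show "collapse (rcsum (mono r u)) w = mono r (rep u) w" unfolding e mono_def .
    qed
    then show ?case using mono_tr_PI[OF rep mono(2,1)] by simp
  qed
qed

lemma PI_eq: "PI = ZI"
proof (rule antisym[OF PI_sub_ZI], rule subsetI)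
  fix f assume f: "f \<in> ZI"
  then have "collapse (rcsum f) = \<zero>\<^bsub>FA\<^esub>" by (auto simp: ZI_def collapse_def FA_simps)
  then show "f \<in> PI" using collapse_PI[of f] f by (auto simp: ZI_def FA.minus_eq)
qed

end

text \<open>The induced map on quotients does not depend on the representative.\<close>

lemma quot_map_coset:
  assumes A: "ring A" "ideal I A" and B: "ring B" "ideal J B"
    and h: "\<And>x. x \<in> carrier A \<Longrightarrow> h x \<in> carrier B" "\<And>x y. x \<in> carrier A \<Longrightarrow> y \<in> carrier A \<Longrightarrow> h (x \<oplus>\<^bsub>A\<^esub> y) = h x \<oplus>\<^bsub>B\<^esub> h y"
    and I: "h ` I \<subseteq> J" and a: "a \<in> carrier A"
  shows "quot_map B J h (I +>\<^bsub>A\<^esub> a) = J +>\<^bsub>B\<^esub> h a"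
proof -
  interpret A: ring A by (rule A)
  interpret B: ring B by (rule B)
  interpret I: ideal I A by (rule A)
  interpret J: ideal J B by (rule B)
  show ?thesis
  proof
    show "quot_map B J h (I +>\<^bsub>A\<^esub> a) \<subseteq> J +>\<^bsub>B\<^esub> h a"
    proof
      fix z assume "z \<in> quot_map B J h (I +>\<^bsub>A\<^esub> a)"
      then obtain j i where ji: "j \<in> J" "i \<in> I" "z = j \<oplus>\<^bsub>B\<^esub> h (i \<oplus>\<^bsub>A\<^esub> a)"
        unfolding quot_map_def set_add_def set_mult_def a_r_coset_def r_coset_def by auto
      have "z = (j \<oplus>\<^bsub>B\<^esub> h i) \<oplus>\<^bsub>B\<^esub> h a"
        unfolding ji(3) using ji(1,2) a h by (simp add: B.a_assoc)
      moreover have "j \<oplus>\<^bsub>B\<^esub> h i \<in> J" using ji(1,2) I by (intro J.a_closed) auto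
      ultimately show "z \<in> J +>\<^bsub>B\<^esub> h a" unfolding a_r_coset_def r_coset_def by auto
    qed
    show "J +>\<^bsub>B\<^esub> h a \<subseteq> quot_map B J h (I +>\<^bsub>A\<^esub> a)"
    proof
      fix z assume "z \<in> J +>\<^bsub>B\<^esub> h a"
      then obtain j where j: "j \<in> J" "z = j \<oplus>\<^bsub>B\<^esub> h a" unfolding a_r_coset_def r_coset_def by auto
      have "a = \<zero>\<^bsub>A\<^esub> \<oplus>\<^bsub>A\<^esub> a" using a by simp
      then have "a \<in> I +>\<^bsub>A\<^esub> a" using I.zero_closed unfolding a_r_coset_def r_coset_def by auto
      then show "z \<in> quot_map B J h (I +>\<^bsub>A\<^esub> a)" unfolding quot_map_def set_add_def set_mult_def using j by auto
    qed
  qed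
qed

context trace_coeffs
begin

section \<open>Powers of the augmentation ideal\<close>

definition pr :: "('a list \<Rightarrow> 'r) \<Rightarrow> ('a list \<Rightarrow> 'r) set" where
  "pr f = PI +>\<^bsub>FA\<^esub> f"

abbreviation "Q \<equiv> pc_poly R V E"

lemma ring_Q: "ring Q"
  unfolding pc_poly_def using ideal.quotient_is_ring[OF ideal_PI] .

sublocale Q: ring Q by (rule ring_Q)

lemma pr_hom: "pr \<in> ring_hom FA Q"
  unfolding pc_poly_def pr_def[abs_def] using ideal.rcos_ring_hom[OF ideal_PI] .

lemma pr_closed[simp]: "f \<in> carrier FA \<Longrightarrow> pr f \<in> carrier Q"
  using ring_hom_closed[OF pr_hom] .

lemma pr_mult: "f \<in> carrier FA \<Longrightarrow> g \<in> carrier FA \<Longrightarrow> pr (f \<otimes>\<^bsub>FA\<^esub> g) = pr f \<otimes>\<^bsub>Q\<^esub> pr g"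
  using ring_hom_mult[OF pr_hom] .

lemma pr_add: "f \<in> carrier FA \<Longrightarrow> g \<in> carrier FA \<Longrightarrow> pr (f \<oplus>\<^bsub>FA\<^esub> g) = pr f \<oplus>\<^bsub>Q\<^esub> pr g"
  using ring_hom_add[OF pr_hom] .

lemma Q_carrier: "carrier Q = pr ` carrier FA"
  unfolding pc_poly_def FactRing_def pr_def A_RCOSETS_def RCOSETS_def a_r_coset_def by auto

lemma ZI_rcsum: "f \<in> carrier FA \<Longrightarrow> g \<in> carrier FA \<Longrightarrow> f \<ominus>\<^bsub>FA\<^esub> g \<in> ZI \<longleftrightarrow> (\<forall>t. rcsum f t = rcsum g t)"
proof -
  assume f: "f \<in> carrier FA" and g: "g \<in> carrier FA"
  have "rcsum (f \<ominus>\<^bsub>FA\<^esub> g) t = \<zero> \<longleftrightarrow> rcsum f t = rcsum g t" for t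
    unfolding FA_diff[OF f g] rcsum_diff[OF FA_SR[OF f] FA_SR[OF g]]
    by (rule r_right_minus_eq) (use f g FA_SR in auto)
  then show ?thesis unfolding ZI_def using FA.minus_closed[OF f g] by simp
qed

lemma pr_eq: "f \<in> carrier FA \<Longrightarrow> g \<in> carrier FA \<Longrightarrow> pr f = pr g \<longleftrightarrow> (\<forall>t. rcsum f t = rcsum g t)"
  unfolding pr_def using PI_rcos_eq[of f g] ZI_rcsum[of f g] PI_eq by metis

lemma pr_collapse: "f \<in> carrier FA \<Longrightarrow> pr (collapse (rcsum f)) = pr f"
  using pr_eq[OF collapse_FA] rcsum_rcsum_collapse[OF FA_SR] by blast

lemma Wn_FA: "f \<in> Wn n \<Longrightarrow> f \<in> carrier FA"
  by (simp add: Wn_def)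

lemma collapse_low: "f \<in> Wn n \<Longrightarrow> length w < n \<Longrightarrow> collapse (rcsum f) w = \<zero>"
  by (simp add: Wn_def collapse_def)

lemma Wn_I: "f \<in> carrier FA \<Longrightarrow> (\<And>w. length w < n \<Longrightarrow> f w = \<zero>) \<Longrightarrow> f \<in> Wn n"
  unfolding Wn_def using rcsum_low[of n f] by blast

lemma rconv_low:
  assumes "f \<in> carrier SR" "g \<in> carrier SR" "\<And>w. length w < m \<Longrightarrow> f w = \<zero>" "\<And>w. length w < n \<Longrightarrow> g w = \<zero>" "length w < m + n"
  shows "rconv f g w = \<zero>"
proof (rule ccontr)
  assume "rconv f g w \<noteq> \<zero>"
  then obtain u v where "w = u @ v" "f u \<noteq> \<zero>" "g v \<noteq> \<zero>"
    using rconv_supp[of f g w] SR_closed[OF assms(1)] SR_closed[OF assms(2)] by blast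
  then show False using assms(3)[of u] assms(4)[of v] assms(5) by fastforce
qed

lemma Wn_mult:
  assumes f: "f \<in> Wn m" and g: "g \<in> Wn n"
  shows "f \<otimes>\<^bsub>FA\<^esub> g \<in> Wn (m + n)"
proof -
  let ?f = "collapse (rcsum f)" and ?g = "collapse (rcsum g)"
  note c = Wn_FA[OF f] Wn_FA[OF g] collapse_FA[OF Wn_FA[OF f]] collapse_FA[OF Wn_FA[OF g]]
  have "pr (?f \<otimes>\<^bsub>FA\<^esub> ?g) = pr (f \<otimes>\<^bsub>FA\<^esub> g)" using c by (simp add: pr_mult pr_collapse)
  then have "rcsum (?f \<otimes>\<^bsub>FA\<^esub> ?g) t = rcsum (f \<otimes>\<^bsub>FA\<^esub> g) t" for t
    using pr_eq[OF FA.m_closed[OF c(3,4)] FA.m_closed[OF c(1,2)]] by blast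
  moreover have "?f \<otimes>\<^bsub>FA\<^esub> ?g \<in> Wn (m + n)"
  proof (rule Wn_I[OF FA.m_closed[OF c(3,4)]])
    fix w :: "'a list" assume "length w < m + n"
    then show "(?f \<otimes>\<^bsub>FA\<^esub> ?g) w = \<zero>" unfolding FA_simps
      by (intro rconv_low[OF FA_SR[OF c(3)] FA_SR[OF c(4)] collapse_low[OF f] collapse_low[OF g]])
  qed
  ultimately show ?thesis using FA.m_closed[OF c(1,2)] unfolding Wn_def by simp
qed

lemma Wn_0: "Wn 0 = carrier FA"
  by (simp add: Wn_def)

lemma ideal_Wn: "ideal (Wn n) FA"
proof (rule idealI)
  show "ring FA" by (rule ring_FA)
  show "subgroup (Wn n) (add_monoid FA)"
  proof (rule FA.add.subgroupI)
    show "Wn n \<subseteq> carrier FA" by (auto simp: Wn_def)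
    have "\<zero>\<^bsub>FA\<^esub> \<in> Wn n" by (rule Wn_I[OF FA.zero_closed]) (simp add: FA_simps)
    then show "Wn n \<noteq> {}" by blast
    fix f assume f: "f \<in> Wn n"
    have m: "\<ominus>\<^bsub>FA\<^esub> f \<in> carrier FA" using FA.a_inv_closed[OF Wn_FA[OF f]] .
    show "\<ominus>\<^bsub>FA\<^esub> f \<in> Wn n" using m f
      unfolding Wn_def FA_minus[OF Wn_FA[OF f]] by (simp add: rcsum_minus[OF FA_SR[OF Wn_FA[OF f]]])
    fix g assume g: "g \<in> Wn n"
    have "f \<oplus>\<^bsub>FA\<^esub> g \<in> carrier FA" using FA.a_closed[OF Wn_FA[OF f] Wn_FA[OF g]] .
    then show "f \<oplus>\<^bsub>FA\<^esub> g \<in> Wn n" using f g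
      unfolding Wn_def FA_simps by (simp add: rcsum_add[OF FA_SR[OF Wn_FA[OF f]] FA_SR[OF Wn_FA[OF g]]])
  qed
  fix f g assume f: "f \<in> Wn n" and g: "g \<in> carrier FA"
  show "g \<otimes>\<^bsub>FA\<^esub> f \<in> Wn n" using Wn_mult[of g 0 f n] f g by (simp add: Wn_0)
  show "f \<otimes>\<^bsub>FA\<^esub> g \<in> Wn n" using Wn_mult[of f n g 0] f g by (simp add: Wn_0)
qed

lemma ideal_pr_Wn: "ideal (pr ` Wn n) Q"
  unfolding pc_poly_def pr_def[abs_def] using FA.ring_ideal_imp_quot_ideal[OF ideal_PI ideal_Wn] .

lemma pc_var_pr: "pc_var R V E v = pr (mono \<one> [v])"
  by (simp add: pc_var_def pr_def var_mono)

lemma pr_Wn_induct: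
  assumes f: "f \<in> Wn n" and zero: "P \<zero>\<^bsub>Q\<^esub>"
    and add: "\<And>x y. P x \<Longrightarrow> P y \<Longrightarrow> x \<in> carrier Q \<Longrightarrow> y \<in> carrier Q \<Longrightarrow> P (x \<oplus>\<^bsub>Q\<^esub> y)"
    and mono: "\<And>r u. r \<in> carrier R \<Longrightarrow> u \<in> lists V \<Longrightarrow> n \<le> length u \<Longrightarrow> P (pr (mono r u))"
  shows "P (pr f)"
proof -
  have z: "pr (\<lambda>w. \<zero>) = \<zero>\<^bsub>Q\<^esub>"
    using ring_hom_zero[OF pr_hom ring_FA ring_Q] by (simp add: FA_simps)
  have "collapse (rcsum f) \<in> carrier FA" "{w. collapse (rcsum f) w \<noteq> \<zero>} \<subseteq> {w. n \<le> length w}"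
    using collapse_FA[OF Wn_FA[OF f]] collapse_low[OF f] by (auto simp: not_less[symmetric])
  then have "P (pr (collapse (rcsum f)))"
  proof (induction rule: FA_induct)
    case zero
    then show ?case unfolding z by (rule assms(2))
  next
    case (add f g)
    then show ?case using assms(3) pr_add by simp
  qed (auto intro: mono)
  then show ?thesis using pr_collapse[OF Wn_FA[OF f]] by simp
qed

lemma mono_split: "r \<in> carrier R \<Longrightarrow> v # u \<in> lists V \<Longrightarrow> pr (mono r (v # u)) = pr (mono \<one> [v]) \<otimes>\<^bsub>Q\<^esub> pr (mono r u)"
  using mono_mult[of \<one> r "[v]" u] pr_mult[of "mono \<one> [v]" "mono r u"] by simp

lemma mono_Wn: "r \<in> carrier R \<Longrightarrow> u \<in> lists V \<Longrightarrow> n \<le> length u \<Longrightarrow> mono r u \<in> Wn n"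
  by (rule Wn_I[OF mono_closed]) (auto simp: mono_def)

lemma var_Wn: "v \<in> V \<Longrightarrow> mono \<one> [v] \<in> Wn 1"
  by (rule mono_Wn) auto

lemma pc_omega_eq: "pc_omega R V E = pr ` Wn 1"
proof
  have sub: "pc_var R V E ` V \<subseteq> carrier Q" using mono_closed by (auto simp: pc_var_pr)
  show "pc_omega R V E \<subseteq> pr ` Wn 1"
    unfolding pc_omega_def by (rule Q.genideal_minimal[OF ideal_pr_Wn]) (use var_Wn in \<open>auto simp: pc_var_pr simp del: One_nat_def\<close>)
  have I: "ideal (pc_omega R V E) Q" unfolding pc_omega_def by (rule Q.genideal_ideal[OF sub])
  interpret I: ideal "pc_omega R V E" Q by (rule I)
  show "pr ` Wn 1 \<subseteq> pc_omega R V E"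
  proof (rule image_subsetI)
    fix f assume "f \<in> Wn 1"
    then show "pr f \<in> pc_omega R V E"
    proof (rule pr_Wn_induct)
      fix r and u :: "'a list" assume r: "r \<in> carrier R" and u: "u \<in> lists V" "1 \<le> length u"
      obtain v u' where vu: "u = v # u'" using u(2) by (cases u) auto
      have "pr (mono \<one> [v]) \<in> pc_omega R V E"
        using Q.genideal_self[OF sub] u vu unfolding pc_omega_def by (auto simp: pc_var_pr)
      moreover have "pr (mono r u') \<in> carrier Q" using r u vu by simp
      ultimately show "pr (mono r u) \<in> pc_omega R V E"
        unfolding vu using mono_split[of r v u'] r u vu I.I_r_closed by simp
    qed (auto intro: I.zero_closed I.a_closed)
  qed
qed

text \<open>Every monomial of length at least \<open>n\<close> is a product of \<open>n\<close> variables and a monomial; conversely class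
  sums of products vanish below the sum of the degrees.\<close>

lemma pc_omega_pow_eq: "pc_omega_pow R V E n = pr ` Wn n"
proof (induction n)
  case 0
  show ?case by (simp add: Wn_0 Q_carrier)
next
  case (Suc n)
  have "ideal_prod Q (pr ` Wn 1) (pr ` Wn n) = pr ` Wn (Suc n)"
  proof
    show "ideal_prod Q (pr ` Wn 1) (pr ` Wn n) \<subseteq> pr ` Wn (Suc n)"
    proof
      fix x assume "x \<in> ideal_prod Q (pr ` Wn 1) (pr ` Wn n)"
      then show "x \<in> pr ` Wn (Suc n)"
      proof (induction rule: ideal_prod.induct)
        case (prod i j)
        then obtain f g where fg: "f \<in> Wn 1" "g \<in> Wn n" "i = pr f" "j = pr g" by blast
        then have "i \<otimes>\<^bsub>Q\<^esub> j = pr (f \<otimes>\<^bsub>FA\<^esub> g)" using pr_mult Wn_FA by simp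
        then show ?case using Wn_mult[OF fg(1,2)] by simp
      next
        case (sum s t)
        then show ?case using additive_subgroup.a_closed[OF ideal.axioms(1)[OF ideal_pr_Wn]] by blast
      qed
    qed
    show "pr ` Wn (Suc n) \<subseteq> ideal_prod Q (pr ` Wn 1) (pr ` Wn n)"
    proof (rule image_subsetI)
      fix f assume "f \<in> Wn (Suc n)"
      then show "pr f \<in> ideal_prod Q (pr ` Wn 1) (pr ` Wn n)"
      proof (rule pr_Wn_induct)
        have "\<zero>\<^bsub>Q\<^esub> \<in> pr ` Wn m" for m
          using additive_subgroup.zero_closed[OF ideal.axioms(1)[OF ideal_pr_Wn]] .
        from ideal_prod.prod[OF this[of 1] this[of n], of Q]
        show "\<zero>\<^bsub>Q\<^esub> \<in> ideal_prod Q (pr ` Wn 1) (pr ` Wn n)" by simp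
        fix r and u :: "'a list" assume r: "r \<in> carrier R" and u: "u \<in> lists V" "Suc n \<le> length u"
        obtain v u' where vu: "u = v # u'" using u(2) by (cases u) auto
        have "pr (mono \<one> [v]) \<in> pr ` Wn 1" "pr (mono r u') \<in> pr ` Wn n"
          using u vu r by (auto intro!: mono_Wn)
        from ideal_prod.prod[OF this, of Q] show "pr (mono r u) \<in> ideal_prod Q (pr ` Wn 1) (pr ` Wn n)"
          unfolding vu using mono_split[of r v u'] r u vu by simp
      qed (rule ideal_prod.sum)
    qed
  qed
  then show ?case using Suc by (simp add: pc_omega_eq)
qed

lemma ideal_pow: "ideal (pc_omega_pow R V E n) Q"
  unfolding pc_omega_pow_eq by (rule ideal_pr_Wn)

section \<open>Truncated polynomial rings\<close>

definition qn :: "nat \<Rightarrow> ('a list \<Rightarrow> 'r) \<Rightarrow> ('a list \<Rightarrow> 'r) set set" where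
  "qn n f = pc_omega_pow R V E n +>\<^bsub>Q\<^esub> pr f"

lemma ring_trunc: "ring (pc_trunc R V E n)"
  unfolding pc_trunc_def using ideal.quotient_is_ring[OF ideal_pow] .

lemma qn_hom: "qn n \<in> ring_hom FA (pc_trunc R V E n)"
proof -
  have "(\<lambda>x. pc_omega_pow R V E n +>\<^bsub>Q\<^esub> x) \<circ> pr \<in> ring_hom FA (pc_trunc R V E n)"
    unfolding pc_trunc_def by (rule ring_hom_trans[OF pr_hom ideal.rcos_ring_hom[OF ideal_pow]])
  moreover have "(\<lambda>x. pc_omega_pow R V E n +>\<^bsub>Q\<^esub> x) \<circ> pr = qn n" by (simp add: qn_def fun_eq_iff)
  ultimately show ?thesis by simp
qed

lemma trunc_carrier: "carrier (pc_trunc R V E n) = qn n ` carrier FA"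
  unfolding pc_trunc_def FactRing_def A_RCOSETS_def RCOSETS_def qn_def a_r_coset_def Q_carrier by auto

text \<open>Elements of the truncated ring are the families of class sums below degree \<open>n\<close>.\<close>

lemma qn_eq:
  assumes f: "f \<in> carrier FA" and g: "g \<in> carrier FA"
  shows "qn n f = qn n g \<longleftrightarrow> (\<forall>t. length t < n \<longrightarrow> rcsum f t = rcsum g t)"
proof -
  have d: "f \<ominus>\<^bsub>FA\<^esub> g \<in> carrier FA" using FA.minus_closed[OF f g] .
  have "pr f \<ominus>\<^bsub>Q\<^esub> pr g = pr (f \<ominus>\<^bsub>FA\<^esub> g)"
  proof -
    interpret H: ring_hom_ring FA Q pr by (rule ring_hom_ringI2[OF ring_FA ring_Q pr_hom])
    show ?thesis using f g pr_add[OF f FA.a_inv_closed[OF g]] by (simp add: FA.minus_eq Q.minus_eq)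
  qed
  then have "qn n f = qn n g \<longleftrightarrow> pr (f \<ominus>\<^bsub>FA\<^esub> g) \<in> pr ` Wn n"
    unfolding qn_def using Q.quotient_eq_iff_same_a_r_cos[OF ideal_pow, of "pr f" "pr g" n] f g pc_omega_pow_eq by simp
  also have "\<dots> \<longleftrightarrow> f \<ominus>\<^bsub>FA\<^esub> g \<in> Wn n"
  proof
    assume "pr (f \<ominus>\<^bsub>FA\<^esub> g) \<in> pr ` Wn n"
    then obtain h where h: "h \<in> Wn n" "pr (f \<ominus>\<^bsub>FA\<^esub> g) = pr h" by blast
    then have "rcsum (f \<ominus>\<^bsub>FA\<^esub> g) t = rcsum h t" for t using pr_eq[OF d Wn_FA[OF h(1)]] by blast
    then show "f \<ominus>\<^bsub>FA\<^esub> g \<in> Wn n" using h(1) d by (simp add: Wn_def)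
  qed simp
  also have "\<dots> \<longleftrightarrow> (\<forall>t. length t < n \<longrightarrow> rcsum f t = rcsum g t)"
  proof -
    have "rcsum (f \<ominus>\<^bsub>FA\<^esub> g) t = \<zero> \<longleftrightarrow> rcsum f t = rcsum g t" for t
      unfolding FA_diff[OF f g] rcsum_diff[OF FA_SR[OF f] FA_SR[OF g]]
      by (rule r_right_minus_eq) (use f g FA_SR in auto)
    then show ?thesis unfolding Wn_def using d by simp
  qed
  finally show ?thesis .
qed

lemma quot_map_qn:
  assumes "m \<le> n" "f \<in> carrier FA"
  shows "quot_map Q (pc_omega_pow R V E m) id (qn n f) = qn m f"
proof -
  have "id ` pc_omega_pow R V E n \<subseteq> pc_omega_pow R V E m"
    using assms(1) unfolding pc_omega_pow_eq Wn_def by force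
  then show ?thesis unfolding qn_def
    by (subst quot_map_coset[OF ring_Q ideal_pow ring_Q ideal_pow]) (use assms in auto)
qed

end

section \<open>The Magnus ring\<close>

locale magnus_coeffs = trace_coeffs R V E
  for R :: "('r, 'm) ring_scheme" (structure) and V :: "'a set" and E +
  assumes fin_V: "finite V"
begin

abbreviation "MR \<equiv> magnus_ring R V E"
abbreviation "TR n \<equiv> pc_trunc R V E n"

definition tr_n :: "nat \<Rightarrow> ('a list \<Rightarrow> 'r) \<Rightarrow> 'a list \<Rightarrow> 'r" where
  "tr_n n f = (\<lambda>w. if length w < n then f w else \<zero>)"

lemma tr_n_FA: "f \<in> carrier SR \<Longrightarrow> tr_n n f \<in> carrier FA"
proof -
  assume f: "f \<in> carrier SR"
  have "{w. tr_n n f w \<noteq> \<zero>} \<subseteq> (\<Union>k<n. {xs. set xs \<subseteq> V \<and> length xs = k})"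
    using f by (auto simp: tr_n_def SR_carrier split: if_splits)
  then have "finite {w. tr_n n f w \<noteq> \<zero>}" by (rule finite_subset) (auto intro!: finite_lists_length_eq fin_V)
  then show ?thesis using f unfolding FA_carrier SR_carrier tr_n_def by simp
qed

lemma rcsum_cong: "(\<And>w. length w = length t \<Longrightarrow> f w = g w) \<Longrightarrow> g \<in> carrier SR \<Longrightarrow> rcsum f t = rcsum g t"
  unfolding rcsum_def by (rule finsum_cong') (auto simp: cl_def tr_length SR_carrier)

lemma rcsum_tr_n: "f \<in> carrier SR \<Longrightarrow> length t < n \<Longrightarrow> rcsum (tr_n n f) t = rcsum f t"
  by (rule rcsum_cong) (simp_all add: tr_n_def)

text \<open>The image of a power series in the inverse limit.\<close>

definition Phi :: "('a list \<Rightarrow> 'r) \<Rightarrow> nat \<Rightarrow> ('a list \<Rightarrow> 'r) set set" where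
  "Phi f = (\<lambda>n\<in>{1..}. qn n (tr_n n f))"

lemma MR_carrier: "x \<in> carrier MR \<longleftrightarrow> x \<in> PiE {1..} (\<lambda>n. carrier (TR n)) \<and>
   (\<forall>m\<in>{1..}. \<forall>n\<in>{1..}. m \<le> n \<longrightarrow> quot_map Q (pc_omega_pow R V E m) id (x n) = x m)"
  by (simp add: magnus_ring_def inv_lim_ring_def inv_lim_def)

lemma MR_simps:
  "x \<otimes>\<^bsub>MR\<^esub> y = (\<lambda>n\<in>{1..}. x n \<otimes>\<^bsub>TR n\<^esub> y n)" "\<one>\<^bsub>MR\<^esub> = (\<lambda>n\<in>{1..}. \<one>\<^bsub>TR n\<^esub>)"
  "x \<oplus>\<^bsub>MR\<^esub> y = (\<lambda>n\<in>{1..}. x n \<oplus>\<^bsub>TR n\<^esub> y n)" "\<zero>\<^bsub>MR\<^esub> = (\<lambda>n\<in>{1..}. \<zero>\<^bsub>TR n\<^esub>)"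
  by (simp_all add: magnus_ring_def inv_lim_ring_def)

lemma Phi_closed: "f \<in> carrier SR \<Longrightarrow> Phi f \<in> carrier MR"
proof -
  assume f: "f \<in> carrier SR"
  have "quot_map Q (pc_omega_pow R V E m) id (qn n (tr_n n f)) = qn m (tr_n m f)" if "m \<le> n" for m n
    unfolding quot_map_qn[OF that tr_n_FA[OF f]] qn_eq[OF tr_n_FA[OF f] tr_n_FA[OF f]]
    using rcsum_tr_n[OF f] that by simp
  then show ?thesis unfolding MR_carrier Phi_def using tr_n_FA[OF f] by (auto simp: trunc_carrier)
qed

text \<open>The coefficient of a trace in an element of the Magnus ring.\<close>

definition kap :: "(nat \<Rightarrow> ('a list \<Rightarrow> 'r) set set) \<Rightarrow> 'a list \<Rightarrow> 'r" where
  "kap x t = rcsum (SOME f. f \<in> carrier FA \<and> x (Suc (length t)) = qn (Suc (length t)) f) t"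

lemma MR_rep:
  assumes "x \<in> carrier MR" "1 \<le> n"
  obtains f where "f \<in> carrier FA" "x n = qn n f"
proof -
  have "x n \<in> carrier (TR n)" using assms unfolding MR_carrier by auto
  then show ?thesis using that unfolding trunc_carrier by blast
qed

lemma MR_compat: "x \<in> carrier MR \<Longrightarrow> 1 \<le> m \<Longrightarrow> m \<le> n \<Longrightarrow> quot_map Q (pc_omega_pow R V E m) id (x n) = x m"
  unfolding MR_carrier by auto

lemma kap_eq:
  assumes x: "x \<in> carrier MR" and f: "f \<in> carrier FA" "x n = qn n f" and t: "length t < n"
  shows "kap x t = rcsum f t"
proof -
  let ?m = "Suc (length t)"
  let ?g = "SOME g. g \<in> carrier FA \<and> x ?m = qn ?m g"
  obtain g where "g \<in> carrier FA" "x ?m = qn ?m g" using MR_rep[OF x, of ?m] by auto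
  then have g: "?g \<in> carrier FA \<and> x ?m = qn ?m ?g" using someI[of "\<lambda>g. g \<in> carrier FA \<and> x ?m = qn ?m g" g] by blast
  have "x ?m = quot_map Q (pc_omega_pow R V E ?m) id (x n)" by (rule MR_compat[OF x, symmetric]) (use t in auto)
  also have "\<dots> = qn ?m f" unfolding f(2) by (rule quot_map_qn[OF _ f(1)]) (use t in simp)
  finally have "qn ?m ?g = qn ?m f" using g by simp
  then show ?thesis unfolding kap_def using qn_eq[of ?g f ?m] g f(1) by simp
qed

lemma kap_Phi: "f \<in> carrier SR \<Longrightarrow> kap (Phi f) t = rcsum f t"
  using kap_eq[OF Phi_closed tr_n_FA, where n = "Suc (length t)" and t = t and f2 = f] rcsum_tr_n[of f t "Suc (length t)"]
  by (simp add: Phi_def)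

lemma kap_tr: "x \<in> carrier MR \<Longrightarrow> tr E u w \<Longrightarrow> kap x w = kap x u"
proof -
  assume x: "x \<in> carrier MR" and t: "tr E u w"
  obtain f where f: "f \<in> carrier FA" "x (Suc (length u)) = qn (Suc (length u)) f" using MR_rep[OF x, of "Suc (length u)"] by auto
  show ?thesis using kap_eq[OF x f, of u] kap_eq[OF x f, of w] rcsum_tr[OF t] tr_length[OF t] by simp
qed

lemma kap_closed: "x \<in> carrier MR \<Longrightarrow> kap x w \<in> carrier R"
  and kap_outside: "x \<in> carrier MR \<Longrightarrow> w \<notin> lists V \<Longrightarrow> kap x w = \<zero>"
proof -
  assume x: "x \<in> carrier MR"
  obtain f where f: "f \<in> carrier FA" "x (Suc (length w)) = qn (Suc (length w)) f" using MR_rep[OF x, of "Suc (length w)"] by auto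
  show "kap x w \<in> carrier R" using kap_eq[OF x f, of w] FA_SR[OF f(1)] by simp
  show "kap x w = \<zero>" if "w \<notin> lists V" using kap_eq[OF x f, of w] rcsum_notin[OF FA_SR[OF f(1)] that] by simp
qed

lemma MR_eqI:
  assumes x: "x \<in> carrier MR" and y: "y \<in> carrier MR" and k: "\<And>t. kap x t = kap y t"
  shows "x = y"
proof (rule extensionalityI[of _ "{1..}"])
  show "x \<in> extensional {1..}" "y \<in> extensional {1..}" using x y unfolding MR_carrier PiE_def by auto
  fix n :: nat assume n: "n \<in> {1..}"
  obtain f where f: "f \<in> carrier FA" "x n = qn n f" using MR_rep[OF x, of n] n by auto
  obtain g where g: "g \<in> carrier FA" "y n = qn n g" using MR_rep[OF y, of n] n by auto
  show "x n = y n" unfolding f(2) g(2) qn_eq[OF f(1) g(1)]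
    using kap_eq[OF x f] kap_eq[OF y g] k by metis
qed

lemma collapse_SR:
  assumes "\<And>u. c u \<in> carrier R" "\<And>u. u \<notin> lists V \<Longrightarrow> c u = \<zero>"
  shows "collapse c \<in> carrier SR"
  unfolding SR_carrier collapse_def using assms by auto

text \<open>Together with \<open>MR_eqI\<close> this identifies the Magnus ring with the functions on traces.\<close>

lemma MR_realise:
  assumes "\<And>u. c u \<in> carrier R" "\<And>u. u \<notin> lists V \<Longrightarrow> c u = \<zero>" "\<And>u w. tr E u w \<Longrightarrow> c w = c u"
  shows "Phi (collapse c) \<in> carrier MR \<and> (\<forall>t. kap (Phi (collapse c)) t = c t)"
  using Phi_closed[OF collapse_SR[OF assms(1,2)]] kap_Phi[OF collapse_SR[OF assms(1,2)]]
    rcsum_collapse[of c, OF assms(3,1)] by simp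

lemma collapse_kap: "x \<in> carrier MR \<Longrightarrow> collapse (kap x) \<in> carrier SR"
  by (rule collapse_SR) (auto intro: kap_closed kap_outside)

lemma Phi_kap: "x \<in> carrier MR \<Longrightarrow> Phi (collapse (kap x)) = x"
proof -
  assume x: "x \<in> carrier MR"
  have r: "Phi (collapse (kap x)) \<in> carrier MR \<and> (\<forall>t. kap (Phi (collapse (kap x))) t = kap x t)"
    by (rule MR_realise) (auto intro: kap_closed[OF x] kap_outside[OF x] kap_tr[OF x])
  show ?thesis by (rule MR_eqI) (use r x in auto)
qed

lemma rconv_cong:
  assumes "f \<in> carrier SR" "g \<in> carrier SR" "\<And>u. length u \<le> length w \<Longrightarrow> f' u = f u" "\<And>u. length u \<le> length w \<Longrightarrow> g' u = g u"
  shows "rconv f' g' w = rconv f g w"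
  unfolding rconv_def by (rule finsum_cong') (use assms SR_closed in auto)

lemma Phi_hom: "Phi \<in> ring_hom SR MR"
proof (rule ring_hom_memI)
  fix f g assume f: "f \<in> carrier SR" and g: "g \<in> carrier SR"
  show "Phi f \<in> carrier MR" by (rule Phi_closed[OF f])
  have fn: "tr_n n f \<in> carrier FA" and gn: "tr_n n g \<in> carrier FA" for n by (rule tr_n_FA, fact)+
  have fg: "rconv f g \<in> carrier SR" by (rule SR_mult_closed[OF f g])
  have "qn n (tr_n n (rconv f g)) = qn n (tr_n n f) \<otimes>\<^bsub>TR n\<^esub> qn n (tr_n n g)" for n
  proof -
    have "qn n (tr_n n (rconv f g)) = qn n (tr_n n f \<otimes>\<^bsub>FA\<^esub> tr_n n g)"
      unfolding qn_eq[OF tr_n_FA[OF fg] FA.m_closed[OF fn gn]]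
    proof (intro allI impI)
      fix t :: "'a list" assume t: "length t < n"
      show "rcsum (tr_n n (rconv f g)) t = rcsum (tr_n n f \<otimes>\<^bsub>FA\<^esub> tr_n n g) t"
      proof (rule rcsum_cong)
        fix w :: "'a list" assume w: "length w = length t"
        show "tr_n n (rconv f g) w = (tr_n n f \<otimes>\<^bsub>FA\<^esub> tr_n n g) w"
          unfolding FA_simps using rconv_cong[OF f g, of w "tr_n n f" "tr_n n g"] t w by (simp add: tr_n_def)
      qed (rule FA_SR[OF FA.m_closed[OF fn gn]])
    qed
    then show ?thesis using ring_hom_mult[OF qn_hom fn gn] by simp
  qed
  then show "Phi (f \<otimes>\<^bsub>SR\<^esub> g) = Phi f \<otimes>\<^bsub>MR\<^esub> Phi g" unfolding Phi_def MR_simps FA_simps by (intro restrict_ext) simp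
  have "tr_n n (\<lambda>w. f w \<oplus> g w) = tr_n n f \<oplus>\<^bsub>FA\<^esub> tr_n n g" for n
    by (auto simp: tr_n_def FA_simps fun_eq_iff)
  then show "Phi (f \<oplus>\<^bsub>SR\<^esub> g) = Phi f \<oplus>\<^bsub>MR\<^esub> Phi g" unfolding Phi_def MR_simps FA_simps
    using ring_hom_add[OF qn_hom fn gn] by (intro restrict_ext) (simp add: FA_simps)
next
  have "qn n (tr_n n \<one>\<^bsub>SR\<^esub>) = \<one>\<^bsub>TR n\<^esub>" if "n \<in> {1..}" for n
  proof -
    have "tr_n n \<one>\<^bsub>SR\<^esub> = \<one>\<^bsub>FA\<^esub>" using that by (auto simp: tr_n_def FA_simps fun_eq_iff)
    then show ?thesis using ring_hom_one[OF qn_hom] by simp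
  qed
  then show "Phi \<one>\<^bsub>SR\<^esub> = \<one>\<^bsub>MR\<^esub>" unfolding Phi_def MR_simps by (intro restrict_ext) simp
qed

lemma Phi_zero: "Phi \<zero>\<^bsub>SR\<^esub> = \<zero>\<^bsub>MR\<^esub>"
proof -
  have "qn n (tr_n n \<zero>\<^bsub>SR\<^esub>) = \<zero>\<^bsub>TR n\<^esub>" for n
  proof -
    have "tr_n n \<zero>\<^bsub>SR\<^esub> = \<zero>\<^bsub>FA\<^esub>" by (auto simp: tr_n_def FA_simps fun_eq_iff)
    then show ?thesis using ring_hom_zero[OF qn_hom ring_FA ring_trunc] by simp
  qed
  then show ?thesis unfolding Phi_def MR_simps by (intro restrict_ext) simp
qed

lemma Phi_image: "Phi ` carrier SR = carrier MR"
proof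
  show "Phi ` carrier SR \<subseteq> carrier MR" using Phi_closed by blast
  show "carrier MR \<subseteq> Phi ` carrier SR" using Phi_kap collapse_kap by (metis image_eqI subsetI)
qed

lemma ring_MR: "ring MR"
  using SR.ring_hom_imp_img_ring[OF Phi_hom] unfolding Phi_image Phi_zero by simp

sublocale MR: ring MR by (rule ring_MR)

lemma kap_add: "x \<in> carrier MR \<Longrightarrow> y \<in> carrier MR \<Longrightarrow> kap (x \<oplus>\<^bsub>MR\<^esub> y) t = kap x t \<oplus> kap y t"
proof -
  assume x: "x \<in> carrier MR" and y: "y \<in> carrier MR"
  let ?f = "collapse (kap x)" and ?g = "collapse (kap y)"
  note f = collapse_kap[OF x] and g = collapse_kap[OF y]
  have "x \<oplus>\<^bsub>MR\<^esub> y = Phi (?f \<oplus>\<^bsub>SR\<^esub> ?g)" using ring_hom_add[OF Phi_hom f g] Phi_kap x y by simp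
  then have "kap (x \<oplus>\<^bsub>MR\<^esub> y) t = rcsum (?f \<oplus>\<^bsub>SR\<^esub> ?g) t" using kap_Phi[OF SR.a_closed[OF f g]] by simp
  also have "\<dots> = rcsum ?f t \<oplus> rcsum ?g t" unfolding FA_simps by (rule rcsum_add[OF f g])
  also have "\<dots> = kap x t \<oplus> kap y t" using kap_Phi[OF f] kap_Phi[OF g] Phi_kap x y by simp
  finally show ?thesis .
qed

lemma kap_zero: "kap \<zero>\<^bsub>MR\<^esub> t = \<zero>"
  using kap_Phi[OF SR.zero_closed] rcsum_zero unfolding Phi_zero by (simp add: FA_simps)

lemma kap_one: "kap \<one>\<^bsub>MR\<^esub> t = (if t = [] then \<one> else \<zero>)"
proof -
  have "\<one>\<^bsub>SR\<^esub> = mono \<one> []" by (auto simp: FA_simps mono_def)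
  moreover have "tr E t [] \<longleftrightarrow> t = []" using tr_length[of E t "[]"] by (auto intro: tr_refl)
  ultimately show ?thesis using kap_Phi[OF SR.one_closed, of t] rcsum_mono[of \<one> "[]" t]
    unfolding ring_hom_one[OF Phi_hom] by simp
qed

lemma kap_minus: "x \<in> carrier MR \<Longrightarrow> kap (\<ominus>\<^bsub>MR\<^esub> x) t = \<ominus> kap x t"
proof -
  assume x: "x \<in> carrier MR"
  have "kap (\<ominus>\<^bsub>MR\<^esub> x) t \<oplus> kap x t = \<zero>"
    using kap_add[OF MR.a_inv_closed[OF x] x, of t] x by (simp add: MR.l_neg kap_zero)
  then show ?thesis using minus_equality kap_closed x by simp
qed

text \<open>Elements of the Magnus ring of order at least \<open>n\<close>.\<close>

definition Om :: "nat \<Rightarrow> (nat \<Rightarrow> ('a list \<Rightarrow> 'r) set set) set" where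
  "Om n = {x \<in> carrier MR. \<forall>t. length t < n \<longrightarrow> kap x t = \<zero>}"

lemma Phi_Om: "f \<in> carrier SR \<Longrightarrow> (\<And>w. length w < n \<Longrightarrow> f w = \<zero>) \<Longrightarrow> Phi f \<in> Om n"
  unfolding Om_def using Phi_closed kap_Phi rcsum_low[of n f] by simp

lemma Om_low: "x \<in> Om n \<Longrightarrow> length w < n \<Longrightarrow> collapse (kap x) w = \<zero>"
  by (simp add: Om_def collapse_def)

lemma Om_MR: "x \<in> Om n \<Longrightarrow> x \<in> carrier MR"
  by (simp add: Om_def)

lemma Om_mult: "x \<in> Om m \<Longrightarrow> y \<in> Om n \<Longrightarrow> x \<otimes>\<^bsub>MR\<^esub> y \<in> Om (m + n)"
proof -
  assume x: "x \<in> Om m" and y: "y \<in> Om n"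
  let ?f = "collapse (kap x)" and ?g = "collapse (kap y)"
  note f = collapse_kap[OF Om_MR[OF x]] and g = collapse_kap[OF Om_MR[OF y]]
  have "x \<otimes>\<^bsub>MR\<^esub> y = Phi (?f \<otimes>\<^bsub>SR\<^esub> ?g)"
    using ring_hom_mult[OF Phi_hom f g] Phi_kap[OF Om_MR[OF x]] Phi_kap[OF Om_MR[OF y]] by simp
  also have "\<dots> \<in> Om (m + n)"
  proof (rule Phi_Om[OF SR.m_closed[OF f g]])
    fix w :: "'a list" assume "length w < m + n"
    then show "(?f \<otimes>\<^bsub>SR\<^esub> ?g) w = \<zero>" unfolding FA_simps
      by (intro rconv_low[OF f g Om_low[OF x] Om_low[OF y]])
  qed
  finally show ?thesis .
qed

lemma Om_0: "Om 0 = carrier MR"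
  by (simp add: Om_def)

lemma ideal_Om: "ideal (Om n) MR"
proof (rule idealI)
  show "ring MR" by (rule ring_MR)
  show "subgroup (Om n) (add_monoid MR)"
  proof (rule MR.add.subgroupI)
    show "Om n \<subseteq> carrier MR" by (auto simp: Om_def)
    have "\<zero>\<^bsub>MR\<^esub> \<in> Om n" unfolding Om_def using kap_zero MR.zero_closed by simp
    then show "Om n \<noteq> {}" by blast
    fix x assume x: "x \<in> Om n"
    show "\<ominus>\<^bsub>MR\<^esub> x \<in> Om n" using x MR.a_inv_closed unfolding Om_def by (simp add: kap_minus)
    fix y assume y: "y \<in> Om n"
    show "x \<oplus>\<^bsub>MR\<^esub> y \<in> Om n" using x y MR.a_closed unfolding Om_def by (simp add: kap_add)
  qed
  fix x y assume x: "x \<in> Om n" and y: "y \<in> carrier MR"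
  show "y \<otimes>\<^bsub>MR\<^esub> x \<in> Om n" using Om_mult[of y 0 x n] x y by (simp add: Om_0)
  show "x \<otimes>\<^bsub>MR\<^esub> y \<in> Om n" using Om_mult[of x n y 0] x y by (simp add: Om_0)
qed

lemma mono_SR: "r \<in> carrier R \<Longrightarrow> u \<in> lists V \<Longrightarrow> mono r u \<in> carrier SR"
  using FA_SR mono_closed by blast

lemma magnus_var_Phi: "v \<in> V \<Longrightarrow> magnus_var R V E v = Phi (mono \<one> [v])"
proof -
  assume v: "v \<in> V"
  have m: "mono \<one> [v] \<in> carrier FA" using v by simp
  have "qn n (mono \<one> [v]) = qn n (tr_n n (mono \<one> [v]))" for n
    unfolding qn_eq[OF m tr_n_FA[OF FA_SR[OF m]]] using rcsum_tr_n[OF FA_SR[OF m]] by simp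
  then show ?thesis unfolding magnus_var_def Phi_def pc_var_pr qn_def by (intro restrict_ext) simp
qed

text \<open>The decomposition \<open>f = \<Sum>\<^sub>v v f\<^sub>v\<close> of a series without constant term by first letters is finite because
  \<open>V\<close> is. It shows that elements of high order lie in powers of the ideal generated by the variables,
  not just in their closure.\<close>

lemma Phi_split:
  assumes P: "P \<zero>\<^bsub>MR\<^esub>" "\<And>x y. P x \<Longrightarrow> P y \<Longrightarrow> x \<in> carrier MR \<Longrightarrow> y \<in> carrier MR \<Longrightarrow> P (x \<oplus>\<^bsub>MR\<^esub> y)"
    "\<And>v x. v \<in> V \<Longrightarrow> x \<in> Om n \<Longrightarrow> P (magnus_var R V E v \<otimes>\<^bsub>MR\<^esub> x)"
    and x: "x \<in> Om (Suc n)"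
  shows "P x"
proof -
  have main: "P (Phi f)" if "U \<subseteq> V" "f \<in> carrier SR" "\<And>w. f w \<noteq> \<zero> \<Longrightarrow> n < length w \<and> hd w \<in> U" for U f
    using finite_subset[OF that(1) fin_V] that
  proof (induction U arbitrary: f rule: finite_induct)
    case empty
    then have "f = \<zero>\<^bsub>SR\<^esub>" by (auto simp: FA_simps)
    then show ?case using Phi_zero P(1) by simp
  next
    case (insert v U)
    have v: "v \<in> V" using insert.prems by simp
    define g where "g = (\<lambda>w. f (v # w))"
    define h where "h = (\<lambda>w. if hd w = v then \<zero> else f w)"
    have fc: "\<And>w. f w \<in> carrier R" by (rule SR_closed[OF insert.prems(2)])
    have g: "g \<in> carrier SR" unfolding SR_carrier g_def using insert.prems(2) v unfolding SR_carrier by (metis Cons_in_lists_iff)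
    have h: "h \<in> carrier SR" unfolding SR_carrier h_def using insert.prems(2) unfolding SR_carrier by simp
    have mv: "mono \<one> [v] \<in> carrier SR" by (rule mono_SR) (use v in auto)
    have m1: "rconv (mono \<one> [v]) g (v # w) = g w" for w
      using rconv_mono_left(1)[where f = g and r = \<one> and u = "[v]" and x = w] SR_closed[OF g] by simp
    have m2: "rconv (mono \<one> [v]) g w = \<zero>" if "w = [] \<or> hd w \<noteq> v" for w
    proof (rule rconv_mono_left(2))
      show "w \<noteq> [v] @ x" for x using that by auto
    qed (use SR_closed[OF g] in auto)
    have "f = (mono \<one> [v] \<otimes>\<^bsub>SR\<^esub> g) \<oplus>\<^bsub>SR\<^esub> h"
    proof
      fix w
      show "f w = ((mono \<one> [v] \<otimes>\<^bsub>SR\<^esub> g) \<oplus>\<^bsub>SR\<^esub> h) w"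
      proof (cases "w = [] \<or> hd w \<noteq> v")
        case True
        have "f [] = \<zero>" using insert.prems(3)[of "[]"] by auto
        then have "h w = f w" using True by (auto simp: h_def)
        then show ?thesis unfolding FA_simps m2[OF True] using fc by simp
      next
        case False
        then obtain w' where w': "w = v # w'" by (cases w) auto
        show ?thesis unfolding FA_simps w' m1 using fc by (simp add: h_def g_def)
      qed
    qed
    then have eq: "Phi f = magnus_var R V E v \<otimes>\<^bsub>MR\<^esub> Phi g \<oplus>\<^bsub>MR\<^esub> Phi h"
      using ring_hom_add[OF Phi_hom SR.m_closed[OF mv g] h] ring_hom_mult[OF Phi_hom mv g] magnus_var_Phi[OF v] by simp
    have "Phi g \<in> Om n"
    proof (rule Phi_Om[OF g])
      fix w :: "'a list" assume "length w < n"
      then show "g w = \<zero>" using insert.prems(3)[of "v # w"] by (auto simp: g_def)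
    qed
    moreover have "P (Phi h)"
    proof (rule insert.IH[OF _ h])
      fix w assume "h w \<noteq> \<zero>"
      then have "hd w \<noteq> v" "f w \<noteq> \<zero>" by (auto simp: h_def split: if_splits)
      then show "n < length w \<and> hd w \<in> U" using insert.prems(3)[of w] by auto
    qed (use insert.prems in auto)
    moreover have "magnus_var R V E v \<otimes>\<^bsub>MR\<^esub> Phi g \<in> carrier MR"
      unfolding magnus_var_Phi[OF v] using Phi_closed[OF mv] Phi_closed[OF g] by simp
    ultimately show ?case unfolding eq using P(2) P(3)[OF v] Phi_closed[OF h] by blast
  qed
  have "P (Phi (collapse (kap x)))"
  proof (rule main[OF subset_refl collapse_kap[OF Om_MR[OF x]]])
    fix w assume w: "collapse (kap x) w \<noteq> \<zero>"
    then have "\<not> length w < Suc n" using Om_low[OF x] by blast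
    moreover have "w \<in> lists V" using w collapse_kap[OF Om_MR[OF x]] unfolding SR_carrier by blast
    ultimately show "n < length w \<and> hd w \<in> V" by (cases w) auto
  qed
  then show ?thesis using Phi_kap[OF Om_MR[OF x]] by simp
qed

lemma var_Om: "v \<in> V \<Longrightarrow> magnus_var R V E v \<in> Om 1"
  unfolding magnus_var_Phi by (rule Phi_Om[OF mono_SR]) (auto simp: mono_def)

lemma magnus_omega_eq: "magnus_omega R V E = Om 1"
proof
  have sub: "magnus_var R V E ` V \<subseteq> carrier MR" using var_Om Om_MR by blast
  show "magnus_omega R V E \<subseteq> Om 1" unfolding magnus_omega_def
    by (rule MR.genideal_minimal[OF ideal_Om]) (use var_Om in blast)
  have I: "ideal (magnus_omega R V E) MR" unfolding magnus_omega_def by (rule MR.genideal_ideal[OF sub])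
  interpret I: ideal "magnus_omega R V E" MR by (rule I)
  show "Om 1 \<subseteq> magnus_omega R V E"
  proof
    fix x assume "x \<in> Om 1"
    then have "x \<in> Om (Suc 0)" by simp
    then show "x \<in> magnus_omega R V E"
    proof (rule Phi_split[rotated 3])
      fix v y assume v: "v \<in> V" and y: "y \<in> Om 0"
      have "magnus_var R V E v \<in> magnus_omega R V E"
        using MR.genideal_self[OF sub] v unfolding magnus_omega_def by blast
      then show "magnus_var R V E v \<otimes>\<^bsub>MR\<^esub> y \<in> magnus_omega R V E" using I.I_r_closed Om_MR[OF y] by blast
    qed (auto intro: I.zero_closed I.a_closed)
  qed
qed

theorem magnus_omega_pow_eq: "ideal_power MR (magnus_omega R V E) n = Om n"
proof (induction n)
  case 0
  show ?case by (simp add: Om_0)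
next
  case (Suc n)
  have "ideal_prod MR (Om 1) (Om n) = Om (Suc n)"
  proof
    show "ideal_prod MR (Om 1) (Om n) \<subseteq> Om (Suc n)"
    proof
      fix x assume "x \<in> ideal_prod MR (Om 1) (Om n)"
      then show "x \<in> Om (Suc n)"
      proof (induction rule: ideal_prod.induct)
        case (prod i j)
        then show ?case using Om_mult[of i 1 j n] by simp
      next
        case (sum s t)
        then show ?case using additive_subgroup.a_closed[OF ideal.axioms(1)[OF ideal_Om]] by blast
      qed
    qed
    show "Om (Suc n) \<subseteq> ideal_prod MR (Om 1) (Om n)"
    proof
      fix x assume "x \<in> Om (Suc n)"
      then show "x \<in> ideal_prod MR (Om 1) (Om n)"
      proof (rule Phi_split[rotated 3])
        have z: "\<zero>\<^bsub>MR\<^esub> \<in> Om m" for m using additive_subgroup.zero_closed[OF ideal.axioms(1)[OF ideal_Om]] .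
        from ideal_prod.prod[OF z[of 1] z[of n], of MR]
        show "\<zero>\<^bsub>MR\<^esub> \<in> ideal_prod MR (Om 1) (Om n)" by simp
        fix v y assume "v \<in> V" "y \<in> Om n"
        then show "magnus_var R V E v \<otimes>\<^bsub>MR\<^esub> y \<in> ideal_prod MR (Om 1) (Om n)"
          using ideal_prod.prod[OF var_Om, of v y "Om n" MR] by blast
      qed (rule ideal_prod.sum)
    qed
  qed
  then show ?case using Suc by (simp add: magnus_omega_eq)
qed

lemma one_plus_iff:
  assumes "x \<in> carrier MR"
  shows "x \<in> one_plus MR (Om n) \<longleftrightarrow> (\<forall>t. length t < n \<longrightarrow> kap x t = kap \<one>\<^bsub>MR\<^esub> t)"
proof
  assume "x \<in> one_plus MR (Om n)"
  then obtain y where y: "y \<in> Om n" "x = \<one>\<^bsub>MR\<^esub> \<oplus>\<^bsub>MR\<^esub> y" by (auto simp: one_plus_def)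
  show "\<forall>t. length t < n \<longrightarrow> kap x t = kap \<one>\<^bsub>MR\<^esub> t"
    unfolding y(2) using y(1) kap_add[OF MR.one_closed Om_MR[OF y(1)]] kap_closed[OF MR.one_closed]
    by (simp add: Om_def)
next
  assume h: "\<forall>t. length t < n \<longrightarrow> kap x t = kap \<one>\<^bsub>MR\<^esub> t"
  let ?y = "x \<oplus>\<^bsub>MR\<^esub> \<ominus>\<^bsub>MR\<^esub> \<one>\<^bsub>MR\<^esub>"
  have y: "?y \<in> carrier MR" using assms by simp
  have "?y \<in> Om n" unfolding Om_def
    using h y kap_add[OF assms MR.a_inv_closed[OF MR.one_closed]] kap_minus[OF MR.one_closed] kap_closed[OF MR.one_closed]
    by (simp add: r_neg)
  moreover have "x = \<one>\<^bsub>MR\<^esub> \<oplus>\<^bsub>MR\<^esub> ?y"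
    using assms by (simp add: MR.a_lcomm MR.r_neg)
  ultimately show "x \<in> one_plus MR (Om n)" unfolding one_plus_def by blast
qed

end

section \<open>Change of coefficients\<close>

text \<open>A homomorphism of coefficient rings commutes with class sums, hence with the presentation of the
  truncated rings by class sums.\<close>

lemma pc_trunc_map_qn:
  assumes A: "trace_coeffs R V E" and B: "trace_coeffs S V E" and h: "h \<in> ring_hom R S"
    and mn: "m \<le> n" and f: "f \<in> carrier (free_alg R V)"
  shows "pc_trunc_map S V E m h (trace_coeffs.qn R V E n f) = trace_coeffs.qn S V E m (h \<circ> f)"
    and "h \<circ> f \<in> carrier (free_alg S V)"
    and "trace_coeffs.rcsum S E (h \<circ> f) t = h (trace_coeffs.rcsum R E f t)"
proof -
  interpret A: trace_coeffs R V E by (rule A)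
  interpret B: trace_coeffs S V E by (rule B)
  interpret H: ring_hom_cring R S h
    by (intro ring_hom_cring.intro ring_hom_cring_axioms.intro A.is_cring B.is_cring h)
  have hFA: "h \<circ> g \<in> carrier B.FA" if g: "g \<in> carrier A.FA" for g
  proof -
    have sub: "{w. (h \<circ> g) w \<noteq> \<zero>\<^bsub>S\<^esub>} \<subseteq> {w. g w \<noteq> \<zero>\<^bsub>R\<^esub>}" by auto
    then have "finite {w. (h \<circ> g) w \<noteq> \<zero>\<^bsub>S\<^esub>}" using g finite_subset unfolding A.FA_carrier by blast
    moreover have "h \<circ> g \<in> carrier B.SR" using A.FA_SR[OF g] sub unfolding A.SR_carrier B.SR_carrier by auto
    ultimately show ?thesis unfolding B.FA_carrier by blast
  qed
  have rc: "B.rcsum (h \<circ> g) t = h (A.rcsum g t)" if g: "g \<in> carrier A.FA" for g t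
  proof -
    have "h (A.rcsum g t) = finsum S (h \<circ> g) (cl E t)" unfolding A.rcsum_def
      by (rule H.hom_finsum) (use A.SR_closed[OF A.FA_SR[OF g]] in auto)
    then show ?thesis by (simp add: B.rcsum_def)
  qed
  show "h \<circ> f \<in> carrier B.FA" by (rule hFA[OF f])
  show "B.rcsum (h \<circ> f) t = h (A.rcsum f t)" by (rule rc[OF f])
  have hadd: "h \<circ> (g \<oplus>\<^bsub>A.FA\<^esub> g') = (h \<circ> g) \<oplus>\<^bsub>B.FA\<^esub> (h \<circ> g')" if "g \<in> carrier A.FA" "g' \<in> carrier A.FA" for g g'
    unfolding A.FA_simps B.FA_simps comp_def
    by (rule ext) (use A.SR_closed[OF A.FA_SR[OF that(1)]] A.SR_closed[OF A.FA_SR[OF that(2)]] in simp)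
  let ?H = "quot_map B.FA B.PI (\<lambda>f. h \<circ> f)"
  have Hpr: "?H (A.pr g) = B.pr (h \<circ> g)" if g: "g \<in> carrier A.FA" for g
    unfolding A.pr_def B.pr_def
  proof (rule quot_map_coset[OF A.ring_FA A.ideal_PI B.ring_FA B.ideal_PI hFA hadd _ g])
    show "(\<lambda>f. h \<circ> f) ` A.PI \<subseteq> B.PI"
    proof (rule image_subsetI)
      fix g assume "g \<in> A.PI"
      then have "g \<in> A.ZI" by (simp add: A.PI_eq)
      then have "h \<circ> g \<in> B.ZI" using hFA rc unfolding A.ZI_def B.ZI_def by simp
      then show "h \<circ> g \<in> B.PI" by (simp add: B.PI_eq)
    qed
  qed
  have Hc: "?H x \<in> carrier B.Q" if "x \<in> carrier A.Q" for x
    using that Hpr hFA unfolding A.Q_carrier by auto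
  have Ha: "?H (x \<oplus>\<^bsub>A.Q\<^esub> y) = ?H x \<oplus>\<^bsub>B.Q\<^esub> ?H y" if x: "x \<in> carrier A.Q" and y: "y \<in> carrier A.Q" for x y
  proof -
    obtain g where g: "g \<in> carrier A.FA" "x = A.pr g" using x unfolding A.Q_carrier by blast
    obtain g' where g': "g' \<in> carrier A.FA" "y = A.pr g'" using y unfolding A.Q_carrier by blast
    have "?H (x \<oplus>\<^bsub>A.Q\<^esub> y) = B.pr (h \<circ> (g \<oplus>\<^bsub>A.FA\<^esub> g'))"
      unfolding g(2) g'(2) A.pr_add[OF g(1) g'(1), symmetric] by (rule Hpr[OF A.FA.a_closed[OF g(1) g'(1)]])
    also have "\<dots> = B.pr (h \<circ> g) \<oplus>\<^bsub>B.Q\<^esub> B.pr (h \<circ> g')"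
      unfolding hadd[OF g(1) g'(1)] by (rule B.pr_add[OF hFA[OF g(1)] hFA[OF g'(1)]])
    finally show ?thesis using Hpr g g' by simp
  qed
  have "?H ` pc_omega_pow R V E n \<subseteq> pc_omega_pow S V E m"
    unfolding A.pc_omega_pow_eq B.pc_omega_pow_eq
  proof (rule image_subsetI)
    fix x assume "x \<in> A.pr ` A.Wn n"
    then obtain g where g: "g \<in> A.Wn n" "x = A.pr g" by blast
    have "h \<circ> g \<in> B.Wn m" using g(1) mn hFA rc unfolding A.Wn_def B.Wn_def by simp
    then show "?H x \<in> B.pr ` B.Wn m" unfolding g(2) Hpr[OF A.Wn_FA[OF g(1)]] by blast
  qed
  from quot_map_coset[OF A.ring_Q A.ideal_pow B.ring_Q B.ideal_pow Hc Ha this A.pr_closed[OF f]]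
  show "pc_trunc_map S V E m h (A.qn n f) = B.qn m (h \<circ> f)"
    unfolding pc_trunc_map_def A.qn_def B.qn_def Hpr[OF f] .
qed

section \<open>The \<open>p\<close>-adic integers\<close>

locale prime_base =
  fixes p :: nat
  assumes p_prime: "Factorial_Ring.prime p"
begin

abbreviation "rs k \<equiv> residue_ring (int p ^ k)"

lemma pk_gt_1: "1 \<le> k \<Longrightarrow> int p ^ k > 1"
  using prime_gt_1_nat[OF p_prime] by (simp add: one_less_power)

lemma pk_pos: "int p ^ k > 0"
  using prime_gt_0_nat[OF p_prime] by simp

lemma rs_cring: "1 \<le> k \<Longrightarrow> cring (rs k)"
  using residues.cring[OF residues.intro[OF pk_gt_1]] .

lemma rs_simps: "carrier (rs k) = {0..<int p ^ k}" "x \<otimes>\<^bsub>rs k\<^esub> y = (x * y) mod int p ^ k" "\<one>\<^bsub>rs k\<^esub> = 1" "\<zero>\<^bsub>rs k\<^esub> = 0"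
  "x \<oplus>\<^bsub>rs k\<^esub> y = (x + y) mod int p ^ k"
  by (auto simp: residue_ring_def)

lemma rs_finsum:
  assumes k: "1 \<le> k" and B: "finite B" and f: "\<And>x. x \<in> B \<Longrightarrow> f x \<in> {0..<int p ^ k}"
  shows "finsum (rs k) f B = (\<Sum>x\<in>B. f x) mod int p ^ k"
  using B f
proof (induction B rule: finite_induct)
  case empty
  interpret cring "rs k" by (rule rs_cring[OF k])
  show ?case by (simp add: rs_simps)
next
  case (insert x B)
  interpret cring "rs k" by (rule rs_cring[OF k])
  have "finsum (rs k) f (insert x B) = f x \<oplus>\<^bsub>rs k\<^esub> finsum (rs k) f B"
    by (rule finsum_insert) (use insert in \<open>auto simp: rs_simps(1)\<close>)
  then show ?case using insert by (simp add: rs_simps mod_simps)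
qed

lemma Zp_carrier: "x \<in> carrier (Zp p) \<longleftrightarrow> x \<in> PiE {1..} (\<lambda>k. {0..<int p ^ k}) \<and> (\<forall>l\<in>{1..}. \<forall>k\<in>{1..}. l \<le> k \<longrightarrow> x k mod int p ^ l = x l)"
  by (simp add: Zp_def inv_lim_ring_def inv_lim_def rs_simps(1))

lemma Zp_simps: "x \<otimes>\<^bsub>Zp p\<^esub> y = (\<lambda>k\<in>{1..}. (x k * y k) mod int p ^ k)" "\<one>\<^bsub>Zp p\<^esub> = (\<lambda>k\<in>{1..}. 1)"
  "x \<oplus>\<^bsub>Zp p\<^esub> y = (\<lambda>k\<in>{1..}. (x k + y k) mod int p ^ k)" "\<zero>\<^bsub>Zp p\<^esub> = (\<lambda>k\<in>{1..}. 0)"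
  by (simp_all add: Zp_def inv_lim_ring_def rs_simps)

lemma Zp_I:
  assumes "\<And>l k. 1 \<le> l \<Longrightarrow> l \<le> k \<Longrightarrow> z k mod int p ^ l = z l mod int p ^ l"
  shows "(\<lambda>k\<in>{1..}. z k mod int p ^ k) \<in> carrier (Zp p)"
  unfolding Zp_carrier
proof (intro conjI ballI impI)
  show "(\<lambda>k\<in>{1..}. z k mod int p ^ k) \<in> PiE {1..} (\<lambda>k. {0..<int p ^ k})"
    using pos_mod_sign[OF pk_pos] pos_mod_bound[OF pk_pos] by (auto simp: PiE_def)
  fix l k :: nat assume lk: "l \<in> {1..}" "k \<in> {1..}" "l \<le> k"
  have "int p ^ l dvd int p ^ k" using lk(3) by (rule le_imp_power_dvd)
  then have "z k mod int p ^ k mod int p ^ l = z k mod int p ^ l" by (rule mod_mod_cancel)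
  then show "(\<lambda>k\<in>{1..}. z k mod int p ^ k) k mod int p ^ l = (\<lambda>k\<in>{1..}. z k mod int p ^ k) l"
    using assms[of l k] lk by simp
qed

lemma Zp_val: "x \<in> carrier (Zp p) \<Longrightarrow> 1 \<le> k \<Longrightarrow> x k mod int p ^ k = x k"
  and Zp_compat: "x \<in> carrier (Zp p) \<Longrightarrow> 1 \<le> l \<Longrightarrow> l \<le> k \<Longrightarrow> x k mod int p ^ l = x l"
  unfolding Zp_carrier by auto

lemma Zp_eqI: "x \<in> carrier (Zp p) \<Longrightarrow> y \<in> carrier (Zp p) \<Longrightarrow> (\<And>k. 1 \<le> k \<Longrightarrow> x k = y k) \<Longrightarrow> x = y"
  unfolding Zp_carrier by (auto simp: PiE_def intro: extensionalityI[of _ "{1..}"])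

lemma Zp_op_closed:
  assumes x: "x \<in> carrier (Zp p)" and y: "y \<in> carrier (Zp p)"
  shows "x \<otimes>\<^bsub>Zp p\<^esub> y \<in> carrier (Zp p)" "x \<oplus>\<^bsub>Zp p\<^esub> y \<in> carrier (Zp p)" "(\<lambda>k\<in>{1..}. (- x k) mod int p ^ k) \<in> carrier (Zp p)"
proof -
  have c: "x k mod int p ^ l = x l mod int p ^ l" "y k mod int p ^ l = y l mod int p ^ l" if "1 \<le> l" "l \<le> k" for l k
    using Zp_compat[OF x that] Zp_compat[OF y that] Zp_val[OF x that(1)] Zp_val[OF y that(1)] by auto
  show "x \<otimes>\<^bsub>Zp p\<^esub> y \<in> carrier (Zp p)" unfolding Zp_simps by (rule Zp_I) (rule mod_mult_cong[OF c])
  show "x \<oplus>\<^bsub>Zp p\<^esub> y \<in> carrier (Zp p)" unfolding Zp_simps by (rule Zp_I) (rule mod_add_cong[OF c])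
  show "(\<lambda>k\<in>{1..}. (- x k) mod int p ^ k) \<in> carrier (Zp p)" by (rule Zp_I) (rule mod_minus_cong[OF c(1)])
qed

lemma Zp_const: "(\<lambda>k\<in>{1..}. 1) \<in> carrier (Zp p)" "(\<lambda>k\<in>{1..}. 0) \<in> carrier (Zp p)"
proof -
  have "(\<lambda>k\<in>{1..}. 1) = (\<lambda>k\<in>{1..}. 1 mod int p ^ k)" using pk_gt_1 by (auto intro!: restrict_ext)
  also have "\<dots> \<in> carrier (Zp p)" by (rule Zp_I) simp
  finally show "(\<lambda>k\<in>{1..}. 1) \<in> carrier (Zp p)" .
  have "(\<lambda>k\<in>{1..}. 0) = (\<lambda>k\<in>{1..}. 0 mod int p ^ k)" by simp
  also have "\<dots> \<in> carrier (Zp p)" by (rule Zp_I) simp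
  finally show "(\<lambda>k\<in>{1..}. 0) \<in> carrier (Zp p)" .
qed

lemma cring_Zp: "cring (Zp p)"
proof (rule cringI)
  show "abelian_group (Zp p)"
  proof (rule abelian_groupI)
    fix x y z assume x: "x \<in> carrier (Zp p)" and y: "y \<in> carrier (Zp p)" and z: "z \<in> carrier (Zp p)"
    show "x \<oplus>\<^bsub>Zp p\<^esub> y \<in> carrier (Zp p)" by (rule Zp_op_closed[OF x y])
    show "x \<oplus>\<^bsub>Zp p\<^esub> y \<oplus>\<^bsub>Zp p\<^esub> z = x \<oplus>\<^bsub>Zp p\<^esub> (y \<oplus>\<^bsub>Zp p\<^esub> z)"
      unfolding Zp_simps by (rule restrict_ext) (simp add: mod_simps add.assoc)
    show "x \<oplus>\<^bsub>Zp p\<^esub> y = y \<oplus>\<^bsub>Zp p\<^esub> x" unfolding Zp_simps by (simp add: add.commute)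
  next
    fix x assume x: "x \<in> carrier (Zp p)"
    show "\<zero>\<^bsub>Zp p\<^esub> \<oplus>\<^bsub>Zp p\<^esub> x = x"
      by (rule Zp_eqI[OF Zp_op_closed(2)[OF _ x] x]) (use Zp_const Zp_val[OF x] in \<open>auto simp: Zp_simps\<close>)
    show "\<exists>y\<in>carrier (Zp p). y \<oplus>\<^bsub>Zp p\<^esub> x = \<zero>\<^bsub>Zp p\<^esub>"
      by (rule bexI[OF _ Zp_op_closed(3)[OF x x]]) (auto simp: Zp_simps mod_simps intro!: restrict_ext)
  qed (simp add: Zp_simps Zp_const[simplified])
  show "comm_monoid (Zp p)"
  proof (rule comm_monoidI)
    fix x y z assume x: "x \<in> carrier (Zp p)" and y: "y \<in> carrier (Zp p)" and z: "z \<in> carrier (Zp p)"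
    show "x \<otimes>\<^bsub>Zp p\<^esub> y \<in> carrier (Zp p)" by (rule Zp_op_closed[OF x y])
    show "x \<otimes>\<^bsub>Zp p\<^esub> y \<otimes>\<^bsub>Zp p\<^esub> z = x \<otimes>\<^bsub>Zp p\<^esub> (y \<otimes>\<^bsub>Zp p\<^esub> z)"
      unfolding Zp_simps by (rule restrict_ext) (simp add: mod_simps mult.assoc)
    show "x \<otimes>\<^bsub>Zp p\<^esub> y = y \<otimes>\<^bsub>Zp p\<^esub> x" unfolding Zp_simps by (simp add: mult.commute)
  next
    fix x assume x: "x \<in> carrier (Zp p)"
    show "\<one>\<^bsub>Zp p\<^esub> \<otimes>\<^bsub>Zp p\<^esub> x = x"
      by (rule Zp_eqI[OF Zp_op_closed(1)[OF _ x] x]) (use Zp_const Zp_val[OF x] in \<open>auto simp: Zp_simps\<close>)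
  qed (simp add: Zp_simps Zp_const[simplified])
  fix x y z assume x: "x \<in> carrier (Zp p)" and y: "y \<in> carrier (Zp p)" and z: "z \<in> carrier (Zp p)"
  show "(x \<oplus>\<^bsub>Zp p\<^esub> y) \<otimes>\<^bsub>Zp p\<^esub> z = x \<otimes>\<^bsub>Zp p\<^esub> z \<oplus>\<^bsub>Zp p\<^esub> y \<otimes>\<^bsub>Zp p\<^esub> z"
    unfolding Zp_simps by (rule restrict_ext) (simp add: mod_simps distrib_right)
qed

lemma ev_hom: "1 \<le> k \<Longrightarrow> (\<lambda>a. a k) \<in> ring_hom (Zp p) (rs k)"
  by (rule ring_hom_memI) (auto simp: Zp_simps rs_simps Zp_carrier)

lemma mod_hom:
  assumes "1 \<le> l" "l \<le> k"
  shows "(\<lambda>a. a mod int p ^ l) \<in> ring_hom (rs k) (rs l)"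
proof -
  have d: "int p ^ l dvd int p ^ k" using assms(2) by (rule le_imp_power_dvd)
  show ?thesis
    by (rule ring_hom_memI) (use pk_pos[of l] pk_gt_1[OF assms(1)] in \<open>auto simp: rs_simps mod_mod_cancel[OF d] mod_simps\<close>)
qed

end

section \<open>Comparison with the profinite limit\<close>

text \<open>All three sides are described by class sums: the completion by congruence subgroups, the Magnus ring over
  \<open>\<int>\<^sub>p\<close>, and the finite rings that define its topology.\<close>

locale magnus_setup = raag_prime V E r p for V :: "'a set" and E r p
begin

sublocale prime_base p by unfold_locales (rule p)

lemma tc: "cring R \<Longrightarrow> magnus_coeffs R V E"
  using edge_vertices fin_V by (auto simp: magnus_coeffs_def trace_coeffs_def magnus_coeffs_axioms_def trace_coeffs_axioms_def)

sublocale Z: magnus_coeffs "Zp p" V E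
  by (rule tc[OF cring_Zp])

lemma tS: "1 \<le> k \<Longrightarrow> magnus_coeffs (rs k) V E"
  by (rule tc[OF rs_cring])

lemma tS': "1 \<le> k \<Longrightarrow> trace_coeffs (rs k) V E"
  using tS magnus_coeffs.axioms(1) by blast

abbreviation "qS k \<equiv> trace_coeffs.qn (rs k) V E"
abbreviation "mtp \<equiv> magnus_to_profinite p V E"

lemma mtp_qn:
  assumes "1 \<le> n" "1 \<le> k" "f \<in> carrier Z.FA" "x n = Z.qn n f"
  shows "mtp x (n, k) = qS k n ((\<lambda>a. a k) \<circ> f)"
  using pc_trunc_map_qn(1)[OF Z.trace_coeffs_axioms tS'[OF assms(2)] ev_hom[OF assms(2)] order_refl[of n] assms(3)] assms
  by (simp add: magnus_to_profinite_def)

lemma mtp_eq_iff: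
  assumes n: "1 \<le> n" and k: "1 \<le> k" and x: "x \<in> carrier Z.MR" and y: "y \<in> carrier Z.MR"
  shows "mtp x (n, k) = mtp y (n, k) \<longleftrightarrow> (\<forall>t. length t < n \<longrightarrow> Z.kap x t k = Z.kap y t k)"
proof -
  interpret S: magnus_coeffs "rs k" V E by (rule tS[OF k])
  obtain f where f: "f \<in> carrier Z.FA" "x n = Z.qn n f" using Z.MR_rep[OF x n] .
  obtain g where g: "g \<in> carrier Z.FA" "y n = Z.qn n g" using Z.MR_rep[OF y n] .
  note E = pc_trunc_map_qn[OF Z.trace_coeffs_axioms tS'[OF k] ev_hom[OF k] order_refl[of n]]
  show ?thesis
    unfolding mtp_qn[where x = x, OF n k f] mtp_qn[where x = y, OF n k g] S.qn_eq[OF E(2)[OF f(1)] E(2)[OF g(1)]] E(3)[OF f(1)] E(3)[OF g(1)]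
    using Z.kap_eq[OF x f] Z.kap_eq[OF y g] by simp
qed

lemma MR_eq_mtp:
  assumes x: "x \<in> carrier Z.MR" and y: "y \<in> carrier Z.MR"
    and e: "\<And>n k. 1 \<le> n \<Longrightarrow> 1 \<le> k \<Longrightarrow> mtp x (n, k) = mtp y (n, k)"
  shows "x = y"
proof (rule Z.MR_eqI[OF x y])
  fix t
  show "Z.kap x t = Z.kap y t"
  proof (rule Zp_eqI[OF Z.kap_closed[OF x] Z.kap_closed[OF y]])
    fix k :: nat assume k: "1 \<le> k"
    have "1 \<le> Suc (length t)" by simp
    then show "Z.kap x t k = Z.kap y t k" using e[of "Suc (length t)" k] k mtp_eq_iff[OF _ k x y, of "Suc (length t)"] by simp
  qed
qed

lemma mtp_mult:
  assumes n: "1 \<le> n" and k: "1 \<le> k" and x: "x \<in> carrier Z.MR" and y: "y \<in> carrier Z.MR"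
  shows "mtp (x \<otimes>\<^bsub>Z.MR\<^esub> y) (n, k) = mtp x (n, k) \<otimes>\<^bsub>pc_trunc (rs k) V E n\<^esub> mtp y (n, k)"
proof -
  interpret S: magnus_coeffs "rs k" V E by (rule tS[OF k])
  interpret H: ring_hom_cring "Zp p" "rs k" "\<lambda>a. a k"
    by (intro ring_hom_cring.intro ring_hom_cring_axioms.intro cring_Zp rs_cring[OF k] ev_hom[OF k])
  obtain f where f: "f \<in> carrier Z.FA" "x n = Z.qn n f" using Z.MR_rep[OF x n] .
  obtain g where g: "g \<in> carrier Z.FA" "y n = Z.qn n g" using Z.MR_rep[OF y n] .
  note E = pc_trunc_map_qn[OF Z.trace_coeffs_axioms tS'[OF k] ev_hom[OF k] order_refl[of n]]
  have fg: "f \<otimes>\<^bsub>Z.FA\<^esub> g \<in> carrier Z.FA" using f g by simp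
  have "(x \<otimes>\<^bsub>Z.MR\<^esub> y) n = Z.qn n (f \<otimes>\<^bsub>Z.FA\<^esub> g)"
    using n f g ring_hom_mult[OF Z.qn_hom f(1) g(1)] by (simp add: Z.MR_simps)
  from mtp_qn[where x = "x \<otimes>\<^bsub>Z.MR\<^esub> y", OF n k fg this]
  have 1: "mtp (x \<otimes>\<^bsub>Z.MR\<^esub> y) (n, k) = qS k n ((\<lambda>a. a k) \<circ> (f \<otimes>\<^bsub>Z.FA\<^esub> g))" .
  have "(\<lambda>a. a k) \<circ> (f \<otimes>\<^bsub>Z.FA\<^esub> g) = ((\<lambda>a. a k) \<circ> f) \<otimes>\<^bsub>S.FA\<^esub> ((\<lambda>a. a k) \<circ> g)"
  proof
    fix w
    have c: "f u \<in> carrier (Zp p)" "g u \<in> carrier (Zp p)" for u using f g Z.FA_SR Z.SR_closed by blast+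
    have "Z.rconv f g w k = finsum (rs k) ((\<lambda>a. a k) \<circ> (\<lambda>i. f (take i w) \<otimes>\<^bsub>Zp p\<^esub> g (drop i w))) {..length w}"
      unfolding Z.rconv_def by (rule H.hom_finsum) (use c Zp_op_closed in auto)
    also have "\<dots> = S.rconv ((\<lambda>a. a k) \<circ> f) ((\<lambda>a. a k) \<circ> g) w"
      unfolding S.rconv_def comp_def using c H.hom_mult by simp
    finally show "((\<lambda>a. a k) \<circ> (f \<otimes>\<^bsub>Z.FA\<^esub> g)) w = (((\<lambda>a. a k) \<circ> f) \<otimes>\<^bsub>S.FA\<^esub> ((\<lambda>a. a k) \<circ> g)) w"
      by (simp add: Z.FA_simps S.FA_simps)
  qed
  then show ?thesis unfolding 1 mtp_qn[where x = x, OF n k f] mtp_qn[where x = y, OF n k g]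
    using ring_hom_mult[OF S.qn_hom E(2)[OF f(1)] E(2)[OF g(1)]] by simp
qed

lemma mtp_inv_lim:
  assumes x: "x \<in> carrier Z.MR"
  shows "mtp x \<in> topspace (magnus_profinite_topology p V E)"
proof -
  have sc: "mtp x (n, k) \<in> carrier (pc_trunc (rs k) V E n)" if n: "1 \<le> n" and k: "1 \<le> k" for n k
  proof -
    interpret S: magnus_coeffs "rs k" V E by (rule tS[OF k])
    obtain f where f: "f \<in> carrier Z.FA" "x n = Z.qn n f" using Z.MR_rep[OF x n] .
    show ?thesis unfolding mtp_qn[where x = x, OF n k f] S.trunc_carrier
      using pc_trunc_map_qn(2)[OF Z.trace_coeffs_axioms tS'[OF k] ev_hom[OF k] order_refl[of n] f(1)] by blast
  qed
  have comp: "pc_trunc_map (rs l) V E m (\<lambda>a. a mod int p ^ l) (mtp x (n, k)) = mtp x (m, l)"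
    if m: "1 \<le> m" and l: "1 \<le> l" and mn: "m \<le> n" and lk: "l \<le> k" for m l n k
  proof -
    have n: "1 \<le> n" and k: "1 \<le> k" using m l mn lk by auto
    obtain f where f: "f \<in> carrier Z.FA" "x n = Z.qn n f" using Z.MR_rep[OF x n] .
    have xm: "x m = Z.qn m f" using Z.MR_compat[OF x m mn] Z.quot_map_qn[OF mn f(1)] f(2) by simp
    note E = pc_trunc_map_qn[OF Z.trace_coeffs_axioms tS'[OF k] ev_hom[OF k] order_refl[of n] f(1)]
    have "(\<lambda>a. a mod int p ^ l) \<circ> ((\<lambda>a. a k) \<circ> f) = (\<lambda>a. a l) \<circ> f"
      using Zp_compat[OF Z.SR_closed[OF Z.FA_SR[OF f(1)]] l lk] by (auto simp: fun_eq_iff)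
    then show ?thesis unfolding mtp_qn[where x = x, OF n k f] mtp_qn[where x = x, OF m l f(1) xm]
      using pc_trunc_map_qn(1)[OF tS'[OF k] tS'[OF l] mod_hom[OF l lk] mn E(2)] by simp
  qed
  have "mtp x \<in> extensional ({1..} \<times> {1..})" by (simp add: magnus_to_profinite_def)
  then show ?thesis
    unfolding magnus_profinite_topology_def inv_lim_topology_def topspace_subtopology topspace_product_topology
    using sc comp by (auto simp: inv_lim_def PiE_def)
qed

text \<open>The Magnus expansion of a word, reduced modulo \<open>p\<^sup>k\<close> and truncated in degree \<open>n\<close>.\<close>

definition Fk :: "nat \<Rightarrow> nat \<Rightarrow> ('a \<times> bool) list \<Rightarrow> 'a list \<Rightarrow> int" where
  "Fk n k w t = (if length t < n then coef (magnus w) t mod int p ^ k else 0)"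

lemma Fk_FA:
  assumes w: "w \<in> L" and k: "1 \<le> k"
  shows "Fk n k w \<in> carrier (free_alg (rs k) V)"
proof -
  interpret S: magnus_coeffs "rs k" V E by (rule tS[OF k])
  have "{t. Fk n k w t \<noteq> 0} \<subseteq> short n"
  proof
    fix t assume "t \<in> {t. Fk n k w t \<noteq> 0}"
    then have t: "length t < n" "coef (magnus w) t mod int p ^ k \<noteq> 0" by (auto simp: Fk_def split: if_splits)
    then have "coef (magnus w) t \<noteq> 0" by auto
    then show "t \<in> short n" using magnus_supp[OF w] t(1) by (simp add: short_def)
  qed
  then have "finite {t. Fk n k w t \<noteq> 0}" "\<And>t. Fk n k w t \<noteq> 0 \<Longrightarrow> t \<in> lists V"
    using finite_subset[OF _ finite_short] by (auto simp: short_def)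
  then show ?thesis unfolding S.FA_carrier S.SR_carrier using pk_pos[of k] by (auto simp: rs_simps Fk_def)
qed

lemma Fk_rcsum:
  assumes "1 \<le> k" "length t < n"
  shows "trace_coeffs.rcsum (rs k) E (Fk n k w) t = csum E (magnus w) t mod int p ^ k"
proof -
  interpret S: magnus_coeffs "rs k" V E by (rule tS[OF assms(1)])
  have "S.rcsum (Fk n k w) t = (\<Sum>u\<in>cl E t. Fk n k w u) mod int p ^ k"
    unfolding S.rcsum_def by (rule rs_finsum[OF assms(1) finite_cl]) (use pk_pos[of k] in \<open>auto simp: Fk_def\<close>)
  also have "\<dots> = (\<Sum>u\<in>cl E t. coef (magnus w) u mod int p ^ k) mod int p ^ k"
    using assms(2) by (intro arg_cong[where f = "\<lambda>z. z mod int p ^ k"] sum.cong HOL.refl) (auto simp: Fk_def cl_def tr_length)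
  finally show ?thesis by (simp add: csum_def mod_sum_eq)
qed

lemma mtp_Fk:
  assumes n: "1 \<le> n" and k: "1 \<le> k" and x: "x \<in> carrier Z.MR" and w: "w \<in> L"
    and e: "\<And>t. length t < n \<Longrightarrow> Z.kap x t k = csum E (magnus w) t mod int p ^ k"
  shows "mtp x (n, k) = qS k n (Fk n k w)"
proof -
  interpret S: magnus_coeffs "rs k" V E by (rule tS[OF k])
  obtain f where f: "f \<in> carrier Z.FA" "x n = Z.qn n f" using Z.MR_rep[OF x n] .
  note E = pc_trunc_map_qn[OF Z.trace_coeffs_axioms tS'[OF k] ev_hom[OF k] order_refl[of n] f(1)]
  show ?thesis unfolding mtp_qn[where x = x, OF n k f] S.qn_eq[OF E(2) Fk_FA[OF w k]]
    using Z.kap_eq[OF x f] e Fk_rcsum[OF k] E(3) by simp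
qed

lemma Fk_mult:
  assumes n: "1 \<le> n" and k: "1 \<le> k" and u: "u \<in> L" and w: "w \<in> L"
  shows "qS k n (Fk n k u) \<otimes>\<^bsub>pc_trunc (rs k) V E n\<^esub> qS k n (Fk n k w) = qS k n (Fk n k (u @ w))"
proof -
  interpret S: magnus_coeffs "rs k" V E by (rule tS[OF k])
  have uw: "u @ w \<in> L" using u w by simp
  note F = Fk_FA[OF u k, of n] Fk_FA[OF w k, of n] Fk_FA[OF uw k, of n]
  have "qS k n (Fk n k u \<otimes>\<^bsub>S.FA\<^esub> Fk n k w) = qS k n (Fk n k (u @ w))"
    unfolding S.qn_eq[OF S.FA.m_closed[OF F(1,2)] F(3)]
  proof (intro allI impI)
    fix t :: "'a list" assume t: "length t < n"
    show "S.rcsum (Fk n k u \<otimes>\<^bsub>S.FA\<^esub> Fk n k w) t = S.rcsum (Fk n k (u @ w)) t"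
    proof (rule S.rcsum_cong[OF _ S.FA_SR[OF F(3)]])
      fix v :: "'a list" assume v: "length v = length t"
      let ?q = "int p ^ k"
      have "S.rconv (Fk n k u) (Fk n k w) v = (\<Sum>i\<le>length v. (Fk n k u (take i v) * Fk n k w (drop i v)) mod ?q) mod ?q"
        unfolding S.rconv_def rs_simps(2) by (rule rs_finsum[OF k]) (use pk_pos[of k] in auto)
      also have "\<dots> = (\<Sum>i\<le>length v. (coef (magnus u) (take i v) * coef (magnus w) (drop i v)) mod ?q) mod ?q"
        by (rule arg_cong2[where f = "(mod)", OF sum.cong[OF HOL.refl] HOL.refl]) (use t v in \<open>auto simp: Fk_def mod_mult_eq\<close>)
      also have "\<dots> = Fk n k (u @ w) v" using t v by (simp add: Fk_def coef_mult mod_sum_eq)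
      finally show "(Fk n k u \<otimes>\<^bsub>S.FA\<^esub> Fk n k w) v = Fk n k (u @ w) v" by (simp add: S.FA_simps)
    qed
  qed
  then show ?thesis using ring_hom_mult[OF S.qn_hom F(1,2)] by simp
qed

end

section \<open>The Magnus map\<close>

context magnus_setup
begin

abbreviation "OG \<equiv> one_plus_omega_group p V E"
abbreviation "emb w \<equiv> pro_p_embed p A (cls w)"

lemma emb_val: "N \<in> Ix \<Longrightarrow> emb w N = N #>\<^bsub>A\<^esub> cls w"
  by (simp add: pro_p_embed_def)

lemma emb_carrier: "w \<in> L \<Longrightarrow> emb w \<in> carrier PG"
proof (rule PG_I)
  show "emb w \<in> extensional Ix" by (simp add: pro_p_embed_def)
  show "\<exists>u\<in>L. emb w M = M #>\<^bsub>A\<^esub> cls u \<and> emb w N = N #>\<^bsub>A\<^esub> cls u" if "w \<in> L" "N \<in> Ix" "M \<in> Ix" for N M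
    using that emb_val by blast
qed

lemma emb_append:
  assumes u: "u \<in> L" and w: "w \<in> L"
  shows "emb (u @ w) = emb u \<otimes>\<^bsub>PG\<^esub> emb w"
proof (rule PG_eqI)
  have uw: "u @ w \<in> L" using u w by simp
  show "emb (u @ w) \<in> carrier PG" by (rule emb_carrier[OF uw])
  show "emb u \<otimes>\<^bsub>PG\<^esub> emb w \<in> carrier PG" using emb_carrier[OF u] emb_carrier[OF w] by simp
  show "emb (u @ w) (Kc j) = (emb u \<otimes>\<^bsub>PG\<^esub> emb w) (Kc j)" for j
    using PG_mult_rep[where x = "emb u" and y = "emb w", OF Kc_Ix u w emb_val[OF Kc_Ix] emb_val[OF Kc_Ix]] emb_val[OF Kc_Ix] by simp
qed

lemma emb_inv:
  assumes w: "w \<in> L"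
  shows "inv\<^bsub>PG\<^esub> emb w = emb (word_inv w)"
proof (rule PG_eqI)
  show "inv\<^bsub>PG\<^esub> emb w \<in> carrier PG" using emb_carrier[OF w] by simp
  show "emb (word_inv w) \<in> carrier PG" by (rule emb_carrier[OF word_inv_lists[OF w]])
  show "(inv\<^bsub>PG\<^esub> emb w) (Kc j) = emb (word_inv w) (Kc j)" for j
    using PG_inv[OF emb_carrier[OF w] Kc_Ix w emb_val[OF Kc_Ix]] emb_val[OF Kc_Ix] by simp
qed

lemma emb_Nil: "emb [] = \<one>\<^bsub>PG\<^esub>"
proof (rule PG_eqI[OF emb_carrier PG.one_closed])
  show "emb [] (Kc j) = \<one>\<^bsub>PG\<^esub> (Kc j)" for j
    unfolding emb_val[OF Kc_Ix] PG_one restrict_apply'[OF Kc_Ix] by (rule Mod_one[OF Kc_Ix, symmetric])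
qed simp

subsection \<open>Coefficients of an element of the completion\<close>

definition rp :: "(('a \<times> bool) list set set \<Rightarrow> ('a \<times> bool) list set set) \<Rightarrow> nat \<Rightarrow> nat \<Rightarrow> ('a \<times> bool) list" where
  "rp x n k = (SOME w. w \<in> L \<and> x (KA n (int p ^ k)) = KA n (int p ^ k) #>\<^bsub>A\<^esub> cls w)"

lemma rp: 
  assumes "x \<in> carrier PG"
  shows "rp x n k \<in> L" "x (KA n (int p ^ k)) = KA n (int p ^ k) #>\<^bsub>A\<^esub> cls (rp x n k)"
proof -
  have "\<exists>w. w \<in> L \<and> x (KA n (int p ^ k)) = KA n (int p ^ k) #>\<^bsub>A\<^esub> cls w" using PG_rep[OF assms KA_index] by blast
  from someI_ex[OF this] have r: "rp x n k \<in> L \<and> x (KA n (int p ^ k)) = KA n (int p ^ k) #>\<^bsub>A\<^esub> cls (rp x n k)"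
    unfolding rp_def .
  show "rp x n k \<in> L" by (rule conjunct1[OF r])
  show "x (KA n (int p ^ k)) = KA n (int p ^ k) #>\<^bsub>A\<^esub> cls (rp x n k)" by (rule conjunct2[OF r])
qed

text \<open>The coefficient of \<open>t\<close> in \<open>\<mu>\<^sub>p(x)\<close>: modulo \<open>p\<^sup>k\<close> it is the class sum of any word that represents \<open>x\<close>
  modulo \<open>KA n (p\<^sup>k)\<close> with \<open>n\<close> exceeding the length of \<open>t\<close> (\<open>cf_eq\<close>).\<close>

definition cf :: "(('a \<times> bool) list set set \<Rightarrow> ('a \<times> bool) list set set) \<Rightarrow> 'a list \<Rightarrow> nat \<Rightarrow> int" where
  "cf x t = (\<lambda>k\<in>{1..}. csum E (magnus (rp x (Suc (length t)) k)) t mod int p ^ k)"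

lemma cf_eq:
  assumes x: "x \<in> carrier PG" and w: "w \<in> L" "x (KA n (int p ^ k)) = KA n (int p ^ k) #>\<^bsub>A\<^esub> cls w"
    and t: "length t < n" and k: "1 \<le> k"
  shows "cf x t k = csum E (magnus w) t mod int p ^ k"
proof -
  let ?n = "Suc (length t)" and ?q = "int p ^ k"
  have "x (KA ?n ?q) = KA ?n ?q #>\<^bsub>A\<^esub> cls w"
    by (rule PG_rep_mono[OF x KA_index KA_index KA_mono w]) (use t in auto)
  then have "magnus (rp x ?n k) - magnus w \<in> Idn E ?n ?q"
    using KA_coset_eq[OF rp(1)[OF x] w(1)] rp(2)[OF x] by metis
  then have "?q dvd csum E (magnus (rp x ?n k) - magnus w) t" by (rule Idn_D) simp
  then show ?thesis using k by (simp add: cf_def mod_eq_dvd_iff)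
qed

lemma cf_Zp:
  assumes x: "x \<in> carrier PG"
  shows "cf x t \<in> carrier (Zp p)"
  unfolding cf_def
proof (rule Zp_I)
  fix l k :: nat assume l: "1 \<le> l" and lk: "l \<le> k"
  let ?n = "Suc (length t)"
  have "x (KA ?n (int p ^ l)) = KA ?n (int p ^ l) #>\<^bsub>A\<^esub> cls (rp x ?n k)"
    by (rule PG_rep_mono[OF x KA_index KA_index KA_mono rp[OF x]]) (use lk in \<open>auto intro: le_imp_power_dvd\<close>)
  from cf_eq[OF x rp(1)[OF x] this lessI l] cf_eq[where t = t, OF x rp[OF x] lessI l]
  show "csum E (magnus (rp x ?n k)) t mod int p ^ l = csum E (magnus (rp x ?n l)) t mod int p ^ l"
    by (rule HOL.trans[OF HOL.sym])
qed

definition mu0 :: "(('a \<times> bool) list set set \<Rightarrow> ('a \<times> bool) list set set) \<Rightarrow> nat \<Rightarrow> ('a list \<Rightarrow> nat \<Rightarrow> int) set set" where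
  "mu0 x = Z.Phi (Z.collapse (cf x))"

lemma mu0:
  assumes x: "x \<in> carrier PG"
  shows "mu0 x \<in> carrier Z.MR" "Z.kap (mu0 x) t = cf x t"
proof -
  have "cf x u = \<zero>\<^bsub>Zp p\<^esub>" if "u \<notin> lists V" for u
    unfolding cf_def Zp_simps using csum_supp[OF magnus_supp[OF rp(1)[OF x]] that] by simp
  moreover have "cf x w = cf x u" if "tr E u w" for u w
    unfolding cf_def using tr_length[OF that] csum_tr[OF that] by simp
  ultimately show "mu0 x \<in> carrier Z.MR" "Z.kap (mu0 x) t = cf x t"
    using Z.MR_realise[of "cf x", OF cf_Zp[OF x]] unfolding mu0_def by blast+
qed

lemma mtp_mu0:
  assumes n: "1 \<le> n" and k: "1 \<le> k" and x: "x \<in> carrier PG"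
    and w: "w \<in> L" "x (KA n (int p ^ k)) = KA n (int p ^ k) #>\<^bsub>A\<^esub> cls w"
  shows "mtp (mu0 x) (n, k) = qS k n (Fk n k w)"
  by (rule mtp_Fk[OF n k mu0(1)[OF x] w(1)]) (use cf_eq[OF x w _ k] mu0(2)[OF x] in simp)

text \<open>In each finite quotient both sides are the truncated Magnus expansion of the same word.\<close>

lemma mu0_mult:
  assumes x: "x \<in> carrier PG" and y: "y \<in> carrier PG"
  shows "mu0 (x \<otimes>\<^bsub>PG\<^esub> y) = mu0 x \<otimes>\<^bsub>Z.MR\<^esub> mu0 y"
proof (rule MR_eq_mtp)
  have xy: "x \<otimes>\<^bsub>PG\<^esub> y \<in> carrier PG" using x y by simp
  show "mu0 (x \<otimes>\<^bsub>PG\<^esub> y) \<in> carrier Z.MR" by (rule mu0(1)[OF xy])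
  show "mu0 x \<otimes>\<^bsub>Z.MR\<^esub> mu0 y \<in> carrier Z.MR" using mu0(1)[OF x] mu0(1)[OF y] by simp
  fix n k :: nat assume n: "1 \<le> n" and k: "1 \<le> k"
  obtain u where u: "u \<in> L" "x (KA n (int p ^ k)) = KA n (int p ^ k) #>\<^bsub>A\<^esub> cls u" using PG_rep[OF x KA_index] by blast
  obtain w where w: "w \<in> L" "y (KA n (int p ^ k)) = KA n (int p ^ k) #>\<^bsub>A\<^esub> cls w" using PG_rep[OF y KA_index] by blast
  have uw: "u @ w \<in> L" using u w by simp
  have "(x \<otimes>\<^bsub>PG\<^esub> y) (KA n (int p ^ k)) = KA n (int p ^ k) #>\<^bsub>A\<^esub> cls (u @ w)"
    by (rule PG_mult_rep[where x = x and y = y, OF KA_index u(1) w(1) u(2) w(2)])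
  from mtp_mu0[OF n k xy uw this]
  show "mtp (mu0 (x \<otimes>\<^bsub>PG\<^esub> y)) (n, k) = mtp (mu0 x \<otimes>\<^bsub>Z.MR\<^esub> mu0 y) (n, k)"
    unfolding mtp_mult[OF n k mu0(1)[OF x] mu0(1)[OF y]] mtp_mu0[OF n k x u] mtp_mu0[OF n k y w]
    using Fk_mult[OF n k u(1) w(1)] by simp
qed

lemma kap_one_val: "1 \<le> k \<Longrightarrow> Z.kap \<one>\<^bsub>Z.MR\<^esub> t k = csum E 1 t mod int p ^ k"
  using pk_gt_1[of k] by (simp add: Z.kap_one csum_1 Zp_simps)

lemma mu0_one_plus:
  assumes x: "x \<in> carrier PG"
  shows "mu0 x \<in> one_plus Z.MR (Z.Om 1)"
  unfolding Z.one_plus_iff[OF mu0(1)[OF x]]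
proof (intro allI impI)
  fix t :: "'a list" assume t: "length t < 1"
  show "Z.kap (mu0 x) t = Z.kap \<one>\<^bsub>Z.MR\<^esub> t"
  proof (rule Zp_eqI[OF Z.kap_closed[OF mu0(1)[OF x]] Z.kap_closed[OF Z.MR.one_closed]])
    fix k :: nat assume k: "1 \<le> k"
    show "Z.kap (mu0 x) t k = Z.kap \<one>\<^bsub>Z.MR\<^esub> t k"
      unfolding mu0(2)[OF x] kap_one_val[OF k] using t k by (simp add: cf_def csum_1)
  qed
qed

lemma OG_simps: "carrier OG = one_plus Z.MR (Z.Om 1)" "x \<otimes>\<^bsub>OG\<^esub> y = x \<otimes>\<^bsub>Z.MR\<^esub> y"
  unfolding one_plus_omega_group_def Z.magnus_omega_eq by (simp_all add: units_of_def)

lemma one_plus_Om_carrier: "x \<in> one_plus Z.MR (Z.Om n) \<Longrightarrow> x \<in> carrier Z.MR"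
  unfolding one_plus_def using Z.Om_MR by auto

abbreviation "g1 v \<equiv> \<one>\<^bsub>Z.MR\<^esub> \<oplus>\<^bsub>Z.MR\<^esub> magnus_var (Zp p) V E v"

lemma g1_closed: "v \<in> V \<Longrightarrow> g1 v \<in> carrier Z.MR"
  using Z.Om_MR[OF Z.var_Om] by simp

lemma mu0_gen:
  assumes v: "v \<in> V"
  shows "mu0 (emb [(v, True)]) = g1 v"
proof -
  have L1: "[(v, True)] \<in> L" using v by simp
  note e = emb_carrier[OF L1]
  note vc = Z.Om_MR[OF Z.var_Om[OF v]]
  have one: "\<one>\<^bsub>Zp p\<^esub> \<in> carrier (Zp p)" unfolding Zp_simps by (rule Zp_const)
  show ?thesis
  proof (rule Z.MR_eqI[OF mu0(1)[OF e] g1_closed[OF v]])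
    fix t
    show "Z.kap (mu0 (emb [(v, True)])) t = Z.kap (g1 v) t"
    proof (rule Zp_eqI[OF Z.kap_closed[OF mu0(1)[OF e]] Z.kap_closed[OF g1_closed[OF v]]])
      fix k :: nat assume k: "1 \<le> k"
      have "cf (emb [(v, True)]) t k = csum E (magnus [(v, True)]) t mod int p ^ k"
        by (rule cf_eq[OF e L1 emb_val[OF KA_index] lessI k])
      also have "\<dots> = (csum E 1 t + csum E (var v) t) mod int p ^ k" by simp
      finally have 1: "cf (emb [(v, True)]) t k = (csum E 1 t + csum E (var v) t) mod int p ^ k" .
      have "csum E (var v) t = (\<Sum>u\<in>cl E t. if u = [v] then 1 else 0)" unfolding csum_def coef_var ..
      also have "\<dots> = (if tr E t [v] then 1 else 0)" by (subst sum.delta[OF finite_cl]) (simp add: cl_def)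
      finally have 2: "csum E (var v) t = (if tr E t [v] then 1 else 0)" .
      have lv: "[v] \<in> lists V" using v by simp
      have "Z.kap (magnus_var (Zp p) V E v) t = (if tr E t [v] then \<one>\<^bsub>Zp p\<^esub> else \<zero>\<^bsub>Zp p\<^esub>)"
        unfolding Z.magnus_var_Phi[OF v] Z.kap_Phi[OF Z.mono_SR[OF one lv]] by (rule Z.rcsum_mono[OF one])
      then have 3: "Z.kap (magnus_var (Zp p) V E v) t k = csum E (var v) t" using k 2 by (simp add: Zp_simps)
      show "Z.kap (mu0 (emb [(v, True)])) t k = Z.kap (g1 v) t k"
        unfolding mu0(2)[OF e] 1 Z.kap_add[OF Z.MR.one_closed vc] Zp_simps
        using k by (simp add: 3[simplified] kap_one_val[OF k, simplified] mod_simps)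
    qed
  qed
qed

subsection \<open>Continuity\<close>

abbreviation "TP \<equiv> pro_p_topology p A"
abbreviation "TK n k \<equiv> discrete_topology (carrier (pc_trunc (rs k) V E n))"

lemma topspace_TP: "topspace TP = carrier PG"
  unfolding pro_p_topology_def inv_lim_topology_def topspace_subtopology topspace_product_topology
  by (auto simp: pro_p_completion_def inv_lim_monoid_def inv_lim_def)

text \<open>A coordinate of the image only depends on the component of \<open>x\<close> at one congruence subgroup.\<close>

lemma continuous_mtp_mu0:
  assumes n: "1 \<le> n" and k: "1 \<le> k"
  shows "continuous_map TP (TK n k) (\<lambda>x. mtp (mu0 x) (n, k))"
proof -
  interpret S: magnus_coeffs "rs k" V E by (rule tS[OF k])
  let ?N = "KA n (int p ^ k)"
  define g where "g C = qS k n (Fk n k (SOME w. w \<in> L \<and> C = ?N #>\<^bsub>A\<^esub> cls w))" for C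
  have some: "(SOME w. w \<in> L \<and> C = ?N #>\<^bsub>A\<^esub> cls w) \<in> L \<and> C = ?N #>\<^bsub>A\<^esub> cls (SOME w. w \<in> L \<and> C = ?N #>\<^bsub>A\<^esub> cls w)"
    if "C \<in> carrier (A Mod ?N)" for C
  proof (rule someI_ex)
    show "\<exists>w. w \<in> L \<and> C = ?N #>\<^bsub>A\<^esub> cls w" using that by (auto simp: carrier_FactGroup carrier_A)
  qed
  have "g C \<in> carrier (pc_trunc (rs k) V E n)" if "C \<in> carrier (A Mod ?N)" for C
    unfolding g_def S.trunc_carrier using Fk_FA[OF conjunct1[OF some[OF that]] k] by blast
  then have g: "continuous_map (discrete_topology (carrier (A Mod ?N))) (TK n k) g" by auto
  have "continuous_map TP (discrete_topology (carrier (A Mod ?N))) (\<lambda>x. x ?N)"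
    unfolding pro_p_topology_def inv_lim_topology_def
    by (rule continuous_map_from_subtopology[OF continuous_map_product_projection[OF KA_index]])
  from continuous_map_compose[OF this g]
  show ?thesis
  proof (rule continuous_map_eq)
    fix x assume "x \<in> topspace TP"
    then have x: "x \<in> carrier PG" by (simp add: topspace_TP)
    have "x ?N \<in> carrier (A Mod ?N)" using x KA_index unfolding PG_carrier by blast
    from some[OF this] have "mtp (mu0 x) (n, k) = g (x ?N)" unfolding g_def by (intro mtp_mu0[OF n k x]) blast+
    then show "(g \<circ> (\<lambda>x. x ?N)) x = mtp (mu0 x) (n, k)" by simp
  qed
qed

lemma continuous_mu0:
  "continuous_map TP (one_plus_omega_topology p V E) mu0"
  unfolding one_plus_omega_topology_def continuous_map_in_subtopology
proof
  show "mu0 \<in> topspace TP \<rightarrow> one_plus Z.MR (magnus_omega (Zp p) V E)"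
    unfolding topspace_TP Z.magnus_omega_eq using mu0_one_plus by blast
  have top: "(mtp \<circ> mu0) \<in> topspace TP \<rightarrow> topspace (magnus_profinite_topology p V E)"
    unfolding topspace_TP using mtp_inv_lim mu0(1) by auto
  show "continuous_map TP (magnus_topology p V E) mu0"
    unfolding magnus_topology_def
  proof (rule continuous_map_pullback')
    show "topspace TP \<subseteq> mu0 -` carrier Z.MR" unfolding topspace_TP using mu0(1) by blast
    show "continuous_map TP (magnus_profinite_topology p V E) (mtp \<circ> mu0)"
      unfolding magnus_profinite_topology_def inv_lim_topology_def continuous_map_in_subtopology
    proof
      show "mtp \<circ> mu0 \<in> topspace TP \<rightarrow> inv_lim ({1..} \<times> {1..}) (\<lambda>(m, l) (n, k). m \<le> n \<and> l \<le> k)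
          (\<lambda>(n, k). carrier (pc_trunc (rs k) V E n)) (\<lambda>(m, l) (n, k). pc_trunc_map (rs l) V E m (\<lambda>a. a mod int p ^ l))"
        using top unfolding magnus_profinite_topology_def inv_lim_topology_def topspace_subtopology by blast
      show "continuous_map TP (product_topology (\<lambda>i. discrete_topology (case i of (n, k) \<Rightarrow> carrier (pc_trunc (rs k) V E n))) ({1..} \<times> {1..})) (mtp \<circ> mu0)"
        unfolding continuous_map_componentwise
      proof (intro conjI ballI)
        show "(mtp \<circ> mu0) ` topspace TP \<subseteq> extensional ({1..} \<times> {1..})" by (auto simp: magnus_to_profinite_def)
        fix i :: "nat \<times> nat" assume "i \<in> {1..} \<times> {1..}"
        then obtain n k where i: "i = (n, k)" "1 \<le> n" "1 \<le> k" by auto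
        show "continuous_map TP (discrete_topology (case i of (n, k) \<Rightarrow> carrier (pc_trunc (rs k) V E n))) (\<lambda>x. (mtp \<circ> mu0) x i)"
          using continuous_mtp_mu0[OF i(2,3)] unfolding i(1) by (simp add: comp_def)
      qed
    qed
  qed
qed

definition mu :: "(('a \<times> bool) list set set \<Rightarrow> ('a \<times> bool) list set set) \<Rightarrow> nat \<Rightarrow> ('a list \<Rightarrow> nat \<Rightarrow> int) set set" where
  "mu = restrict mu0 (carrier PG)"

lemma mu_eq: "x \<in> carrier PG \<Longrightarrow> mu x = mu0 x"
  by (simp add: mu_def)

theorem mu_magnus: "is_magnus_map p V E mu"
  unfolding is_magnus_map_def
proof (intro conjI ballI)
  show "mu \<in> extensional (carrier PG)" by (simp add: mu_def)
  show "mu \<in> hom PG OG"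
    by (rule homI) (use mu0_one_plus mu0_mult PG.m_closed in \<open>simp_all add: mu_eq OG_simps\<close>)
  show "continuous_map TP (one_plus_omega_topology p V E) mu"
    by (rule continuous_map_eq[OF continuous_mu0]) (simp add: topspace_TP mu_eq)
  fix v assume v: "v \<in> V"
  then have "[(v, True)] \<in> L" by simp
  then show "mu (pro_p_embed p A (raag_gen V E v)) = g1 v"
    unfolding raag_gen_def using mu0_gen[OF v] mu_eq[OF emb_carrier] by simp
qed

subsection \<open>Uniqueness\<close>

text \<open>An open set constrains finitely many components, and a single group \<open>Kc j\<close> lies in all the subgroups
  concerned.\<close>

lemma TP_neighbourhood:
  assumes U: "openin TP U" and x: "x \<in> U"
  obtains j where "\<And>y. y \<in> carrier PG \<Longrightarrow> y (Kc j) = x (Kc j) \<Longrightarrow> y \<in> U"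
proof -
  let ?D = "\<lambda>N. discrete_topology (carrier (A Mod N))"
  have xc: "x \<in> carrier PG" using openin_subset[OF U] x topspace_TP by blast
  obtain W where W: "openin (product_topology ?D Ix) W" "U = W \<inter> carrier PG"
    using U topspace_TP unfolding pro_p_topology_def inv_lim_topology_def openin_subtopology
    by (auto simp: pro_p_completion_def inv_lim_monoid_def)
  have "x \<in> W" using x W(2) by blast
  from bspec[OF W(1)[unfolded openin_product_topology_alt] this]
  obtain P where P: "finite {N \<in> Ix. P N \<noteq> topspace (?D N)}" "x \<in> PiE Ix P" "PiE Ix P \<subseteq> W"
    by (elim exE conjE)
  let ?F = "{N \<in> Ix. P N \<noteq> topspace (?D N)}"
  have "\<exists>j. \<forall>N\<in>F. Kc j \<subseteq> N" if "finite F" "F \<subseteq> Ix" for F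
    using that
  proof (induction F rule: finite_induct)
    case (insert N F)
    then obtain j where j: "\<forall>N\<in>F. Kc j \<subseteq> N" by auto
    obtain i where i: "Kc i \<subseteq> N" using Kc_cofinal insert.prems by blast
    have "Kc (max i j) \<subseteq> Kc i" "Kc (max i j) \<subseteq> Kc j" by (rule Kc_mono, simp)+
    then show ?case using i j by (intro exI[of _ "max i j"]) blast
  qed simp
  from this[OF P(1)] obtain j where j: "\<forall>N\<in>?F. Kc j \<subseteq> N" by auto
  have "y \<in> U" if y: "y \<in> carrier PG" and e: "y (Kc j) = x (Kc j)" for y
  proof -
    obtain w where w: "w \<in> L" "x (Kc j) = Kc j #>\<^bsub>A\<^esub> cls w" using PG_rep[OF xc Kc_Ix] by blast
    have "y (Kc j) = Kc j #>\<^bsub>A\<^esub> cls w" using e w(2) by simp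
    note yw = w(1) this
    have "y \<in> PiE Ix P"
    proof (rule PiE_I)
      fix N assume N: "N \<in> Ix"
      show "y N \<in> P N"
      proof (cases "N \<in> ?F")
        case True
        then have s: "Kc j \<subseteq> N" using j by blast
        have "y N = x N" using PG_rep_mono[OF y N Kc_Ix s yw] PG_rep_mono[OF xc N Kc_Ix s w] by simp
        then show ?thesis using P(2) N by (auto simp: PiE_def)
      next
        case False
        then show ?thesis using N y unfolding PG_carrier by auto
      qed
    next
      show "y N = undefined" if "N \<notin> Ix" for N using y that unfolding PG_carrier by blast
    qed
    then show ?thesis using P(3) W(2) y by blast
  qed
  then show ?thesis using that by blast
qed

text \<open>If \<open>(1 + y)\<^sup>2 = 1 + y\<close> then \<open>y = - y\<^sup>2\<close>, so the order of \<open>y\<close> exceeds every bound. A multiplicative map into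
  \<open>1 + \<omega>\<close> therefore preserves the identity.\<close>

lemma one_plus_idempotent:
  assumes e: "e \<in> one_plus Z.MR (Z.Om 1)" and ee: "e \<otimes>\<^bsub>Z.MR\<^esub> e = e"
  shows "e = \<one>\<^bsub>Z.MR\<^esub>"
proof -
  obtain y where y1: "y \<in> Z.Om 1" "e = \<one>\<^bsub>Z.MR\<^esub> \<oplus>\<^bsub>Z.MR\<^esub> y" using e unfolding one_plus_def by blast
  have y: "y \<in> carrier Z.MR" by (rule Z.Om_MR[OF y1(1)])
  have "e \<otimes>\<^bsub>Z.MR\<^esub> e = e \<oplus>\<^bsub>Z.MR\<^esub> (y \<oplus>\<^bsub>Z.MR\<^esub> y \<otimes>\<^bsub>Z.MR\<^esub> y)"
    unfolding y1(2) using y by (simp add: Z.MR.l_distr Z.MR.r_distr Z.MR.a_ac)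
  then have "y \<oplus>\<^bsub>Z.MR\<^esub> y \<otimes>\<^bsub>Z.MR\<^esub> y = \<zero>\<^bsub>Z.MR\<^esub>"
    using ee y one_plus_Om_carrier[OF e] by simp
  then have s: "y = \<ominus>\<^bsub>Z.MR\<^esub> (y \<otimes>\<^bsub>Z.MR\<^esub> y)" using y Z.MR.minus_equality[of y "y \<otimes>\<^bsub>Z.MR\<^esub> y"] by simp
  have yn: "y \<in> Z.Om (Suc n)" for n
  proof (induction n)
    case (Suc n)
    have "y \<otimes>\<^bsub>Z.MR\<^esub> y \<in> Z.Om (Suc (Suc n))" using Z.Om_mult[OF y1(1) Suc] by simp
    then have "\<ominus>\<^bsub>Z.MR\<^esub> (y \<otimes>\<^bsub>Z.MR\<^esub> y) \<in> Z.Om (Suc (Suc n))"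
      by (rule additive_subgroup.a_inv_closed[OF ideal.axioms(1)[OF Z.ideal_Om] ])
    then show ?case unfolding s[symmetric] .
  qed (use y1(1) in simp)
  have "Z.kap y t = \<zero>\<^bsub>Zp p\<^esub>" for t using yn[of "length t"] by (simp add: Z.Om_def)
  then have "y = \<zero>\<^bsub>Z.MR\<^esub>" by (intro Z.MR_eqI[OF y Z.MR.zero_closed]) (simp add: Z.kap_zero)
  then show ?thesis using y1(2) by simp
qed

lemma magnus_map_words:
  assumes f: "is_magnus_map p V E f" and w: "w \<in> L"
  shows "f (emb w) = mu0 (emb w)"
proof -
  have hom: "f \<in> hom PG OG" and gen: "\<And>v. v \<in> V \<Longrightarrow> f (emb [(v, True)]) = g1 v"
    using f unfolding is_magnus_map_def raag_gen_def by blast+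
  have fc: "f x \<in> one_plus Z.MR (Z.Om 1)" if "x \<in> carrier PG" for x
    using hom_in_carrier[OF hom that] unfolding OG_simps .
  have fm: "f (x \<otimes>\<^bsub>PG\<^esub> y) = f x \<otimes>\<^bsub>Z.MR\<^esub> f y" if "x \<in> carrier PG" "y \<in> carrier PG" for x y
    using hom_mult[OF hom that] unfolding OG_simps .
  have f1: "f \<one>\<^bsub>PG\<^esub> = \<one>\<^bsub>Z.MR\<^esub>"
    by (rule one_plus_idempotent[OF fc]) (use fm[of "\<one>\<^bsub>PG\<^esub>" "\<one>\<^bsub>PG\<^esub>"] in simp_all)
  have m1: "mu0 \<one>\<^bsub>PG\<^esub> = \<one>\<^bsub>Z.MR\<^esub>"
    by (rule one_plus_idempotent[OF mu0_one_plus]) (use mu0_mult[of "\<one>\<^bsub>PG\<^esub>" "\<one>\<^bsub>PG\<^esub>"] in simp_all)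
  have letter: "f (emb [(v, b)]) = mu0 (emb [(v, b)])" if v: "v \<in> V" for v b
  proof (cases b)
    case True
    then show ?thesis using gen[OF v] mu0_gen[OF v] by simp
  next
    case False
    have l: "[(v, True)] \<in> L" "[(v, False)] \<in> L" using v by simp_all
    note c = emb_carrier[OF l(1)] emb_carrier[OF l(2)]
    have i: "emb [(v, False)] = inv\<^bsub>PG\<^esub> emb [(v, True)]" using emb_inv[OF l(1)] by (simp add: word_inv_def)
    have "f (emb [(v, False)]) \<otimes>\<^bsub>Z.MR\<^esub> g1 v = \<one>\<^bsub>Z.MR\<^esub>"
      using fm[OF c(2,1)] gen[OF v] f1 PG.l_inv[OF c(1)] unfolding i by simp
    moreover have "g1 v \<otimes>\<^bsub>Z.MR\<^esub> mu0 (emb [(v, False)]) = \<one>\<^bsub>Z.MR\<^esub>"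
      using mu0_mult[OF c] mu0_gen[OF v] m1 PG.r_inv[OF c(1)] unfolding i by simp
    ultimately have "f (emb [(v, False)]) = mu0 (emb [(v, False)])"
      by (rule Z.MR.inv_unique) (use one_plus_Om_carrier[OF fc[OF c(2)]] g1_closed[OF v] mu0(1)[OF c(2)] in auto)
    then show ?thesis using False by simp
  qed
  show ?thesis using w
  proof (induction w rule: list.induct)
    case Nil
    then show ?case using f1 m1 emb_Nil by simp
  next
    case (Cons a w)
    obtain v b where a: "a = (v, b)" by force
    have v: "v \<in> V" and w: "w \<in> L" using Cons.prems a by auto
    have l: "[(v, b)] \<in> L" using v by simp
    have "emb (a # w) = emb [(v, b)] \<otimes>\<^bsub>PG\<^esub> emb w" using emb_append[OF l w] a by simp
    then show ?case using fm[OF emb_carrier[OF l] emb_carrier[OF w]] mu0_mult[OF emb_carrier[OF l] emb_carrier[OF w]]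
        letter[OF v] Cons.IH[OF w] by simp
  qed
qed

lemma magnus_map_coordinate_open:
  assumes f: "is_magnus_map p V E f" and n: "1 \<le> n" and k: "1 \<le> k"
  shows "continuous_map TP (TK n k) (\<lambda>x. mtp (f x) (n, k))"
proof -
  have c: "continuous_map TP (magnus_topology p V E) f"
    using f unfolding is_magnus_map_def one_plus_omega_topology_def continuous_map_in_subtopology by blast
  let ?D = "\<lambda>i. discrete_topology (case i of (n, k) \<Rightarrow> carrier (pc_trunc (rs k) V E n))"
  have "(n, k) \<in> {1..} \<times> {1..}" using n k by simp
  then have "continuous_map (magnus_profinite_topology p V E) (?D (n, k)) (\<lambda>x. x (n, k))"
    unfolding magnus_profinite_topology_def inv_lim_topology_def
    by (intro continuous_map_from_subtopology continuous_map_product_projection)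
  then have "continuous_map (magnus_topology p V E) (?D (n, k)) ((\<lambda>x. x (n, k)) \<circ> mtp)"
    unfolding magnus_topology_def by (rule continuous_map_pullback)
  from continuous_map_compose[OF c this] show ?thesis by (simp add: comp_def)
qed

text \<open>Near \<open>x\<close> there is the image of a word at which any given coordinates of both maps agree with those at \<open>x\<close>;
  on words the maps coincide.\<close>

theorem magnus_map_unique:
  assumes f: "is_magnus_map p V E f"
  shows "f = mu"
proof (rule extensionalityI)
  show "f \<in> extensional (carrier PG)" using f unfolding is_magnus_map_def by blast
  show "mu \<in> extensional (carrier PG)" by (simp add: mu_def)
  fix x assume x: "x \<in> carrier PG"
  have hom: "f \<in> hom PG OG" using f unfolding is_magnus_map_def by blast
  have fx: "f x \<in> carrier Z.MR"
    by (rule one_plus_Om_carrier[OF hom_in_carrier[OF hom x, unfolded OG_simps]])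
  have "f x = mu0 x"
  proof (rule MR_eq_mtp[OF fx mu0(1)[OF x]])
    fix n k :: nat assume n: "1 \<le> n" and k: "1 \<le> k"
    have nb: "\<exists>j. \<forall>y\<in>carrier PG. y (Kc j) = x (Kc j) \<longrightarrow> h y = h x" if h: "continuous_map TP (TK n k) h" for h
    proof -
      have "h x \<in> topspace (TK n k)" 
        by (rule funcset_mem[OF continuous_map_funspace[OF h]]) (simp add: topspace_TP x)
      then have "openin (TK n k) {h x}" by simp
      from openin_continuous_map_preimage[OF h this]
      have o: "openin TP {y \<in> carrier PG. h y \<in> {h x}}" unfolding topspace_TP .
      have "x \<in> {y \<in> carrier PG. h y \<in> {h x}}" using x by simp
      from TP_neighbourhood[OF o this] obtain j
        where j: "\<And>y. y \<in> carrier PG \<Longrightarrow> y (Kc j) = x (Kc j) \<Longrightarrow> y \<in> {y \<in> carrier PG. h y \<in> {h x}}" by blast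
      then show ?thesis by (intro exI[of _ j]) simp
    qed
    obtain i where i: "\<forall>y\<in>carrier PG. y (Kc i) = x (Kc i) \<longrightarrow> mtp (f y) (n, k) = mtp (f x) (n, k)"
      using nb[OF magnus_map_coordinate_open[OF f n k]] by blast
    obtain j where j: "\<forall>y\<in>carrier PG. y (Kc j) = x (Kc j) \<longrightarrow> mtp (mu0 y) (n, k) = mtp (mu0 x) (n, k)"
      using nb[OF continuous_mtp_mu0[OF n k]] by blast
    obtain w where w: "w \<in> L" "x (Kc (max i j)) = Kc (max i j) #>\<^bsub>A\<^esub> cls w" using PG_rep[OF x Kc_Ix] by blast
    have "emb w (Kc l) = x (Kc l)" if "l \<le> max i j" for l
      using PG_rep_mono[OF x Kc_Ix Kc_Ix Kc_mono[OF that] w] emb_val[OF Kc_Ix] by simp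
    then have "emb w (Kc i) = x (Kc i)" "emb w (Kc j) = x (Kc j)" by simp_all
    then have "mtp (f (emb w)) (n, k) = mtp (f x) (n, k)" "mtp (mu0 (emb w)) (n, k) = mtp (mu0 x) (n, k)"
      using bspec[OF i emb_carrier[OF w(1)]] bspec[OF j emb_carrier[OF w(1)]] by simp_all
    then show "mtp (f x) (n, k) = mtp (mu0 x) (n, k)" using magnus_map_words[OF f w(1)] by simp
  qed
  then show "f x = mu x" by (simp add: mu_eq[OF x])
qed

subsection \<open>Injectivity and the lower central series\<close>

text \<open>The coefficients modulo \<open>p\<^sup>j\<close> below degree \<open>j\<close> determine the component at \<open>Kc j\<close>.\<close>

theorem mu_inj: "inj_on mu (carrier PG)"
proof (rule inj_onI)
  fix x y assume x: "x \<in> carrier PG" and y: "y \<in> carrier PG" and e: "mu x = mu y"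
  have cf: "cf x t = cf y t" for t using e mu0(2)[OF x] mu0(2)[OF y] mu_eq[OF x] mu_eq[OF y] by metis
  show "x = y"
  proof (rule PG_eqI[OF x y])
    fix j
    obtain u where u: "u \<in> L" "x (Kc j) = Kc j #>\<^bsub>A\<^esub> cls u" using PG_rep[OF x Kc_Ix] by blast
    obtain w where w: "w \<in> L" "y (Kc j) = Kc j #>\<^bsub>A\<^esub> cls w" using PG_rep[OF y Kc_Ix] by blast
    have "magnus u - magnus w \<in> Idn E j (int p ^ j)"
      unfolding magnus_Idn_iff[OF u(1) w(1)]
    proof
      fix t assume "t \<in> short j"
      then have t: "length t < j" and j: "1 \<le> j" by (auto simp: short_def)
      show "csum E (magnus u) t mod int p ^ j = csum E (magnus w) t mod int p ^ j"
        using cf_eq[OF x u[unfolded Kc_def] t j] cf_eq[OF y w[unfolded Kc_def] t j] cf by simp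
    qed
    then show "x (Kc j) = y (Kc j)" unfolding u(2) w(2) Kc_coset[OF u(1) w(1)] .
  qed
qed

lemma mu0_depth:
  assumes x: "x \<in> carrier PG"
  shows "mu0 x \<in> one_plus Z.MR (Z.Om n) \<longleftrightarrow> x \<in> PD n"
proof
  have nil: "[] \<in> L" by simp
  assume "mu0 x \<in> one_plus Z.MR (Z.Om n)"
  then have h: "\<And>t. length t < n \<Longrightarrow> cf x t = Z.kap \<one>\<^bsub>Z.MR\<^esub> t"
    using Z.one_plus_iff[OF mu0(1)[OF x]] mu0(2)[OF x] by simp
  show "x \<in> PD n" unfolding PD_def
  proof (intro CollectI conjI allI x)
    fix k
    obtain w where w: "w \<in> L" "x (KA n (int p ^ k)) = KA n (int p ^ k) #>\<^bsub>A\<^esub> cls w" using PG_rep[OF x KA_index] by blast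
    have "magnus w - magnus [] \<in> Idn E n (int p ^ k)"
      unfolding magnus_Idn_iff[OF w(1) nil]
    proof
      fix t assume "t \<in> short n"
      then have t: "length t < n" by (simp add: short_def)
      show "csum E (magnus w) t mod int p ^ k = csum E (magnus []) t mod int p ^ k"
      proof (cases "k = 0")
        case False
        then have k: "1 \<le> k" by simp
        show ?thesis using cf_eq[OF x w t k] h[OF t] kap_one_val[OF k, of t] by simp
      qed simp
    qed
    then have "w \<in> Kw E n (int p ^ k)" by (simp add: Kw_def)
    then show "x (KA n (int p ^ k)) = KA n (int p ^ k)" unfolding w(2) using KA_rcos_self[OF w(1)] by blast
  qed
next
  have nil: "[] \<in> L" by simp
  assume x': "x \<in> PD n"
  show "mu0 x \<in> one_plus Z.MR (Z.Om n)"
    unfolding Z.one_plus_iff[OF mu0(1)[OF x]] mu0(2)[OF x]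
  proof (intro allI impI)
    fix t :: "'a list" assume t: "length t < n"
    show "cf x t = Z.kap \<one>\<^bsub>Z.MR\<^esub> t"
    proof (rule Zp_eqI[OF cf_Zp[OF x] Z.kap_closed[OF Z.MR.one_closed]])
      fix k :: nat assume k: "1 \<le> k"
      have "[] \<in> Kw E n (int p ^ k)" by (simp add: Kw_def)
      then have "x (KA n (int p ^ k)) = KA n (int p ^ k) #>\<^bsub>A\<^esub> cls []" using PD_D[OF x'] KA_rcos_self[OF nil] by simp
      from cf_eq[OF x nil this t k] show "cf x t k = Z.kap \<one>\<^bsub>Z.MR\<^esub> t k" using kap_one_val[OF k] by simp
    qed
  qed
qed

theorem mu_preimage:
  assumes "1 \<le> n"
  shows "{x \<in> carrier PG. mu x \<in> one_plus Z.MR (ideal_power Z.MR (magnus_omega (Zp p) V E) n)} = lower_central PG n"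
proof -
  obtain m where m: "n = Suc m" using assms by (cases n) auto
  have "{x \<in> carrier PG. mu x \<in> one_plus Z.MR (Z.Om n)} = PD n"
    using mu0_depth mu_eq PD_c by auto
  then show ?thesis unfolding Z.magnus_omega_pow_eq m lower_central_PG .
qed

end

theorem theorem3p9:
  fixes V :: "'a set" and E :: "'a set set" and p :: nat
  assumes "finite_simplicial_graph V E"
    and "Factorial_Ring.prime p"
  shows "(\<exists>!\<mu>. is_magnus_map p V E \<mu>) \<and>
    (\<forall>\<mu>. is_magnus_map p V E \<mu> \<longrightarrow>
       inj_on \<mu> (carrier (raag_pro_p p V E)) \<and>
       (\<forall>n\<ge>1. {x \<in> carrier (raag_pro_p p V E).
                  \<mu> x \<in> one_plus (magnus_Zp p V E)
                          (ideal_power (magnus_Zp p V E) (magnus_omega (Zp p) V E) n)}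
              = lower_central (raag_pro_p p V E) n))"
proof -
  have fin: "finite V" using assms(1) by (simp add: finite_simplicial_graph_def)
  \<comment> \<open>The Lyndon words refer to a total order on the vertices.\<close>
  obtain r :: "'a \<Rightarrow> nat" where r: "inj_on r V" using finite_imp_inj_to_nat_seg[OF fin] by blast
  interpret magnus_setup V E r p
    by unfold_locales (use r fin assms in auto)
  show ?thesis
  proof (intro conjI allI impI)
    show "\<exists>!\<mu>. is_magnus_map p V E \<mu>"
    proof (rule ex1I)
      show "is_magnus_map p V E mu" by (rule mu_magnus)
      show "f = mu" if "is_magnus_map p V E f" for f using that by (rule magnus_map_unique)
    qed
    fix f assume "is_magnus_map p V E f"
    then have f: "f = mu" by (rule magnus_map_unique)
    show "inj_on f (carrier PG)" unfolding f by (rule mu_inj)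
    fix n :: nat assume "1 \<le> n"
    then show "{x \<in> carrier PG. f x \<in> one_plus Z.MR (ideal_power Z.MR (magnus_omega (Zp p) V E) n)} = lower_central PG n"
      unfolding f by (rule mu_preimage)
  qed
qed

end
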